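(* Let $d\ge 1$. Let $\{X_i, i\in\mathbb{Z}\}$ be a stationary sequence of standard (mean 0, variance 1) Gaussian random variables (a stationary Gaussian sequence) with covariance function $r_n=E(X_1X_{n+1})$, and let $\{O_{id}^{(r)}(X), i\in\mathbb{Z}\}$, $r\in\{1,d\}$, be the sequence of Gaussian $r$-th order statistics generated by $X$, with first crossing point $\Upsilon(O_X^{(r)})$ and last exit time $\tau(O_X^{(r)})$ (all defined in the context; they depend on $\beta>0$). Suppose $$r_n\ln n\to \gamma>0\quad\text{as } n\to\infty .$$ Put $\rho_\beta=\gamma/|\ln\beta|$ and $b(\beta,\rho_\beta,r)=\sqrt{1-\rho_\beta}\;a\big(\beta/\sqrt{1-\rho_\beta},\,r\big)$, with $a(\cdot,\cdot)$ as in the context. Let $\Phi$ be the standard normal distribution function. 1) Case $r=1$: with $u_{\beta}(x)=\left(b(\beta,\rho_{\beta},1)+\sqrt{\rho_{\beta}}\,x\right)\beta^{-1}$, for any $x,y\in\mathbb{R}$ $$\lim_{\beta\to0}P\left(\Upsilon(O_{X}^{(1)})\geq-u_{\beta}(x),\ \tau(O_{X}^{(1)})\leq u_{\beta}(y)\right)=\int_{\mathbb{R}^{d}}\exp\Big(-\frac{1}{d}\sum_{j=1}^{d}\big(e^{-\sqrt{2\gamma}(x-z_{j})}+e^{-\sqrt{2\gamma}(y-z_{j})}\big)\Big)\,d\Phi(z_{1})\cdots d\Phi(z_{d})$$ and $$\lim_{\beta\to0}P\left(\Upsilon(O_{X}^{(1)})\geq-u_{\beta}(x)\right)=\lim_{\beta\to0}P\left(\tau(O_{X}^{(1)})\leq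 u_{\beta}(x)\right)=\int_{\mathbb{R}^{d}}\exp\Big(-\frac{1}{d}\sum_{j=1}^{d}e^{-\sqrt{2\gamma}(x-z_{j})}\Big)\,d\Phi(z_{1})\cdots d\Phi(z_{d}).$$ 2) Case $r=d$: with $u_{\beta}(x)=\left(b(\beta,\rho_{\beta},d)+\sqrt{\rho_{\beta}}\,d^{-1}x\right)\beta^{-1}$, for any $x,y\in\mathbb{R}$ $$\lim_{\beta\to0}P\left(\Upsilon(O_{X}^{(d)})\geq-u_{\beta}(x),\ \tau(O_{X}^{(d)})\leq u_{\beta}(y)\right)=\int_{\mathbb{R}^{d}}\exp\Big(-\big(e^{-\sqrt{2d^{-1}\gamma}\,(x-\sum_{j=1}^{d}z_{j})}+e^{-\sqrt{2d^{-1}\gamma}\,(y-\sum_{j=1}^{d}z_{j})}\big)\Big)\,d\Phi(z_{1})\cdots d\Phi(z_{d})$$ and $$\lim_{\beta\to0}P\left(\Upsilon(O_{X}^{(d)})\geq-u_{\beta}(x)\right)=\lim_{\beta\to0}P\left(\tau(O_{X}^{(d)})\leq u_{\beta}(x)\right)=\int_{\mathbb{R}^{d}}\exp\Big(-e^{-\sqrt{2d^{-1}\gamma}\,(x-\sum_{j=1}^{d}z_{j})}\Big)\,d\Phi(z_{1})\cdots d\Phi(z_{d}).$$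
   Context: Order statistics: let $\{X_{ij}, i\in\mathbb{Z}\}$, $j=1,\ldots,d$, be independent copies of the sequence $\{X_i,i\in\mathbb{Z}\}$. For each $i\in\mathbb{Z}$, the order statistics of $X_{i1},\ldots,X_{id}$ are arranged in decreasing order: $$O_{id}^{(d)}(X)=\min_{1\le j\le d}X_{ij}\le\cdots\le O_{id}^{(r)}(X)\le\cdots\le O_{id}^{(1)}(X)=\max_{1\le j\le d}X_{ij}.$$ For $\beta>0$, the first crossing point and the last exit time are $$\Upsilon(O_{X}^{(r)})=\min\{i\in\mathbb{Z}: O_{id}^{(r)}(X)>-\beta i\},\qquad \tau(O_{X}^{(r)})=\max\{i\geq 0: O_{id}^{(r)}(X)>\beta i\}$$ ($i$ ranging over integers), which are almost surely finite; if the set defining $\tau$ is empty, $\tau$ is taken to be $0$. The function $a$ is $$a(\beta,r)=\sqrt{\frac{2}{r}\left(\ln\beta^{-1}-\frac{r+1}{2}\ln\left(\frac{2}{r}\ln\beta^{-1}\right)+\ln\left(C_{d}^{r}r^{-1}(2\pi)^{-r/2}\right)\right)},\qquad C_d^r=\frac{d!}{r!(d-r)!}$$ (so $C_d^1=d$ and $C_d^d=1$). The limit $\beta\to0$ is through positive values, and all quantities are considered for $\beta$ small enough that they are well defined. The integer $r$ (order-statistic index) is unrelated to the covariances $r_n$. *)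

theory Defs
  imports "HOL-Probability.Probability"
begin

definition normal_rv :: "'a measure \<Rightarrow> ('a \<Rightarrow> real) \<Rightarrow> bool" where
  "normal_rv M Y \<longleftrightarrow> Y \<in> borel_measurable M \<and>
     (\<exists>\<mu> \<sigma>. \<sigma> \<ge> 0 \<and>
        distr M borel Y =
          (if \<sigma> = 0 then return borel \<mu> else density lborel (\<lambda>x. ennreal (normal_density \<mu> \<sigma> x))))"

text \<open>Gaussian sequence: every finite linear combination is normal, where constants count as
  normal variables of variance \<open>0\<close> (so the finite-dimensional laws may be singular).\<close>

definition gaussian_sequence :: "'a measure \<Rightarrow> (int \<Rightarrow> 'a \<Rightarrow> real) \<Rightarrow> bool" where
  "gaussian_sequence M X \<longleftrightarrow>
     (\<forall>F c. finite F \<longrightarrow> normal_rv M (\<lambda>\<omega>. \<Sum>i\<in>F. c i * X i \<omega>))"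

definition sequence_law :: "'a measure \<Rightarrow> (int \<Rightarrow> 'a \<Rightarrow> real) \<Rightarrow> (int \<Rightarrow> real) measure" where
  "sequence_law M X = distr M (\<Pi>\<^sub>M i\<in>UNIV. borel) (\<lambda>\<omega> i. X i \<omega>)"

definition stationary_sequence :: "'a measure \<Rightarrow> (int \<Rightarrow> 'a \<Rightarrow> real) \<Rightarrow> bool" where
  "stationary_sequence M X \<longleftrightarrow> (\<forall>k. sequence_law M (\<lambda>i. X (i + k)) = sequence_law M X)"

definition standard_stationary_gaussian :: "'a measure \<Rightarrow> (int \<Rightarrow> 'a \<Rightarrow> real) \<Rightarrow> bool" where
  "standard_stationary_gaussian M X \<longleftrightarrow>
     gaussian_sequence M X \<and> stationary_sequence M X \<and>
     (\<forall>i. prob_space.expectation M (X i) = 0 \<and> prob_space.variance M (X i) = 1)"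

definition covariance_fun :: "'a measure \<Rightarrow> (int \<Rightarrow> 'a \<Rightarrow> real) \<Rightarrow> nat \<Rightarrow> real" where
  "covariance_fun M X n = prob_space.expectation M (\<lambda>\<omega>. X 1 \<omega> * X (int n + 1) \<omega>)"

text \<open>\<open>Xs j\<close>, for \<open>j = 1, \<dots>, d\<close>, are independent copies, as whole sequences, of \<open>X\<close>. The copies
  live on \<open>M\<close>, which need not be the space \<open>N\<close> of \<open>X\<close>.\<close>

definition independent_copies ::
    "'a measure \<Rightarrow> nat \<Rightarrow> (nat \<Rightarrow> int \<Rightarrow> 'a \<Rightarrow> real) \<Rightarrow> 'b measure \<Rightarrow> (int \<Rightarrow> 'b \<Rightarrow> real) \<Rightarrow> bool" where
  "independent_copies M d Xs N X \<longleftrightarrow>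
     prob_space.indep_vars M (\<lambda>_. \<Pi>\<^sub>M i\<in>(UNIV::int set). borel) (\<lambda>j \<omega> i. Xs j i \<omega>) {1..d} \<and>
     (\<forall>j\<in>{1..d}. sequence_law M (Xs j) = sequence_law N X)"

text \<open>The \<open>r\<close>-th largest of \<open>x 1, \<dots>, x d\<close>, meaningful for \<open>1 \<le> r \<le> d\<close>.\<close>

definition order_stat :: "nat \<Rightarrow> nat \<Rightarrow> (nat \<Rightarrow> real) \<Rightarrow> real" where
  "order_stat d r x = rev (sort (map x [1..<Suc d])) ! (r - 1)"

definition order_stat_seq ::
    "nat \<Rightarrow> nat \<Rightarrow> (nat \<Rightarrow> int \<Rightarrow> 'a \<Rightarrow> real) \<Rightarrow> 'a \<Rightarrow> int \<Rightarrow> real" where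
  "order_stat_seq d r Xs \<omega> i = order_stat d r (\<lambda>j. Xs j i \<omega>)"

text \<open>If the minimum (maximum) does not exist, \<open>LEAST\<close> (\<open>GREATEST\<close>) returns an unspecified integer
  that does not depend on the path; for the order statistics this is an event of probability
  \<open>0\<close>.\<close>

definition first_crossing :: "real \<Rightarrow> (int \<Rightarrow> real) \<Rightarrow> int" where
  "first_crossing \<beta> y = (LEAST i. y i > - \<beta> * real_of_int i)"

definition last_exit :: "real \<Rightarrow> (int \<Rightarrow> real) \<Rightarrow> int" where
  "last_exit \<beta> y =
     (if \<exists>i\<ge>0. y i > \<beta> * real_of_int i
      then (GREATEST i. i \<ge> 0 \<and> y i > \<beta> * real_of_int i) else 0)"

definition a_level :: "nat \<Rightarrow> real \<Rightarrow> nat \<Rightarrow> real" where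
  "a_level d \<beta> r =
     sqrt (2 / real r *
       (ln (1 / \<beta>) - (real r + 1) / 2 * ln (2 / real r * ln (1 / \<beta>))
        + ln (real (d choose r) * (1 / real r) * (2 * pi) powr (- real r / 2))))"

definition b_level :: "nat \<Rightarrow> real \<Rightarrow> real \<Rightarrow> nat \<Rightarrow> real" where
  "b_level d \<beta> \<rho> r = sqrt (1 - \<rho>) * a_level d (\<beta> / sqrt (1 - \<rho>)) r"

definition rho :: "real \<Rightarrow> real \<Rightarrow> real" where
  "rho \<gamma> \<beta> = \<gamma> / \<bar>ln \<beta>\<bar>"

definition u_max :: "nat \<Rightarrow> real \<Rightarrow> real \<Rightarrow> real \<Rightarrow> real" where
  "u_max d \<gamma> \<beta> x = (b_level d \<beta> (rho \<gamma> \<beta>) 1 + sqrt (rho \<gamma> \<beta>) * x) / \<beta>"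

definition u_min :: "nat \<Rightarrow> real \<Rightarrow> real \<Rightarrow> real \<Rightarrow> real" where
  "u_min d \<gamma> \<beta> x = (b_level d \<beta> (rho \<gamma> \<beta>) d + sqrt (rho \<gamma> \<beta>) * (1 / real d) * x) / \<beta>"

text \<open>The product measure \<open>d\<Phi>(z\<^sub>1) \<cdots> d\<Phi>(z\<^sub>d)\<close>.\<close>

definition Phi_prod :: "nat \<Rightarrow> (nat \<Rightarrow> real) measure" where
  "Phi_prod d = (\<Pi>\<^sub>M j\<in>{1..d}. std_normal_distribution)"

end

theory Submission
  imports Defs "HOL-Real_Asymp.Real_Asymp"
begin

text \<open>Slowly decaying correlations with \<open>r\<^sub>n ln n \<rightarrow> \<gamma>\<close> act, at the scale of the crossings, like one common
  Gaussian component. The indices that matter are of the order \<open>\<surd>(ln (1 / \<beta>)) / \<beta>\<close>, almost all pairs of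
  them are at a distance whose logarithm is asymptotic to \<open>ln (1 / \<beta>)\<close>, and so their correlation is \<open>\<rho> = \<gamma> / ln (1 / \<beta>)\<close>
  up to a smaller order. The sequence is therefore compared with the exchangeable reference sequence
  \<open>\<surd>\<rho> Z + \<surd>(1 - \<rho>) \<zeta>\<^sub>i\<close>.

  Comparison. Two Gaussian vectors are joined by a rotation, and integration by parts bounds the
  change of the probability of no exceedance by the covariance differences times joint densities at
  the levels (\<open>gauss_comparison\<close>). Weights in this inequality allow the independent copies to be
  exchanged one at a time (\<open>copies_comparison\<close>). For joint exceedances of \<open>D\<close> copies the error is a
  double sum over pairs of indices. Pairs at a distance of at most a small power of \<open>1 / \<beta>\<close> are controlled
  by their number, since a correlation bounded away from \<open>1\<close> makes their joint exceedances rare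
  enough. For the other pairs the joint density is comparable to the product of the marginal
  densities, and the gain is the difference between the correlations and \<open>\<rho>\<close> (\<open>comparison_error\<close>).

  Reference sequence. Given \<open>Z\<close>, the exceedances are independent and rare. Mills' ratio turns their
  expected number into a geometric series whose value tends to \<open>intensity\<close>: the shift \<open>\<surd>\<rho> (x / D - Z)\<close> of
  the level, multiplied by the level, which is asymptotic to \<open>\<surd>(2 \<gamma> / (D \<rho>))\<close>, has a finite limit, which is where the factors
  \<open>exp (- \<surd>(2 \<gamma> / D) (x - \<Sum>z))\<close> come from. The probability of no exceedance tends to
  the Poisson expression \<open>exp (- intensity)\<close>, integrated over \<open>Z\<close> (\<open>reference_limit\<close>). Together with
  the comparison this gives \<open>crossing_limit\<close>.

  Functionals. Almost surely the copies grow slower than every line, so that \<open>\<Upsilon> \<ge> - u\<close> and \<open>\<tau> \<le> v\<close> say that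
  the order statistic does not exceed \<open>\<beta> \<bar>i\<bar>\<close> for \<open>i < - u\<close> and \<open>i > v\<close> (\<open>measure_exit_events\<close>). The minimum
  exceeds a level exactly when all copies do, which is \<open>crossing_limit\<close> with \<open>D = d\<close>. The maximum stays
  below a level exactly when every copy does; by independence this is a product of \<open>d\<close> probabilities, each
  with the limit for \<open>D = 1\<close>.\<close>

section \<open>Characteristic functions of random vectors\<close>

text \<open>Levy's uniqueness theorem for finite measures instead of probability measures: the law of
  \<open>X\<close> under the measure with density \<open>w\<close> is determined by its Fourier transform.\<close>

lemma weighted_Levy_uniqueness:
  fixes X w :: "'a \<Rightarrow> real" and Y v :: "'b \<Rightarrow> real"
  assumes M: "prob_space M" and N: "prob_space N"
    and [measurable]: "X \<in> borel_measurable M" "w \<in> borel_measurable M"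
      "Y \<in> borel_measurable N" "v \<in> borel_measurable N"
    and w: "\<And>\<omega>. 0 \<le> w \<omega>" "\<And>\<omega>. w \<omega> \<le> B" and v: "\<And>\<omega>. 0 \<le> v \<omega>" "\<And>\<omega>. v \<omega> \<le> B"
    and eq: "\<And>s. (CLINT \<omega>|M. iexp (s * X \<omega>) * w \<omega>) = (CLINT \<omega>|N. iexp (s * Y \<omega>) * v \<omega>)"
    and A [measurable]: "A \<in> sets borel"
  shows "(\<integral>\<omega>. indicator A (X \<omega>) * w \<omega> \<partial>M) = (\<integral>\<omega>. indicator A (Y \<omega>) * v \<omega> \<partial>N)"
proof -
  interpret M: prob_space M by fact
  interpret N: prob_space N by fact
  have iw: "integrable M w" by (rule M.integrable_const_bound[of _ B]) (use w in auto)
  have iv: "integrable N v" by (rule N.integrable_const_bound[of _ B]) (use v in auto)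
  define m where "m = (\<integral>\<omega>. w \<omega> \<partial>M)"
  have "complex_of_real (\<integral>\<omega>. w \<omega> \<partial>M) = complex_of_real (\<integral>\<omega>. v \<omega> \<partial>N)"
    using eq[of 0] by simp
  hence m2: "m = (\<integral>\<omega>. v \<omega> \<partial>N)" unfolding m_def by (simp only: of_real_eq_iff)
  have m0: "m \<ge> 0" unfolding m_def using w by (intro integral_nonneg_AE) auto
  show ?thesis
  proof (cases "m = 0")
    case True
    have "AE \<omega> in M. w \<omega> = 0"
      using integral_nonneg_eq_0_iff_AE[OF iw] w True m_def by simp
    hence "AE \<omega> in M. indicator A (X \<omega>) * w \<omega> = 0" by auto
    hence 1: "(\<integral>\<omega>. indicator A (X \<omega>) * w \<omega> \<partial>M) = 0" by (rule integral_eq_zero_AE)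
    have "AE \<omega> in N. v \<omega> = 0"
      using integral_nonneg_eq_0_iff_AE[OF iv] v True m2 by simp
    hence "AE \<omega> in N. indicator A (Y \<omega>) * v \<omega> = 0" by auto
    hence 2: "(\<integral>\<omega>. indicator A (Y \<omega>) * v \<omega> \<partial>N) = 0" by (rule integral_eq_zero_AE)
    show ?thesis using 1 2 by simp
  next
    case False
    hence mp: "m > 0" using m0 by simp
    have prob: "prob_space (density K (\<lambda>\<omega>. ennreal (f \<omega> / m)))"
      if "integrable K f" "\<And>\<omega>. 0 \<le> f \<omega>" "m = (\<integral>\<omega>. f \<omega> \<partial>K)" for K :: "'c measure" and f
    proof -
      have "(\<integral>\<^sup>+\<omega>. ennreal (f \<omega> / m) \<partial>K) = ennreal (\<integral>\<omega>. f \<omega> / m \<partial>K)"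
        using that mp by (intro nn_integral_eq_integral) auto
      also have "(\<integral>\<omega>. f \<omega> / m \<partial>K) = 1" using that mp by simp
      finally show ?thesis using that
        by (intro prob_spaceI) (auto simp: emeasure_density cong: nn_integral_cong)
    qed
    let ?P = "density M (\<lambda>\<omega>. ennreal (w \<omega> / m))" and ?Q = "density N (\<lambda>\<omega>. ennreal (v \<omega> / m))"
    have P: "prob_space ?P" by (rule prob[OF iw w(1) m_def])
    have Q: "prob_space ?Q" by (rule prob[OF iv v(1) m2])
    let ?p = "distr ?P borel X" and ?q = "distr ?Q borel Y"
    have rp: "real_distribution ?p" and rq: "real_distribution ?q"
      using P Q by (auto intro!: prob_space.real_distribution_distr)
    have cp: "char ?p s = (CLINT \<omega>|M. iexp (s * X \<omega>) * w \<omega>) / m" for s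
    proof -
      have "char ?p s = (CLINT \<omega>|M. (w \<omega> / m) *\<^sub>R iexp (s * X \<omega>))"
        unfolding char_def using w mp by (subst integral_distr) (auto simp: integral_density)
      also have "\<dots> = (CLINT \<omega>|M. (iexp (s * X \<omega>) * w \<omega>) / m)"
        by (intro Bochner_Integration.integral_cong) (auto simp: scaleR_conv_of_real)
      finally show ?thesis by simp
    qed
    have cq: "char ?q s = (CLINT \<omega>|N. iexp (s * Y \<omega>) * v \<omega>) / m" for s
    proof -
      have "char ?q s = (CLINT \<omega>|N. (v \<omega> / m) *\<^sub>R iexp (s * Y \<omega>))"
        unfolding char_def using v mp by (subst integral_distr) (auto simp: integral_density)
      also have "\<dots> = (CLINT \<omega>|N. (iexp (s * Y \<omega>) * v \<omega>) / m)"
        by (intro Bochner_Integration.integral_cong) (auto simp: scaleR_conv_of_real)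
      finally show ?thesis by simp
    qed
    have "?p = ?q" by (rule Levy_uniqueness[OF rp rq]) (rule ext, simp only: cp cq eq)
    hence "(\<integral>x. indicator A x \<partial>?p) = (\<integral>x. indicator A x \<partial>?q :: real)" by simp
    moreover have "(\<integral>x. indicator A x \<partial>?p :: real) = (\<integral>\<omega>. indicator A (X \<omega>) * w \<omega> \<partial>M) / m"
      using w mp by (subst integral_distr)
        (auto simp: integral_density intro!: trans[OF _ integral_divide_zero] Bochner_Integration.integral_cong)
    moreover have "(\<integral>x. indicator A x \<partial>?q :: real) = (\<integral>\<omega>. indicator A (Y \<omega>) * v \<omega> \<partial>N) / m"
      using v mp by (subst integral_distr)
        (auto simp: integral_density intro!: trans[OF _ integral_divide_zero] Bochner_Integration.integral_cong)
    ultimately show ?thesis using mp by simp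
  qed
qed

lemma complex_integral_eqI:
  fixes f :: "'a \<Rightarrow> complex" and g :: "'b \<Rightarrow> complex"
  assumes "integrable M f" "integrable N g"
    and "(\<integral>x. Re (f x) \<partial>M) = (\<integral>x. Re (g x) \<partial>N)" "(\<integral>x. Im (f x) \<partial>M) = (\<integral>x. Im (g x) \<partial>N)"
  shows "(\<integral>x. f x \<partial>M) = (\<integral>x. g x \<partial>N)"
  using assms by (simp add: complex_eq_iff)

text \<open>The step that adds one coordinate \<open>X\<close> to the indicator part of a mixed expectation. To a
  trigonometric weight, which has no sign, the uniqueness theorem is applied through the
  nonnegative weights \<open>G\<close>, \<open>G (1 + cos T)\<close> and \<open>G (1 + sin T)\<close>.\<close>

lemma mixed_expectation_step:
  fixes X T G :: "'a \<Rightarrow> real" and Y U H :: "'b \<Rightarrow> real"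
  assumes M: "prob_space M" and N: "prob_space N"
    and [measurable]: "X \<in> borel_measurable M" "T \<in> borel_measurable M" "G \<in> borel_measurable M"
      "Y \<in> borel_measurable N" "U \<in> borel_measurable N" "H \<in> borel_measurable N"
    and G: "\<And>\<omega>. 0 \<le> G \<omega>" "\<And>\<omega>. G \<omega> \<le> 1" and H: "\<And>\<omega>. 0 \<le> H \<omega>" "\<And>\<omega>. H \<omega> \<le> 1"
    and eq: "\<And>s r. (CLINT \<omega>|M. iexp (s * X \<omega> + r * T \<omega>) * G \<omega>)
                 = (CLINT \<omega>|N. iexp (s * Y \<omega> + r * U \<omega>) * H \<omega>)"
    and A [measurable]: "A \<in> sets borel"
  shows "(CLINT \<omega>|M. iexp (T \<omega>) * (indicator A (X \<omega>) * G \<omega>))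
       = (CLINT \<omega>|N. iexp (U \<omega>) * (indicator A (Y \<omega>) * H \<omega>))"
proof -
  interpret M: prob_space M by fact
  interpret N: prob_space N by fact
  have iM: "integrable M (\<lambda>\<omega>. iexp (f \<omega>) * complex_of_real (g \<omega>))"
    if [measurable]: "f \<in> borel_measurable M" "g \<in> borel_measurable M" and "\<And>\<omega>. \<bar>g \<omega>\<bar> \<le> B" for f g B
    by (rule M.integrable_const_bound[of _ B]) (use that in \<open>auto simp: norm_mult\<close>)
  have iN: "integrable N (\<lambda>\<omega>. iexp (f \<omega>) * complex_of_real (g \<omega>))"
    if [measurable]: "f \<in> borel_measurable N" "g \<in> borel_measurable N" and "\<And>\<omega>. \<bar>g \<omega>\<bar> \<le> B" for f g B
    by (rule N.integrable_const_bound[of _ B]) (use that in \<open>auto simp: norm_mult\<close>)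
  have rM: "integrable M f" if [measurable]: "f \<in> borel_measurable M" and "\<And>\<omega>. \<bar>f \<omega>\<bar> \<le> B" for f :: "'a \<Rightarrow> real" and B
    by (rule M.integrable_const_bound[of _ B]) (use that in auto)
  have rN: "integrable N f" if [measurable]: "f \<in> borel_measurable N" and "\<And>\<omega>. \<bar>f \<omega>\<bar> \<le> B" for f :: "'b \<Rightarrow> real" and B
    by (rule N.integrable_const_bound[of _ B]) (use that in auto)
  have Gb: "\<bar>G \<omega>\<bar> \<le> 1" for \<omega> using G[of \<omega>] by auto
  have Hb: "\<bar>H \<omega>\<bar> \<le> 1" for \<omega> using H[of \<omega>] by auto
  have w2: "0 \<le> g * (1 + t)" "g * (1 + t) \<le> 2" if "0 \<le> g" "g \<le> 1" "- 1 \<le> t" "t \<le> 1" for g t :: real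
    using that mult_mono[of g 1 "1 + t" 2] by auto
  have cosE: "iexp x * complex_of_real (g * (1 + cos t)) =
      iexp x * g + (iexp (x + t) * g + iexp (x + - 1 * t) * g) / 2" for x t g :: real
    by (simp add: complex_eq_iff Re_exp Im_exp cos_add sin_add cos_diff sin_diff) (simp add: field_simps)
  have sinE: "iexp x * complex_of_real (g * (1 + sin t)) =
      iexp x * g + (iexp (x + t) * g - iexp (x + - 1 * t) * g) * (- \<i> / 2)" for x t g :: real
    by (simp add: complex_eq_iff Re_exp Im_exp cos_add sin_add cos_diff sin_diff) (simp add: field_simps)
  have c0: "(CLINT \<omega>|M. iexp (s * X \<omega>) * G \<omega>) = (CLINT \<omega>|N. iexp (s * Y \<omega>) * H \<omega>)" for s
    using eq[of s 0] by simp
  have c1: "(CLINT \<omega>|M. iexp (s * X \<omega> + T \<omega>) * G \<omega>) = (CLINT \<omega>|N. iexp (s * Y \<omega> + U \<omega>) * H \<omega>)" for s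
    using eq[of s 1] by simp
  have c2: "(CLINT \<omega>|M. iexp (s * X \<omega> + -1 * T \<omega>) * G \<omega>) = (CLINT \<omega>|N. iexp (s * Y \<omega> + -1 * U \<omega>) * H \<omega>)" for s
    using eq[of s "-1"] by simp
  have e0: "(\<integral>\<omega>. indicator A (X \<omega>) * G \<omega> \<partial>M) = (\<integral>\<omega>. indicator A (Y \<omega>) * H \<omega> \<partial>N)"
    by (rule weighted_Levy_uniqueness[OF M N, where B=1]) (use G H c0 in auto)
  have ec: "(\<integral>\<omega>. indicator A (X \<omega>) * (G \<omega> * (1 + cos (T \<omega>))) \<partial>M) = (\<integral>\<omega>. indicator A (Y \<omega>) * (H \<omega> * (1 + cos (U \<omega>))) \<partial>N)"
  proof (rule weighted_Levy_uniqueness[OF M N, where B=2])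
    show "0 \<le> G \<omega> * (1 + cos (T \<omega>))" "G \<omega> * (1 + cos (T \<omega>)) \<le> 2" for \<omega>
      by (intro w2 G cos_ge_minus_one cos_le_one)+
    show "0 \<le> H \<omega> * (1 + cos (U \<omega>))" "H \<omega> * (1 + cos (U \<omega>)) \<le> 2" for \<omega>
      by (intro w2 H cos_ge_minus_one cos_le_one)+
    show "(CLINT \<omega>|M. iexp (s * X \<omega>) * (G \<omega> * (1 + cos (T \<omega>)))) = (CLINT \<omega>|N. iexp (s * Y \<omega>) * (H \<omega> * (1 + cos (U \<omega>))))" for s
      unfolding cosE
      by (subst Bochner_Integration.integral_add Bochner_Integration.integral_divide_zero; (intro Bochner_Integration.integrable_add integrable_divide_zero iM[OF _ _ Gb] iN[OF _ _ Hb]; measurable)?)+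
         (simp only: c0 c1 c2)
  qed measurable
  have es: "(\<integral>\<omega>. indicator A (X \<omega>) * (G \<omega> * (1 + sin (T \<omega>))) \<partial>M) = (\<integral>\<omega>. indicator A (Y \<omega>) * (H \<omega> * (1 + sin (U \<omega>))) \<partial>N)"
  proof (rule weighted_Levy_uniqueness[OF M N, where B=2])
    show "0 \<le> G \<omega> * (1 + sin (T \<omega>))" "G \<omega> * (1 + sin (T \<omega>)) \<le> 2" for \<omega>
      by (intro w2 G sin_ge_minus_one sin_le_one)+
    show "0 \<le> H \<omega> * (1 + sin (U \<omega>))" "H \<omega> * (1 + sin (U \<omega>)) \<le> 2" for \<omega>
      by (intro w2 H sin_ge_minus_one sin_le_one)+
    show "(CLINT \<omega>|M. iexp (s * X \<omega>) * (G \<omega> * (1 + sin (T \<omega>)))) = (CLINT \<omega>|N. iexp (s * Y \<omega>) * (H \<omega> * (1 + sin (U \<omega>))))" for s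
      unfolding sinE
      by (subst Bochner_Integration.integral_add Bochner_Integration.integral_diff integral_mult_left_zero; (intro Bochner_Integration.integrable_add Bochner_Integration.integrable_diff integrable_mult_left iM[OF _ _ Gb] iN[OF _ _ Hb]; measurable)?)+
         (simp only: c0 c1 c2)
  qed measurable
  have b: "\<bar>indicator A x * (g :: real)\<bar> \<le> 1" if "0 \<le> g" "g \<le> 1" for x g :: real
    using that by (auto simp: indicator_def)
  have b2: "\<bar>indicator A x * (g * t)\<bar> \<le> 1" if "0 \<le> g" "g \<le> 1" "\<bar>t\<bar> \<le> 1" for x g t :: real
    using that mult_mono[of "\<bar>g\<bar>" 1 "\<bar>t\<bar>" 1] by (auto simp: indicator_def abs_mult)
  have iG: "integrable M (\<lambda>\<omega>. indicator A (X \<omega>) * G \<omega>)"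
      "integrable M (\<lambda>\<omega>. indicator A (X \<omega>) * (G \<omega> * cos (T \<omega>)))"
      "integrable M (\<lambda>\<omega>. indicator A (X \<omega>) * (G \<omega> * sin (T \<omega>)))"
    by (rule rM[of _ 1]; (measurable; fail)?; intro b b2 G abs_cos_le_one abs_sin_le_one)+
  have iH: "integrable N (\<lambda>\<omega>. indicator A (Y \<omega>) * H \<omega>)"
      "integrable N (\<lambda>\<omega>. indicator A (Y \<omega>) * (H \<omega> * cos (U \<omega>)))"
      "integrable N (\<lambda>\<omega>. indicator A (Y \<omega>) * (H \<omega> * sin (U \<omega>)))"
    by (rule rN[of _ 1]; (measurable; fail)?; intro b b2 H abs_cos_le_one abs_sin_le_one)+
  have C: "(\<integral>\<omega>. indicator A (X \<omega>) * (G \<omega> * cos (T \<omega>)) \<partial>M) = (\<integral>\<omega>. indicator A (Y \<omega>) * (H \<omega> * cos (U \<omega>)) \<partial>N)"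
    using ec e0 unfolding distrib_left mult_1_right
    by (subst (asm) (1 2) Bochner_Integration.integral_add) (auto intro!: iG iH)
  have S: "(\<integral>\<omega>. indicator A (X \<omega>) * (G \<omega> * sin (T \<omega>)) \<partial>M) = (\<integral>\<omega>. indicator A (Y \<omega>) * (H \<omega> * sin (U \<omega>)) \<partial>N)"
    using es e0 unfolding distrib_left mult_1_right
    by (subst (asm) (1 2) Bochner_Integration.integral_add) (auto intro!: iG iH)
  show ?thesis
  proof (rule complex_integral_eqI)
    show "integrable M (\<lambda>\<omega>. iexp (T \<omega>) * complex_of_real (indicator A (X \<omega>) * G \<omega>))"
      by (rule iM[of _ _ 1]) (use b G in auto)
    show "integrable N (\<lambda>\<omega>. iexp (U \<omega>) * complex_of_real (indicator A (Y \<omega>) * H \<omega>))"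
      by (rule iN[of _ _ 1]) (use b H in auto)
  qed (use C S in \<open>simp_all add: cis_conv_exp[symmetric] mult_ac\<close>)
qed

text \<open>Uniqueness for random vectors follows from the one-dimensional theorem: the trigonometric factors
  are replaced by indicators one coordinate at a time, while the remaining coordinates act as a
  weight. In the end only the probabilities of boxes are left.\<close>

lemma char_vector_unique:
  fixes X :: "'i \<Rightarrow> 'a \<Rightarrow> real" and Y :: "'i \<Rightarrow> 'b \<Rightarrow> real"
  assumes fin: "finite I" and M: "prob_space M" and N: "prob_space N"
    and X [measurable]: "\<And>i. i \<in> I \<Longrightarrow> X i \<in> borel_measurable M"
    and Y [measurable]: "\<And>i. i \<in> I \<Longrightarrow> Y i \<in> borel_measurable N"
    and eq: "\<And>t. (CLINT \<omega>|M. iexp (\<Sum>i\<in>I. t i * X i \<omega>)) = (CLINT \<omega>|N. iexp (\<Sum>i\<in>I. t i * Y i \<omega>))"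
  shows "distr M (\<Pi>\<^sub>M i\<in>I. borel) (\<lambda>\<omega>. \<lambda>i\<in>I. X i \<omega>) = distr N (\<Pi>\<^sub>M i\<in>I. borel) (\<lambda>\<omega>. \<lambda>i\<in>I. Y i \<omega>)"
proof -
  interpret M: prob_space M by fact
  interpret N: prob_space N by fact
  have mixed: "(CLINT \<omega>|M. iexp (\<Sum>i\<in>I. t i * X i \<omega>) * (\<Prod>i\<in>S. indicator (A i) (X i \<omega>) :: real))
     = (CLINT \<omega>|N. iexp (\<Sum>i\<in>I. t i * Y i \<omega>) * (\<Prod>i\<in>S. indicator (A i) (Y i \<omega>) :: real))"
    if "S \<subseteq> I" and A: "\<And>i. i \<in> S \<Longrightarrow> A i \<in> sets borel" for S A t
    using finite_subset[OF that(1) fin] that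
  proof (induction S arbitrary: t rule: finite_induct)
    case empty
    then show ?case using eq by simp
  next
    case (insert k S)
    note [measurable] = insert.prems(2)
    have k: "k \<in> I" and SI: "\<And>i. i \<in> S \<Longrightarrow> i \<in> I" using insert.prems(1) by auto
    have coord: "(\<Sum>i\<in>I. (if i = k then s + r * t i else r * t i) * x i) = s * x k + r * (\<Sum>i\<in>I. t i * x i)" for s r and x :: "'i \<Rightarrow> real"
    proof -
      have "(\<Sum>i\<in>I. (if i = k then s + r * t i else r * t i) * x i) = (\<Sum>i\<in>I. (if i = k then s * x k else 0) + r * (t i * x i))"
        by (intro sum.cong) (auto simp: algebra_simps)
      then show ?thesis using fin k by (simp add: sum.distrib sum_distrib_left)
    qed
    have "(CLINT \<omega>|M. iexp (\<Sum>i\<in>I. t i * X i \<omega>) * (indicator (A k) (X k \<omega>) * (\<Prod>i\<in>S. indicator (A i) (X i \<omega>) :: real)))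
     = (CLINT \<omega>|N. iexp (\<Sum>i\<in>I. t i * Y i \<omega>) * (indicator (A k) (Y k \<omega>) * (\<Prod>i\<in>S. indicator (A i) (Y i \<omega>) :: real)))"
    proof (rule mixed_expectation_step[OF M N])
      show "(CLINT \<omega>|M. iexp (s * X k \<omega> + r * (\<Sum>i\<in>I. t i * X i \<omega>)) * (\<Prod>i\<in>S. indicator (A i) (X i \<omega>) :: real)) =
        (CLINT \<omega>|N. iexp (s * Y k \<omega> + r * (\<Sum>i\<in>I. t i * Y i \<omega>)) * (\<Prod>i\<in>S. indicator (A i) (Y i \<omega>) :: real))" for s r
        using insert.IH[of "\<lambda>i. if i = k then s + r * t i else r * t i"] insert.prems
        by (simp only: coord) blast
      show "(\<lambda>\<omega>. \<Prod>i\<in>S. indicator (A i) (X i \<omega>) :: real) \<in> borel_measurable M"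
        using SI insert.prems by measurable
      show "(\<lambda>\<omega>. \<Prod>i\<in>S. indicator (A i) (Y i \<omega>) :: real) \<in> borel_measurable N"
        using SI insert.prems by measurable
    qed (use k insert.prems in \<open>auto intro!: prod_nonneg prod_le_1\<close>)
    then show ?case using insert.hyps by simp
  qed
  have mX: "(\<lambda>\<omega>. \<lambda>i\<in>I. X i \<omega>) \<in> measurable M (\<Pi>\<^sub>M i\<in>I. borel)" by measurable
  have mY: "(\<lambda>\<omega>. \<lambda>i\<in>I. Y i \<omega>) \<in> measurable N (\<Pi>\<^sub>M i\<in>I. borel)" by measurable
  have box: "emeasure (distr K (\<Pi>\<^sub>M i\<in>I. borel) (\<lambda>\<omega>. \<lambda>i\<in>I. Z i \<omega>)) (Pi\<^sub>E I A) = ennreal (\<integral>\<omega>. (\<Prod>i\<in>I. indicator (A i) (Z i \<omega>)) \<partial>K)"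
    if K: "prob_space K" and Z [measurable]: "\<And>i. i \<in> I \<Longrightarrow> Z i \<in> borel_measurable K"
      and A [measurable]: "\<And>i. i \<in> I \<Longrightarrow> A i \<in> sets borel" for K :: "'c measure" and Z and A :: "'i \<Rightarrow> real set"
  proof -
    interpret K: prob_space K by fact
    have mZ: "(\<lambda>\<omega>. \<lambda>i\<in>I. Z i \<omega>) \<in> measurable K (\<Pi>\<^sub>M i\<in>I. borel)" by measurable
    have s: "Pi\<^sub>E I A \<in> sets (\<Pi>\<^sub>M i\<in>I. borel)" using fin A by (intro sets_PiM_I_finite) auto
    have "emeasure (distr K (\<Pi>\<^sub>M i\<in>I. borel) (\<lambda>\<omega>. \<lambda>i\<in>I. Z i \<omega>)) (Pi\<^sub>E I A) = emeasure K ((\<lambda>\<omega>. \<lambda>i\<in>I. Z i \<omega>) -` (Pi\<^sub>E I A) \<inter> space K)"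
      by (rule emeasure_distr[OF mZ s])
    also have "\<dots> = ennreal (\<integral>\<omega>. indicator ((\<lambda>\<omega>. \<lambda>i\<in>I. Z i \<omega>) -` (Pi\<^sub>E I A) \<inter> space K) \<omega> \<partial>K)"
      using measurable_sets[OF mZ s] by (simp add: K.emeasure_eq_measure)
    also have "(\<integral>\<omega>. indicator ((\<lambda>\<omega>. \<lambda>i\<in>I. Z i \<omega>) -` (Pi\<^sub>E I A) \<inter> space K) \<omega> \<partial>K) = (\<integral>\<omega>. (\<Prod>i\<in>I. indicator (A i) (Z i \<omega>)) \<partial>K :: real)"
      using fin by (intro Bochner_Integration.integral_cong) (auto simp: indicator_def PiE_iff prod_zero_iff)
    finally show ?thesis .
  qed
  show ?thesis
  proof (rule measure_eqI_PiM_finite[where I=I and M="\<lambda>_. borel" and A="\<lambda>_. Pi\<^sub>E I (\<lambda>_. UNIV)"])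
    fix A :: "'i \<Rightarrow> real set" assume A: "\<And>i. i \<in> I \<Longrightarrow> A i \<in> sets borel"
    have "complex_of_real (\<integral>\<omega>. (\<Prod>i\<in>I. indicator (A i) (X i \<omega>)) \<partial>M) = complex_of_real (\<integral>\<omega>. (\<Prod>i\<in>I. indicator (A i) (Y i \<omega>)) \<partial>N)"
      using mixed[of I A "\<lambda>_. 0"] A by (simp del: of_real_prod)
    hence "(\<integral>\<omega>. (\<Prod>i\<in>I. indicator (A i) (X i \<omega>)) \<partial>M :: real) = (\<integral>\<omega>. (\<Prod>i\<in>I. indicator (A i) (Y i \<omega>)) \<partial>N)"
      by (simp only: of_real_eq_iff)
    then show "emeasure (distr M (\<Pi>\<^sub>M i\<in>I. borel) (\<lambda>\<omega>. \<lambda>i\<in>I. X i \<omega>)) (Pi\<^sub>E I A) = emeasure (distr N (\<Pi>\<^sub>M i\<in>I. borel) (\<lambda>\<omega>. \<lambda>i\<in>I. Y i \<omega>)) (Pi\<^sub>E I A)"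
      by (simp add: box[OF M X A] box[OF N Y A])
  next
    show "emeasure (distr M (\<Pi>\<^sub>M i\<in>I. borel) (\<lambda>\<omega>. \<lambda>i\<in>I. X i \<omega>)) (Pi\<^sub>E I (\<lambda>_. UNIV)) \<noteq> \<infinity>"
      using M.prob_space_distr[OF mX] by (simp add: prob_space_def finite_measure.emeasure_finite)
  qed (use fin in \<open>auto simp: space_PiM intro!: prod_algebraI_finite\<close>)
qed

section \<open>Gaussian vectors\<close>

abbreviation \<Phi> :: "real measure" where "\<Phi> \<equiv> std_normal_distribution"

lemma prob_space_std_normal: "prob_space \<Phi>"
  using real_dist_normal_dist by (simp add: real_distribution_def)

lemma expectation_iexp_std_normal: "(CLINT x|\<Phi>. iexp (t * x)) = exp (- (t\<^sup>2) / 2)"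
  using fun_cong[OF char_std_normal_distribution, of t] by (simp add: char_def)

lemma std_normal_stein:
  assumes d: "\<And>x. (k has_real_derivative k' x) (at x)" and c: "continuous_on UNIV k'"
    and k: "\<And>x. \<bar>k x\<bar> \<le> B" and k': "\<And>x. \<bar>k' x\<bar> \<le> C"
  shows "(\<integral>x. k x * x \<partial>\<Phi>) = (\<integral>x. k' x \<partial>\<Phi>)"
proof -
  interpret prob_space \<Phi> by (rule prob_space_std_normal)
  let ?p = std_normal_density
  have B0: "B \<ge> 0" using k[of 0] by linarith
  have dk: "continuous_on UNIV k" using d by (meson DERIV_isCont continuous_at_imp_continuous_on)
  have [measurable]: "k \<in> borel_measurable borel" "k' \<in> borel_measurable borel"
    using dk c by (auto intro: borel_measurable_continuous_onI)
  have i1: "integrable lborel (\<lambda>x. ?p x * (k x * x))"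
  proof (rule Bochner_Integration.integrable_bound[of _ "\<lambda>x. B * (?p x * \<bar>x\<bar>^1)"])
    show "integrable lborel (\<lambda>x. B * (?p x * \<bar>x\<bar>^1))"
      by (intro integrable_mult_right integrable_std_normal_moment_abs)
    show "AE x in lborel. norm (?p x * (k x * x)) \<le> norm (B * (?p x * \<bar>x\<bar>^1))"
    proof (intro AE_I2)
      fix x :: real
      have "\<bar>k x\<bar> * (?p x * \<bar>x\<bar>) \<le> B * (?p x * \<bar>x\<bar>)" by (intro mult_right_mono k) auto
      then show "norm (?p x * (k x * x)) \<le> norm (B * (?p x * \<bar>x\<bar>^1))"
        using B0 by (simp add: abs_mult mult_ac)
    qed
  qed measurable
  have i2: "integrable lborel (\<lambda>x. ?p x * k' x)"
  proof (rule Bochner_Integration.integrable_bound[of _ "\<lambda>x. C * ?p x"])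
    show "AE x in lborel. norm (?p x * k' x) \<le> norm (C * ?p x)"
      using k' by (intro AE_I2) (simp add: abs_mult mult.commute order_trans[OF _ abs_ge_self] mult_right_mono)
  qed auto
  let ?F = "\<lambda>x. - (k x * ?p x)" and ?f = "\<lambda>x. ?p x * (k x * x) - ?p x * k' x"
  have dp: "(?p has_real_derivative - x * ?p x) (at x)" for x
    unfolding std_normal_density_def by (auto intro!: derivative_eq_intros simp: field_simps)
  have lim: "((\<lambda>x. B * ?p x) \<longlongrightarrow> 0) at_top" "((\<lambda>x. B * ?p x) \<longlongrightarrow> 0) at_bot"
    unfolding std_normal_density_def by real_asymp+
  have F0: "(?F \<longlongrightarrow> 0) at_top" "(?F \<longlongrightarrow> 0) at_bot"
    by (rule Lim_null_comparison[OF _ lim(1)], intro always_eventually allI, simp add: abs_mult k mult_right_mono,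
        rule Lim_null_comparison[OF _ lim(2)], intro always_eventually allI, simp add: abs_mult k mult_right_mono)
  have "(LBINT x=-\<infinity>..\<infinity>. ?f x) = 0 - 0"
  proof (rule interval_integral_FTC_integrable)
    show "(?F has_vector_derivative ?f x) (at x)" for x
      unfolding has_real_derivative_iff_has_vector_derivative[symmetric]
      by (auto intro!: derivative_eq_intros d dp simp: algebra_simps)
    show "isCont ?f x" for x
    proof -
      have "isCont ?p x" using dp DERIV_isCont by blast
      moreover have "isCont k x" "isCont k' x" using dk c by (auto simp: continuous_on_eq_continuous_at)
      ultimately show ?thesis by (intro continuous_intros)
    qed
    show "set_integrable lborel (einterval (-\<infinity>) \<infinity>) ?f"
      unfolding set_integrable_def using i1 i2 by simp
  qed (use F0 in \<open>simp_all add: ereal_tendsto_simps\<close>)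
  hence "(\<integral>x. ?f x \<partial>lborel) = 0" by (simp add: interval_lebesgue_integral_def set_lebesgue_integral_def)
  hence "(\<integral>x. ?p x * (k x * x) \<partial>lborel) = (\<integral>x. ?p x * k' x \<partial>lborel)"
    using i1 i2 by (simp add: Bochner_Integration.integral_diff)
  then show ?thesis by (simp add: integral_density)
qed

text \<open>Centred Gaussian vectors are described by their characteristic function, so that singular
  covariances \<open>R\<close> are included.\<close>

definition gauss_family :: "'a measure \<Rightarrow> 'i set \<Rightarrow> ('i \<Rightarrow> 'a \<Rightarrow> real) \<Rightarrow> ('i \<Rightarrow> 'i \<Rightarrow> real) \<Rightarrow> bool" where
  "gauss_family M I X R \<longleftrightarrow> (\<forall>i\<in>I. X i \<in> borel_measurable M) \<and>
     (\<forall>t. (CLINT \<omega>|M. iexp (\<Sum>i\<in>I. t i * X i \<omega>)) =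
        complex_of_real (exp (- (\<Sum>i\<in>I. \<Sum>k\<in>I. t i * t k * R i k) / 2)))"

text \<open>Density of two standard normal variables with correlation \<open>c\<close>.\<close>

definition bvn :: "real \<Rightarrow> real \<Rightarrow> real \<Rightarrow> real" where
  "bvn c x y = exp (- (x\<^sup>2 - 2 * c * x * y + y\<^sup>2) / (2 * (1 - c\<^sup>2))) / (2 * pi * sqrt (1 - c\<^sup>2))"

lemma bvn_nonneg: "\<bar>c\<bar> < 1 \<Longrightarrow> 0 \<le> bvn c x y"
  by (auto simp: bvn_def abs_square_less_1 less_imp_le intro!: divide_nonneg_nonneg)

lemma bvn_factor:
  assumes "\<bar>c\<bar> < 1"
  shows "std_normal_density x * normal_density (c * x) (sqrt (1 - c\<^sup>2)) y = bvn c x y"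
proof -
  have c: "0 < 1 - c\<^sup>2" using assms by (simp add: abs_square_less_1)
  have "- x\<^sup>2 / 2 + - (y - c * x)\<^sup>2 / (2 * (1 - c\<^sup>2)) = - (x\<^sup>2 - 2 * c * x * y + y\<^sup>2) / (2 * (1 - c\<^sup>2))"
    using c by (simp add: divide_simps) (simp add: algebra_simps power2_eq_square)
  hence "exp (- x\<^sup>2 / 2) * exp (- (y - c * x)\<^sup>2 / (2 * (1 - c\<^sup>2))) = exp (- (x\<^sup>2 - 2 * c * x * y + y\<^sup>2) / (2 * (1 - c\<^sup>2)))"
    by (simp only: exp_add[symmetric])
  moreover have "sqrt (2 * pi) * sqrt (2 * pi * (1 - c\<^sup>2)) = 2 * pi * sqrt (1 - c\<^sup>2)"
    using real_sqrt_mult[of "2 * pi" "1 - c\<^sup>2"] real_sqrt_mult_self[of "2 * pi"]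
    by (simp only: mult.assoc[symmetric]) simp
  ultimately show ?thesis
    using c unfolding normal_density_def bvn_def by (simp add: field_simps)
qed

lemma integral_pair_iexp_prod:
  assumes "prob_space M" "prob_space N"
    and [measurable]: "f \<in> borel_measurable M" "g \<in> borel_measurable N"
  shows "(CLINT p|M \<Otimes>\<^sub>M N. iexp (f (fst p) + g (snd p))) = (CLINT x|M. iexp (f x)) * (CLINT y|N. iexp (g y))"
proof -
  interpret M: prob_space M by fact
  interpret N: prob_space N by fact
  interpret P: pair_prob_space M N ..
  have "(CLINT p|M \<Otimes>\<^sub>M N. iexp (f (fst p) + g (snd p))) = (CLINT x|M. CLINT y|N. iexp (f x) * iexp (g y))"
    by (subst P.integral_fst'[symmetric])
       (auto intro!: P.integrable_const_bound[of _ 1] Bochner_Integration.integral_cong simp: exp_add norm_mult distrib_left)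
  also have "\<dots> = (CLINT x|M. iexp (f x)) * (CLINT y|N. iexp (g y))" by simp
  finally show ?thesis .
qed

text \<open>A correlated pair has the law of \<open>(\<zeta>, c \<zeta> + \<surd>(1 - c\<^sup>2) \<eta>)\<close> with independent standard
  normal \<open>\<zeta>\<close> and \<open>\<eta>\<close>.\<close>

lemma nn_integral_gauss_pair:
  assumes M: "prob_space M" and [measurable]: "A \<in> borel_measurable M" "B \<in> borel_measurable M"
    and char: "\<And>s t. (CLINT \<omega>|M. iexp (s * A \<omega> + t * B \<omega>)) = exp (- (s\<^sup>2 + 2 * c * s * t + t\<^sup>2) / 2)"
    and c: "\<bar>c\<bar> < 1" and f [measurable]: "case_prod f \<in> borel_measurable (borel \<Otimes>\<^sub>M borel)"
  shows "(\<integral>\<^sup>+\<omega>. f (A \<omega>) (B \<omega>) \<partial>M) = (\<integral>\<^sup>+x. \<integral>\<^sup>+y. ennreal (bvn c x y) * f x y \<partial>lborel \<partial>lborel)"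
proof -
  interpret M: prob_space M by fact
  interpret S: prob_space \<Phi> by (rule prob_space_std_normal)
  interpret P: pair_prob_space \<Phi> \<Phi> ..
  define r where "r = sqrt (1 - c\<^sup>2)"
  have c1: "0 < 1 - c\<^sup>2" using c by (simp add: abs_square_less_1)
  have r: "r > 0" "r\<^sup>2 = 1 - c\<^sup>2" using c1 by (auto simp: r_def)
  let ?X = "\<lambda>b::bool. if b then A else B"
  let ?Y = "\<lambda>b::bool. if b then (\<lambda>p. fst p) else (\<lambda>p. c * fst p + r * snd p)"
  have eq: "distr M (\<Pi>\<^sub>M i\<in>UNIV. borel) (\<lambda>\<omega>. \<lambda>i\<in>UNIV. ?X i \<omega>) = distr (\<Phi> \<Otimes>\<^sub>M \<Phi>) (\<Pi>\<^sub>M i\<in>UNIV. borel) (\<lambda>\<omega>. \<lambda>i\<in>UNIV. ?Y i \<omega>)"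
  proof (rule char_vector_unique)
    fix t :: "bool \<Rightarrow> real"
    have "(CLINT p|\<Phi> \<Otimes>\<^sub>M \<Phi>. iexp (\<Sum>i\<in>UNIV. t i * ?Y i p)) = (CLINT p|\<Phi> \<Otimes>\<^sub>M \<Phi>. iexp ((t True + c * t False) * fst p + (r * t False) * snd p))"
      by (intro Bochner_Integration.integral_cong) (auto simp: UNIV_bool algebra_simps)
    also have "\<dots> = (CLINT x|\<Phi>. iexp ((t True + c * t False) * x)) * (CLINT x|\<Phi>. iexp (r * t False * x))"
      by (rule integral_pair_iexp_prod[OF prob_space_std_normal prob_space_std_normal]) auto
    also have "\<dots> = exp (- ((t True + c * t False)\<^sup>2) / 2 + - ((r * t False)\<^sup>2) / 2)"
      by (subst expectation_iexp_std_normal)+ (simp only: exp_add of_real_mult)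
    also have "- ((t True + c * t False)\<^sup>2) / 2 + - ((r * t False)\<^sup>2) / 2 = - ((t True)\<^sup>2 + 2 * c * t True * t False + (t False)\<^sup>2) / 2"
      unfolding power_mult_distrib r(2) by (simp add: field_simps power2_eq_square)
    also have "complex_of_real (exp \<dots>) = (CLINT \<omega>|M. iexp (\<Sum>i\<in>UNIV. t i * ?X i \<omega>))"
      by (subst char[symmetric]) (simp add: UNIV_bool add.commute)
    finally show "(CLINT \<omega>|M. iexp (\<Sum>i\<in>UNIV. t i * ?X i \<omega>)) = (CLINT p|\<Phi> \<Otimes>\<^sub>M \<Phi>. iexp (\<Sum>i\<in>UNIV. t i * ?Y i p))" ..
  qed (auto intro: M P.prob_space_axioms)
  have mX: "(\<lambda>\<omega>. \<lambda>i\<in>UNIV. ?X i \<omega>) \<in> measurable M (\<Pi>\<^sub>M i\<in>UNIV. borel)"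
    by (rule measurable_restrict) auto
  have mY: "(\<lambda>\<omega>. \<lambda>i\<in>UNIV. ?Y i \<omega>) \<in> measurable (\<Phi> \<Otimes>\<^sub>M \<Phi>) (\<Pi>\<^sub>M i\<in>UNIV. borel)"
    by (rule measurable_restrict) auto
  have g: "(\<lambda>x. f (x True) (x False)) \<in> borel_measurable (\<Pi>\<^sub>M i\<in>(UNIV::bool set). borel :: real measure)" by measurable
  have "(\<integral>\<^sup>+\<omega>. f (A \<omega>) (B \<omega>) \<partial>M) = (\<integral>\<^sup>+x. f (x True) (x False) \<partial>distr M (\<Pi>\<^sub>M i\<in>UNIV. borel) (\<lambda>\<omega>. \<lambda>i\<in>UNIV. ?X i \<omega>))"
    using g by (subst nn_integral_distr[OF mX]) auto
  also have "\<dots> = (\<integral>\<^sup>+p. f (fst p) (c * fst p + r * snd p) \<partial>(\<Phi> \<Otimes>\<^sub>M \<Phi>))"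
    unfolding eq using g by (subst nn_integral_distr[OF mY]) auto
  also have "\<dots> = (\<integral>\<^sup>+x. \<integral>\<^sup>+z. f x (c * x + r * z) \<partial>\<Phi> \<partial>\<Phi>)"
    by (subst S.nn_integral_fst[symmetric]) auto
  also have "\<dots> = (\<integral>\<^sup>+x. ennreal (std_normal_density x) * (\<integral>\<^sup>+z. ennreal (std_normal_density z) * f x (c * x + r * z) \<partial>lborel) \<partial>lborel)"
    by (simp add: nn_integral_density)
  also have "\<dots> = (\<integral>\<^sup>+x. ennreal (std_normal_density x) * (\<integral>\<^sup>+y. ennreal (normal_density (c * x) r y) * f x y \<partial>lborel) \<partial>lborel)"
  proof (rule nn_integral_cong, rule arg_cong2[where f="(*)"], rule refl)
    fix x :: real
    have "(\<integral>\<^sup>+y. ennreal (normal_density (c * x) r y) * f x y \<partial>lborel) = ennreal \<bar>r\<bar> * (\<integral>\<^sup>+z. ennreal (normal_density (c * x) r (c * x + r * z)) * f x (c * x + r * z) \<partial>lborel)"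
      using r by (intro nn_integral_real_affine) auto
    also have "\<dots> = (\<integral>\<^sup>+z. ennreal r * (ennreal (normal_density (c * x) r (c * x + r * z)) * f x (c * x + r * z)) \<partial>lborel)"
      using r by (subst nn_integral_cmult) auto
    also have "\<dots> = (\<integral>\<^sup>+z. ennreal (std_normal_density z) * f x (c * x + r * z) \<partial>lborel)"
    proof (intro nn_integral_cong)
      fix z :: real
      have "r * normal_density (c * x) r (c * x + r * z) = std_normal_density z"
        using r(1) by (simp add: normal_density_def real_sqrt_mult power_mult_distrib)
      then show "ennreal r * (ennreal (normal_density (c * x) r (c * x + r * z)) * f x (c * x + r * z)) = ennreal (std_normal_density z) * f x (c * x + r * z)"
        using r(1) by (simp add: mult.assoc[symmetric] ennreal_mult[symmetric])
    qed
    finally show "(\<integral>\<^sup>+z. ennreal (std_normal_density z) * f x (c * x + r * z) \<partial>lborel) = (\<integral>\<^sup>+y. ennreal (normal_density (c * x) r y) * f x y \<partial>lborel)" ..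
  qed
  also have "\<dots> = (\<integral>\<^sup>+x. \<integral>\<^sup>+y. ennreal (bvn c x y) * f x y \<partial>lborel \<partial>lborel)"
    by (intro nn_integral_cong, subst nn_integral_cmult[symmetric])
       (auto simp: bvn_factor[OF c, symmetric] r_def mult.assoc[symmetric] ennreal_mult[symmetric])
  finally show ?thesis .
qed

text \<open>The regression of a Gaussian vector \<open>V\<close> on a standard normal variable \<open>W\<close> with
  \<open>Cov V\<^sub>i W = \<kappa>\<^sub>i\<close>: the residual \<open>V - \<kappa> W\<close> is independent of \<open>W\<close>, so \<open>W\<close> can be replaced by a
  fresh standard normal variable.\<close>

lemma gauss_regression:
  fixes V :: "'i \<Rightarrow> 'a \<Rightarrow> real"
  assumes fin: "finite I" and M: "prob_space M"
    and V [measurable]: "\<And>i. i \<in> I \<Longrightarrow> V i \<in> borel_measurable M" and [measurable]: "W \<in> borel_measurable M"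
    and char: "\<And>t s. (CLINT \<omega>|M. iexp ((\<Sum>i\<in>I. t i * V i \<omega>) + s * W \<omega>)) =
       exp (- (q0 t + 2 * s * (\<Sum>i\<in>I. t i * \<kappa> i) + s\<^sup>2) / 2)"
  defines "K \<equiv> insert None (Some ` I)"
  shows "distr M (\<Pi>\<^sub>M i\<in>K. borel) (\<lambda>\<omega>. \<lambda>i\<in>K. case_option W V i \<omega>)
       = distr (M \<Otimes>\<^sub>M \<Phi>) (\<Pi>\<^sub>M i\<in>K. borel)
           (\<lambda>p. \<lambda>i\<in>K. case_option (snd p) (\<lambda>i. V i (fst p) - \<kappa> i * W (fst p) + \<kappa> i * snd p) i)"
proof -
  interpret M: prob_space M by fact
  interpret S: prob_space \<Phi> by (rule prob_space_std_normal)
  interpret P: pair_prob_space M \<Phi> ..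
  have split: "(\<Sum>i\<in>K. f i) = (\<Sum>i\<in>I. f (Some i)) + f None" for f :: "'i option \<Rightarrow> real"
    using fin by (simp add: K_def sum.reindex add.commute)
  show ?thesis
  proof (rule char_vector_unique[where Y="\<lambda>i p. case_option (snd p) (\<lambda>i. V i (fst p) - \<kappa> i * W (fst p) + \<kappa> i * snd p) i"])
    fix t :: "'i option \<Rightarrow> real"
    let ?t = "\<lambda>i. t (Some i)" and ?s = "t None" and ?k = "\<Sum>i\<in>I. t (Some i) * \<kappa> i"
    have "(CLINT p|M \<Otimes>\<^sub>M \<Phi>. iexp (\<Sum>i\<in>K. t i * case_option (snd p) (\<lambda>i. V i (fst p) - \<kappa> i * W (fst p) + \<kappa> i * snd p) i))
      = (CLINT p|M \<Otimes>\<^sub>M \<Phi>. iexp (((\<Sum>i\<in>I. ?t i * V i (fst p)) + (- ?k) * W (fst p)) + (?s + ?k) * snd p))"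
    proof (intro Bochner_Integration.integral_cong refl arg_cong[where f=iexp])
      fix p :: "'a \<times> real"
      have "(\<Sum>i\<in>K. t i * case_option (snd p) (\<lambda>i. V i (fst p) - \<kappa> i * W (fst p) + \<kappa> i * snd p) i)
        = (\<Sum>i\<in>I. ?t i * V i (fst p) - (?t i * \<kappa> i) * W (fst p) + (?t i * \<kappa> i) * snd p) + ?s * snd p"
        unfolding split by (simp add: algebra_simps)
      also have "\<dots> = ((\<Sum>i\<in>I. ?t i * V i (fst p)) + (- ?k) * W (fst p)) + (?s + ?k) * snd p"
        unfolding sum.distrib sum_subtractf sum_distrib_right[symmetric] by (simp only: algebra_simps)
      finally show "(\<Sum>i\<in>K. t i * case_option (snd p) (\<lambda>i. V i (fst p) - \<kappa> i * W (fst p) + \<kappa> i * snd p) i)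
        = ((\<Sum>i\<in>I. ?t i * V i (fst p)) + (- ?k) * W (fst p)) + (?s + ?k) * snd p" .
    qed
    also have "\<dots> = (CLINT \<omega>|M. iexp ((\<Sum>i\<in>I. ?t i * V i \<omega>) + (- ?k) * W \<omega>)) * (CLINT x|\<Phi>. iexp ((?s + ?k) * x))"
      by (rule integral_pair_iexp_prod[OF M prob_space_std_normal]) auto
    also have "\<dots> = exp (- (q0 ?t + 2 * (- ?k) * ?k + (- ?k)\<^sup>2) / 2 + - ((?s + ?k)\<^sup>2) / 2)"
      by (subst char, subst expectation_iexp_std_normal) (simp only: exp_add of_real_mult)
    also have "- (q0 ?t + 2 * (- ?k) * ?k + (- ?k)\<^sup>2) / 2 + - ((?s + ?k)\<^sup>2) / 2 = - (q0 ?t + 2 * ?s * ?k + ?s\<^sup>2) / 2"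
      by (simp add: field_simps power2_eq_square)
    also have "complex_of_real (exp \<dots>) = (CLINT \<omega>|M. iexp ((\<Sum>i\<in>I. ?t i * V i \<omega>) + ?s * W \<omega>))"
      by (rule char[symmetric])
    also have "\<dots> = (CLINT \<omega>|M. iexp (\<Sum>i\<in>K. t i * case_option W V i \<omega>))"
      unfolding split by simp
    finally show "(CLINT \<omega>|M. iexp (\<Sum>i\<in>K. t i * case_option W V i \<omega>)) =
      (CLINT p|M \<Otimes>\<^sub>M \<Phi>. iexp (\<Sum>i\<in>K. t i * case_option (snd p) (\<lambda>i. V i (fst p) - \<kappa> i * W (fst p) + \<kappa> i * snd p) i))" ..
  qed (use fin M P.prob_space_axioms in \<open>auto simp: K_def\<close>)
qed

section \<open>Comparison of two Gaussian vectors\<close>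

lemma gauss_family_marginal:
  assumes M: "prob_space M" and g: "gauss_family M I X R" and fin: "finite I" and i: "i \<in> I" and R: "R i i = 1"
  shows "distr M borel (X i) = \<Phi>"
proof (rule Levy_uniqueness[OF _ real_dist_normal_dist])
  interpret prob_space M by fact
  have m [measurable]: "X i \<in> borel_measurable M" using g i by (auto simp: gauss_family_def)
  show "real_distribution (distr M borel (X i))" by (rule real_distribution_distr[OF m])
  show "char (distr M borel (X i)) = char \<Phi>"
  proof (rule ext)
    fix s
    have e: "(\<Sum>k\<in>I. (if k = i then s else 0) * f k) = s * f i" for f :: "_ \<Rightarrow> real"
    proof -
      have "(\<Sum>k\<in>I. (if k = i then s else 0) * f k) = (\<Sum>k\<in>I. if k = i then s * f k else 0)"
        by (intro sum.cong) auto
      then show ?thesis using fin i by simp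
    qed
    have "char (distr M borel (X i)) s = (CLINT \<omega>|M. iexp (\<Sum>k\<in>I. (if k = i then s else 0) * X k \<omega>))"
      unfolding char_def e by (subst integral_distr) auto
    also have "\<dots> = exp (- (\<Sum>k\<in>I. (if k = i then s else 0) * (\<Sum>l\<in>I. (if l = i then s else 0) * R k l)) / 2)"
      using g unfolding gauss_family_def by (simp add: sum_distrib_left mult.assoc)
    also have "\<dots> = char \<Phi> s" unfolding e char_std_normal_distribution R by (simp add: power2_eq_square)
    finally show "char (distr M borel (X i)) s = char \<Phi> s" .
  qed
qed

lemma gauss_family_integrable_abs:
  assumes M: "prob_space M" and g: "gauss_family M I X R" and fin: "finite I" and i: "i \<in> I" and R: "R i i = 1"
  shows "integrable M (\<lambda>\<omega>. \<bar>X i \<omega>\<bar>)"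
proof -
  have m [measurable]: "X i \<in> borel_measurable M" using g i by (auto simp: gauss_family_def)
  have "integrable (distr M borel (X i)) (\<lambda>x. x)"
    unfolding gauss_family_marginal[OF assms] using integrable_std_normal_distribution_moment[of 1] by simp
  then show ?thesis by (subst (asm) integrable_distr_eq) auto
qed

lemma expectation_has_derivative:
  fixes f f' :: "real \<Rightarrow> 'a \<Rightarrow> real"
  assumes d: "\<And>\<theta> \<omega>. ((\<lambda>\<theta>. f \<theta> \<omega>) has_real_derivative f' \<theta> \<omega>) (at \<theta>)"
    and b: "\<And>\<theta> \<omega>. \<bar>f' \<theta> \<omega>\<bar> \<le> g \<omega>" and g: "integrable M g"
    and f: "\<And>\<theta>. integrable M (f \<theta>)" and m: "f' \<theta> \<in> borel_measurable M"
  shows "((\<lambda>\<theta>. \<integral>\<omega>. f \<theta> \<omega> \<partial>M) has_real_derivative (\<integral>\<omega>. f' \<theta> \<omega> \<partial>M)) (at \<theta>)"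
  unfolding DERIV_def tendsto_at_iff_sequentially comp_def
proof (intro allI impI)
  fix S :: "nat \<Rightarrow> real" assume S: "\<forall>i. S i \<in> UNIV - {0}" and S0: "S \<longlonglongrightarrow> 0"
  have "(\<lambda>n. \<integral>\<omega>. (f (\<theta> + S n) \<omega> - f \<theta> \<omega>) / S n \<partial>M) \<longlonglongrightarrow> (\<integral>\<omega>. f' \<theta> \<omega> \<partial>M)"
  proof (rule integral_dominated_convergence[OF m _ g])
    show "(\<lambda>\<omega>. (f (\<theta> + S n) \<omega> - f \<theta> \<omega>) / S n) \<in> borel_measurable M" for n
      using f[THEN borel_measurable_integrable] by auto
    show "AE \<omega> in M. (\<lambda>n. (f (\<theta> + S n) \<omega> - f \<theta> \<omega>) / S n) \<longlonglongrightarrow> f' \<theta> \<omega>"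
      using d S S0 unfolding DERIV_def tendsto_at_iff_sequentially comp_def by auto
    show "AE \<omega> in M. norm ((f (\<theta> + S n) \<omega> - f \<theta> \<omega>) / S n) \<le> g \<omega>" for n
    proof (intro AE_I2)
      fix \<omega>
      have "norm (f (\<theta> + S n) \<omega> - f \<theta> \<omega>) \<le> g \<omega> * norm ((\<theta> + S n) - \<theta>)"
        by (rule field_differentiable_bound[of UNIV "\<lambda>\<theta>. f \<theta> \<omega>" "\<lambda>\<theta>. f' \<theta> \<omega>"]) (use d b in auto)
      then show "norm ((f (\<theta> + S n) \<omega> - f \<theta> \<omega>) / S n) \<le> g \<omega>"
        using S by (simp add: divide_simps)
    qed
  qed
  then show "(\<lambda>n. ((\<integral>\<omega>. f (\<theta> + S n) \<omega> \<partial>M) - (\<integral>\<omega>. f \<theta> \<omega> \<partial>M)) / S n) \<longlonglongrightarrow> (\<integral>\<omega>. f' \<theta> \<omega> \<partial>M)"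
    using f by simp
qed

lemma weighted_factor_bounds:
  assumes "0 \<le> w" "w \<le> 1" "0 \<le> h" "h \<le> (1::real)"
  shows "0 \<le> 1 - w * h" "1 - w * h \<le> 1"
  using assms mult_mono[of w 1 h 1] by auto

text \<open>Integration by parts in the direction of \<open>W\<close>. Since \<open>V\<^sub>j\<close> is uncorrelated with \<open>W\<close>,
  the factor \<open>h'\<^sub>j\<close> is not differentiated, so that once differentiable functions \<open>h\<close> are smooth
  enough.\<close>

lemma stein_product_bound:
  fixes V :: "'i \<Rightarrow> 'a \<Rightarrow> real" and h h' :: "'i \<Rightarrow> real \<Rightarrow> real"
  assumes fin: "finite I" and M: "prob_space M"
    and V [measurable]: "\<And>i. i \<in> I \<Longrightarrow> V i \<in> borel_measurable M" and W [measurable]: "W \<in> borel_measurable M"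
    and char: "\<And>t s. (CLINT \<omega>|M. iexp ((\<Sum>i\<in>I. t i * V i \<omega>) + s * W \<omega>)) =
       exp (- (q0 t + 2 * s * (\<Sum>i\<in>I. t i * \<kappa> i) + s\<^sup>2) / 2)"
    and j: "j \<in> I" "\<kappa> j = 0"
    and h: "\<And>i x. (h i has_real_derivative h' i x) (at x)" and h'c: "\<And>i. continuous_on UNIV (h' i)"
    and hb: "\<And>i x. 0 \<le> h i x" "\<And>i x. h i x \<le> 1" and h'b: "\<And>i x. 0 \<le> h' i x" "\<And>i x. h' i x \<le> C"
    and w: "\<And>i. 0 \<le> w i" "\<And>i. w i \<le> 1"
  shows "\<bar>\<integral>\<omega>. h' j (V j \<omega>) * (\<Prod>l\<in>I - {j}. 1 - w l * h l (V l \<omega>)) * W \<omega> \<partial>M\<bar>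
     \<le> (\<Sum>l\<in>I - {j}. \<bar>\<kappa> l\<bar> * w l * (\<integral>\<omega>. h' j (V j \<omega>) * h' l (V l \<omega>) \<partial>M))"
proof -
  interpret M: prob_space M by fact
  interpret S: prob_space \<Phi> by (rule prob_space_std_normal)
  interpret P: pair_prob_space M \<Phi> ..
  define K where "K = insert None (Some ` I)"
  have KN: "None \<in> K" and KS: "\<And>i. i \<in> I \<Longrightarrow> Some i \<in> K" by (auto simp: K_def)
  define J where "J = I - {j}"
  have J: "finite J" "\<And>l. l \<in> J \<Longrightarrow> l \<in> I" using fin by (auto simp: J_def)
  define U where "U i \<omega> = V i \<omega> - \<kappa> i * W \<omega>" for i \<omega>
  have U [measurable]: "U i \<in> borel_measurable M" if "i \<in> I" for i unfolding U_def using that by measurable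
  have hc: "continuous_on UNIV (h i)" for i using h by (meson DERIV_isCont continuous_at_imp_continuous_on)
  have [measurable]: "h i \<in> borel_measurable borel" "h' i \<in> borel_measurable borel" for i
    using hc h'c by (auto intro: borel_measurable_continuous_onI)
  note hcont [continuous_intros] = continuous_on_compose2[OF hc] continuous_on_compose2[OF h'c]
  have C0: "C \<ge> 0" using h'b[of j 0] by linarith
  let ?Z = "\<lambda>\<omega>. \<lambda>i\<in>K. case_option W V i \<omega>" and ?Z' = "\<lambda>p. \<lambda>i\<in>K. case_option (snd p) (\<lambda>i. U i (fst p) + \<kappa> i * snd p) i"
  have eq: "distr M (\<Pi>\<^sub>M i\<in>K. borel) ?Z = distr (M \<Otimes>\<^sub>M \<Phi>) (\<Pi>\<^sub>M i\<in>K. borel) ?Z'"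
    using gauss_regression[OF fin M V W char] unfolding K_def U_def .
  have mZ: "?Z \<in> measurable M (\<Pi>\<^sub>M i\<in>K. borel)"
    by (rule measurable_restrict) (auto simp: K_def)
  have mZ': "?Z' \<in> measurable (M \<Otimes>\<^sub>M \<Phi>) (\<Pi>\<^sub>M i\<in>K. borel)"
    by (rule measurable_restrict) (auto simp: K_def)
  have transfer: "(\<integral>\<omega>. f (?Z \<omega>) \<partial>M) = (\<integral>p. f (?Z' p) \<partial>(M \<Otimes>\<^sub>M \<Phi>))"
    if f: "f \<in> borel_measurable (\<Pi>\<^sub>M i\<in>K. borel)" for f :: "('i option \<Rightarrow> real) \<Rightarrow> real"
    using integral_distr[OF mZ f] integral_distr[OF mZ' f] eq by simp
  have comp [measurable]: "(\<lambda>x. x k) \<in> borel_measurable (\<Pi>\<^sub>M i\<in>K. borel :: real measure)" if "k \<in> K" for k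
    using that by (rule measurable_component_singleton)
  let ?pr = "\<lambda>\<omega> z. \<Prod>l\<in>J. 1 - w l * h l (U l \<omega> + \<kappa> l * z)"
  let ?D = "\<lambda>\<omega> z. \<Sum>l\<in>J. \<bar>\<kappa> l\<bar> * w l * h' l (U l \<omega> + \<kappa> l * z)"
  have prb: "0 \<le> (\<Prod>l\<in>T. 1 - w l * h l (x l))" "(\<Prod>l\<in>T. 1 - w l * h l (x l)) \<le> 1" for x T
    using weighted_factor_bounds[OF w hb] by (auto intro!: prod_nonneg prod_le_1)
  have Db: "0 \<le> ?D \<omega> z" "?D \<omega> z \<le> (\<Sum>l\<in>J. \<bar>\<kappa> l\<bar> * w l * C)" for \<omega> z
    using w h'b by (auto intro!: sum_nonneg sum_mono mult_left_mono)
  let ?B = "\<Sum>l\<in>J. \<bar>\<kappa> l\<bar> * w l * C"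
  have mpr: "(\<lambda>p. ?pr (fst p) (snd p)) \<in> borel_measurable (M \<Otimes>\<^sub>M \<Phi>)" using J by measurable
  have mD: "(\<lambda>p. ?D (fst p) (snd p)) \<in> borel_measurable (M \<Otimes>\<^sub>M \<Phi>)" using J by measurable
  have Uj [measurable]: "U j \<in> borel_measurable M" using j by simp
  note [measurable] = mpr mD
  have iz: "integrable (M \<Otimes>\<^sub>M \<Phi>) (\<lambda>p. C * \<bar>snd p\<bar>)"
  proof (rule P.Fubini_integrable)
    show "AE x in M. integrable \<Phi> (\<lambda>y. C * \<bar>snd (x, y)\<bar>)"
      using integrable_std_normal_distribution_moment[of 1] by (auto intro!: integrable_mult_right integrable_abs)
  qed auto
  have ig: "integrable (M \<Otimes>\<^sub>M \<Phi>) (\<lambda>p. h' j (U j (fst p)) * ?pr (fst p) (snd p) * snd p)"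
  proof (rule Bochner_Integration.integrable_bound[OF iz])
    show "AE p in M \<Otimes>\<^sub>M \<Phi>. norm (h' j (U j (fst p)) * ?pr (fst p) (snd p) * snd p) \<le> norm (C * \<bar>snd p\<bar>)"
    proof (intro AE_I2)
      fix p :: "'a \<times> real"
      have "\<bar>h' j (U j (fst p))\<bar> * \<bar>?pr (fst p) (snd p)\<bar> \<le> C * 1"
        using h'b prb by (intro mult_mono) (auto simp: abs_of_nonneg C0)
      then show "norm (h' j (U j (fst p)) * ?pr (fst p) (snd p) * snd p) \<le> norm (C * \<bar>snd p\<bar>)"
        using C0 by (simp add: abs_mult mult_right_mono)
    qed
  qed measurable
  have iD: "integrable (M \<Otimes>\<^sub>M \<Phi>) (\<lambda>p. h' j (U j (fst p)) * ?D (fst p) (snd p))"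
  proof (rule P.integrable_const_bound[of _ "C * ?B"])
    show "AE p in M \<Otimes>\<^sub>M \<Phi>. norm (h' j (U j (fst p)) * ?D (fst p) (snd p)) \<le> C * ?B"
      using h'b Db C0 by (intro AE_I2) (auto simp: abs_mult abs_of_nonneg intro!: mult_mono)
  qed measurable
  have inner: "\<bar>\<integral>z. h' j (U j \<omega>) * ?pr \<omega> z * z \<partial>\<Phi>\<bar> \<le> (\<integral>z. h' j (U j \<omega>) * ?D \<omega> z \<partial>\<Phi>)" if "\<omega> \<in> space M" for \<omega>
  proof -
    let ?k' = "\<lambda>z. \<Sum>l\<in>J. - (w l * (\<kappa> l * h' l (U l \<omega> + \<kappa> l * z))) * (\<Prod>m\<in>J - {l}. 1 - w m * h m (U m \<omega> + \<kappa> m * z))"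
    have dk: "(?pr \<omega> has_real_derivative ?k' z) (at z)" for z
    proof -
      have "((\<lambda>z. 1 - w l * h l (U l \<omega> + \<kappa> l * z)) has_real_derivative - (w l * (\<kappa> l * h' l (U l \<omega> + \<kappa> l * z)))) (at z)" for l
        by (auto intro!: derivative_eq_intros DERIV_chain2[OF h])
      then show ?thesis by (intro has_field_derivative_prod)
    qed
    have k'b: "\<bar>?k' z\<bar> \<le> ?D \<omega> z" for z
    proof -
      have "\<bar>?k' z\<bar> \<le> (\<Sum>l\<in>J. \<bar>- (w l * (\<kappa> l * h' l (U l \<omega> + \<kappa> l * z))) * (\<Prod>m\<in>J - {l}. 1 - w m * h m (U m \<omega> + \<kappa> m * z))\<bar>)"
        by (rule sum_abs)
      also have "\<dots> \<le> ?D \<omega> z"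
      proof (rule sum_mono)
        fix l
        have "\<bar>- (w l * (\<kappa> l * h' l (U l \<omega> + \<kappa> l * z)))\<bar> * \<bar>\<Prod>m\<in>J - {l}. 1 - w m * h m (U m \<omega> + \<kappa> m * z)\<bar> \<le> (\<bar>\<kappa> l\<bar> * w l * h' l (U l \<omega> + \<kappa> l * z)) * 1"
          using w h'b prb by (intro mult_mono) (auto simp: abs_mult abs_of_nonneg)
        then show "\<bar>- (w l * (\<kappa> l * h' l (U l \<omega> + \<kappa> l * z))) * (\<Prod>m\<in>J - {l}. 1 - w m * h m (U m \<omega> + \<kappa> m * z))\<bar> \<le> \<bar>\<kappa> l\<bar> * w l * h' l (U l \<omega> + \<kappa> l * z)"
          by (simp add: abs_mult)
      qed
      finally show ?thesis .
    qed
    have k'c: "continuous_on UNIV ?k'" by (intro continuous_intros) auto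
    have Dc: "continuous_on UNIV (?D \<omega>)" by (intro continuous_intros) auto
    have [measurable]: "?k' \<in> borel_measurable borel" "?D \<omega> \<in> borel_measurable borel"
      using k'c Dc by (auto intro: borel_measurable_continuous_onI)
    have "(\<integral>z. ?pr \<omega> z * z \<partial>\<Phi>) = (\<integral>z. ?k' z \<partial>\<Phi>)"
    proof (rule std_normal_stein[OF dk k'c])
      show "\<bar>?pr \<omega> z\<bar> \<le> 1" for z using prb by (simp add: abs_of_nonneg)
      show "\<bar>?k' z\<bar> \<le> ?B" for z by (rule order_trans[OF k'b Db(2)])
    qed
    moreover have "\<bar>\<integral>z. ?k' z \<partial>\<Phi>\<bar> \<le> (\<integral>z. ?D \<omega> z \<partial>\<Phi>)"
    proof (rule integral_abs_bound_integral)
      show "integrable \<Phi> ?k'"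
      proof (rule S.integrable_const_bound)
        show "AE z in \<Phi>. norm (?k' z) \<le> ?B" using order_trans[OF k'b Db(2)] by (intro AE_I2) (simp only: real_norm_def)
        have "(borel_measurable \<Phi> :: (real \<Rightarrow> real) set) = borel_measurable borel" by (rule measurable_cong_sets) auto
        then show "?k' \<in> borel_measurable \<Phi>" using borel_measurable_continuous_onI[OF k'c] by (simp only:)
      qed
      show "integrable \<Phi> (?D \<omega>)" by (rule S.integrable_const_bound[of _ ?B]) (use Db in \<open>auto simp: abs_of_nonneg\<close>)
    qed (rule k'b)
    ultimately have "\<bar>\<integral>z. ?pr \<omega> z * z \<partial>\<Phi>\<bar> \<le> (\<integral>z. ?D \<omega> z \<partial>\<Phi>)" by simp
    from mult_left_mono[OF this h'b(1)[of j "U j \<omega>"]] show ?thesis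
      by (simp add: mult.assoc abs_mult abs_of_nonneg h'b)
  qed
  have "(\<integral>\<omega>. h' j (V j \<omega>) * (\<Prod>l\<in>J. 1 - w l * h l (V l \<omega>)) * W \<omega> \<partial>M)
      = (\<integral>\<omega>. (\<lambda>x. h' j (x (Some j)) * (\<Prod>l\<in>J. 1 - w l * h l (x (Some l))) * x None) (?Z \<omega>) \<partial>M)"
    using j J by (intro Bochner_Integration.integral_cong) (auto simp: K_def intro!: prod.cong)
  also have "\<dots> = (\<integral>p. (\<lambda>x. h' j (x (Some j)) * (\<Prod>l\<in>J. 1 - w l * h l (x (Some l))) * x None) (?Z' p) \<partial>(M \<Otimes>\<^sub>M \<Phi>))"
    by (rule transfer) (use j J KS KN in measurable)
  also have "\<dots> = (\<integral>p. h' j (U j (fst p)) * ?pr (fst p) (snd p) * snd p \<partial>(M \<Otimes>\<^sub>M \<Phi>))"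
    using j J by (intro Bochner_Integration.integral_cong) (auto simp: K_def intro!: prod.cong)
  also have "\<dots> = (\<integral>\<omega>. \<integral>z. h' j (U j \<omega>) * ?pr \<omega> z * z \<partial>\<Phi> \<partial>M)"
    using P.integral_fst'[OF ig] by simp
  finally have "\<bar>\<integral>\<omega>. h' j (V j \<omega>) * (\<Prod>l\<in>J. 1 - w l * h l (V l \<omega>)) * W \<omega> \<partial>M\<bar> = \<bar>\<integral>\<omega>. \<integral>z. h' j (U j \<omega>) * ?pr \<omega> z * z \<partial>\<Phi> \<partial>M\<bar>" by simp
  also have "\<dots> \<le> (\<integral>\<omega>. \<integral>z. h' j (U j \<omega>) * ?D \<omega> z \<partial>\<Phi> \<partial>M)"
  proof (rule order_trans[OF integral_abs_bound], rule integral_mono)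
    show "integrable M (\<lambda>\<omega>. \<bar>\<integral>z. h' j (U j \<omega>) * ?pr \<omega> z * z \<partial>\<Phi>\<bar>)"
      using integrable_abs[OF P.integrable_fst'[OF ig]] by simp
    show "integrable M (\<lambda>\<omega>. \<integral>z. h' j (U j \<omega>) * ?D \<omega> z \<partial>\<Phi>)"
      using P.integrable_fst'[OF iD] by simp
  qed (rule inner)
  also have "\<dots> = (\<integral>p. h' j (U j (fst p)) * ?D (fst p) (snd p) \<partial>(M \<Otimes>\<^sub>M \<Phi>))"
    using P.integral_fst'[OF iD] by simp
  also have "\<dots> = (\<integral>p. (\<lambda>x. h' j (x (Some j)) * (\<Sum>l\<in>J. \<bar>\<kappa> l\<bar> * w l * h' l (x (Some l)))) (?Z' p) \<partial>(M \<Otimes>\<^sub>M \<Phi>))"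
    using j J by (intro Bochner_Integration.integral_cong) (auto simp: K_def intro!: sum.cong)
  also have "\<dots> = (\<integral>\<omega>. (\<lambda>x. h' j (x (Some j)) * (\<Sum>l\<in>J. \<bar>\<kappa> l\<bar> * w l * h' l (x (Some l)))) (?Z \<omega>) \<partial>M)"
    by (rule transfer[symmetric]) (use j J KS KN in measurable)
  also have "\<dots> = (\<integral>\<omega>. (\<Sum>l\<in>J. \<bar>\<kappa> l\<bar> * w l * (h' j (V j \<omega>) * h' l (V l \<omega>))) \<partial>M)"
    using j J by (intro Bochner_Integration.integral_cong) (auto simp: K_def sum_distrib_left mult_ac intro!: sum.cong)
  also have "\<dots> = (\<Sum>l\<in>J. \<bar>\<kappa> l\<bar> * w l * (\<integral>\<omega>. h' j (V j \<omega>) * h' l (V l \<omega>) \<partial>M))"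
  proof (subst Bochner_Integration.integral_sum)
    fix l assume "l \<in> J"
    then have [measurable]: "V l \<in> borel_measurable M" "V j \<in> borel_measurable M" using J j by auto
    have "integrable M (\<lambda>\<omega>. h' j (V j \<omega>) * h' l (V l \<omega>))"
      by (rule M.integrable_const_bound[of _ "C * C"]) (use h'b C0 in \<open>auto simp: abs_mult abs_of_nonneg intro!: mult_mono\<close>)
    then show "integrable M (\<lambda>\<omega>. \<bar>\<kappa> l\<bar> * w l * (h' j (V j \<omega>) * h' l (V l \<omega>)))" by simp
  qed simp
  finally show ?thesis unfolding J_def .
qed

lemma quadratic_form_shift:
  fixes R :: "'i \<Rightarrow> 'i \<Rightarrow> real"
  assumes fin: "finite I" and j: "j \<in> I" and sym: "\<And>i k. R i k = R k i"
  shows "(\<Sum>i\<in>I. \<Sum>k\<in>I. (a * t i + (if i = j then b else 0)) * (a * t k + (if k = j then b else 0)) * R i k)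
     = a\<^sup>2 * (\<Sum>i\<in>I. \<Sum>k\<in>I. t i * t k * R i k) + 2 * a * b * (\<Sum>i\<in>I. t i * R i j) + b\<^sup>2 * R j j"
proof -
  have d: "(\<Sum>k\<in>I. (if k = j then b else 0) * f k) = b * f j" for f
  proof -
    have "(\<Sum>k\<in>I. (if k = j then b else 0) * f k) = (\<Sum>k\<in>I. if k = j then b * f k else 0)" by (intro sum.cong) auto
    then show ?thesis using fin j by simp
  qed
  have 1: "(\<Sum>k\<in>I. (a * t k + (if k = j then b else 0)) * g k) = a * (\<Sum>k\<in>I. t k * g k) + b * g j" for g
    unfolding distrib_right sum.distrib d by (simp add: sum_distrib_left mult.assoc)
  have "(\<Sum>i\<in>I. \<Sum>k\<in>I. (a * t i + (if i = j then b else 0)) * (a * t k + (if k = j then b else 0)) * R i k)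
     = (\<Sum>i\<in>I. (a * t i + (if i = j then b else 0)) * (\<Sum>k\<in>I. (a * t k + (if k = j then b else 0)) * R i k))"
    by (simp add: sum_distrib_left mult.assoc)
  also have "\<dots> = a * (\<Sum>i\<in>I. t i * (a * (\<Sum>k\<in>I. t k * R i k) + b * R i j)) + b * (a * (\<Sum>k\<in>I. t k * R j k) + b * R j j)"
    unfolding 1 ..
  also have "(\<Sum>i\<in>I. t i * (a * (\<Sum>k\<in>I. t k * R i k) + b * R i j)) = a * (\<Sum>i\<in>I. \<Sum>k\<in>I. t i * t k * R i k) + b * (\<Sum>i\<in>I. t i * R i j)"
    by (simp add: distrib_left sum.distrib sum_distrib_left mult_ac)
  also have "(\<Sum>k\<in>I. t k * R j k) = (\<Sum>k\<in>I. t k * R k j)"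
    by (intro sum.cong refl arg_cong2[where f="(*)"] sym)
  finally show ?thesis by (simp add: algebra_simps power2_eq_square)
qed

lemma sin_cos_abs_le_half: "\<bar>sin \<theta> * cos \<theta>\<bar> \<le> 1 / (2::real)"
proof -
  have "\<bar>sin (2 * \<theta>)\<bar> \<le> 1" by simp
  then show ?thesis by (simp add: sin_double)
qed

text \<open>Two Gaussian vectors are joined by the rotation \<open>V = sin \<theta> X + cos \<theta> Y\<close>, whose covariance
  moves along the segment from \<open>R'\<close> to \<open>R\<close>. Its velocity \<open>W\<close> is again Gaussian, so that the
  derivative of the expectation is controlled by integration by parts, and only pairs of distinct
  coordinates contribute.\<close>

lemma smooth_gauss_comparison:
  fixes X :: "'i \<Rightarrow> 'a \<Rightarrow> real" and Y :: "'i \<Rightarrow> 'b \<Rightarrow> real" and h h' :: "'i \<Rightarrow> real \<Rightarrow> real"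
  assumes fin: "finite I" and M: "prob_space M" and N: "prob_space N"
    and X: "gauss_family M I X R" and Y: "gauss_family N I Y R'"
    and sym: "\<And>i k. R i k = R k i" "\<And>i k. R' i k = R' k i"
    and diag: "\<And>i. R i i = 1" "\<And>i. R' i i = 1"
    and h: "\<And>i x. (h i has_real_derivative h' i x) (at x)" and h'c: "\<And>i. continuous_on UNIV (h' i)"
    and hb: "\<And>i x. 0 \<le> h i x" "\<And>i x. h i x \<le> 1" and h'b: "\<And>i x. 0 \<le> h' i x" "\<And>i x. h' i x \<le> C"
    and h'int: "\<And>i. (\<integral>\<^sup>+x. ennreal (h' i x) \<partial>lborel) = 1"
    and h's: "\<And>i x. h' i x \<noteq> 0 \<Longrightarrow> u i \<le> x \<and> x \<le> u i + 1"
    and w: "\<And>i. 0 \<le> w i" "\<And>i. w i \<le> 1"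
    and dens: "\<And>i k c x y. i \<in> I \<Longrightarrow> k \<in> I \<Longrightarrow> i \<noteq> k \<Longrightarrow> c \<in> closed_segment (R i k) (R' i k) \<Longrightarrow>
       u i \<le> x \<Longrightarrow> x \<le> u i + 1 \<Longrightarrow> u k \<le> y \<Longrightarrow> y \<le> u k + 1 \<Longrightarrow> \<bar>c\<bar> < 1 \<and> bvn c x y \<le> B i k"
  shows "\<bar>(\<integral>\<omega>. (\<Prod>i\<in>I. 1 - w i * h i (X i \<omega>)) \<partial>M) - (\<integral>\<omega>. (\<Prod>i\<in>I. 1 - w i * h i (Y i \<omega>)) \<partial>N)\<bar>
     \<le> (\<Sum>i\<in>I. \<Sum>k\<in>I - {i}. \<bar>R i k - R' i k\<bar> * B i k * (w i * w k))"
proof -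
  interpret M: prob_space M by fact
  interpret N: prob_space N by fact
  interpret P: pair_prob_space M N ..
  have mX [measurable]: "X i \<in> borel_measurable M" if "i \<in> I" for i using X that by (auto simp: gauss_family_def)
  have mY [measurable]: "Y i \<in> borel_measurable N" if "i \<in> I" for i using Y that by (auto simp: gauss_family_def)
  have hc: "continuous_on UNIV (h i)" for i using h by (meson DERIV_isCont continuous_at_imp_continuous_on)
  have [measurable]: "h i \<in> borel_measurable borel" "h' i \<in> borel_measurable borel" for i
    using hc h'c by (auto intro: borel_measurable_continuous_onI)
  define V where "V \<theta> i p = sin \<theta> * X i (fst p) + cos \<theta> * Y i (snd p)" for \<theta> i and p :: "'a \<times> 'b"
  define W where "W \<theta> i p = cos \<theta> * X i (fst p) - sin \<theta> * Y i (snd p)" for \<theta> i and p :: "'a \<times> 'b"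
  define \<kappa> where "\<kappa> \<theta> j i = sin \<theta> * cos \<theta> * (R i j - R' i j)" for \<theta> i j
  define Q where "Q \<theta> i k = (sin \<theta>)\<^sup>2 * R i k + (cos \<theta>)\<^sup>2 * R' i k" for \<theta> i k
  have [measurable]: "V \<theta> i \<in> borel_measurable (M \<Otimes>\<^sub>M N)" "W \<theta> i \<in> borel_measurable (M \<Otimes>\<^sub>M N)" if "i \<in> I" for \<theta> i
    unfolding V_def W_def using that by measurable
  have char: "(CLINT p|M \<Otimes>\<^sub>M N. iexp ((\<Sum>i\<in>I. t i * V \<theta> i p) + s * W \<theta> j p)) =
       exp (- ((\<Sum>i\<in>I. \<Sum>k\<in>I. t i * t k * Q \<theta> i k) + 2 * s * (\<Sum>i\<in>I. t i * \<kappa> \<theta> j i) + s\<^sup>2) / 2)" if j: "j \<in> I" for t s \<theta> j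
  proof -
    have d: "(\<Sum>k\<in>I. (if k = j then b else 0) * f k) = b * f j" for f and b :: real
    proof -
      have "(\<Sum>k\<in>I. (if k = j then b else 0) * f k) = (\<Sum>k\<in>I. if k = j then b * f k else 0)" by (intro sum.cong) auto
      then show ?thesis using fin j by simp
    qed
    let ?a = "\<lambda>i. sin \<theta> * t i + (if i = j then s * cos \<theta> else 0)" and ?b = "\<lambda>i. cos \<theta> * t i + (if i = j then - (s * sin \<theta>) else 0)"
    have "(CLINT p|M \<Otimes>\<^sub>M N. iexp ((\<Sum>i\<in>I. t i * V \<theta> i p) + s * W \<theta> j p)) =
       (CLINT p|M \<Otimes>\<^sub>M N. iexp ((\<Sum>i\<in>I. ?a i * X i (fst p)) + (\<Sum>i\<in>I. ?b i * Y i (snd p))))"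
    proof (intro Bochner_Integration.integral_cong refl arg_cong[where f=iexp])
      fix p :: "'a \<times> 'b"
      show "(\<Sum>i\<in>I. t i * V \<theta> i p) + s * W \<theta> j p = (\<Sum>i\<in>I. ?a i * X i (fst p)) + (\<Sum>i\<in>I. ?b i * Y i (snd p))"
        unfolding distrib_right sum.distrib d unfolding V_def W_def
        by (simp add: algebra_simps sum.distrib)
    qed
    also have "\<dots> = (CLINT \<omega>|M. iexp (\<Sum>i\<in>I. ?a i * X i \<omega>)) * (CLINT \<omega>|N. iexp (\<Sum>i\<in>I. ?b i * Y i \<omega>))"
      by (rule integral_pair_iexp_prod[OF M N]) auto
    also have "\<dots> = exp (- (\<Sum>i\<in>I. \<Sum>k\<in>I. ?a i * ?a k * R i k) / 2 + - (\<Sum>i\<in>I. \<Sum>k\<in>I. ?b i * ?b k * R' i k) / 2)"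
      using X Y unfolding gauss_family_def by (simp only: exp_add of_real_mult)
    also have "- (\<Sum>i\<in>I. \<Sum>k\<in>I. ?a i * ?a k * R i k) / 2 + - (\<Sum>i\<in>I. \<Sum>k\<in>I. ?b i * ?b k * R' i k) / 2
        = - ((\<Sum>i\<in>I. \<Sum>k\<in>I. t i * t k * Q \<theta> i k) + 2 * s * (\<Sum>i\<in>I. t i * \<kappa> \<theta> j i) + s\<^sup>2) / 2"
    proof -
      have alg: "- (sn\<^sup>2 * A + 2 * sn * (s * cs) * r + (s * cs)\<^sup>2 * 1) / 2 + - (cs\<^sup>2 * A' + 2 * cs * (- (s * sn)) * r' + (- (s * sn))\<^sup>2 * 1) / 2
         = - ((sn\<^sup>2 * A + cs\<^sup>2 * A') + 2 * s * (sn * cs * (r - r')) + ((s * cs)\<^sup>2 + (- (s * sn))\<^sup>2)) / 2" for sn cs A A' r r' :: real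
        by (simp add: field_simps power2_eq_square)
      have q: "(\<Sum>i\<in>I. \<Sum>k\<in>I. t i * t k * Q \<theta> i k) = (sin \<theta>)\<^sup>2 * (\<Sum>i\<in>I. \<Sum>k\<in>I. t i * t k * R i k) + (cos \<theta>)\<^sup>2 * (\<Sum>i\<in>I. \<Sum>k\<in>I. t i * t k * R' i k)"
        unfolding Q_def by (simp add: sum_distrib_left distrib_left sum.distrib mult_ac)
      have k: "(\<Sum>i\<in>I. t i * \<kappa> \<theta> j i) = sin \<theta> * cos \<theta> * ((\<Sum>i\<in>I. t i * R i j) - (\<Sum>i\<in>I. t i * R' i j))"
        unfolding \<kappa>_def by (simp add: sum_distrib_left right_diff_distrib sum_subtractf mult_ac)
      have s2: "s\<^sup>2 = (s * cos \<theta>)\<^sup>2 + (- (s * sin \<theta>))\<^sup>2"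
        using sin_cos_squared_add[of \<theta>] by (simp add: power_mult_distrib distrib_left[symmetric] add.commute)
      show ?thesis
        unfolding quadratic_form_shift[OF fin j sym(1)] quadratic_form_shift[OF fin j sym(2)] q k diag
        by (subst s2) (rule alg)
    qed
    finally show ?thesis .
  qed
  have k0: "\<kappa> \<theta> j j = 0" for \<theta> j by (simp add: \<kappa>_def diag)
  have pairB: "(\<integral>p. h' i (V \<theta> i p) * h' k (V \<theta> k p) \<partial>(M \<Otimes>\<^sub>M N)) \<le> B i k" if ik: "i \<in> I" "k \<in> I" "i \<noteq> k" for \<theta> i k
  proof -
    note [measurable] = ik(1,2)
    let ?c = "Q \<theta> k i"
    have cseg: "?c \<in> closed_segment (R i k) (R' i k)"
      unfolding closed_segment_def Q_def
      by (auto intro!: exI[of _ "(cos \<theta>)\<^sup>2"] simp: sym[of k i] sin_squared_eq abs_square_le_1)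
    have cl: "\<bar>?c\<bar> < 1" using dens[OF ik cseg, of "u i" "u k"] by simp
    have Bn: "0 \<le> B i k" using dens[OF ik cseg, of "u i" "u k"] bvn_nonneg[OF cl, of "u i" "u k"] by simp
    have ch: "(CLINT p|M \<Otimes>\<^sub>M N. iexp (s * V \<theta> i p + t * V \<theta> k p)) = exp (- (s\<^sup>2 + 2 * ?c * s * t + t\<^sup>2) / 2)" for s t
    proof -
      let ?t = "\<lambda>l. if l = k then t else 0"
      have d: "(\<Sum>l\<in>I. (if l = m then b else 0) * f l) = b * f m" if "m \<in> I" for f m and b :: real
      proof -
        have "(\<Sum>l\<in>I. (if l = m then b else 0) * f l) = (\<Sum>l\<in>I. if l = m then b * f l else 0)" by (intro sum.cong) auto
        then show ?thesis using fin that by simp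
      qed
      have symQ: "Q \<theta> i k = Q \<theta> k i" for i k by (simp add: Q_def sym[of i k])
      have "(\<Sum>l\<in>I. (1 * ?t l + (if l = i then s else 0)) * V \<theta> l p) = s * V \<theta> i p + t * V \<theta> k p" for p
        unfolding distrib_right sum.distrib mult_1_left d[OF ik(1)] d[OF ik(2)] by simp
      hence "(CLINT p|M \<Otimes>\<^sub>M N. iexp (s * V \<theta> i p + t * V \<theta> k p)) = (CLINT p|M \<Otimes>\<^sub>M N. iexp ((\<Sum>l\<in>I. (1 * ?t l + (if l = i then s else 0)) * V \<theta> l p) + 0 * W \<theta> i p))"
        by simp
      also have "\<dots> = exp (- (\<Sum>l\<in>I. \<Sum>m\<in>I. (1 * ?t l + (if l = i then s else 0)) * (1 * ?t m + (if m = i then s else 0)) * Q \<theta> l m) / 2)"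
        unfolding char[OF ik(1)] by simp
      also have "(\<Sum>l\<in>I. \<Sum>m\<in>I. (1 * ?t l + (if l = i then s else 0)) * (1 * ?t m + (if m = i then s else 0)) * Q \<theta> l m)
         = (\<Sum>l\<in>I. ?t l * (\<Sum>m\<in>I. ?t m * Q \<theta> l m)) + 2 * s * (\<Sum>l\<in>I. ?t l * Q \<theta> l i) + s\<^sup>2 * Q \<theta> i i"
        unfolding quadratic_form_shift[OF fin ik(1) symQ] by (simp add: sum_distrib_left mult.assoc)
      also have "\<dots> = s\<^sup>2 + 2 * ?c * s * t + t\<^sup>2"
        unfolding d[OF ik(2)] by (simp add: Q_def diag algebra_simps power2_eq_square[of t])
      finally show ?thesis .
    qed
    have "ennreal (\<integral>p. h' i (V \<theta> i p) * h' k (V \<theta> k p) \<partial>(M \<Otimes>\<^sub>M N)) = (\<integral>\<^sup>+p. ennreal (h' i (V \<theta> i p) * h' k (V \<theta> k p)) \<partial>(M \<Otimes>\<^sub>M N))"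
    proof (rule nn_integral_eq_integral[symmetric])
      have C0: "0 \<le> C" using h'b[of i 0] by linarith
      show "integrable (M \<Otimes>\<^sub>M N) (\<lambda>p. h' i (V \<theta> i p) * h' k (V \<theta> k p))"
        by (rule P.integrable_const_bound[of _ "C * C"])
           (use ik h'b C0 in \<open>auto simp: abs_mult abs_of_nonneg intro!: mult_mono\<close>)
    qed (use h'b in auto)
    also have "\<dots> = (\<integral>\<^sup>+x. \<integral>\<^sup>+y. ennreal (bvn ?c x y) * ennreal (h' i x * h' k y) \<partial>lborel \<partial>lborel)"
      by (rule nn_integral_gauss_pair[OF P.prob_space_axioms _ _ ch cl, where f = "\<lambda>x y. ennreal (h' i x * h' k y)"]) (use ik in auto)
    also have "\<dots> \<le> (\<integral>\<^sup>+x. \<integral>\<^sup>+y. ennreal (B i k) * ennreal (h' i x) * ennreal (h' k y) \<partial>lborel \<partial>lborel)"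
    proof (intro nn_integral_mono)
      fix x y
      have "bvn ?c x y * (h' i x * h' k y) \<le> B i k * (h' i x * h' k y)"
      proof (cases "h' i x = 0 \<or> h' k y = 0")
        case False
        then have "bvn ?c x y \<le> B i k" using dens[OF ik cseg] h's by blast
        then show ?thesis using h'b by (intro mult_right_mono) auto
      qed auto
      then show "ennreal (bvn ?c x y) * ennreal (h' i x * h' k y) \<le> ennreal (B i k) * ennreal (h' i x) * ennreal (h' k y)"
        using h'b Bn bvn_nonneg[OF cl] by (simp add: ennreal_mult[symmetric] mult.assoc)
    qed
    also have "\<dots> = ennreal (B i k)"
      by (simp add: nn_integral_cmult nn_integral_multc h'int)
    finally show ?thesis using Bn by simp
  qed
  define f where "f \<theta> p = (\<Prod>i\<in>I. 1 - w i * h i (V \<theta> i p))" for \<theta> p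
  define f' where "f' \<theta> p = (\<Sum>i\<in>I. - (w i * (h' i (V \<theta> i p) * W \<theta> i p)) * (\<Prod>l\<in>I - {i}. 1 - w l * h l (V \<theta> l p)))" for \<theta> p
  define g where "g p = (\<Sum>i\<in>I. C * (\<bar>X i (fst p)\<bar> + \<bar>Y i (snd p)\<bar>))" for p
  have C0: "0 \<le> C" using h'b order_trans by blast
  have prb: "0 \<le> (\<Prod>l\<in>T. 1 - w l * h l (x l))" "(\<Prod>l\<in>T. 1 - w l * h l (x l)) \<le> 1" for x T
    using weighted_factor_bounds[OF w hb] by (auto intro!: prod_nonneg prod_le_1)
  have df: "((\<lambda>\<theta>. f \<theta> p) has_real_derivative f' \<theta> p) (at \<theta>)" for \<theta> p
  proof -
    have "((\<lambda>\<theta>. V \<theta> i p) has_real_derivative W \<theta> i p) (at \<theta>)" for i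
      unfolding V_def W_def by (auto intro!: derivative_eq_intros)
    hence "((\<lambda>\<theta>. h i (V \<theta> i p)) has_real_derivative h' i (V \<theta> i p) * W \<theta> i p) (at \<theta>)" for i
      using DERIV_chain2[OF h] by blast
    hence "((\<lambda>\<theta>. 1 - w i * h i (V \<theta> i p)) has_real_derivative - (w i * (h' i (V \<theta> i p) * W \<theta> i p))) (at \<theta>)" for i
      by (auto intro!: derivative_eq_intros)
    then show ?thesis unfolding f_def f'_def by (intro has_field_derivative_prod)
  qed
  have Wb: "\<bar>W \<theta> i p\<bar> \<le> \<bar>X i (fst p)\<bar> + \<bar>Y i (snd p)\<bar>" for \<theta> i p
  proof -
    have "\<bar>W \<theta> i p\<bar> \<le> \<bar>cos \<theta>\<bar> * \<bar>X i (fst p)\<bar> + \<bar>sin \<theta>\<bar> * \<bar>Y i (snd p)\<bar>"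
      unfolding W_def by (simp add: abs_mult[symmetric] abs_triangle_ineq4)
    also have "\<dots> \<le> 1 * \<bar>X i (fst p)\<bar> + 1 * \<bar>Y i (snd p)\<bar>"
      by (intro add_mono mult_right_mono) auto
    finally show ?thesis by simp
  qed
  have f'b: "\<bar>f' \<theta> p\<bar> \<le> g p" for \<theta> p
  proof -
    have "\<bar>f' \<theta> p\<bar> \<le> (\<Sum>i\<in>I. \<bar>- (w i * (h' i (V \<theta> i p) * W \<theta> i p)) * (\<Prod>l\<in>I - {i}. 1 - w l * h l (V \<theta> l p))\<bar>)"
      unfolding f'_def by (rule sum_abs)
    also have "\<dots> \<le> g p"
      unfolding g_def
    proof (rule sum_mono)
      fix i
      have "\<bar>w i * (h' i (V \<theta> i p) * W \<theta> i p)\<bar> * \<bar>\<Prod>l\<in>I - {i}. 1 - w l * h l (V \<theta> l p)\<bar> \<le> (1 * (C * (\<bar>X i (fst p)\<bar> + \<bar>Y i (snd p)\<bar>))) * 1"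
        unfolding abs_mult using w h'b prb Wb C0 by (intro mult_mono) (auto simp: abs_of_nonneg)
      then show "\<bar>- (w i * (h' i (V \<theta> i p) * W \<theta> i p)) * (\<Prod>l\<in>I - {i}. 1 - w l * h l (V \<theta> l p))\<bar> \<le> C * (\<bar>X i (fst p)\<bar> + \<bar>Y i (snd p)\<bar>)"
        by (simp add: abs_mult)
    qed
    finally show ?thesis .
  qed
  have iX: "integrable (M \<Otimes>\<^sub>M N) (\<lambda>p. \<bar>X i (fst p)\<bar>)" if "i \<in> I" for i
  proof (rule P.Fubini_integrable)
    show "integrable M (\<lambda>x. \<integral>y. norm \<bar>X i (fst (x, y))\<bar> \<partial>N)"
      using gauss_family_integrable_abs[OF M X fin that diag(1)] by simp
  qed (use that in auto)
  have iY: "integrable (M \<Otimes>\<^sub>M N) (\<lambda>p. \<bar>Y i (snd p)\<bar>)" if "i \<in> I" for i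
  proof (rule P.Fubini_integrable)
    show "AE x in M. integrable N (\<lambda>y. \<bar>Y i (snd (x, y))\<bar>)"
      using gauss_family_integrable_abs[OF N Y fin that diag(2)] by simp
  qed (use that in auto)
  have gi: "integrable (M \<Otimes>\<^sub>M N) g"
    unfolding g_def using iX iY by auto
  have fi: "integrable (M \<Otimes>\<^sub>M N) (f \<theta>)" for \<theta>
    unfolding f_def by (rule P.integrable_const_bound[of _ 1]) (use prb in \<open>auto simp: abs_of_nonneg\<close>)
  have ti: "integrable (M \<Otimes>\<^sub>M N) (\<lambda>p. h' i (V \<theta> i p) * (\<Prod>l\<in>I - {i}. 1 - w l * h l (V \<theta> l p)) * W \<theta> i p)" if "i \<in> I" for \<theta> i
  proof (rule Bochner_Integration.integrable_bound)
    show "integrable (M \<Otimes>\<^sub>M N) (\<lambda>p. C * (\<bar>X i (fst p)\<bar> + \<bar>Y i (snd p)\<bar>))" using iX iY that by auto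
    show "AE p in M \<Otimes>\<^sub>M N. norm (h' i (V \<theta> i p) * (\<Prod>l\<in>I - {i}. 1 - w l * h l (V \<theta> l p)) * W \<theta> i p) \<le> norm (C * (\<bar>X i (fst p)\<bar> + \<bar>Y i (snd p)\<bar>))"
    proof (intro AE_I2)
      fix p :: "'a \<times> 'b"
      have "\<bar>h' i (V \<theta> i p)\<bar> * \<bar>\<Prod>l\<in>I - {i}. 1 - w l * h l (V \<theta> l p)\<bar> * \<bar>W \<theta> i p\<bar> \<le> C * 1 * (\<bar>X i (fst p)\<bar> + \<bar>Y i (snd p)\<bar>)"
        using h'b prb Wb C0 by (intro mult_mono) (auto simp: abs_of_nonneg)
      then show "norm (h' i (V \<theta> i p) * (\<Prod>l\<in>I - {i}. 1 - w l * h l (V \<theta> l p)) * W \<theta> i p) \<le> norm (C * (\<bar>X i (fst p)\<bar> + \<bar>Y i (snd p)\<bar>))"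
        using C0 by (simp add: abs_mult)
    qed
  qed (use that in measurable)
  have f'm: "f' \<theta> \<in> borel_measurable (M \<Otimes>\<^sub>M N)" for \<theta> unfolding f'_def by measurable
  let ?F = "\<lambda>\<theta>. \<integral>p. f \<theta> p \<partial>(M \<Otimes>\<^sub>M N)" and ?F' = "\<lambda>\<theta>. \<integral>p. f' \<theta> p \<partial>(M \<Otimes>\<^sub>M N)"
  let ?S = "\<Sum>i\<in>I. \<Sum>k\<in>I - {i}. \<bar>R i k - R' i k\<bar> * B i k * (w i * w k)"
  have Fd: "(?F has_real_derivative ?F' \<theta>) (at \<theta>)" for \<theta>
    by (rule expectation_has_derivative[OF df f'b gi fi f'm])
  have F'b: "\<bar>?F' \<theta>\<bar> \<le> ?S / 2" for \<theta>
  proof -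
    have "?F' \<theta> = (\<integral>p. (\<Sum>i\<in>I. (- w i) * (h' i (V \<theta> i p) * (\<Prod>l\<in>I - {i}. 1 - w l * h l (V \<theta> l p)) * W \<theta> i p)) \<partial>(M \<Otimes>\<^sub>M N))"
      unfolding f'_def by (intro Bochner_Integration.integral_cong sum.cong) (auto simp: mult_ac)
    also have "\<dots> = (\<Sum>i\<in>I. (- w i) * (\<integral>p. h' i (V \<theta> i p) * (\<Prod>l\<in>I - {i}. 1 - w l * h l (V \<theta> l p)) * W \<theta> i p \<partial>(M \<Otimes>\<^sub>M N)))"
      using ti by (subst Bochner_Integration.integral_sum) (auto intro!: integrable_mult_right)
    finally have F'e: "?F' \<theta> = \<dots>" .
    have "\<bar>?F' \<theta>\<bar> \<le> (\<Sum>i\<in>I. \<bar>(- w i) * (\<integral>p. h' i (V \<theta> i p) * (\<Prod>l\<in>I - {i}. 1 - w l * h l (V \<theta> l p)) * W \<theta> i p \<partial>(M \<Otimes>\<^sub>M N))\<bar>)"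
      unfolding F'e by (rule sum_abs)
    also have "\<dots> \<le> (\<Sum>i\<in>I. w i * (\<Sum>l\<in>I - {i}. \<bar>\<kappa> \<theta> i l\<bar> * w l * (\<integral>p. h' i (V \<theta> i p) * h' l (V \<theta> l p) \<partial>(M \<Otimes>\<^sub>M N))))"
    proof (rule sum_mono)
      fix i assume i: "i \<in> I"
      have "\<bar>\<integral>p. h' i (V \<theta> i p) * (\<Prod>l\<in>I - {i}. 1 - w l * h l (V \<theta> l p)) * W \<theta> i p \<partial>(M \<Otimes>\<^sub>M N)\<bar>
          \<le> (\<Sum>l\<in>I - {i}. \<bar>\<kappa> \<theta> i l\<bar> * w l * (\<integral>p. h' i (V \<theta> i p) * h' l (V \<theta> l p) \<partial>(M \<Otimes>\<^sub>M N)))"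
        by (rule stein_product_bound[OF fin P.prob_space_axioms _ _ char[OF i] i k0 h h'c hb h'b w]) (use i in auto)
      then show "\<bar>(- w i) * (\<integral>p. h' i (V \<theta> i p) * (\<Prod>l\<in>I - {i}. 1 - w l * h l (V \<theta> l p)) * W \<theta> i p \<partial>(M \<Otimes>\<^sub>M N))\<bar>
         \<le> w i * (\<Sum>l\<in>I - {i}. \<bar>\<kappa> \<theta> i l\<bar> * w l * (\<integral>p. h' i (V \<theta> i p) * h' l (V \<theta> l p) \<partial>(M \<Otimes>\<^sub>M N)))"
        using w by (simp add: abs_mult abs_of_nonneg mult_left_mono)
    qed
    also have "\<dots> \<le> (\<Sum>i\<in>I. w i * (\<Sum>l\<in>I - {i}. (\<bar>R i l - R' i l\<bar> / 2) * w l * B i l))"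
    proof (intro sum_mono mult_left_mono w)
      fix i l assume il: "i \<in> I" "l \<in> I - {i}"
      have "\<bar>\<kappa> \<theta> i l\<bar> \<le> 1 / 2 * \<bar>R i l - R' i l\<bar>"
        unfolding \<kappa>_def abs_mult[of "sin \<theta> * cos \<theta>"] sym(1)[of l i] sym(2)[of l i]
        by (intro mult_right_mono sin_cos_abs_le_half) auto
      moreover have "0 \<le> (\<integral>p. h' i (V \<theta> i p) * h' l (V \<theta> l p) \<partial>(M \<Otimes>\<^sub>M N))"
        using h'b by (intro integral_nonneg_AE) auto
      ultimately show "\<bar>\<kappa> \<theta> i l\<bar> * w l * (\<integral>p. h' i (V \<theta> i p) * h' l (V \<theta> l p) \<partial>(M \<Otimes>\<^sub>M N)) \<le> (\<bar>R i l - R' i l\<bar> / 2) * w l * B i l"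
        using w il pairB[of i l \<theta>] by (intro mult_mono mult_right_mono) auto
    qed
    also have "\<dots> = ?S / 2"
      unfolding sum_distrib_left sum_divide_distrib by (intro sum.cong refl) (simp add: mult_ac)
    finally show ?thesis .
  qed
  obtain \<xi> where \<xi>: "?F (pi / 2) - ?F 0 = (pi / 2 - 0) * ?F' \<xi>"
    using MVT2[of 0 "pi / 2" ?F ?F'] Fd pi_gt_zero by force
  have S0: "0 \<le> ?S" using F'b[of 0] abs_ge_zero[of "?F' 0"] by linarith
  have "\<bar>?F (pi / 2) - ?F 0\<bar> = pi / 2 * \<bar>?F' \<xi>\<bar>" unfolding \<xi> by (simp add: abs_mult)
  also have "\<dots> \<le> 2 * (?S / 2)"
    using pi_less_4 F'b[of \<xi>] by (intro mult_mono) auto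
  finally have "\<bar>?F (pi / 2) - ?F 0\<bar> \<le> ?S" by simp
  moreover have "?F (pi / 2) = (\<integral>\<omega>. (\<Prod>i\<in>I. 1 - w i * h i (X i \<omega>)) \<partial>M)"
  proof -
    have "f (pi / 2) = (\<lambda>p. \<Prod>i\<in>I. 1 - w i * h i (X i (fst p)))" by (simp add: fun_eq_iff f_def V_def)
    then show ?thesis using P.integral_fst'[OF fi[of "pi / 2"]] by (simp add: N.prob_space)
  qed
  moreover have "?F 0 = (\<integral>\<omega>. (\<Prod>i\<in>I. 1 - w i * h i (Y i \<omega>)) \<partial>N)"
  proof -
    have "f 0 = (\<lambda>p. \<Prod>i\<in>I. 1 - w i * h i (Y i (snd p)))" by (simp add: fun_eq_iff f_def V_def)
    then show ?thesis using P.integral_fst'[OF fi[of 0]] by (simp add: M.prob_space)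
  qed
  ultimately show ?thesis by simp
qed

text \<open>A continuously differentiable approximation of the indicator of \<open>{u<..}\<close> from below; its
  derivative is the triangular density on \<open>[u, u + 2e]\<close>.\<close>

definition ramp :: "real \<Rightarrow> real \<Rightarrow> real \<Rightarrow> real" where
  "ramp u e x = ((max 0 ((x - u) / e))\<^sup>2 - 2 * (max 0 ((x - u) / e - 1))\<^sup>2 + (max 0 ((x - u) / e - 2))\<^sup>2) / 2"

definition tent :: "real \<Rightarrow> real \<Rightarrow> real \<Rightarrow> real" where
  "tent u e x = (max 0 ((x - u) / e) - 2 * max 0 ((x - u) / e - 1) + max 0 ((x - u) / e - 2)) / e"

lemma DERIV_square_positive_part: "((\<lambda>x::real. (max 0 x)\<^sup>2) has_real_derivative 2 * max 0 x) (at x)"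
proof (cases "x = 0")
  case True
  have "((\<lambda>h. ((max 0 (0 + h))\<^sup>2 - (max 0 0)\<^sup>2) / h) \<longlongrightarrow> (0::real)) (at 0)"
  proof (rule Lim_null_comparison)
    show "((\<lambda>h. \<bar>h\<bar>) \<longlongrightarrow> (0::real)) (at 0)" by (auto intro!: tendsto_eq_intros)
    show "\<forall>\<^sub>F h in at 0. norm (((max 0 (0 + h))\<^sup>2 - (max 0 0)\<^sup>2) / h :: real) \<le> \<bar>h\<bar>"
      by (intro always_eventually allI) (auto simp: max_def power2_eq_square)
  qed
  then show ?thesis using True by (simp add: DERIV_def)
next
  case False
  then consider "x < 0" | "x > 0" by linarith
  then show ?thesis
  proof cases
    case 1
    have "((\<lambda>x::real. 0) has_real_derivative 2 * max 0 x) (at x)" using 1 by (auto simp: max_def)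
    then show ?thesis
      by (rule has_field_derivative_transform_within_open[of _ _ _ "{..<0}"]) (use 1 in auto)
  next
    case 2
    have "((\<lambda>x::real. x\<^sup>2) has_real_derivative 2 * max 0 x) (at x)" using 2 by (auto simp: max_def intro!: derivative_eq_intros)
    then show ?thesis
      by (rule has_field_derivative_transform_within_open[of _ _ _ "{0<..}"]) (use 2 in auto)
  qed
qed

lemma ramp_cases: "e > 0 \<Longrightarrow> x \<le> u \<Longrightarrow> ramp u e x = 0" "e > 0 \<Longrightarrow> u + 2 * e \<le> x \<Longrightarrow> ramp u e x = 1"
proof -
  show "e > 0 \<Longrightarrow> x \<le> u \<Longrightarrow> ramp u e x = 0"
  proof -
    assume "e > 0" "x \<le> u"
    then have "(x - u) / e \<le> 0" by (simp add: divide_le_0_iff)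
    then show ?thesis by (simp add: ramp_def max_def)
  qed
  show "e > 0 \<Longrightarrow> u + 2 * e \<le> x \<Longrightarrow> ramp u e x = 1"
  proof -
    assume "e > 0" "u + 2 * e \<le> x"
    then have s: "2 \<le> (x - u) / e" by (simp add: le_divide_eq)
    define s where "s = (x - u) / e"
    have "2 \<le> s" using s by (simp add: s_def)
    then have "max 0 s = s" "max 0 (s - 1) = s - 1" "max 0 (s - 2) = s - 2" by auto
    then show ?thesis by (simp add: ramp_def s_def[symmetric]) (simp add: power2_eq_square field_simps)
  qed
qed

lemma tent_support: "e > 0 \<Longrightarrow> tent u e x \<noteq> 0 \<Longrightarrow> u \<le> x \<and> x \<le> u + 2 * e"
proof -
  assume e: "e > 0" and t: "tent u e x \<noteq> 0"
  define s where "s = (x - u) / e"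
  have "max 0 s - 2 * max 0 (s - 1) + max 0 (s - 2) \<noteq> 0" using t by (auto simp: tent_def s_def)
  then have "0 \<le> s" "s \<le> 2" by (auto simp: max_def split: if_splits)
  then show ?thesis using e by (simp_all add: s_def pos_le_divide_eq pos_divide_le_eq)
qed

lemma tent_bounds: "e > 0 \<Longrightarrow> 0 \<le> tent u e x" "e > 0 \<Longrightarrow> tent u e x \<le> 1 / e"
proof -
  have 0: "0 \<le> max 0 s - 2 * max 0 (s - 1) + max 0 (s - 2)" "max 0 s - 2 * max 0 (s - 1) + max 0 (s - 2) \<le> 1" for s :: real
    by (auto simp: max_def)
  show "e > 0 \<Longrightarrow> 0 \<le> tent u e x" "e > 0 \<Longrightarrow> tent u e x \<le> 1 / e"
    unfolding tent_def using 0 by (auto intro!: divide_right_mono divide_nonneg_nonneg)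
qed

lemma DERIV_ramp: "(ramp u e has_real_derivative tent u e x) (at x)"
proof -
  have "((\<lambda>x. (max 0 ((x - u) / e - c))\<^sup>2) has_real_derivative (2 * max 0 ((x - u) / e - c)) * (1 / e)) (at x)" for c
    by (rule DERIV_chain2[OF DERIV_square_positive_part]) (auto intro!: derivative_eq_intros simp: divide_inverse)
  note d = this[of 0] this[of 1] this[of 2]
  have "((\<lambda>x. ((max 0 ((x - u) / e - 0))\<^sup>2 - 2 * (max 0 ((x - u) / e - 1))\<^sup>2 + (max 0 ((x - u) / e - 2))\<^sup>2) / 2) has_real_derivative tent u e x) (at x)"
    by (rule derivative_eq_intros d refl | simp add: tent_def)+ (simp add: field_simps add_divide_distrib diff_divide_distrib)
  moreover have "ramp u e = (\<lambda>x. ((max 0 ((x - u) / e - 0))\<^sup>2 - 2 * (max 0 ((x - u) / e - 1))\<^sup>2 + (max 0 ((x - u) / e - 2))\<^sup>2) / 2)"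
    by (simp add: fun_eq_iff ramp_def)
  ultimately show ?thesis by simp
qed

lemma continuous_tent: "continuous_on UNIV (tent u e)"
  unfolding tent_def divide_inverse by (intro continuous_intros)

lemma ramp_mono: "e > 0 \<Longrightarrow> x \<le> y \<Longrightarrow> ramp u e x \<le> ramp u e y"
  by (rule DERIV_nonneg_imp_nondecreasing[of x y]) (use DERIV_ramp tent_bounds in blast)+

lemma ramp_bounds: "e > 0 \<Longrightarrow> 0 \<le> ramp u e x" "e > 0 \<Longrightarrow> ramp u e x \<le> 1"
proof -
  show "e > 0 \<Longrightarrow> 0 \<le> ramp u e x"
    using ramp_mono[of e "min x u" x u] ramp_cases(1)[of e "min x u" u] by simp
  show "e > 0 \<Longrightarrow> ramp u e x \<le> 1"
    using ramp_mono[of e x "max x (u + 2 * e)" u] ramp_cases(2)[of e u "max x (u + 2 * e)"] by simp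
qed

lemma nn_integral_tent: assumes "e > 0" shows "(\<integral>\<^sup>+x. ennreal (tent u e x) \<partial>lborel) = 1"
proof -
  have [measurable]: "tent u e \<in> borel_measurable borel"
    using continuous_tent by (rule borel_measurable_continuous_onI)
  have "(\<integral>\<^sup>+x. ennreal (tent u e x) \<partial>lborel) = (\<integral>\<^sup>+x. ennreal (tent u e x) * indicator {u..u + 2 * e} x \<partial>lborel)"
  proof (intro nn_integral_cong)
    fix x
    show "ennreal (tent u e x) = ennreal (tent u e x) * indicator {u..u + 2 * e} x"
      using tent_support[OF assms, of u x] by (cases "tent u e x = 0") auto
  qed
  also have "\<dots> = ennreal (ramp u e (u + 2 * e) - ramp u e u)"
    by (rule nn_integral_FTC_Icc) (use assms in \<open>auto intro: tent_bounds has_field_derivative_at_within DERIV_ramp\<close>)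
  also have "\<dots> = 1" using ramp_cases[of e] assms by simp
  finally show ?thesis .
qed

lemma ramp_tendsto_indicator:
  "(\<lambda>n. ramp u (1 / (2 * real (Suc n))) x) \<longlonglongrightarrow> indicator {u<..} x"
proof (cases "x \<le> u")
  case True
  then show ?thesis using ramp_cases(1)[of _ x u] by simp
next
  case False
  have "(\<lambda>n. u + 1 / real (Suc n)) \<longlonglongrightarrow> u + 0" by (intro tendsto_add tendsto_const LIMSEQ_Suc lim_1_over_n)
  then have "\<forall>\<^sub>F n in sequentially. u + 1 / real (Suc n) < x" by (rule order_tendstoD) (use False in auto)
  then have "\<forall>\<^sub>F n in sequentially. ramp u (1 / (2 * real (Suc n))) x = indicator {u<..} x"
  proof eventually_elim
    case (elim n)
    then have "ramp u (1 / (2 * real (Suc n))) x = 1" by (intro ramp_cases(2)) (auto simp: field_simps)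
    then show ?case using False by simp
  qed
  then show ?thesis by (rule tendsto_eventually)
qed

text \<open>The normal comparison inequality with weights \<open>w\<close>. The weights make it possible to exchange
  one of several independent copies while the others are kept fixed.\<close>

lemma gauss_comparison:
  fixes X :: "'i \<Rightarrow> 'a \<Rightarrow> real" and Y :: "'i \<Rightarrow> 'b \<Rightarrow> real"
  assumes fin: "finite I" and M: "prob_space M" and N: "prob_space N"
    and X: "gauss_family M I X R" and Y: "gauss_family N I Y R'"
    and sym: "\<And>i k. R i k = R k i" "\<And>i k. R' i k = R' k i"
    and diag: "\<And>i. R i i = 1" "\<And>i. R' i i = 1"
    and w: "\<And>i. 0 \<le> w i" "\<And>i. w i \<le> 1"
    and dens: "\<And>i k c x y. i \<in> I \<Longrightarrow> k \<in> I \<Longrightarrow> i \<noteq> k \<Longrightarrow> c \<in> closed_segment (R i k) (R' i k) \<Longrightarrow>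
       u i \<le> x \<Longrightarrow> x \<le> u i + 1 \<Longrightarrow> u k \<le> y \<Longrightarrow> y \<le> u k + 1 \<Longrightarrow> \<bar>c\<bar> < 1 \<and> bvn c x y \<le> B i k"
  shows "\<bar>(\<integral>\<omega>. (\<Prod>i\<in>I. 1 - w i * indicator {u i<..} (X i \<omega>)) \<partial>M) - (\<integral>\<omega>. (\<Prod>i\<in>I. 1 - w i * indicator {u i<..} (Y i \<omega>)) \<partial>N)\<bar>
     \<le> (\<Sum>i\<in>I. \<Sum>k\<in>I - {i}. \<bar>R i k - R' i k\<bar> * B i k * (w i * w k))"
proof -
  let ?e = "\<lambda>n. 1 / (2 * real (Suc n))"
  have lim: "(\<lambda>n. \<integral>\<omega>. (\<Prod>i\<in>I. 1 - w i * ramp (u i) (?e n) (Z i \<omega>)) \<partial>K) \<longlonglongrightarrow> (\<integral>\<omega>. (\<Prod>i\<in>I. 1 - w i * indicator {u i<..} (Z i \<omega>)) \<partial>K)"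
    if K: "prob_space K" and Z [measurable]: "\<And>i. i \<in> I \<Longrightarrow> Z i \<in> borel_measurable K" for K :: "'c measure" and Z
  proof (rule integral_dominated_convergence[where w="\<lambda>_. 1"])
    interpret K: prob_space K by fact
    show "integrable K (\<lambda>_. 1::real)" by simp
    have [measurable]: "ramp a b \<in> borel_measurable borel" for a b
      by (rule borel_measurable_continuous_onI) (meson DERIV_ramp DERIV_isCont continuous_at_imp_continuous_on)
    show "(\<lambda>\<omega>. \<Prod>i\<in>I. 1 - w i * ramp (u i) (?e n) (Z i \<omega>)) \<in> borel_measurable K" for n by measurable
    show "(\<lambda>\<omega>. \<Prod>i\<in>I. 1 - w i * indicator {u i<..} (Z i \<omega>)) \<in> borel_measurable K" by measurable
    show "AE \<omega> in K. (\<lambda>n. \<Prod>i\<in>I. 1 - w i * ramp (u i) (?e n) (Z i \<omega>)) \<longlonglongrightarrow> (\<Prod>i\<in>I. 1 - w i * indicator {u i<..} (Z i \<omega>))"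
      by (intro AE_I2 tendsto_intros ramp_tendsto_indicator)
    show "AE \<omega> in K. norm (\<Prod>i\<in>I. 1 - w i * ramp (u i) (?e n) (Z i \<omega>)) \<le> 1" for n
    proof (intro AE_I2)
      fix \<omega>
      have "0 \<le> (\<Prod>i\<in>I. 1 - w i * ramp (u i) (?e n) (Z i \<omega>))" "(\<Prod>i\<in>I. 1 - w i * ramp (u i) (?e n) (Z i \<omega>)) \<le> 1"
        using weighted_factor_bounds[OF w ramp_bounds] by (auto intro!: prod_nonneg prod_le_1)
      then show "norm (\<Prod>i\<in>I. 1 - w i * ramp (u i) (?e n) (Z i \<omega>)) \<le> 1" by simp
    qed
  qed
  have mX: "X i \<in> borel_measurable M" if "i \<in> I" for i using X that by (auto simp: gauss_family_def)
  have mY: "Y i \<in> borel_measurable N" if "i \<in> I" for i using Y that by (auto simp: gauss_family_def)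
  show ?thesis
  proof (rule LIMSEQ_le_const2)
    show "(\<lambda>n. \<bar>(\<integral>\<omega>. (\<Prod>i\<in>I. 1 - w i * ramp (u i) (?e n) (X i \<omega>)) \<partial>M) - (\<integral>\<omega>. (\<Prod>i\<in>I. 1 - w i * ramp (u i) (?e n) (Y i \<omega>)) \<partial>N)\<bar>)
      \<longlonglongrightarrow> \<bar>(\<integral>\<omega>. (\<Prod>i\<in>I. 1 - w i * indicator {u i<..} (X i \<omega>)) \<partial>M) - (\<integral>\<omega>. (\<Prod>i\<in>I. 1 - w i * indicator {u i<..} (Y i \<omega>)) \<partial>N)\<bar>"
      by (intro tendsto_intros lim M N mX mY)
    show "\<exists>N0. \<forall>n\<ge>N0. \<bar>(\<integral>\<omega>. (\<Prod>i\<in>I. 1 - w i * ramp (u i) (?e n) (X i \<omega>)) \<partial>M) - (\<integral>\<omega>. (\<Prod>i\<in>I. 1 - w i * ramp (u i) (?e n) (Y i \<omega>)) \<partial>N)\<bar>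
       \<le> (\<Sum>i\<in>I. \<Sum>k\<in>I - {i}. \<bar>R i k - R' i k\<bar> * B i k * (w i * w k))"
    proof (intro exI allI impI)
      fix n :: nat
      have e: "0 < ?e n" "2 * ?e n \<le> 1" by (auto simp: field_simps)
      show "\<bar>(\<integral>\<omega>. (\<Prod>i\<in>I. 1 - w i * ramp (u i) (?e n) (X i \<omega>)) \<partial>M) - (\<integral>\<omega>. (\<Prod>i\<in>I. 1 - w i * ramp (u i) (?e n) (Y i \<omega>)) \<partial>N)\<bar>
       \<le> (\<Sum>i\<in>I. \<Sum>k\<in>I - {i}. \<bar>R i k - R' i k\<bar> * B i k * (w i * w k))"
      proof (rule smooth_gauss_comparison[where u=u, OF fin M N X Y sym diag DERIV_ramp continuous_tent ramp_bounds[OF e(1)] tent_bounds[OF e(1)] nn_integral_tent[OF e(1)] _ w dens])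
        show "u i \<le> x \<and> x \<le> u i + 1" if "tent (u i) (?e n) x \<noteq> 0" for i x
          using tent_support[OF e(1) that] e(2) by linarith
      qed
    qed
  qed
qed

text \<open>The copies are exchanged one after the other. Given the remaining copies, the weight \<open>w\<^sub>i\<close> is \<open>1\<close>
  when all of them exceed \<open>u\<^sub>i\<close> and \<open>0\<close> otherwise; the expectation of \<open>w\<^sub>i w\<^sub>k\<close> yields the power of the
  pair probability \<open>p\<close>.\<close>

lemma copies_comparison:
  fixes \<mu> \<nu> :: "('i \<Rightarrow> real) measure" and J :: "'b set"
    and R R' B p :: "'i \<Rightarrow> 'i \<Rightarrow> real" and u :: "'i \<Rightarrow> real"
  assumes finI: "finite I" and finJ: "finite J"
    and \<mu>: "prob_space \<mu>" "sets \<mu> = sets (\<Pi>\<^sub>M i\<in>I. borel)" and \<nu>: "prob_space \<nu>" "sets \<nu> = sets (\<Pi>\<^sub>M i\<in>I. borel)"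
    and g: "gauss_family \<mu> I (\<lambda>i x. x i) R" "gauss_family \<nu> I (\<lambda>i x. x i) R'"
    and sym: "\<And>i k. R i k = R k i" "\<And>i k. R' i k = R' k i"
    and diag: "\<And>i. R i i = 1" "\<And>i. R' i i = 1"
    and dens: "\<And>i k c x y. i \<in> I \<Longrightarrow> k \<in> I \<Longrightarrow> i \<noteq> k \<Longrightarrow> c \<in> closed_segment (R i k) (R' i k) \<Longrightarrow>
       u i \<le> x \<Longrightarrow> x \<le> u i + 1 \<Longrightarrow> u k \<le> y \<Longrightarrow> y \<le> u k + 1 \<Longrightarrow> \<bar>c\<bar> < 1 \<and> bvn c x y \<le> B i k"
    and p\<mu>: "\<And>i k. i \<in> I \<Longrightarrow> k \<in> I \<Longrightarrow> i \<noteq> k \<Longrightarrow> (\<integral>x. indicator {u i<..} (x i) * indicator {u k<..} (x k) \<partial>\<mu>) \<le> p i k"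
    and p\<nu>: "\<And>i k. i \<in> I \<Longrightarrow> k \<in> I \<Longrightarrow> i \<noteq> k \<Longrightarrow> (\<integral>x. indicator {u i<..} (x i) * indicator {u k<..} (x k) \<partial>\<nu>) \<le> p i k"
  shows "\<bar>(\<integral>x. (\<Prod>i\<in>I. 1 - (\<Prod>j\<in>J. indicator {u i<..} (x j i))) \<partial>(\<Pi>\<^sub>M j\<in>J. \<mu>)) - (\<integral>x. (\<Prod>i\<in>I. 1 - (\<Prod>j\<in>J. indicator {u i<..} (x j i))) \<partial>(\<Pi>\<^sub>M j\<in>J. \<nu>))\<bar>
     \<le> card J * (\<Sum>i\<in>I. \<Sum>k\<in>I - {i}. \<bar>R i k - R' i k\<bar> * B i k * p i k ^ (card J - 1))"
proof -
  let ?E = "\<Sum>i\<in>I. \<Sum>k\<in>I - {i}. \<bar>R i k - R' i k\<bar> * B i k * p i k ^ (card J - 1)"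
  define m where "m S j = (if j \<in> S then \<nu> else \<mu>)" for S and j :: 'b
  define ind where "ind i y = (indicator {u i<..} (y i) :: real)" for i and y :: "'i \<Rightarrow> real"
  define F where "F x = (\<Prod>i\<in>I. 1 - (\<Prod>j\<in>J. ind i (x j)))" for x :: "'b \<Rightarrow> 'i \<Rightarrow> real"
  have ind01: "0 \<le> ind i y" "ind i y \<le> 1" for i y by (auto simp: ind_def)
  have mprob: "prob_space (m S j)" and msets: "sets (m S j) = sets (\<Pi>\<^sub>M i\<in>I. borel)" for S j
    using \<mu> \<nu> by (auto simp: m_def)
  have ind_meas: "ind i \<in> borel_measurable (m S j)" if "i \<in> I" for i S j
  proof -
    have "ind i \<in> borel_measurable (\<Pi>\<^sub>M i\<in>I. borel :: real measure)" unfolding ind_def using that by measurable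
    then show ?thesis using measurable_cong_sets[OF msets refl] by blast
  qed
  have comp_meas: "(\<lambda>x. ind i (x j)) \<in> borel_measurable (PiM T (m S))" if "i \<in> I" "j \<in> T" for i j T S
    using measurable_comp[OF measurable_component_singleton[OF that(2)] ind_meas[OF that(1)]] by (simp add: comp_def)
  have F01: "0 \<le> F x" "F x \<le> 1" for x
  proof -
    have "0 \<le> (\<Prod>j\<in>J. ind i (x j))" "(\<Prod>j\<in>J. ind i (x j)) \<le> 1" for i
      using ind01 by (auto intro!: prod_nonneg prod_le_1)
    then show "0 \<le> F x" "F x \<le> 1" unfolding F_def by (auto intro!: prod_nonneg prod_le_1)
  qed
  have F_meas: "F \<in> borel_measurable (PiM J (m S))" for S
    unfolding F_def using comp_meas by (intro borel_measurable_prod borel_measurable_diff borel_measurable_const) auto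
  have step: "\<bar>(\<integral>x. F x \<partial>PiM J (m S)) - (\<integral>x. F x \<partial>PiM J (m (insert k S)))\<bar> \<le> ?E" if k: "k \<in> J" "k \<notin> S" for k S
  proof -
    define J' where "J' = J - {k}"
    have J': "finite J'" "k \<notin> J'" "J = insert k J'" using k finJ by (auto simp: J'_def)
    have cJ: "card J' = card J - 1" using J' by simp
    interpret A: product_prob_space "m S" UNIV
      by (intro product_prob_spaceI mprob)
    interpret A': product_prob_space "m (insert k S)" UNIV
      by (intro product_prob_spaceI mprob)
    interpret PA: prob_space "PiM J (m S)" by (intro prob_space_PiM mprob)
    interpret PA': prob_space "PiM J (m (insert k S))" by (intro prob_space_PiM mprob)
    interpret PJ: prob_space "PiM J' (m S)" by (intro prob_space_PiM mprob)
    have i1: "integrable (PiM (insert k J') (m S)) F"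
      unfolding J'(3)[symmetric] by (rule PA.integrable_const_bound[of _ 1]) (use F01 F_meas in auto)
    have i2: "integrable (PiM (insert k J') (m (insert k S))) F"
      unfolding J'(3)[symmetric] by (rule PA'.integrable_const_bound[of _ 1]) (use F01 F_meas in auto)
    have eqJ: "PiM J' (m (insert k S)) = PiM J' (m S)"
      by (rule PiM_cong) (use J' in \<open>auto simp: m_def\<close>)
    define wt where "wt x i = (\<Prod>j\<in>J'. ind i (x j))" for i and x :: "'b \<Rightarrow> 'i \<Rightarrow> real"
    have wt01: "0 \<le> wt x i" "wt x i \<le> 1" for x i unfolding wt_def using ind01 by (auto intro!: prod_nonneg prod_le_1)
    have Fupd: "F (x(k := y)) = (\<Prod>i\<in>I. 1 - wt x i * indicator {u i<..} (y i))" for x y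
    proof -
      have "(\<Prod>j\<in>J. ind i ((x(k := y)) j)) = wt x i * indicator {u i<..} (y i)" for i
      proof -
        have "(\<Prod>j\<in>J'. ind i ((x(k := y)) j)) = wt x i"
          unfolding wt_def using J'(2) by (intro prod.cong) auto
        then show ?thesis unfolding J'(3) using J'(1,2) by (simp add: ind_def mult.commute)
      qed
      then show ?thesis by (simp add: F_def)
    qed
    have e1: "(\<integral>x. F x \<partial>PiM J (m S)) = (\<integral>x. (\<integral>y. F (x(k := y)) \<partial>\<mu>) \<partial>PiM J' (m S))"
      using A.product_integral_insert[OF J'(1,2) i1] k by (simp add: J'(3)[symmetric] m_def)
    have e2: "(\<integral>x. F x \<partial>PiM J (m (insert k S))) = (\<integral>x. (\<integral>y. F (x(k := y)) \<partial>\<nu>) \<partial>PiM J' (m S))"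
      using A'.product_integral_insert[OF J'(1,2) i2] eqJ by (simp add: J'(3)[symmetric]) (simp add: m_def)
    have bound: "\<bar>(\<integral>y. F (x(k := y)) \<partial>\<mu>) - (\<integral>y. F (x(k := y)) \<partial>\<nu>)\<bar> \<le> (\<Sum>i\<in>I. \<Sum>l\<in>I - {i}. \<bar>R i l - R' i l\<bar> * B i l * (wt x i * wt x l))" for x
      unfolding Fupd by (rule gauss_comparison[OF finI \<mu>(1) \<nu>(1) g sym diag wt01 dens])
    have int1: "integrable (PiM J' (m S)) (\<lambda>x. \<integral>y. F (x(k := y)) \<partial>\<mu>)"
    proof (rule PJ.integrable_const_bound[of _ 1])
      interpret Mu: prob_space \<mu> by fact
      have "\<bar>\<integral>y. F (x(k := y)) \<partial>\<mu>\<bar> \<le> (\<integral>y. 1 \<partial>\<mu>)" for x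
        by (rule order_trans[OF integral_abs_bound]) (rule integral_mono', use F01 in auto)
      then show "AE x in PiM J' (m S). norm (\<integral>y. F (x(k := y)) \<partial>\<mu>) \<le> 1" by (simp add: Mu.prob_space)
      have "(\<lambda>(x, y). F (x(k := y))) \<in> borel_measurable (PiM J' (m S) \<Otimes>\<^sub>M m S k)"
        using measurable_comp[OF measurable_add_dim[of k J' "m S"] F_meas[of S, unfolded J'(3)]] by (simp add: comp_def case_prod_beta')
      then have "(\<lambda>x. \<integral>y. F (x(k := y)) \<partial>(m S k)) \<in> borel_measurable (PiM J' (m S))"
        by (intro sigma_finite_measure.borel_measurable_lebesgue_integral prob_space_imp_sigma_finite mprob)
      then show "(\<lambda>x. \<integral>y. F (x(k := y)) \<partial>\<mu>) \<in> borel_measurable (PiM J' (m S))" using k by (simp add: m_def)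
    qed
    have int2: "integrable (PiM J' (m S)) (\<lambda>x. \<integral>y. F (x(k := y)) \<partial>\<nu>)"
    proof (rule PJ.integrable_const_bound[of _ 1])
      interpret Nu: prob_space \<nu> by fact
      have "\<bar>\<integral>y. F (x(k := y)) \<partial>\<nu>\<bar> \<le> (\<integral>y. 1 \<partial>\<nu>)" for x
        by (rule order_trans[OF integral_abs_bound]) (rule integral_mono', use F01 in auto)
      then show "AE x in PiM J' (m S). norm (\<integral>y. F (x(k := y)) \<partial>\<nu>) \<le> 1" by (simp add: Nu.prob_space)
      have "(\<lambda>(x, y). F (x(k := y))) \<in> borel_measurable (PiM J' (m (insert k S)) \<Otimes>\<^sub>M m (insert k S) k)"
        using measurable_comp[OF measurable_add_dim[of k J' "m (insert k S)"] F_meas[of "insert k S", unfolded J'(3)]] by (simp add: comp_def case_prod_beta')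
      then have "(\<lambda>x. \<integral>y. F (x(k := y)) \<partial>(m (insert k S) k)) \<in> borel_measurable (PiM J' (m (insert k S)))"
        by (intro sigma_finite_measure.borel_measurable_lebesgue_integral prob_space_imp_sigma_finite mprob)
      then show "(\<lambda>x. \<integral>y. F (x(k := y)) \<partial>\<nu>) \<in> borel_measurable (PiM J' (m S))" unfolding eqJ by (simp add: m_def)
    qed
    have wtint: "integrable (PiM J' (m S)) (\<lambda>x. wt x i * wt x l)" if "i \<in> I" "l \<in> I" for i l
    proof (rule PJ.integrable_const_bound[of _ 1])
      show "AE x in PiM J' (m S). norm (wt x i * wt x l) \<le> 1"
        using wt01 by (intro AE_I2) (simp add: abs_mult abs_of_nonneg mult_le_one)
      show "(\<lambda>x. wt x i * wt x l) \<in> borel_measurable (PiM J' (m S))"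
        unfolding wt_def using comp_meas that by (intro borel_measurable_times borel_measurable_prod) auto
    qed
    have wtE: "(\<integral>x. wt x i * wt x l \<partial>PiM J' (m S)) \<le> p i l ^ (card J - 1)" if il: "i \<in> I" "l \<in> I" "i \<noteq> l" for i l
    proof -
      have "(\<integral>x. wt x i * wt x l \<partial>PiM J' (m S)) = (\<integral>x. (\<Prod>j\<in>J'. ind i (x j) * ind l (x j)) \<partial>PiM J' (m S))"
        unfolding wt_def by (simp add: prod.distrib)
      also have "\<dots> = (\<Prod>j\<in>J'. \<integral>y. ind i y * ind l y \<partial>m S j)"
      proof (rule A.product_integral_prod[OF J'(1)])
        fix j
        show "integrable (m S j) (\<lambda>y. ind i y * ind l y)"
          by (rule finite_measure.integrable_const_bound[OF prob_space.axioms(1)[OF mprob], where B=1])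
             (use ind01 ind_meas il in \<open>auto simp: abs_mult abs_of_nonneg intro!: mult_le_one\<close>)
      qed
      also have "\<dots> \<le> (\<Prod>j\<in>J'. p i l)"
      proof (intro prod_mono conjI)
        fix j
        show "0 \<le> (\<integral>y. ind i y * ind l y \<partial>m S j)" using ind01 by (intro integral_nonneg_AE) auto
        show "(\<integral>y. ind i y * ind l y \<partial>m S j) \<le> p i l"
          using p\<mu>[OF il] p\<nu>[OF il] by (auto simp: m_def ind_def)
      qed
      finally show ?thesis by (simp add: cJ)
    qed
    have "\<bar>(\<integral>x. F x \<partial>PiM J (m S)) - (\<integral>x. F x \<partial>PiM J (m (insert k S)))\<bar>
       = \<bar>\<integral>x. (\<integral>y. F (x(k := y)) \<partial>\<mu>) - (\<integral>y. F (x(k := y)) \<partial>\<nu>) \<partial>PiM J' (m S)\<bar>"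
      unfolding e1 e2 using int1 int2 by simp
    also have "\<dots> \<le> (\<integral>x. (\<Sum>i\<in>I. \<Sum>l\<in>I - {i}. \<bar>R i l - R' i l\<bar> * B i l * (wt x i * wt x l)) \<partial>PiM J' (m S))"
    proof (rule order_trans[OF integral_abs_bound], rule integral_mono)
      show "integrable (PiM J' (m S)) (\<lambda>x. \<Sum>i\<in>I. \<Sum>l\<in>I - {i}. \<bar>R i l - R' i l\<bar> * B i l * (wt x i * wt x l))"
        using wtint by (intro Bochner_Integration.integrable_sum integrable_mult_right) auto
    qed (use int1 int2 bound in auto)
    also have "\<dots> = (\<Sum>i\<in>I. \<Sum>l\<in>I - {i}. \<bar>R i l - R' i l\<bar> * B i l * (\<integral>x. wt x i * wt x l \<partial>PiM J' (m S)))"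
    proof -
      have "(\<integral>x. (\<Sum>l\<in>I - {i}. \<bar>R i l - R' i l\<bar> * B i l * (wt x i * wt x l)) \<partial>PiM J' (m S)) = (\<Sum>l\<in>I - {i}. \<bar>R i l - R' i l\<bar> * B i l * (\<integral>x. wt x i * wt x l \<partial>PiM J' (m S)))" if "i \<in> I" for i
        using wtint that by (subst Bochner_Integration.integral_sum) auto
      then show ?thesis
        using wtint by (subst Bochner_Integration.integral_sum) (auto intro!: Bochner_Integration.integrable_sum integrable_mult_right)
    qed
    also have "\<dots> \<le> ?E"
    proof (intro sum_mono mult_left_mono)
      fix i l assume il: "i \<in> I" "l \<in> I - {i}"
      then show "(\<integral>x. wt x i * wt x l \<partial>PiM J' (m S)) \<le> p i l ^ (card J - 1)" using wtE by auto
      have "R i l \<in> closed_segment (R i l) (R' i l)" by simp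
      from dens[OF _ _ _ this, of "u i" "u l"] il bvn_nonneg[of "R i l" "u i" "u l"]
      have "0 \<le> B i l" by force
      then show "0 \<le> \<bar>R i l - R' i l\<bar> * B i l" by simp
    qed
    finally show ?thesis .
  qed
  have "\<bar>(\<integral>x. F x \<partial>PiM J (m {})) - (\<integral>x. F x \<partial>PiM J (m S))\<bar> \<le> card S * ?E" if "S \<subseteq> J" for S
    using finite_subset[OF that finJ] that
  proof (induction S rule: finite_induct)
    case (insert k S)
    then have "\<bar>(\<integral>x. F x \<partial>PiM J (m {})) - (\<integral>x. F x \<partial>PiM J (m (insert k S)))\<bar> \<le> card S * ?E + ?E"
      using step[of k S] by fastforce
    also have "\<dots> = card (insert k S) * ?E" using insert by (simp add: algebra_simps)
    finally show ?case .
  qed simp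
  from this[of J] have "\<bar>(\<integral>x. F x \<partial>PiM J (m {})) - (\<integral>x. F x \<partial>PiM J (m J))\<bar> \<le> card J * ?E" by simp
  moreover have "PiM J (m {}) = (\<Pi>\<^sub>M j\<in>J. \<mu>)" "PiM J (m J) = (\<Pi>\<^sub>M j\<in>J. \<nu>)"
    by (auto simp: m_def intro!: PiM_cong)
  ultimately show ?thesis by (simp add: F_def ind_def)
qed

section \<open>Gaussian tails of one and two variables\<close>

definition normal_tail :: "real \<Rightarrow> real" where
  "normal_tail t = measure \<Phi> {t<..}"

lemma normal_tail_bounds01: "0 \<le> normal_tail t" "normal_tail t \<le> 1"
  using prob_space.prob_le_1[OF prob_space_std_normal] by (auto simp: normal_tail_def)

lemma normal_tail_eq_nn_integral:
  "ennreal (normal_tail t) = (\<integral>\<^sup>+x. ennreal (std_normal_density x) * indicator {t..} x \<partial>lborel)"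
proof -
  interpret prob_space \<Phi> by (rule prob_space_std_normal)
  have "ennreal (normal_tail t) = emeasure \<Phi> {t<..}" by (simp add: normal_tail_def emeasure_eq_measure)
  also have "\<dots> = (\<integral>\<^sup>+x. ennreal (std_normal_density x) * indicator {t<..} x \<partial>lborel)"
    by (simp add: emeasure_density)
  also have "\<dots> = (\<integral>\<^sup>+x. ennreal (std_normal_density x) * indicator {t..} x \<partial>lborel)"
    by (intro nn_integral_cong_AE) (use AE_lborel_singleton[of t] in \<open>auto elim!: eventually_mono simp: indicator_def\<close>)
  finally show ?thesis .
qed

lemma DERIV_std_normal_density: "(std_normal_density has_real_derivative - x * std_normal_density x) (at x)"
  unfolding std_normal_density_def by (auto intro!: derivative_eq_intros simp: field_simps)

lemma normal_tail_upper: assumes "t > 0" shows "normal_tail t \<le> std_normal_density t / t"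
proof -
  have "ennreal (normal_tail t) \<le> (\<integral>\<^sup>+x. ennreal (x / t * std_normal_density x) * indicator {t..} x \<partial>lborel)"
    unfolding normal_tail_eq_nn_integral
  proof (intro nn_integral_mono)
    fix x
    have "std_normal_density x \<le> x / t * std_normal_density x" if "t \<le> x"
      using that assms mult_right_mono[of 1 "x / t" "std_normal_density x"] by simp
    then show "ennreal (std_normal_density x) * indicator {t..} x \<le> ennreal (x / t * std_normal_density x) * indicator {t..} x"
      by (auto simp: indicator_def intro!: ennreal_leI)
  qed
  also have "\<dots> = ennreal (0 - - (std_normal_density t / t))"
  proof (rule nn_integral_FTC_atLeast[where F="\<lambda>x. - (std_normal_density x / t)"])
    show "((\<lambda>x. - (std_normal_density x / t)) has_real_derivative x / t * std_normal_density x) (at x)" for x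
      using assms by (auto intro!: derivative_eq_intros DERIV_std_normal_density)
    show "((\<lambda>x. - (std_normal_density x / t)) \<longlongrightarrow> 0) at_top"
      unfolding std_normal_density_def using assms by real_asymp
  qed (use assms in auto)
  finally show ?thesis using assms by simp
qed

lemma normal_tail_lower: assumes "1 \<le> t" shows "std_normal_density t * (t / (1 + t\<^sup>2)) \<le> normal_tail t"
proof -
  let ?F = "\<lambda>x. - (std_normal_density x * (x / (1 + x\<^sup>2)))"
  let ?f = "\<lambda>x. std_normal_density x * (1 - 2 / (1 + x\<^sup>2)\<^sup>2)"
  have pos: "1 + x\<^sup>2 \<noteq> 0" for x :: real by (smt (verit) zero_le_power2)
  have d: "(?F has_real_derivative ?f x) (at x)" for x
  proof -
    have q: "((\<lambda>x. x / (1 + x\<^sup>2)) has_real_derivative (1 * (1 + x\<^sup>2) - x * (2 * x)) / ((1 + x\<^sup>2) * (1 + x\<^sup>2))) (at x)"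
      using pos[of x] by (auto intro!: derivative_eq_intros)
    have "(?F has_real_derivative - (- x * std_normal_density x * (x / (1 + x\<^sup>2)) + ((1 * (1 + x\<^sup>2) - x * (2 * x)) / ((1 + x\<^sup>2) * (1 + x\<^sup>2))) * std_normal_density x)) (at x)"
      by (intro DERIV_minus DERIV_mult DERIV_std_normal_density q)
    moreover have "- (- x * std_normal_density x * (x / (1 + x\<^sup>2)) + ((1 * (1 + x\<^sup>2) - x * (2 * x)) / ((1 + x\<^sup>2) * (1 + x\<^sup>2))) * std_normal_density x) = ?f x"
      using pos[of x] by (simp add: divide_simps) (simp add: algebra_simps power2_eq_square)
    ultimately show ?thesis by simp
  qed
  have "ennreal (0 - ?F t) = (\<integral>\<^sup>+x. ennreal (?f x) * indicator {t..} x \<partial>lborel)"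
  proof (rule nn_integral_FTC_atLeast[symmetric, where F="?F" and f="?f"])
    show "0 \<le> ?f x" if "t \<le> x" for x
    proof -
      have "1 \<le> x\<^sup>2" using that assms by (simp add: one_le_power)
      then have "2\<^sup>2 \<le> (1 + x\<^sup>2)\<^sup>2" by (intro power_mono) auto
      then have "2 / (1 + x\<^sup>2)\<^sup>2 \<le> 2 / 2\<^sup>2" by (intro frac_le) auto
      then show ?thesis by (intro mult_nonneg_nonneg) auto
    qed
    show "(?F \<longlongrightarrow> 0) at_top" unfolding std_normal_density_def by real_asymp
  qed (use d in auto)
  also have "\<dots> \<le> ennreal (normal_tail t)"
    unfolding normal_tail_eq_nn_integral
  proof (intro nn_integral_mono mult_right_mono ennreal_leI)
    show "?f x \<le> std_normal_density x" for x
      using mult_left_mono[of "1 - 2 / (1 + x\<^sup>2)\<^sup>2" 1 "std_normal_density x"] by simp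
  qed simp
  finally show ?thesis using normal_tail_bounds01 by simp
qed

lemma normal_tail_antimono: "s \<le> t \<Longrightarrow> normal_tail t \<le> normal_tail s"
  unfolding normal_tail_def
  by (rule finite_measure.finite_measure_mono[OF prob_space.axioms(1)[OF prob_space_std_normal]]) auto

lemma borel_measurable_normal_tail [measurable]: "normal_tail \<in> borel_measurable borel"
proof -
  have "mono (\<lambda>t. - normal_tail t)" by (auto simp: mono_def normal_tail_antimono)
  then have "(\<lambda>t. - normal_tail t) \<in> borel_measurable borel" by (rule borel_measurable_mono)
  then show ?thesis using borel_measurable_uminus_eq by blast
qed

lemma std_normal_density_le_exp: "std_normal_density t \<le> exp (- t\<^sup>2 / 2)"
proof -
  have "1 \<le> sqrt (2 * pi)" using pi_gt3 by (intro real_le_rsqrt) auto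
  then have "exp (- t\<^sup>2 / 2) / sqrt (2 * pi) \<le> exp (- t\<^sup>2 / 2) / 1" by (intro divide_left_mono) auto
  then show ?thesis by (simp add: std_normal_density_def)
qed

lemma normal_tail_le_exp: assumes "1 \<le> t" shows "normal_tail t \<le> exp (- t\<^sup>2 / 2)"
proof -
  have "normal_tail t \<le> std_normal_density t / t" using assms by (intro normal_tail_upper) auto
  also have "\<dots> \<le> std_normal_density t / 1" using assms by (intro divide_left_mono) auto
  finally show ?thesis using std_normal_density_le_exp[of t] by simp
qed

lemma normal_tail_tendsto_0: "(normal_tail \<longlongrightarrow> 0) at_top"
proof (rule tendsto_sandwich[where f="\<lambda>_. 0" and h="\<lambda>t. exp (- t\<^sup>2 / 2)"])
  show "((\<lambda>t::real. exp (- t\<^sup>2 / 2)) \<longlongrightarrow> 0) at_top" by real_asymp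
  show "\<forall>\<^sub>F t in at_top. normal_tail t \<le> exp (- t\<^sup>2 / 2)"
    using eventually_ge_at_top[of 1] by eventually_elim (rule normal_tail_le_exp)
qed (auto simp: normal_tail_bounds01)

text \<open>On the quadrant \<open>x, y \<ge> m\<close> the quadratic form is smallest at the corner \<open>x = y = m\<close>, which gives
  the exponent \<open>- m\<^sup>2 / (1 + c)\<close>. This improves on the exponent \<open>- m\<^sup>2 / 2\<close> of a single tail as soon as
  \<open>c\<close> is bounded away from \<open>1\<close>.\<close>

lemma bvn_le_near:
  assumes c: "\<bar>c\<bar> \<le> \<delta>" "\<delta> < 1" and m: "0 \<le> m" "m \<le> x" "m \<le> y"
  shows "bvn c x y \<le> exp (- m\<^sup>2 / (1 + \<delta>)) / (2 * pi * sqrt (1 - \<delta>\<^sup>2))"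
proof -
  have cd: "c\<^sup>2 \<le> \<delta>\<^sup>2" "\<delta>\<^sup>2 < 1" "0 \<le> \<delta>" using c
    by (auto simp: abs_le_square_iff[symmetric] abs_square_less_1)
  have p: "0 < 1 - c\<^sup>2" "0 < 1 + c" "0 < 1 - c" using cd c by auto
  have mm: "m\<^sup>2 \<le> x\<^sup>2" "m\<^sup>2 \<le> y\<^sup>2" using m by (auto intro: power_mono)
  have "(1 - c) * (2 * m\<^sup>2) \<le> x\<^sup>2 - 2 * c * x * y + y\<^sup>2"
  proof (cases "0 \<le> c")
    case True
    have "2 * m\<^sup>2 \<le> x\<^sup>2 + y\<^sup>2" using mm by simp
    then have "(1 - c) * (2 * m\<^sup>2) \<le> (1 - c) * (x\<^sup>2 + y\<^sup>2)" using p by (intro mult_left_mono) auto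
    also have "\<dots> \<le> (1 - c) * (x\<^sup>2 + y\<^sup>2) + c * (x - y)\<^sup>2" using True by simp
    also have "\<dots> = x\<^sup>2 - 2 * c * x * y + y\<^sup>2" by (simp add: power2_eq_square algebra_simps)
    finally show ?thesis .
  next
    case False
    have "m\<^sup>2 \<le> x * y" unfolding power2_eq_square using m by (intro mult_mono) auto
    then have "2 * (- c) * m\<^sup>2 \<le> 2 * (- c) * (x * y)" using False by (intro mult_left_mono) auto
    moreover have "2 * m\<^sup>2 \<le> x\<^sup>2 + y\<^sup>2" using mm by simp
    ultimately show ?thesis by (simp add: algebra_simps)
  qed
  then have "(1 - c) * (2 * m\<^sup>2) / (2 * (1 - c\<^sup>2)) \<le> (x\<^sup>2 - 2 * c * x * y + y\<^sup>2) / (2 * (1 - c\<^sup>2))"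
    using p by (intro divide_right_mono) auto
  moreover have "(1 - c) * (2 * m\<^sup>2) / (2 * (1 - c\<^sup>2)) = m\<^sup>2 / (1 + c)"
  proof -
    have f: "1 - c\<^sup>2 = (1 - c) * (1 + c)" by (simp add: power2_eq_square algebra_simps)
    have "(1 - c) * (2 * m\<^sup>2) / (2 * (1 - c\<^sup>2)) = (2 * (1 - c)) * m\<^sup>2 / ((2 * (1 - c)) * (1 + c))"
      unfolding f by (simp only: mult_ac)
    also have "\<dots> = m\<^sup>2 / (1 + c)" by (rule mult_divide_mult_cancel_left) (use p in simp)
    finally show ?thesis .
  qed
  moreover have "m\<^sup>2 / (1 + \<delta>) \<le> m\<^sup>2 / (1 + c)" using p c by (intro divide_left_mono) auto
  ultimately have "exp (- (x\<^sup>2 - 2 * c * x * y + y\<^sup>2) / (2 * (1 - c\<^sup>2))) \<le> exp (- m\<^sup>2 / (1 + \<delta>))"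
    by (simp only: exp_le_cancel_iff minus_divide_left[symmetric])
  moreover have "sqrt (1 - \<delta>\<^sup>2) \<le> sqrt (1 - c\<^sup>2)" using cd by simp
  ultimately show ?thesis unfolding bvn_def using cd
    by (intro frac_le mult_left_mono mult_pos_pos) auto
qed

text \<open>For correlations of the order \<open>1 / (x y)\<close> the joint density is of the order of the product of
  the marginal densities.\<close>

lemma bvn_le_far:
  assumes c: "\<bar>c\<bar> \<le> 1 / 2" and K: "\<bar>c\<bar> * (x * y) \<le> K" and xy: "0 \<le> x" "0 \<le> y"
  shows "bvn c x y \<le> exp (2 * K) * exp (- (x\<^sup>2 + y\<^sup>2) / 2)"
proof -
  have c2: "c\<^sup>2 \<le> 1 / 4" using abs_le_square_iff[of c "1 / 2"] c by (simp add: power2_eq_square)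
  have K0: "0 \<le> K" using K xy by (smt (verit) mult_nonneg_nonneg abs_ge_zero)
  have "c * x * y \<le> K" using K xy by (smt (verit) abs_ge_self mult.assoc mult_right_mono mult_nonneg_nonneg)
  then have "x\<^sup>2 + y\<^sup>2 - 2 * K \<le> x\<^sup>2 - 2 * c * x * y + y\<^sup>2" by simp
  then have "(x\<^sup>2 + y\<^sup>2 - 2 * K) / (2 * (1 - c\<^sup>2)) \<le> (x\<^sup>2 - 2 * c * x * y + y\<^sup>2) / (2 * (1 - c\<^sup>2))"
    using c2 by (intro divide_right_mono) auto
  moreover have "(x\<^sup>2 + y\<^sup>2) / 2 - 2 * K \<le> (x\<^sup>2 + y\<^sup>2 - 2 * K) / (2 * (1 - c\<^sup>2))"
  proof -
    have "((x\<^sup>2 + y\<^sup>2) / 2 - 2 * K) * (2 * (1 - c\<^sup>2)) = (x\<^sup>2 + y\<^sup>2) * (1 - c\<^sup>2) - 4 * K * (1 - c\<^sup>2)"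
      by (simp add: field_simps)
    also have "\<dots> \<le> (x\<^sup>2 + y\<^sup>2) * 1 - 4 * K * (1 / 2)"
      using c2 K0 by (intro diff_mono mult_left_mono) auto
    finally show ?thesis using c2 by (simp add: pos_le_divide_eq)
  qed
  ultimately have e: "exp (- (x\<^sup>2 - 2 * c * x * y + y\<^sup>2) / (2 * (1 - c\<^sup>2))) \<le> exp (2 * K) * exp (- (x\<^sup>2 + y\<^sup>2) / 2)"
    by (simp only: exp_add[symmetric] exp_le_cancel_iff minus_divide_left[symmetric])
  have "1 / 2 \<le> sqrt (1 - c\<^sup>2)" using c2 by (intro real_le_rsqrt) (simp add: power2_eq_square)
  then have "2 * pi * (1 / 2) \<le> 2 * pi * sqrt (1 - c\<^sup>2)" by (intro mult_left_mono) auto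
  then have "1 \<le> 2 * pi * sqrt (1 - c\<^sup>2)" using pi_gt3 by linarith
  then have "exp (- (x\<^sup>2 - 2 * c * x * y + y\<^sup>2) / (2 * (1 - c\<^sup>2))) / (2 * pi * sqrt (1 - c\<^sup>2)) \<le> exp (- (x\<^sup>2 - 2 * c * x * y + y\<^sup>2) / (2 * (1 - c\<^sup>2))) / 1"
    by (intro divide_left_mono) auto
  then show ?thesis unfolding bvn_def using e by simp
qed

lemma gauss_family_pair_char:
  assumes g: "gauss_family M I X R" and fin: "finite I" and ik: "i \<in> I" "k \<in> I" "i \<noteq> k"
    and sym: "\<And>i k. R i k = R k i" and diag: "\<And>i. R i i = 1"
  shows "(CLINT \<omega>|M. iexp (s * X i \<omega> + t * X k \<omega>)) = exp (- (s\<^sup>2 + 2 * R i k * s * t + t\<^sup>2) / 2)"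
proof -
  let ?t = "\<lambda>l. if l = k then t else 0"
  have d: "(\<Sum>l\<in>I. (if l = m then b else 0) * f l) = b * f m" if "m \<in> I" for f m and b :: real
  proof -
    have "(\<Sum>l\<in>I. (if l = m then b else 0) * f l) = (\<Sum>l\<in>I. if l = m then b * f l else 0)" by (intro sum.cong) auto
    then show ?thesis using fin that by simp
  qed
  have "(\<Sum>l\<in>I. (1 * ?t l + (if l = i then s else 0)) * X l \<omega>) = s * X i \<omega> + t * X k \<omega>" for \<omega>
    unfolding distrib_right sum.distrib mult_1_left d[OF ik(1)] d[OF ik(2)] by simp
  hence "(CLINT \<omega>|M. iexp (s * X i \<omega> + t * X k \<omega>)) = (CLINT \<omega>|M. iexp (\<Sum>l\<in>I. (1 * ?t l + (if l = i then s else 0)) * X l \<omega>))"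
    by simp
  also have "\<dots> = exp (- (\<Sum>l\<in>I. \<Sum>m\<in>I. (1 * ?t l + (if l = i then s else 0)) * (1 * ?t m + (if m = i then s else 0)) * R l m) / 2)"
    by (rule g[unfolded gauss_family_def, THEN conjunct2, rule_format])
  also have "(\<Sum>l\<in>I. \<Sum>m\<in>I. (1 * ?t l + (if l = i then s else 0)) * (1 * ?t m + (if m = i then s else 0)) * R l m)
     = (\<Sum>l\<in>I. ?t l * (\<Sum>m\<in>I. ?t m * R l m)) + 2 * s * (\<Sum>l\<in>I. ?t l * R l i) + s\<^sup>2 * R i i"
    unfolding quadratic_form_shift[OF fin ik(1) sym] by (simp add: sum_distrib_left mult.assoc)
  also have "\<dots> = s\<^sup>2 + 2 * R i k * s * t + t\<^sup>2"
    unfolding d[OF ik(2)] sym[of k i] by (simp add: diag algebra_simps power2_eq_square[of t])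
  finally show ?thesis .
qed

text \<open>If both variables exceed \<open>m\<close>, then their sum, of variance \<open>2 + 2 c\<close>, exceeds \<open>2 m\<close>.\<close>

lemma pair_tail_near:
  assumes M: "prob_space M" and [measurable]: "A \<in> borel_measurable M" "B \<in> borel_measurable M"
    and char: "\<And>s t. (CLINT \<omega>|M. iexp (s * A \<omega> + t * B \<omega>)) = exp (- (s\<^sup>2 + 2 * c * s * t + t\<^sup>2) / 2)"
    and c: "\<bar>c\<bar> \<le> \<delta>" "\<delta> < 1" and m: "1 \<le> m" "m \<le> a" "m \<le> b"
  shows "(\<integral>\<omega>. indicator {a<..} (A \<omega>) * indicator {b<..} (B \<omega>) \<partial>M) \<le> exp (- m\<^sup>2 / (1 + \<delta>))"
proof -
  interpret M: prob_space M by fact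
  define \<sigma> where "\<sigma> = sqrt (2 + 2 * c)"
  have s2: "\<sigma>\<^sup>2 = 2 + 2 * c" "\<sigma> > 0" using c by (auto simp: \<sigma>_def)
  have sle: "\<sigma> \<le> 2" unfolding \<sigma>_def using c by (intro real_le_lsqrt) auto
  have law: "distr M borel (\<lambda>\<omega>. (A \<omega> + B \<omega>) / \<sigma>) = \<Phi>"
  proof (rule Levy_uniqueness[OF _ real_dist_normal_dist])
    show "real_distribution (distr M borel (\<lambda>\<omega>. (A \<omega> + B \<omega>) / \<sigma>))" by (rule M.real_distribution_distr) measurable
    show "char (distr M borel (\<lambda>\<omega>. (A \<omega> + B \<omega>) / \<sigma>)) = char \<Phi>"
    proof (rule ext)
      fix s
      have "char (distr M borel (\<lambda>\<omega>. (A \<omega> + B \<omega>) / \<sigma>)) s = (CLINT \<omega>|M. iexp (s / \<sigma> * A \<omega> + s / \<sigma> * B \<omega>))"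
        unfolding char_def by (subst integral_distr) (auto simp: add_divide_distrib distrib_left)
      also have "\<dots> = exp (- ((s / \<sigma>)\<^sup>2 * (2 + 2 * c)) / 2)"
        unfolding char by (simp add: algebra_simps power2_eq_square)
      also have "(s / \<sigma>)\<^sup>2 * (2 + 2 * c) = s\<^sup>2" unfolding s2(1)[symmetric] using s2(2) by (simp add: power_divide)
      finally show "char (distr M borel (\<lambda>\<omega>. (A \<omega> + B \<omega>) / \<sigma>)) s = char \<Phi> s"
        unfolding char_std_normal_distribution by simp
    qed
  qed
  let ?t = "2 * m / \<sigma>"
  have t1: "1 \<le> ?t" using sle s2(2) m by (simp add: le_divide_eq)
  have "(\<integral>\<omega>. indicator {a<..} (A \<omega>) * indicator {b<..} (B \<omega>) \<partial>M) \<le> (\<integral>\<omega>. indicator {?t<..} ((A \<omega> + B \<omega>) / \<sigma>) \<partial>M :: real)"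
  proof (rule integral_mono)
    show "integrable M (\<lambda>\<omega>. indicator {a<..} (A \<omega>) * indicator {b<..} (B \<omega>) :: real)"
      by (rule M.integrable_const_bound[of _ 1]) (auto simp: indicator_def)
    show "integrable M (\<lambda>\<omega>. indicator {?t<..} ((A \<omega> + B \<omega>) / \<sigma>) :: real)"
      by (rule M.integrable_const_bound[of _ 1]) (auto simp: indicator_def)
    show "indicator {a<..} (A \<omega>) * indicator {b<..} (B \<omega>) \<le> (indicator {?t<..} ((A \<omega> + B \<omega>) / \<sigma>) :: real)" for \<omega>
      using m s2(2) by (auto simp: indicator_def divide_strict_right_mono)
  qed
  also have "\<dots> = (\<integral>x. indicator {?t<..} x \<partial>distr M borel (\<lambda>\<omega>. (A \<omega> + B \<omega>) / \<sigma>))"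
    by (subst integral_distr) auto
  also have "\<dots> = normal_tail ?t" unfolding law normal_tail_def by simp
  also have "\<dots> \<le> std_normal_density ?t / ?t" using t1 by (intro normal_tail_upper) auto
  also have "\<dots> \<le> std_normal_density ?t / 1" using t1 by (intro divide_left_mono) auto
  also have "\<dots> \<le> exp (- ?t\<^sup>2 / 2)"
  proof -
    have "1 \<le> sqrt (2 * pi)" using pi_gt3 by (intro real_le_rsqrt) auto
    then have "exp (- ?t\<^sup>2 / 2) / sqrt (2 * pi) \<le> exp (- ?t\<^sup>2 / 2) / 1" by (intro divide_left_mono) auto
    then show ?thesis by (simp add: std_normal_density_def)
  qed
  also have "\<dots> \<le> exp (- m\<^sup>2 / (1 + \<delta>))"
  proof -
    have "m\<^sup>2 / (1 + \<delta>) \<le> m\<^sup>2 / (1 + c)" using c by (intro divide_left_mono mult_pos_pos) auto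
    also have "m\<^sup>2 / (1 + c) = ?t\<^sup>2 / 2" using c by (simp add: power_divide power_mult_distrib s2(1) divide_simps)
    finally show ?thesis by simp
  qed
  finally show ?thesis .
qed

lemma nn_integral_exp_tail: assumes "0 < a"
  shows "(\<integral>\<^sup>+x. ennreal (exp (- (x - u) * a)) * indicator {u..} x \<partial>lborel) = ennreal (1 / a)"
proof -
  have "(\<integral>\<^sup>+x. ennreal (exp (- (x - u) * a)) * indicator {u..} x \<partial>lborel) = ennreal (0 - - (exp (- (u - u) * a) / a))"
  proof (rule nn_integral_FTC_atLeast[where F="\<lambda>x. - (exp (- (x - u) * a) / a)"])
    show "((\<lambda>x. - (exp (- (x - u) * a) / a)) has_real_derivative exp (- (x - u) * a)) (at x)" for x
      using assms by (auto intro!: derivative_eq_intros)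
    show "((\<lambda>x. - (exp (- (x - u) * a) / a)) \<longlongrightarrow> 0) at_top" using assms by real_asymp
  qed auto
  then show ?thesis by simp
qed

text \<open>On the quadrant beyond \<open>(a, b)\<close> the exponent of the joint density lies below its tangent at the
  corner, whose slopes are at most \<open>- a / 2\<close> and \<open>- b / 2\<close>. Integrating the two exponentials gives
  the factor \<open>4 / (a b)\<close>.\<close>

lemma pair_tail_far:
  assumes M: "prob_space M" and [measurable]: "A \<in> borel_measurable M" "B \<in> borel_measurable M"
    and char: "\<And>s t. (CLINT \<omega>|M. iexp (s * A \<omega> + t * B \<omega>)) = exp (- (s\<^sup>2 + 2 * c * s * t + t\<^sup>2) / 2)"
    and c: "\<bar>c\<bar> \<le> 1 / 2" and K: "\<bar>c\<bar> * (a * b) \<le> K"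
    and ab: "0 < a" "0 < b" "\<bar>c\<bar> * b \<le> a / 2" "\<bar>c\<bar> * a \<le> b / 2"
  shows "(\<integral>\<omega>. indicator {a<..} (A \<omega>) * indicator {b<..} (B \<omega>) \<partial>M) \<le> 4 * exp (2 * K) * exp (- (a\<^sup>2 + b\<^sup>2) / 2) / (a * b)"
proof -
  interpret M: prob_space M by fact
  have c2: "c\<^sup>2 \<le> 1 / 4" using abs_le_square_iff[of c "1 / 2"] c by (simp add: power2_eq_square)
  have cl: "\<bar>c\<bar> < 1" using c by simp
  have dens: "bvn c x y \<le> bvn c a b * (exp (- (x - a) * (a / 2)) * exp (- (y - b) * (b / 2)))" if xy: "a \<le> x" "b \<le> y" for x y
  proof -
    define s t where "s = x - a" and "t = y - b"
    have st: "x = a + s" "y = b + t" "0 \<le> s" "0 \<le> t" using xy by (auto simp: s_def t_def)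
    have cb: "c * b \<le> a / 2" using ab by (smt (verit) abs_ge_self mult_right_mono)
    have ca: "c * a \<le> b / 2" using ab by (smt (verit) abs_ge_self mult_right_mono)
    have "0 \<le> s\<^sup>2 - 2 * c * s * t + t\<^sup>2"
    proof -
      have "c * (s * t) \<le> 1 * (s * t)" using cl st by (intro mult_right_mono) auto
      moreover have "0 \<le> (s - t)\<^sup>2" by simp
      ultimately show ?thesis by (simp add: power2_eq_square algebra_simps)
    qed
    moreover have "s * (a / 2) \<le> s * (a - c * b)" "t * (b / 2) \<le> t * (b - c * a)"
      using cb ca by (rule_tac [!] mult_left_mono, auto simp: st)
    ultimately have "(a\<^sup>2 - 2 * c * a * b + b\<^sup>2) + s * a + t * b \<le> x\<^sup>2 - 2 * c * x * y + y\<^sup>2"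
      unfolding st by (simp add: power2_eq_square algebra_simps)
    then have "((a\<^sup>2 - 2 * c * a * b + b\<^sup>2) + s * a + t * b) / (2 * (1 - c\<^sup>2)) \<le> (x\<^sup>2 - 2 * c * x * y + y\<^sup>2) / (2 * (1 - c\<^sup>2))"
      using c2 by (intro divide_right_mono) auto
    moreover have "(s * a + t * b) / 2 \<le> (s * a + t * b) / (2 * (1 - c\<^sup>2))"
      using c2 st ab by (intro divide_left_mono) auto
    ultimately have "(a\<^sup>2 - 2 * c * a * b + b\<^sup>2) / (2 * (1 - c\<^sup>2)) + s * (a / 2) + t * (b / 2) \<le> (x\<^sup>2 - 2 * c * x * y + y\<^sup>2) / (2 * (1 - c\<^sup>2))"
      by (simp add: add_divide_distrib)
    then have "exp (- (x\<^sup>2 - 2 * c * x * y + y\<^sup>2) / (2 * (1 - c\<^sup>2))) \<le> exp (- (a\<^sup>2 - 2 * c * a * b + b\<^sup>2) / (2 * (1 - c\<^sup>2)) + - s * (a / 2) + - t * (b / 2))"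
      by (simp only: exp_le_cancel_iff minus_divide_left[symmetric])
    then have "exp (- (x\<^sup>2 - 2 * c * x * y + y\<^sup>2) / (2 * (1 - c\<^sup>2))) \<le> exp (- (a\<^sup>2 - 2 * c * a * b + b\<^sup>2) / (2 * (1 - c\<^sup>2))) * (exp (- s * (a / 2)) * exp (- t * (b / 2)))"
      by (simp only: exp_add mult.assoc)
    then have "exp (- (x\<^sup>2 - 2 * c * x * y + y\<^sup>2) / (2 * (1 - c\<^sup>2))) / (2 * pi * sqrt (1 - c\<^sup>2)) \<le> exp (- (a\<^sup>2 - 2 * c * a * b + b\<^sup>2) / (2 * (1 - c\<^sup>2))) * (exp (- s * (a / 2)) * exp (- t * (b / 2))) / (2 * pi * sqrt (1 - c\<^sup>2))"
      using c2 by (intro divide_right_mono) auto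
    then show ?thesis unfolding bvn_def s_def t_def by simp
  qed
  have i: "integrable M (\<lambda>\<omega>. indicator {a<..} (A \<omega>) * indicator {b<..} (B \<omega>) :: real)"
    by (rule M.integrable_const_bound[of _ 1]) (auto simp: indicator_def)
  have "ennreal (\<integral>\<omega>. indicator {a<..} (A \<omega>) * indicator {b<..} (B \<omega>) \<partial>M) = (\<integral>\<^sup>+\<omega>. ennreal (indicator {a<..} (A \<omega>) * indicator {b<..} (B \<omega>)) \<partial>M)"
    by (rule nn_integral_eq_integral[symmetric, OF i]) simp
  also have "\<dots> = (\<integral>\<^sup>+x. \<integral>\<^sup>+y. ennreal (bvn c x y) * ennreal (indicator {a<..} x * indicator {b<..} y) \<partial>lborel \<partial>lborel)"
    by (rule nn_integral_gauss_pair[OF M _ _ char cl, where f = "\<lambda>x y. ennreal (indicator {a<..} x * indicator {b<..} y)"]) auto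
  also have "\<dots> \<le> (\<integral>\<^sup>+x. \<integral>\<^sup>+y. ennreal (bvn c a b) * (ennreal (exp (- (x - a) * (a / 2))) * indicator {a..} x) * (ennreal (exp (- (y - b) * (b / 2))) * indicator {b..} y) \<partial>lborel \<partial>lborel)"
  proof (intro nn_integral_mono)
    fix x y
    show "ennreal (bvn c x y) * ennreal (indicator {a<..} x * indicator {b<..} y)
       \<le> ennreal (bvn c a b) * (ennreal (exp (- (x - a) * (a / 2))) * indicator {a..} x) * (ennreal (exp (- (y - b) * (b / 2))) * indicator {b..} y)"
      using dens[of x y] bvn_nonneg[OF cl, of a b]
      by (auto simp: indicator_def ennreal_mult[symmetric] mult.assoc intro!: ennreal_leI)
  qed
  also have "\<dots> = ennreal (bvn c a b) * ennreal (1 / (a / 2)) * ennreal (1 / (b / 2))"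
  proof -
    have "(\<integral>\<^sup>+y. ennreal (exp (- (y - b) * (b / 2))) * indicator {b..} y \<partial>lborel) = ennreal (1 / (b / 2))"
      "(\<integral>\<^sup>+x. ennreal (exp (- (x - a) * (a / 2))) * indicator {a..} x \<partial>lborel) = ennreal (1 / (a / 2))"
      using ab by (intro nn_integral_exp_tail; simp)+
    then show ?thesis by (simp add: nn_integral_cmult nn_integral_multc del: mult_minus_left)
  qed
  also have "\<dots> = ennreal (bvn c a b * 4 / (a * b))"
    using ab bvn_nonneg[OF cl] by (simp add: ennreal_mult[symmetric])
  finally have "(\<integral>\<omega>. indicator {a<..} (A \<omega>) * indicator {b<..} (B \<omega>) \<partial>M) \<le> bvn c a b * 4 / (a * b)"
    using ab bvn_nonneg[OF cl, of a b] by simp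
  also have "\<dots> \<le> exp (2 * K) * exp (- (a\<^sup>2 + b\<^sup>2) / 2) * 4 / (a * b)"
    using bvn_le_far[OF c K] ab by (intro divide_right_mono mult_right_mono) auto
  finally show ?thesis by (simp add: mult_ac)
qed

section \<open>The reference process with one common Gaussian component\<close>

text \<open>The law of \<open>\<surd>\<rho> Z + \<surd>(1 - \<rho>) \<zeta>\<^sub>i\<close> with independent standard normal \<open>Z\<close> and \<open>\<zeta>\<^sub>i\<close>: the Gaussian
  vector whose correlations all equal \<open>\<rho>\<close>.\<close>

definition common_factor_law :: "real \<Rightarrow> 'i set \<Rightarrow> ('i \<Rightarrow> real) measure" where
  "common_factor_law \<rho> I = distr (\<Phi> \<Otimes>\<^sub>M (\<Pi>\<^sub>M i\<in>I. \<Phi>)) (\<Pi>\<^sub>M i\<in>I. borel)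
     (\<lambda>p. \<lambda>i\<in>I. sqrt \<rho> * fst p + sqrt (1 - \<rho>) * snd p i)"

lemma product_prob_space_std_normal: "product_prob_space (\<lambda>_. \<Phi>)"
  by (intro product_prob_spaceI prob_space_std_normal)

context
  fixes \<rho> :: real and I :: "'i set"
  assumes fin: "finite I" and \<rho>: "0 \<le> \<rho>" "\<rho> < 1"
begin

lemma measurable_common_factor:
  "(\<lambda>p. \<lambda>i\<in>I. sqrt \<rho> * fst p + sqrt (1 - \<rho>) * snd p i) \<in> measurable (\<Phi> \<Otimes>\<^sub>M (\<Pi>\<^sub>M i\<in>I. \<Phi>)) (\<Pi>\<^sub>M i\<in>I. borel)"
proof (rule measurable_restrict)
  fix i assume i: "i \<in> I"
  have "(\<lambda>x. x i) \<in> measurable (\<Pi>\<^sub>M i\<in>I. \<Phi>) \<Phi>" using i by (rule measurable_component_singleton)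
  then have [measurable]: "(\<lambda>x. x i) \<in> borel_measurable (\<Pi>\<^sub>M i\<in>I. \<Phi>)" by simp
  show "(\<lambda>p. sqrt \<rho> * fst p + sqrt (1 - \<rho>) * snd p i) \<in> borel_measurable (\<Phi> \<Otimes>\<^sub>M (\<Pi>\<^sub>M i\<in>I. \<Phi>))" by measurable
qed

lemma prob_space_PiM_std_normal: "prob_space (\<Pi>\<^sub>M i\<in>T. \<Phi>)"
  by (intro prob_space_PiM prob_space_std_normal)

lemma prob_space_common_factor_law: "prob_space (common_factor_law \<rho> I)"
proof -
  interpret A: prob_space \<Phi> by (rule prob_space_std_normal)
  interpret B: prob_space "\<Pi>\<^sub>M i\<in>I. \<Phi>" by (rule prob_space_PiM_std_normal)
  interpret P: pair_prob_space \<Phi> "\<Pi>\<^sub>M i\<in>I. \<Phi>" ..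
  show ?thesis unfolding common_factor_law_def by (rule P.prob_space_distr[OF measurable_common_factor])
qed

lemma sets_common_factor_law: "sets (common_factor_law \<rho> I) = sets (\<Pi>\<^sub>M i\<in>I. borel)"
  by (simp add: common_factor_law_def)

lemma gauss_family_common_factor_law:
  "gauss_family (common_factor_law \<rho> I) I (\<lambda>i x. x i) (\<lambda>i k. if i = k then 1 else \<rho>)"
  unfolding gauss_family_def
proof (intro conjI ballI allI)
  interpret A: prob_space \<Phi> by (rule prob_space_std_normal)
  interpret B: product_prob_space "\<lambda>_. \<Phi>" I by (rule product_prob_space_std_normal)
  fix i assume "i \<in> I"
  then have "(\<lambda>x. x i) \<in> borel_measurable (\<Pi>\<^sub>M i\<in>I. borel :: real measure)" by measurable
  then show "(\<lambda>x. x i) \<in> borel_measurable (common_factor_law \<rho> I)" by (simp add: common_factor_law_def)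
next
  interpret A: prob_space \<Phi> by (rule prob_space_std_normal)
  interpret B: product_prob_space "\<lambda>_. \<Phi>" I by (rule product_prob_space_std_normal)
  fix t :: "'i \<Rightarrow> real"
  define T where "T = (\<Sum>i\<in>I. t i)"
  have m: "(\<lambda>x. iexp (\<Sum>i\<in>I. t i * x i)) \<in> borel_measurable (\<Pi>\<^sub>M i\<in>I. borel :: real measure)" by measurable
  have m2: "(\<lambda>x. \<Sum>i\<in>I. sqrt (1 - \<rho>) * t i * x i) \<in> borel_measurable (\<Pi>\<^sub>M i\<in>I. \<Phi>)"
    by (intro borel_measurable_sum borel_measurable_times borel_measurable_const)
       (use measurable_component_singleton[of _ I "\<lambda>_. \<Phi>"] in simp)
  have "(CLINT x|common_factor_law \<rho> I. iexp (\<Sum>i\<in>I. t i * x i))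
     = (CLINT p|\<Phi> \<Otimes>\<^sub>M (\<Pi>\<^sub>M i\<in>I. \<Phi>). iexp (\<Sum>i\<in>I. t i * (\<lambda>i\<in>I. sqrt \<rho> * fst p + sqrt (1 - \<rho>) * snd p i) i))"
    unfolding common_factor_law_def by (rule integral_distr[OF measurable_common_factor m])
  also have "\<dots> = (CLINT p|\<Phi> \<Otimes>\<^sub>M (\<Pi>\<^sub>M i\<in>I. \<Phi>). iexp (sqrt \<rho> * T * fst p + (\<Sum>i\<in>I. sqrt (1 - \<rho>) * t i * snd p i)))"
    by (intro Bochner_Integration.integral_cong refl arg_cong[where f=iexp])
       (simp add: T_def algebra_simps sum.distrib sum_distrib_left sum_distrib_right)
  also have "\<dots> = (CLINT z|\<Phi>. iexp (sqrt \<rho> * T * z)) * (CLINT x|(\<Pi>\<^sub>M i\<in>I. \<Phi>). iexp (\<Sum>i\<in>I. sqrt (1 - \<rho>) * t i * x i))"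
    by (rule integral_pair_iexp_prod[OF prob_space_std_normal prob_space_PiM_std_normal _ m2]) auto
  also have "(CLINT x|(\<Pi>\<^sub>M i\<in>I. \<Phi>). iexp (\<Sum>i\<in>I. sqrt (1 - \<rho>) * t i * x i)) = (CLINT x|(\<Pi>\<^sub>M i\<in>I. \<Phi>). (\<Prod>i\<in>I. iexp (sqrt (1 - \<rho>) * t i * x i)))"
    using fin by (intro Bochner_Integration.integral_cong refl) (simp add: exp_sum sum_distrib_left)
  also have "\<dots> = (\<Prod>i\<in>I. CLINT x|\<Phi>. iexp (sqrt (1 - \<rho>) * t i * x))"
    by (rule B.product_integral_prod[OF fin]) (rule A.integrable_const_bound[of _ 1], auto)
  also have "\<dots> = (\<Prod>i\<in>I. complex_of_real (exp (- ((sqrt (1 - \<rho>) * t i)\<^sup>2) / 2)))"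
    by (intro prod.cong refl expectation_iexp_std_normal)
  also have "\<dots> = complex_of_real (exp (\<Sum>i\<in>I. - ((sqrt (1 - \<rho>) * t i)\<^sup>2) / 2))"
    using fin by (simp add: exp_sum)
  also have "(\<Sum>i\<in>I. - ((sqrt (1 - \<rho>) * t i)\<^sup>2) / 2) = - ((1 - \<rho>) * (\<Sum>i\<in>I. (t i)\<^sup>2)) / 2"
    using \<rho> by (simp add: power_mult_distrib sum_distrib_left sum_negf sum_divide_distrib)
  also have "(CLINT z|\<Phi>. iexp (sqrt \<rho> * T * z)) = exp (- ((sqrt \<rho> * T)\<^sup>2) / 2)" by (rule expectation_iexp_std_normal)
  also have "complex_of_real (exp (- ((sqrt \<rho> * T)\<^sup>2) / 2)) * complex_of_real (exp (- ((1 - \<rho>) * (\<Sum>i\<in>I. (t i)\<^sup>2)) / 2))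
     = complex_of_real (exp (- (\<rho> * T\<^sup>2 + (1 - \<rho>) * (\<Sum>i\<in>I. (t i)\<^sup>2)) / 2))"
    using \<rho> by (simp add: exp_add[symmetric] of_real_mult[symmetric] power_mult_distrib add_divide_distrib diff_divide_distrib del: of_real_mult)
  also have "\<rho> * T\<^sup>2 + (1 - \<rho>) * (\<Sum>i\<in>I. (t i)\<^sup>2) = (\<Sum>i\<in>I. \<Sum>k\<in>I. t i * t k * (if i = k then 1 else \<rho>))"
  proof -
    have "(\<Sum>i\<in>I. \<Sum>k\<in>I. t i * t k * (if i = k then 1 else \<rho>)) = (\<Sum>i\<in>I. \<Sum>k\<in>I. \<rho> * (t i * t k) + (if i = k then (1 - \<rho>) * (t i)\<^sup>2 else 0))"
      by (intro sum.cong refl) (auto simp: power2_eq_square algebra_simps)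
    also have "\<dots> = (\<Sum>i\<in>I. \<Sum>k\<in>I. \<rho> * (t i * t k)) + (\<Sum>i\<in>I. (1 - \<rho>) * (t i)\<^sup>2)"
      using fin by (simp add: sum.distrib)
    also have "(\<Sum>i\<in>I. \<Sum>k\<in>I. \<rho> * (t i * t k)) = \<rho> * T\<^sup>2"
    proof -
      have "T\<^sup>2 = (\<Sum>i\<in>I. \<Sum>k\<in>I. t i * t k)" by (simp add: T_def power2_eq_square sum_product)
      then show ?thesis by (simp add: sum_distrib_left)
    qed
    finally show ?thesis by (simp add: sum_distrib_left)
  qed
  finally show "(CLINT x|common_factor_law \<rho> I. iexp (\<Sum>i\<in>I. t i * x i)) = complex_of_real (exp (- (\<Sum>i\<in>I. \<Sum>k\<in>I. t i * t k * (if i = k then 1 else \<rho>)) / 2))" .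
qed

lemma expectation_common_factor_exceedances:
  assumes T: "T \<subseteq> I"
  shows "(\<integral>x. (\<Prod>i\<in>T. indicator {u i<..} (x i)) \<partial>common_factor_law \<rho> I)
     = (\<integral>z. (\<Prod>i\<in>T. normal_tail ((u i - sqrt \<rho> * z) / sqrt (1 - \<rho>))) \<partial>\<Phi>)"
proof -
  interpret A: prob_space \<Phi> by (rule prob_space_std_normal)
  interpret B: product_prob_space "\<lambda>_. \<Phi>" I by (rule product_prob_space_std_normal)
  interpret PB: prob_space "\<Pi>\<^sub>M i\<in>I. \<Phi>" by (rule prob_space_PiM_std_normal)
  interpret P: pair_prob_space \<Phi> "\<Pi>\<^sub>M i\<in>I. \<Phi>" ..
  have TI: "i \<in> I" if "i \<in> T" for i using T that by auto
  have [measurable]: "(\<lambda>x. x i) \<in> borel_measurable (\<Pi>\<^sub>M i\<in>I. \<Phi>)" if "i \<in> T" for i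
    using measurable_component_singleton[OF TI[OF that], of "\<lambda>_. \<Phi>"] by simp
  have [measurable]: "(\<lambda>x. x i) \<in> borel_measurable (\<Pi>\<^sub>M i\<in>I. borel :: real measure)" if "i \<in> T" for i
    using TI[OF that] by measurable
  have s: "0 < sqrt (1 - \<rho>)" using \<rho> by simp
  let ?g = "\<lambda>i z y. indicator {(u i - sqrt \<rho> * z) / sqrt (1 - \<rho>)<..} y :: real"
  have ind: "indicator {u i<..} (sqrt \<rho> * z + sqrt (1 - \<rho>) * y) = ?g i z y" for i z y
    using s by (auto simp: indicator_def divide_less_eq algebra_simps)
  have m: "(\<lambda>x. \<Prod>i\<in>T. indicator {u i<..} (x i) :: real) \<in> borel_measurable (\<Pi>\<^sub>M i\<in>I. borel :: real measure)" by measurable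
  have "(\<integral>x. (\<Prod>i\<in>T. indicator {u i<..} (x i)) \<partial>common_factor_law \<rho> I)
     = (\<integral>p. (\<Prod>i\<in>T. indicator {u i<..} ((\<lambda>i\<in>I. sqrt \<rho> * fst p + sqrt (1 - \<rho>) * snd p i) i)) \<partial>(\<Phi> \<Otimes>\<^sub>M (\<Pi>\<^sub>M i\<in>I. \<Phi>)) :: real)"
    unfolding common_factor_law_def by (rule integral_distr[OF measurable_common_factor m])
  also have "\<dots> = (\<integral>p. (\<Prod>i\<in>T. indicator {u i<..} (sqrt \<rho> * fst p + sqrt (1 - \<rho>) * snd p i)) \<partial>(\<Phi> \<Otimes>\<^sub>M (\<Pi>\<^sub>M i\<in>I. \<Phi>)))"
    using TI by (intro Bochner_Integration.integral_cong refl prod.cong) auto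
  also have "\<dots> = (\<integral>z. \<integral>x. (\<Prod>i\<in>T. indicator {u i<..} (sqrt \<rho> * z + sqrt (1 - \<rho>) * x i)) \<partial>(\<Pi>\<^sub>M i\<in>I. \<Phi>) \<partial>\<Phi>)"
  proof (subst P.integral_fst'[symmetric])
    show "integrable (\<Phi> \<Otimes>\<^sub>M (\<Pi>\<^sub>M i\<in>I. \<Phi>)) (\<lambda>p. \<Prod>i\<in>T. indicator {u i<..} (sqrt \<rho> * fst p + sqrt (1 - \<rho>) * snd p i) :: real)"
      by (rule P.integrable_const_bound[of _ 1]) (auto simp: abs_prod intro!: prod_le_1)
  qed simp
  also have "\<dots> = (\<integral>z. (\<Prod>i\<in>T. normal_tail ((u i - sqrt \<rho> * z) / sqrt (1 - \<rho>))) \<partial>\<Phi>)"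
  proof (intro Bochner_Integration.integral_cong refl)
    fix z :: real
    have "(\<integral>x. (\<Prod>i\<in>T. indicator {u i<..} (sqrt \<rho> * z + sqrt (1 - \<rho>) * x i)) \<partial>(\<Pi>\<^sub>M i\<in>I. \<Phi>))
        = (\<integral>x. (\<Prod>i\<in>I. (if i \<in> T then ?g i z (x i) else 1)) \<partial>(\<Pi>\<^sub>M i\<in>I. \<Phi>))"
      unfolding ind using T fin by (intro Bochner_Integration.integral_cong refl prod.mono_neutral_cong_left) auto
    also have "\<dots> = (\<Prod>i\<in>I. \<integral>y. (if i \<in> T then ?g i z y else 1) \<partial>\<Phi>)"
      by (rule B.product_integral_prod[OF fin]) (rule A.integrable_const_bound[of _ 1], auto)
    also have "\<dots> = (\<Prod>i\<in>T. normal_tail ((u i - sqrt \<rho> * z) / sqrt (1 - \<rho>)))"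
      using T fin A.prob_space by (intro prod.mono_neutral_cong_right) (auto simp: normal_tail_def)
    finally show "(\<integral>x. (\<Prod>i\<in>T. indicator {u i<..} (sqrt \<rho> * z + sqrt (1 - \<rho>) * x i)) \<partial>(\<Pi>\<^sub>M i\<in>I. \<Phi>)) = (\<Prod>i\<in>T. normal_tail ((u i - sqrt \<rho> * z) / sqrt (1 - \<rho>)))" .
  qed
  finally show ?thesis .
qed

end

text \<open>Given the common components \<open>z\<close>, the reference variables are independent. Both sides are
  expanded by inclusion and exclusion over the set of exceeding indices, which turns them into
  sums of products over the copies.\<close>

lemma expectation_common_factor_copies:
  fixes I :: "'i set" and J :: "'j set"
  assumes finI: "finite I" and finJ: "finite J" and \<rho>: "0 \<le> \<rho>" "\<rho> < 1"
  shows "(\<integral>x. (\<Prod>i\<in>I. 1 - (\<Prod>j\<in>J. indicator {u i<..} (x j i))) \<partial>(\<Pi>\<^sub>M j\<in>J. common_factor_law \<rho> I))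
     = (\<integral>z. (\<Prod>i\<in>I. 1 - (\<Prod>j\<in>J. normal_tail ((u i - sqrt \<rho> * z j) / sqrt (1 - \<rho>)))) \<partial>(\<Pi>\<^sub>M j\<in>J. \<Phi>))"
proof -
  let ?\<nu> = "common_factor_law \<rho> I"
  interpret A: prob_space \<Phi> by (rule prob_space_std_normal)
  interpret N: prob_space ?\<nu> by (rule prob_space_common_factor_law[OF finI \<rho>])
  interpret PA: product_prob_space "\<lambda>_. \<Phi>" J by (rule product_prob_space_std_normal)
  interpret PN: product_prob_space "\<lambda>_. ?\<nu>" J by (intro product_prob_spaceI N.prob_space_axioms)
  have expand: "(\<Prod>i\<in>I. 1 - (\<Prod>j\<in>J. f i j)) = (\<Sum>T\<in>Pow I. (- 1) ^ card T * (\<Prod>j\<in>J. \<Prod>i\<in>T. f i j))" for f :: "'i \<Rightarrow> 'j \<Rightarrow> real"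
  proof -
    have "(\<Prod>i\<in>I. 1 - (\<Prod>j\<in>J. f i j)) = (\<Prod>i\<in>I. - (\<Prod>j\<in>J. f i j) + 1)" by simp
    also have "\<dots> = (\<Sum>T\<in>Pow I. (\<Prod>i\<in>T. - (\<Prod>j\<in>J. f i j)) * (\<Prod>i\<in>I - T. 1))"
      by (rule prod_add[OF finI])
    also have "\<dots> = (\<Sum>T\<in>Pow I. (- 1) ^ card T * (\<Prod>j\<in>J. \<Prod>i\<in>T. f i j))"
    proof (intro sum.cong refl)
      fix T
      show "(\<Prod>i\<in>T. - (\<Prod>j\<in>J. f i j)) * (\<Prod>i\<in>I - T. 1) = (- 1) ^ card T * (\<Prod>j\<in>J. \<Prod>i\<in>T. f i j)"
        using prod.swap[of f J T] by (simp add: prod_uminus)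
    qed
    finally show ?thesis .
  qed
  have ind_meas: "(\<lambda>x. \<Prod>i\<in>T. indicator {u i<..} (x i) :: real) \<in> borel_measurable ?\<nu>" if "T \<subseteq> I" for T
  proof -
    have "(\<lambda>x. \<Prod>i\<in>T. indicator {u i<..} (x i) :: real) \<in> borel_measurable (\<Pi>\<^sub>M i\<in>I. borel :: real measure)"
    proof (rule borel_measurable_prod)
      fix i assume "i \<in> T"
      then have "i \<in> I" using that by auto
      then show "(\<lambda>x. indicator {u i<..} (x i) :: real) \<in> borel_measurable (\<Pi>\<^sub>M i\<in>I. borel :: real measure)" by measurable
    qed
    then show ?thesis using measurable_cong_sets[OF sets_common_factor_law[OF finI \<rho>] refl] by blast
  qed
  have tail_meas [measurable]: "(\<lambda>z. normal_tail ((c - sqrt \<rho> * z) / sqrt (1 - \<rho>))) \<in> borel_measurable borel" for c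
    by measurable
  have int_ind: "integrable ?\<nu> (\<lambda>x. \<Prod>i\<in>T. indicator {u i<..} (x i) :: real)" if "T \<subseteq> I" for T
    by (rule N.integrable_const_bound[of _ 1]) (use ind_meas[OF that] in \<open>auto simp: abs_prod intro!: prod_le_1\<close>)
  have int_tail: "integrable \<Phi> (\<lambda>z. \<Prod>i\<in>T. normal_tail ((u i - sqrt \<rho> * z) / sqrt (1 - \<rho>)))" for T
    by (rule A.integrable_const_bound[of _ 1]) (auto simp: abs_prod normal_tail_bounds01 abs_of_nonneg intro!: prod_le_1)
  have "(\<integral>x. (\<Prod>i\<in>I. 1 - (\<Prod>j\<in>J. indicator {u i<..} (x j i))) \<partial>(\<Pi>\<^sub>M j\<in>J. ?\<nu>))
     = (\<Sum>T\<in>Pow I. (- 1 :: real) ^ card T * (\<integral>x. (\<Prod>j\<in>J. \<Prod>i\<in>T. indicator {u i<..} (x j i)) \<partial>(\<Pi>\<^sub>M j\<in>J. ?\<nu>)))"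
    unfolding expand
    by (subst Bochner_Integration.integral_sum) (auto intro!: integrable_mult_right PN.product_integrable_prod[OF finJ] int_ind)
  also have "\<dots> = (\<Sum>T\<in>Pow I. (- 1) ^ card T * (\<integral>z. (\<Prod>j\<in>J. \<Prod>i\<in>T. normal_tail ((u i - sqrt \<rho> * z j) / sqrt (1 - \<rho>))) \<partial>(\<Pi>\<^sub>M j\<in>J. \<Phi>)))"
  proof (intro sum.cong refl arg_cong2[where f="(*)"])
    fix T assume "T \<in> Pow I"
    then have T: "T \<subseteq> I" by simp
    have "(\<integral>x. (\<Prod>j\<in>J. \<Prod>i\<in>T. indicator {u i<..} (x j i) :: real) \<partial>(\<Pi>\<^sub>M j\<in>J. ?\<nu>)) = (\<Prod>j\<in>J. \<integral>x. (\<Prod>i\<in>T. indicator {u i<..} (x i)) \<partial>?\<nu>)"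
      by (rule PN.product_integral_prod[OF finJ int_ind[OF T]])
    also have "\<dots> = (\<Prod>j\<in>J. \<integral>z. (\<Prod>i\<in>T. normal_tail ((u i - sqrt \<rho> * z) / sqrt (1 - \<rho>))) \<partial>\<Phi>)"
      by (simp only: expectation_common_factor_exceedances[OF finI \<rho> T])
    also have "\<dots> = (\<integral>z. (\<Prod>j\<in>J. \<Prod>i\<in>T. normal_tail ((u i - sqrt \<rho> * z j) / sqrt (1 - \<rho>))) \<partial>(\<Pi>\<^sub>M j\<in>J. \<Phi>))"
      by (rule PA.product_integral_prod[OF finJ int_tail, symmetric])
    finally show "(\<integral>x. (\<Prod>j\<in>J. \<Prod>i\<in>T. indicator {u i<..} (x j i)) \<partial>(\<Pi>\<^sub>M j\<in>J. ?\<nu>)) = (\<integral>z. (\<Prod>j\<in>J. \<Prod>i\<in>T. normal_tail ((u i - sqrt \<rho> * z j) / sqrt (1 - \<rho>))) \<partial>(\<Pi>\<^sub>M j\<in>J. \<Phi>))" .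
  qed
  also have "\<dots> = (\<integral>z. (\<Prod>i\<in>I. 1 - (\<Prod>j\<in>J. normal_tail ((u i - sqrt \<rho> * z j) / sqrt (1 - \<rho>)))) \<partial>(\<Pi>\<^sub>M j\<in>J. \<Phi>))"
    unfolding expand
    by (subst Bochner_Integration.integral_sum) (auto intro!: integrable_mult_right PA.product_integrable_prod[OF finJ] int_tail)
  finally show ?thesis .
qed

section \<open>Poisson limits for rare independent events\<close>

text \<open>If uniformly small probabilities have convergent sums, then the probability that none of the
  corresponding independent events occurs tends to \<open>exp (- l)\<close>.\<close>

lemma prod_one_minus_tendsto_exp:
  fixes q :: "'b \<Rightarrow> 'i \<Rightarrow> real"
  assumes fin: "\<And>b. finite (I b)" and q: "\<forall>\<^sub>F b in F. \<forall>i\<in>I b. 0 \<le> q b i \<and> q b i \<le> \<epsilon> b"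
    and \<epsilon>: "(\<epsilon> \<longlongrightarrow> 0) F" and s: "((\<lambda>b. \<Sum>i\<in>I b. q b i) \<longlongrightarrow> l) F"
  shows "((\<lambda>b. \<Prod>i\<in>I b. 1 - q b i) \<longlongrightarrow> exp (- l)) F"
proof (rule tendsto_sandwich)
  have e2: "\<forall>\<^sub>F b in F. \<epsilon> b < 1 / 2" using \<epsilon> by (rule order_tendstoD) simp
  show "\<forall>\<^sub>F b in F. (\<Prod>i\<in>I b. 1 - q b i) \<le> exp (- (\<Sum>i\<in>I b. q b i))"
    using q e2
  proof eventually_elim
    case (elim b)
    have "(\<Prod>i\<in>I b. 1 - q b i) \<le> (\<Prod>i\<in>I b. exp (- q b i))"
    proof (rule prod_mono)
      fix i assume "i \<in> I b"
      then have "q b i \<le> 1 / 2" using elim by force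
      then show "0 \<le> 1 - q b i \<and> 1 - q b i \<le> exp (- q b i)" using exp_ge_add_one_self[of "- q b i"] by simp
    qed
    then show ?case using fin by (simp add: exp_sum[symmetric] sum_negf)
  qed
  show "\<forall>\<^sub>F b in F. exp (- (1 + 2 * \<epsilon> b) * (\<Sum>i\<in>I b. q b i)) \<le> (\<Prod>i\<in>I b. 1 - q b i)"
    using q e2
  proof eventually_elim
    case (elim b)
    have "(\<Prod>i\<in>I b. exp (- (1 + 2 * \<epsilon> b) * q b i)) \<le> (\<Prod>i\<in>I b. 1 - q b i)"
    proof (rule prod_mono)
      fix i assume i: "i \<in> I b"
      then have qi: "0 \<le> q b i" "q b i \<le> \<epsilon> b" "q b i \<le> 1 / 2" using elim by force+
      have "- (1 + 2 * \<epsilon> b) * q b i \<le> - q b i - 2 * (q b i)\<^sup>2"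
        using mult_right_mono[OF qi(2,1)] by (simp add: algebra_simps power2_eq_square)
      also have "\<dots> \<le> ln (1 - q b i)" by (rule ln_one_minus_pos_lower_bound[OF qi(1,3)])
      finally have "exp (- (1 + 2 * \<epsilon> b) * q b i) \<le> exp (ln (1 - q b i))" by simp
      then show "0 \<le> exp (- (1 + 2 * \<epsilon> b) * q b i) \<and> exp (- (1 + 2 * \<epsilon> b) * q b i) \<le> 1 - q b i" using qi by simp
    qed
    then show ?case using fin by (simp add: exp_sum[symmetric] sum_distrib_left)
  qed
  have "((\<lambda>b. exp (- (1 + 2 * \<epsilon> b) * (\<Sum>i\<in>I b. q b i))) \<longlongrightarrow> exp (- (1 + 2 * 0) * l)) F"
    by (intro tendsto_intros \<epsilon> s)
  then show "((\<lambda>b. exp (- (1 + 2 * \<epsilon> b) * (\<Sum>i\<in>I b. q b i))) \<longlongrightarrow> exp (- l)) F" by simp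
  show "((\<lambda>b. exp (- (\<Sum>i\<in>I b. q b i))) \<longlongrightarrow> exp (- l)) F" by (intro tendsto_intros s)
qed

lemma std_normal_density_shift: "std_normal_density (t + s) = std_normal_density t * exp (- (t * s)) * exp (- s\<^sup>2 / 2)"
proof -
  have "- (t + s)\<^sup>2 / 2 = - t\<^sup>2 / 2 + - (t * s) + - s\<^sup>2 / 2" by (simp add: power2_eq_square field_simps)
  then show ?thesis unfolding std_normal_density_def by (simp only: exp_add)
qed

lemma tendsto_one_minus_exp_ratio:
  assumes y: "(y \<longlongrightarrow> (0::real)) F" and p: "\<forall>\<^sub>F b in F. y b > 0"
  shows "((\<lambda>b. y b / (1 - exp (- y b))) \<longlongrightarrow> 1) F"
proof -
  have "((\<lambda>t::real. t / (1 - exp (- t))) \<longlongrightarrow> 1) (at_right 0)" by real_asymp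
  moreover have "filterlim y (at_right 0) F" using y p by (auto simp: filterlim_at elim: eventually_mono)
  ultimately show ?thesis by (rule filterlim_compose)
qed

text \<open>Sums of products of normal tails over an arithmetic progression of small step \<open>h\<close> that
  starts far out. By Mills' ratio the terms decay like a geometric series with ratio
  \<open>exp (- h (\<Sum>j. t\<^sub>j))\<close>. For the lower bound the series is cut where \<open>m h\<close> reaches
  \<open>1 / \<surd>a\<close>; up to there the quadratic term in the exponent is negligible, and beyond it so is the
  rest of the series.\<close>

lemma normal_tail_sum_tendsto:
  fixes t :: "'j \<Rightarrow> 'b \<Rightarrow> real" and a h :: "'b \<Rightarrow> real" and \<kappa> :: real and n :: "'b \<Rightarrow> nat"
  assumes fin: "finite J" and ne: "J \<noteq> {}"
    and a: "filterlim a at_top F" and t: "\<And>j. j \<in> J \<Longrightarrow> ((\<lambda>b. t j b / a b) \<longlongrightarrow> 1) F"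
    and h: "\<forall>\<^sub>F b in F. h b > 0" and ah: "((\<lambda>b. a b * h b) \<longlongrightarrow> 0) F"
    and dens: "((\<lambda>b. (\<Prod>j\<in>J. std_normal_density (t j b)) / (h b * a b ^ (card J + 1))) \<longlongrightarrow> \<kappa> * card J) F"
    and n: "filterlim (\<lambda>b. a b * (real (n b) * h b)) at_top F"
  shows "((\<lambda>b. \<Sum>m<n b. \<Prod>j\<in>J. normal_tail (t j b + real m * h b)) \<longlongrightarrow> \<kappa>) F"
proof -
  let ?D = "card J"
  have D: "real ?D > 0" using fin ne by (simp add: card_gt_0_iff)
  define T where "T b = (\<Sum>j\<in>J. t j b)" for b
  define s where "s b = 1 / sqrt (a b)" for b
  define N where "N b = min (n b) (nat \<lfloor>s b / h b\<rfloor> + 1)" for b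
  define P where "P b = (\<Prod>j\<in>J. std_normal_density (t j b))" for b
  have apos: "\<forall>\<^sub>F b in F. a b > 0" using a by (auto simp: filterlim_at_top_dense)
  have a0: "\<forall>\<^sub>F b in F. a b \<noteq> 0" using apos by eventually_elim simp
  have tt: "filterlim (t j) at_top F" if "j \<in> J" for j
  proof -
    have "filterlim (\<lambda>b. t j b / a b * a b) at_top F"
      by (rule filterlim_tendsto_pos_mult_at_top[OF t[OF that] _ a]) simp
    then show ?thesis by (rule filterlim_cong[THEN iffD1, rotated -1]) (use a0 in \<open>auto elim: eventually_mono\<close>)
  qed
  have t1: "\<forall>\<^sub>F b in F. \<forall>j\<in>J. t j b \<ge> 1"
    using fin tt by (auto simp: eventually_ball_finite_distrib filterlim_at_top)
  have Ta: "((\<lambda>b. T b / a b) \<longlongrightarrow> ?D) F"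
  proof -
    have "((\<lambda>b. \<Sum>j\<in>J. t j b / a b) \<longlongrightarrow> (\<Sum>j\<in>J. 1)) F" by (intro tendsto_sum t)
    then show ?thesis by (simp add: T_def sum_divide_distrib)
  qed
  have Tpos: "\<forall>\<^sub>F b in F. T b > 0"
    using t1 by eventually_elim (auto simp: T_def intro!: sum_pos fin ne elim: order_less_le_trans[OF zero_less_one])
  have hT: "((\<lambda>b. h b * T b) \<longlongrightarrow> 0) F"
  proof -
    have "((\<lambda>b. a b * h b * (T b / a b)) \<longlongrightarrow> 0 * real ?D) F" by (intro tendsto_intros ah Ta)
    moreover have "\<forall>\<^sub>F b in F. a b * h b * (T b / a b) = h b * T b"
      using a0 by eventually_elim simp
    ultimately show ?thesis by (auto dest: Lim_transform_eventually)
  qed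
  have hTpos: "\<forall>\<^sub>F b in F. h b * T b > 0" using h Tpos by eventually_elim simp
  have geo: "((\<lambda>b. h b * T b / (1 - exp (- (h b * T b)))) \<longlongrightarrow> 1) F"
    by (rule tendsto_one_minus_exp_ratio[OF hT hTpos])
  have s0: "(s \<longlongrightarrow> 0) F"
  proof -
    have "((\<lambda>x. 1 / sqrt x) \<longlongrightarrow> 0) at_top" by real_asymp
    from filterlim_compose[OF this a] show ?thesis by (simp add: s_def[abs_def])
  qed
  have ainv: "((\<lambda>b. inverse (a b)) \<longlongrightarrow> 0) F" using a by (rule tendsto_inverse_0_at_top)
  have main: "((\<lambda>b. P b / (\<Prod>j\<in>J. t j b + c j b) / (1 - exp (- (h b * T b)))) \<longlongrightarrow> \<kappa>) F"
    if c: "\<And>j. j \<in> J \<Longrightarrow> ((\<lambda>b. c j b / a b) \<longlongrightarrow> 0) F" for c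
  proof -
    have "((\<lambda>b. \<Prod>j\<in>J. (t j b / a b + c j b / a b)) \<longlongrightarrow> (\<Prod>j\<in>J. 1 + 0)) F"
      by (intro tendsto_intros t c)
    then have pr: "((\<lambda>b. \<Prod>j\<in>J. (t j b / a b + c j b / a b)) \<longlongrightarrow> 1) F" by simp
    have "((\<lambda>b. P b / (h b * a b ^ (?D + 1)) / (\<Prod>j\<in>J. (t j b / a b + c j b / a b)) * (h b * T b / (1 - exp (- (h b * T b)))) / (T b / a b)) \<longlongrightarrow> \<kappa> * ?D / 1 * 1 / ?D) F"
      unfolding P_def using D by (intro tendsto_intros dens pr geo Ta) auto
    moreover have "\<forall>\<^sub>F b in F. P b / (h b * a b ^ (?D + 1)) / (\<Prod>j\<in>J. (t j b / a b + c j b / a b)) * (h b * T b / (1 - exp (- (h b * T b)))) / (T b / a b)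
        = P b / (\<Prod>j\<in>J. t j b + c j b) / (1 - exp (- (h b * T b)))"
      using apos h Tpos
    proof eventually_elim
      case (elim b)
      have "(\<Prod>j\<in>J. (t j b / a b + c j b / a b)) = (\<Prod>j\<in>J. t j b + c j b) / a b ^ ?D"
        by (simp add: add_divide_distrib[symmetric] prod_dividef)
      moreover have "p / (h b * a b ^ (?D + 1)) / (q / a b ^ ?D) * (h b * T b / e) / (T b / a b) = p / q / e" for p q e :: real
        using elim by (cases "q = 0"; cases "e = 0") (simp_all add: field_simps)
      ultimately show ?case by simp
    qed
    ultimately show ?thesis using D by (auto dest: Lim_transform_eventually)
  qed
  show ?thesis
  proof (rule tendsto_sandwich[where h="\<lambda>b. P b / (\<Prod>j\<in>J. t j b + 0) / (1 - exp (- (h b * T b)))"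
        and f="\<lambda>b. P b / (\<Prod>j\<in>J. t j b + (s b + 1 / t j b)) / (1 - exp (- (h b * T b))) * exp (- (s b)\<^sup>2 / 2) ^ ?D * (1 - exp (- (h b * T b * real (N b))))"])
    show "((\<lambda>b. P b / (\<Prod>j\<in>J. t j b + 0) / (1 - exp (- (h b * T b)))) \<longlongrightarrow> \<kappa>) F"
      by (rule main) simp
    show "\<forall>\<^sub>F b in F. (\<Sum>m<n b. \<Prod>j\<in>J. normal_tail (t j b + real m * h b)) \<le> P b / (\<Prod>j\<in>J. t j b + 0) / (1 - exp (- (h b * T b)))"
      using t1 h hTpos
    proof eventually_elim
      case (elim b)
      let ?r = "exp (- (h b * T b))"
      have r: "0 \<le> ?r" "?r < 1" using elim by auto
      have Tp: "0 < (\<Prod>j\<in>J. t j b)" using elim by (intro prod_pos) force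
      have P0: "0 \<le> P b" unfolding P_def by (intro prod_nonneg) auto
      have "(\<Prod>j\<in>J. normal_tail (t j b + real m * h b)) \<le> P b / (\<Prod>j\<in>J. t j b) * ?r ^ m" for m
      proof -
        have "(\<Prod>j\<in>J. normal_tail (t j b + real m * h b)) \<le> (\<Prod>j\<in>J. std_normal_density (t j b) / t j b * exp (- (t j b * (real m * h b))))"
        proof (intro prod_mono conjI normal_tail_bounds01)
          fix j assume "j \<in> J"
          then have tj: "1 \<le> t j b" using elim by auto
          have mh: "0 \<le> real m * h b" using elim by simp
          have "normal_tail (t j b + real m * h b) \<le> std_normal_density (t j b + real m * h b) / (t j b + real m * h b)"
            using tj mh by (intro normal_tail_upper) auto
          also have "\<dots> \<le> (std_normal_density (t j b) * exp (- (t j b * (real m * h b))) * 1) / t j b"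
            unfolding std_normal_density_shift using tj mh by (intro frac_le mult_left_mono mult_nonneg_nonneg) auto
          finally show "normal_tail (t j b + real m * h b) \<le> std_normal_density (t j b) / t j b * exp (- (t j b * (real m * h b)))" by simp
        qed
        also have "\<dots> = P b / (\<Prod>j\<in>J. t j b) * exp (\<Sum>j\<in>J. - (t j b * (real m * h b)))"
          unfolding P_def prod.distrib prod_dividef using fin by (simp add: exp_sum)
        also have "(\<Sum>j\<in>J. - (t j b * (real m * h b))) = real m * - (h b * T b)"
          by (simp add: T_def sum_negf sum_distrib_left sum_distrib_right mult_ac)
        finally show ?thesis by (simp only: exp_of_nat_mult)
      qed
      then have "(\<Sum>m<n b. \<Prod>j\<in>J. normal_tail (t j b + real m * h b)) \<le> (\<Sum>m<n b. P b / (\<Prod>j\<in>J. t j b) * ?r ^ m)" by (rule sum_mono)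
      also have "\<dots> = P b / (\<Prod>j\<in>J. t j b) * ((1 - ?r ^ n b) / (1 - ?r))"
        unfolding sum_distrib_left[symmetric] sum_gp_strict using elim by auto
      also have "\<dots> \<le> P b / (\<Prod>j\<in>J. t j b) * (1 / (1 - ?r))"
        using r Tp P0 by (intro mult_left_mono divide_right_mono) auto
      finally show ?case by simp
    qed
    let ?c = "\<lambda>j b. s b + 1 / t j b"
    have cl: "((\<lambda>b. ?c j b / a b) \<longlongrightarrow> 0) F" if "j \<in> J" for j
    proof -
      have "((\<lambda>b. inverse (t j b)) \<longlongrightarrow> 0) F" using tt[OF that] by (rule tendsto_inverse_0_at_top)
      then have "((\<lambda>b. (s b + inverse (t j b)) * inverse (a b)) \<longlongrightarrow> (0 + 0) * 0) F" by (intro tendsto_intros s0 ainv)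
      then show ?thesis by (simp add: divide_inverse)
    qed
    have rN: "((\<lambda>b. exp (- (h b * T b * real (N b)))) \<longlongrightarrow> 0) F"
    proof -
      have "filterlim (\<lambda>b. min (a b * (real (n b) * h b)) (sqrt (a b))) at_top F"
        unfolding filterlim_at_top
      proof
        fix Z
        have "\<forall>\<^sub>F b in F. sqrt (a b) \<ge> Z" using filterlim_compose[OF sqrt_at_top a] by (auto simp: filterlim_at_top)
        moreover have "\<forall>\<^sub>F b in F. a b * (real (n b) * h b) \<ge> Z" using n by (auto simp: filterlim_at_top)
        ultimately show "\<forall>\<^sub>F b in F. Z \<le> min (a b * (real (n b) * h b)) (sqrt (a b))" by eventually_elim simp
      qed
      then have "filterlim (\<lambda>b. T b / a b * min (a b * (real (n b) * h b)) (sqrt (a b))) at_top F"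
        by (rule filterlim_tendsto_pos_mult_at_top[OF Ta D])
      moreover have "\<forall>\<^sub>F b in F. T b / a b * min (a b * (real (n b) * h b)) (sqrt (a b)) \<le> h b * T b * real (N b)"
        using apos h Tpos
      proof eventually_elim
        case (elim b)
        have "s b / h b \<le> real (nat \<lfloor>s b / h b\<rfloor> + 1)" by linarith
        then have "s b \<le> real (nat \<lfloor>s b / h b\<rfloor> + 1) * h b" using elim by (simp add: pos_divide_le_eq)
        then have "min (real (n b) * h b) (s b) \<le> real (N b) * h b"
          by (cases "n b \<le> nat \<lfloor>s b / h b\<rfloor> + 1")
             (auto simp only: N_def min_absorb1 min_absorb2 nat_le_linear linorder_not_le less_imp_le intro: min.coboundedI1 min.coboundedI2)
        then have "a b * min (real (n b) * h b) (s b) \<le> a b * (real (N b) * h b)" using elim by simp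
        moreover have "a b * min (real (n b) * h b) (s b) = min (a b * (real (n b) * h b)) (sqrt (a b))"
          using elim by (simp add: min_mult_distrib_left s_def real_div_sqrt)
        ultimately have "T b / a b * min (a b * (real (n b) * h b)) (sqrt (a b)) \<le> T b / a b * (a b * (real (N b) * h b))"
          using elim by (intro mult_left_mono) auto
        then show ?case using elim by (simp add: mult_ac)
      qed
      ultimately have "filterlim (\<lambda>b. h b * T b * real (N b)) at_top F" by (rule filterlim_at_top_mono)
      then have "filterlim (\<lambda>b. - (h b * T b * real (N b))) at_bot F" by (simp add: filterlim_uminus_at_bot)
      then show ?thesis by (rule filterlim_compose[OF exp_at_bot])
    qed
    have "((\<lambda>b. P b / (\<Prod>j\<in>J. t j b + ?c j b) / (1 - exp (- (h b * T b))) * exp (- (s b)\<^sup>2 / 2) ^ ?D * (1 - exp (- (h b * T b * real (N b))))) \<longlongrightarrow> \<kappa> * exp (- 0\<^sup>2 / 2) ^ ?D * (1 - 0)) F"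
      by (intro tendsto_intros main cl s0 rN) auto
    then show "((\<lambda>b. P b / (\<Prod>j\<in>J. t j b + ?c j b) / (1 - exp (- (h b * T b))) * exp (- (s b)\<^sup>2 / 2) ^ ?D * (1 - exp (- (h b * T b * real (N b))))) \<longlongrightarrow> \<kappa>) F" by simp
    show "\<forall>\<^sub>F b in F. P b / (\<Prod>j\<in>J. t j b + ?c j b) / (1 - exp (- (h b * T b))) * exp (- (s b)\<^sup>2 / 2) ^ ?D * (1 - exp (- (h b * T b * real (N b)))) \<le> (\<Sum>m<n b. \<Prod>j\<in>J. normal_tail (t j b + real m * h b))"
      using t1 h hTpos apos
    proof eventually_elim
      case (elim b)
      let ?r = "exp (- (h b * T b))"
      have r: "0 \<le> ?r" "?r < 1" using elim by auto
      have s0: "0 \<le> s b" using elim by (simp add: s_def)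
      let ?E = "exp (- (s b)\<^sup>2 / 2)"
      have "P b / (\<Prod>j\<in>J. t j b + ?c j b) * ?E ^ ?D * ?r ^ m \<le> (\<Prod>j\<in>J. normal_tail (t j b + real m * h b))" if m: "m < N b" for m
      proof -
        have "m \<le> nat \<lfloor>s b / h b\<rfloor>" using m by (simp add: N_def)
        then have "real m \<le> s b / h b" using s0 elim of_nat_floor[of "s b / h b"] by (simp add: order_trans[OF of_nat_mono])
        then have mh: "real m * h b \<le> s b" "0 \<le> real m * h b" using elim by (auto simp: pos_le_divide_eq)
        have "P b / (\<Prod>j\<in>J. t j b + ?c j b) * ?E ^ ?D * ?r ^ m = (\<Prod>j\<in>J. std_normal_density (t j b) / (t j b + ?c j b) * ?E * exp (- (t j b * (real m * h b))))"
        proof -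
          have "(\<Prod>j\<in>J. exp (- (t j b * (real m * h b)))) = exp (\<Sum>j\<in>J. - (t j b * (real m * h b)))" using fin by (simp add: exp_sum)
          also have "(\<Sum>j\<in>J. - (t j b * (real m * h b))) = real m * - (h b * T b)"
            by (simp add: T_def sum_negf sum_distrib_left sum_distrib_right mult_ac)
          also have "exp \<dots> = ?r ^ m" by (simp only: exp_of_nat_mult)
          finally show ?thesis unfolding prod.distrib prod_dividef P_def by simp
        qed
        also have "\<dots> \<le> (\<Prod>j\<in>J. normal_tail (t j b + real m * h b))"
        proof (intro prod_mono conjI)
          fix j assume "j \<in> J"
          then have tj: "1 \<le> t j b" using elim by auto
          let ?t = "t j b + real m * h b"
          have t': "1 \<le> ?t" "t j b \<le> ?t" using tj mh by auto
          show "0 \<le> std_normal_density (t j b) / (t j b + ?c j b) * ?E * exp (- (t j b * (real m * h b)))"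
            using tj s0 by (intro mult_nonneg_nonneg divide_nonneg_nonneg add_nonneg_nonneg) auto
          have "(real m * h b)\<^sup>2 \<le> (s b)\<^sup>2" using mh by (intro power_mono) auto
          then have E: "?E \<le> exp (- (real m * h b)\<^sup>2 / 2)" by simp
          have q: "1 / (t j b + ?c j b) \<le> ?t / (1 + ?t\<^sup>2)"
          proof -
            have "?t / (1 + ?t\<^sup>2) = 1 / (?t + 1 / ?t)" using t' by (simp add: field_simps power2_eq_square)
            moreover have "1 / ?t \<le> 1 / t j b" using t' tj by (intro divide_left_mono) auto
            moreover have "0 < ?t + 1 / ?t"
              using add_pos_pos[of ?t "1 / ?t"] t'(1) by (simp only: zero_less_divide_1_iff)
            ultimately show ?thesis using mh frac_le[of 1 1 "?t + 1 / ?t" "t j b + ?c j b"] by simp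
          qed
          have "std_normal_density (t j b) / (t j b + ?c j b) * ?E * exp (- (t j b * (real m * h b)))
             = (std_normal_density (t j b) * exp (- (t j b * (real m * h b))) * ?E) * (1 / (t j b + ?c j b))" by simp
          also have "\<dots> \<le> (std_normal_density (t j b) * exp (- (t j b * (real m * h b))) * exp (- (real m * h b)\<^sup>2 / 2)) * (?t / (1 + ?t\<^sup>2))"
            using E q tj s0 by (intro mult_mono) (auto intro!: add_nonneg_nonneg)
          also have "\<dots> = std_normal_density ?t * (?t / (1 + ?t\<^sup>2))" by (simp only: std_normal_density_shift)
          also have "\<dots> \<le> normal_tail ?t" by (rule normal_tail_lower[OF t'(1)])
          finally show "std_normal_density (t j b) / (t j b + ?c j b) * ?E * exp (- (t j b * (real m * h b))) \<le> normal_tail ?t" .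
        qed
        finally show ?thesis .
      qed
      then have "(\<Sum>m<N b. P b / (\<Prod>j\<in>J. t j b + ?c j b) * ?E ^ ?D * ?r ^ m) \<le> (\<Sum>m<N b. \<Prod>j\<in>J. normal_tail (t j b + real m * h b))"
        by (intro sum_mono) auto
      also have "\<dots> \<le> (\<Sum>m<n b. \<Prod>j\<in>J. normal_tail (t j b + real m * h b))"
        by (rule sum_mono2) (auto simp: N_def intro!: prod_nonneg normal_tail_bounds01)
      also have "(\<Sum>m<N b. P b / (\<Prod>j\<in>J. t j b + ?c j b) * ?E ^ ?D * ?r ^ m) = P b / (\<Prod>j\<in>J. t j b + ?c j b) * ?E ^ ?D * ((1 - ?r ^ N b) / (1 - ?r))"
        unfolding sum_distrib_left[symmetric] sum_gp_strict using elim by auto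
      also have "?r ^ N b = exp (- (h b * T b * real (N b)))"
        by (simp add: exp_of_nat_mult[symmetric] mult_ac)
      finally show ?case by (simp add: mult_ac)
    qed
  qed
qed

section \<open>Levels and the limit for the reference process\<close>

text \<open>The level \<open>a\<close> is normalised by its first-order growth and by the precise size of
  \<open>exp (- D a\<^sup>2 / 2)\<close>. The latter says that for \<open>D\<close> independent sequences of independent standard
  normal variables the expected number of indices \<open>i > a / \<beta>\<close> at which all of them exceed
  \<open>\<beta> i\<close> tends to \<open>\<kappa>\<close>.\<close>

locale crossing_levels =
  fixes a :: "real \<Rightarrow> real" and \<gamma> \<kappa> :: real and D :: nat
  assumes \<gamma>: "\<gamma> > 0" and D: "D \<ge> 1"
    and a_pos: "\<forall>\<^sub>F \<beta> in at_right 0. a \<beta> > 0"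
    and a_sq: "((\<lambda>\<beta>. (a \<beta>)\<^sup>2 / ln (1 / \<beta>)) \<longlongrightarrow> 2 / D) (at_right 0)"
    and a_dens: "((\<lambda>\<beta>. exp (- (real D * (a \<beta>)\<^sup>2) / 2) / (\<beta> * (a \<beta>) ^ (D + 1)))
      \<longlongrightarrow> \<kappa> * D * sqrt (2 * pi) ^ D) (at_right 0)"
begin

abbreviation \<rho> :: "real \<Rightarrow> real" where "\<rho> \<equiv> rho \<gamma>"

definition level :: "real \<Rightarrow> real \<Rightarrow> real" where
  "level x \<beta> = sqrt (1 - \<rho> \<beta>) * a \<beta> + sqrt (\<rho> \<beta>) * (x / D)"

lemma beta_small: "\<forall>\<^sub>F \<beta> in at_right 0. 0 < \<beta> \<and> \<beta> < (1::real)"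
  using eventually_at_right_real[of 0 "1::real"] by (auto elim: eventually_mono)

lemma L_at_top: "filterlim (\<lambda>\<beta>::real. ln (1 / \<beta>)) at_top (at_right 0)" by real_asymp

lemma L_pos: "\<forall>\<^sub>F \<beta>::real in at_right 0. ln (1 / \<beta>) > 0"
  using L_at_top by (auto simp: filterlim_at_top_dense)

lemma rho_eq: "\<forall>\<^sub>F \<beta> in at_right 0. \<rho> \<beta> = \<gamma> / ln (1 / \<beta>)"
  using beta_small by eventually_elim (simp add: rho_def ln_div)

lemma rho_tendsto: "(\<rho> \<longlongrightarrow> 0) (at_right 0)"
proof -
  have "((\<lambda>\<beta>. \<gamma> * inverse (ln (1 / \<beta>))) \<longlongrightarrow> \<gamma> * 0) (at_right 0)"
    by (intro tendsto_intros tendsto_inverse_0_at_top L_at_top)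
  moreover have "\<forall>\<^sub>F \<beta> in at_right 0. \<gamma> * inverse (ln (1 / \<beta>)) = \<rho> \<beta>"
    using rho_eq by eventually_elim (simp add: divide_inverse)
  ultimately show ?thesis by (auto dest: Lim_transform_eventually)
qed

lemma rho_bounds: "\<forall>\<^sub>F \<beta> in at_right 0. 0 < \<rho> \<beta> \<and> \<rho> \<beta> < 1 / 2"
proof -
  have "\<forall>\<^sub>F \<beta> in at_right 0. \<rho> \<beta> < 1 / 2" using rho_tendsto by (rule order_tendstoD) simp
  then show ?thesis using rho_eq L_pos by eventually_elim (use \<gamma> in simp)
qed

lemma rho_a_sq: "((\<lambda>\<beta>. \<rho> \<beta> * (a \<beta>)\<^sup>2) \<longlongrightarrow> 2 * \<gamma> / D) (at_right 0)"
proof -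
  have "((\<lambda>\<beta>. \<gamma> * ((a \<beta>)\<^sup>2 / ln (1 / \<beta>))) \<longlongrightarrow> \<gamma> * (2 / D)) (at_right 0)" by (intro tendsto_intros a_sq)
  moreover have "\<forall>\<^sub>F \<beta> in at_right 0. \<gamma> * ((a \<beta>)\<^sup>2 / ln (1 / \<beta>)) = \<rho> \<beta> * (a \<beta>)\<^sup>2"
    using rho_eq by eventually_elim simp
  ultimately show ?thesis by (auto dest: Lim_transform_eventually simp: mult.commute)
qed

lemma sqrt_rho_a: "((\<lambda>\<beta>. sqrt (\<rho> \<beta>) * a \<beta>) \<longlongrightarrow> sqrt (2 * \<gamma> / D)) (at_right 0)"
proof -
  have "((\<lambda>\<beta>. sqrt (\<rho> \<beta> * (a \<beta>)\<^sup>2)) \<longlongrightarrow> sqrt (2 * \<gamma> / D)) (at_right 0)" by (intro tendsto_intros rho_a_sq)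
  moreover have "\<forall>\<^sub>F \<beta> in at_right 0. sqrt (\<rho> \<beta> * (a \<beta>)\<^sup>2) = sqrt (\<rho> \<beta>) * a \<beta>"
    using a_pos by eventually_elim (simp add: real_sqrt_mult)
  ultimately show ?thesis by (auto dest: Lim_transform_eventually)
qed

lemma a_at_top: "filterlim a at_top (at_right 0)"
proof -
  have "filterlim (\<lambda>\<beta>. (a \<beta>)\<^sup>2 / ln (1 / \<beta>) * ln (1 / \<beta>)) at_top (at_right 0)"
    by (rule filterlim_tendsto_pos_mult_at_top[OF a_sq _ L_at_top]) (use D in auto)
  then have "filterlim (\<lambda>\<beta>. sqrt ((a \<beta>)\<^sup>2 / ln (1 / \<beta>) * ln (1 / \<beta>))) at_top (at_right 0)"
    by (rule filterlim_compose[OF sqrt_at_top])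
  moreover have "\<forall>\<^sub>F \<beta> in at_right 0. sqrt ((a \<beta>)\<^sup>2 / ln (1 / \<beta>) * ln (1 / \<beta>)) = a \<beta>"
    using a_pos L_pos by eventually_elim simp
  ultimately show ?thesis by (rule filterlim_cong[OF refl refl, THEN iffD1, rotated])
qed

lemma a_ge: "\<forall>\<^sub>F \<beta> in at_right 0. c \<le> a \<beta>" using a_at_top by (auto simp: filterlim_at_top)

text \<open>Powers of \<open>a\<close> grow only logarithmically in \<open>1 / \<beta>\<close>.\<close>

lemma a_power_powr: assumes p: "p > 0" shows "((\<lambda>\<beta>. a \<beta> ^ k * \<beta> powr p) \<longlongrightarrow> 0) (at_right 0)"
proof -
  have "((\<lambda>x. x ^ k / exp x) \<longlongrightarrow> (0::real)) at_top" by (rule tendsto_power_div_exp_0)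
  moreover have "filterlim (\<lambda>\<beta>. p * ln (1 / \<beta>)) at_top (at_right 0)"
    by (rule filterlim_tendsto_pos_mult_at_top[OF tendsto_const p L_at_top])
  ultimately have "((\<lambda>\<beta>. (p * ln (1 / \<beta>)) ^ k / exp (p * ln (1 / \<beta>))) \<longlongrightarrow> 0) (at_right 0)" by (rule filterlim_compose)
  then have "((\<lambda>\<beta>. ((a \<beta>)\<^sup>2 / ln (1 / \<beta>)) ^ k / p ^ k * ((p * ln (1 / \<beta>)) ^ k / exp (p * ln (1 / \<beta>)))) \<longlongrightarrow> (2 / D) ^ k / p ^ k * 0) (at_right 0)"
    by (intro tendsto_intros a_sq) (use p in auto)
  moreover have "\<forall>\<^sub>F \<beta> in at_right 0. ((a \<beta>)\<^sup>2 / ln (1 / \<beta>)) ^ k / p ^ k * ((p * ln (1 / \<beta>)) ^ k / exp (p * ln (1 / \<beta>))) = ((a \<beta>) ^ k)\<^sup>2 * \<beta> powr p"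
    using L_pos beta_small
  proof eventually_elim
    case (elim \<beta>)
    have "exp (p * ln (1 / \<beta>)) = 1 / \<beta> powr p" using elim by (simp add: powr_def ln_div exp_minus field_simps)
    then show ?case using elim p by (simp add: power_divide power_mult_distrib power_mult[symmetric] mult.commute)
  qed
  ultimately have lim: "((\<lambda>\<beta>. ((a \<beta>) ^ k)\<^sup>2 * \<beta> powr p) \<longlongrightarrow> 0) (at_right 0)" by (auto dest: Lim_transform_eventually)
  show ?thesis
  proof (rule tendsto_sandwich[OF _ _ tendsto_const lim])
    show "\<forall>\<^sub>F \<beta> in at_right 0. 0 \<le> a \<beta> ^ k * \<beta> powr p" using a_pos by eventually_elim simp
    show "\<forall>\<^sub>F \<beta> in at_right 0. a \<beta> ^ k * \<beta> powr p \<le> (a \<beta> ^ k)\<^sup>2 * \<beta> powr p"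
      using a_ge[of 1]
    proof eventually_elim
      case (elim \<beta>)
      then have "a \<beta> ^ k * 1 \<le> a \<beta> ^ k * a \<beta> ^ k" by (intro mult_left_mono) (auto simp: one_le_power)
      then show ?case by (simp add: power2_eq_square mult_right_mono)
    qed
  qed
qed

lemma a_power_beta: "((\<lambda>\<beta>. a \<beta> ^ k * \<beta>) \<longlongrightarrow> 0) (at_right 0)"
proof -
  have e: "\<forall>\<^sub>F \<beta> in at_right 0. a \<beta> ^ k * \<beta> powr 1 = a \<beta> ^ k * \<beta>"
    using beta_small by eventually_elim simp
  show ?thesis by (rule Lim_transform_eventually[OF _ e]) (rule a_power_powr, simp)
qed

lemma level_ratio: "((\<lambda>\<beta>. level x \<beta> / a \<beta>) \<longlongrightarrow> 1) (at_right 0)"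
proof -
  have "((\<lambda>\<beta>. sqrt (1 - \<rho> \<beta>) + sqrt (\<rho> \<beta>) * (x / D) * inverse (a \<beta>)) \<longlongrightarrow> sqrt (1 - 0) + sqrt 0 * (x / D) * 0) (at_right 0)"
    by (intro tendsto_intros rho_tendsto tendsto_inverse_0_at_top a_at_top)
  moreover have "\<forall>\<^sub>F \<beta> in at_right 0. sqrt (1 - \<rho> \<beta>) + sqrt (\<rho> \<beta>) * (x / D) * inverse (a \<beta>) = level x \<beta> / a \<beta>"
    using a_pos by eventually_elim (simp add: level_def field_simps)
  ultimately show ?thesis by (auto dest: Lim_transform_eventually)
qed

lemma level_bounds: "\<forall>\<^sub>F \<beta> in at_right 0. a \<beta> / 2 \<le> level x \<beta> \<and> level x \<beta> \<le> 3 / 2 * a \<beta>"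
proof -
  have "\<forall>\<^sub>F \<beta> in at_right 0. 1 / 2 < level x \<beta> / a \<beta>" using level_ratio by (rule order_tendstoD) simp
  moreover have "\<forall>\<^sub>F \<beta> in at_right 0. level x \<beta> / a \<beta> < 3 / 2" using level_ratio by (rule order_tendstoD) simp
  ultimately show ?thesis using a_pos by eventually_elim (auto simp: field_simps)
qed

lemma level_mono: "\<forall>\<^sub>F \<beta> in at_right 0. \<forall>x y. x \<le> y \<longrightarrow> level x \<beta> \<le> level y \<beta>"
  using rho_bounds by eventually_elim (auto simp: level_def intro!: mult_left_mono divide_right_mono)

text \<open>Expanding the square of the level: since \<open>\<rho> a\<^sup>2\<close> tends to \<open>2 \<gamma> / D\<close>, replacing \<open>a\<close> by \<open>\<surd>(1 - \<rho>) a\<close> contributes the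
  factor \<open>exp \<gamma>\<close>, and the shift by \<open>\<surd>\<rho> x / D\<close> the factor \<open>exp (- \<surd>(2 \<gamma> / D) x)\<close>.\<close>

lemma level_density:
  "((\<lambda>\<beta>. exp (- (real D * (level x \<beta>)\<^sup>2) / 2) / (\<beta> * a \<beta> ^ (D + 1))) \<longlongrightarrow>
     \<kappa> * D * sqrt (2 * pi) ^ D * exp (\<gamma> - sqrt (2 * \<gamma> / D) * x)) (at_right 0)"
proof -
  have "((\<lambda>\<beta>. exp (- (real D * (a \<beta>)\<^sup>2) / 2) / (\<beta> * (a \<beta>) ^ (D + 1)) *
      exp (real D / 2 * (\<rho> \<beta> * (a \<beta>)\<^sup>2) - sqrt (1 - \<rho> \<beta>) * (sqrt (\<rho> \<beta>) * a \<beta>) * x - \<rho> \<beta> * (x\<^sup>2 / (2 * real D))))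
     \<longlongrightarrow> \<kappa> * D * sqrt (2 * pi) ^ D * exp (real D / 2 * (2 * \<gamma> / D) - sqrt (1 - 0) * sqrt (2 * \<gamma> / D) * x - 0 * (x\<^sup>2 / (2 * real D)))) (at_right 0)"
    by (intro tendsto_intros a_dens rho_a_sq rho_tendsto sqrt_rho_a)
  moreover have "\<forall>\<^sub>F \<beta> in at_right 0. exp (- (real D * (a \<beta>)\<^sup>2) / 2) / (\<beta> * (a \<beta>) ^ (D + 1)) *
      exp (real D / 2 * (\<rho> \<beta> * (a \<beta>)\<^sup>2) - sqrt (1 - \<rho> \<beta>) * (sqrt (\<rho> \<beta>) * a \<beta>) * x - \<rho> \<beta> * (x\<^sup>2 / (2 * real D)))
      = exp (- (real D * (level x \<beta>)\<^sup>2) / 2) / (\<beta> * a \<beta> ^ (D + 1))"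
    using rho_bounds
  proof eventually_elim
    case (elim \<beta>)
    define s r where "s = sqrt (1 - \<rho> \<beta>)" and "r = sqrt (\<rho> \<beta>)"
    have sr: "s\<^sup>2 = 1 - \<rho> \<beta>" "r\<^sup>2 = \<rho> \<beta>" using elim by (auto simp: s_def r_def)
    define y where "y = x / D"
    have xy: "x = real D * y" using D by (simp add: y_def)
    have lev: "level x \<beta> = s * a \<beta> + r * y" by (simp add: level_def s_def r_def y_def)
    have x2: "x\<^sup>2 / (2 * real D) = real D * y\<^sup>2 / 2" using D by (simp add: xy power2_eq_square)
    have "real D * (level x \<beta>)\<^sup>2 = real D * (s\<^sup>2 * (a \<beta>)\<^sup>2) + 2 * (s * (r * a \<beta>) * x) + r\<^sup>2 * (real D * y\<^sup>2)"
      unfolding lev unfolding xy by (simp add: power2_eq_square algebra_simps)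
    then have "real D * (level x \<beta>)\<^sup>2 = real D * ((1 - \<rho> \<beta>) * (a \<beta>)\<^sup>2) + 2 * (s * (r * a \<beta>) * x) + \<rho> \<beta> * (real D * y\<^sup>2)"
      unfolding sr .
    then have "- (real D * (level x \<beta>)\<^sup>2) / 2 = - (real D * (a \<beta>)\<^sup>2) / 2 + (real D / 2 * (\<rho> \<beta> * (a \<beta>)\<^sup>2) - s * (r * a \<beta>) * x - \<rho> \<beta> * (x\<^sup>2 / (2 * real D)))"
      unfolding x2 by (simp add: field_simps)
    then show ?case unfolding s_def r_def by (simp only: exp_add) simp
  qed
  ultimately have "((\<lambda>\<beta>. exp (- (real D * (level x \<beta>)\<^sup>2) / 2) / (\<beta> * a \<beta> ^ (D + 1))) \<longlongrightarrow>
     \<kappa> * D * sqrt (2 * pi) ^ D * exp (real D / 2 * (2 * \<gamma> / D) - sqrt (1 - 0) * sqrt (2 * \<gamma> / D) * x - 0 * (x\<^sup>2 / (2 * real D)))) (at_right 0)"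
    by (rule Lim_transform_eventually)
  then show ?thesis using D by simp
qed

text \<open>Given the common components \<open>z\<close>, the standardised level is \<open>a\<close> plus a shift of order
  \<open>\<surd>\<rho> (x / D - z\<^sub>j)\<close>; multiplied by \<open>a\<close> it tends to \<open>\<surd>(2 \<gamma> / D) (x / D - z\<^sub>j)\<close>. The shifts of the \<open>D\<close> copies
  therefore multiply \<open>\<kappa>\<close> by the exponential of minus their sum.\<close>

lemma one_sided_intensity:
  fixes z :: "'j \<Rightarrow> real"
  assumes fin: "finite J" and cJ: "card J = D"
  shows "((\<lambda>\<beta>. \<Sum>i\<in>{i::int. level x \<beta> < \<beta> * real_of_int i \<and> \<beta> * real_of_int i \<le> 2 * a \<beta>}.
       \<Prod>j\<in>J. normal_tail ((\<beta> * real_of_int i - sqrt (\<rho> \<beta>) * z j) / sqrt (1 - \<rho> \<beta>)))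
     \<longlongrightarrow> \<kappa> * exp (- sqrt (2 * \<gamma> / D) * (x - (\<Sum>j\<in>J. z j)))) (at_right 0)"
proof -
  have ne: "J \<noteq> {}" using cJ D by auto
  define i0 where "i0 \<beta> = \<lfloor>level x \<beta> / \<beta>\<rfloor> + 1" for \<beta>
  define i1 where "i1 \<beta> = \<lfloor>2 * a \<beta> / \<beta>\<rfloor>" for \<beta>
  define n where "n \<beta> = nat (i1 \<beta> - i0 \<beta> + 1)" for \<beta>
  define S where "S \<beta> = sqrt (1 - \<rho> \<beta>)" for \<beta>
  define e where "e \<beta> = \<beta> * real_of_int (i0 \<beta>) - level x \<beta>" for \<beta>
  define h where "h \<beta> = \<beta> / S \<beta>" for \<beta>
  define t where "t j \<beta> = (\<beta> * real_of_int (i0 \<beta>) - sqrt (\<rho> \<beta>) * z j) / S \<beta>" for j \<beta>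
  define d where "d j \<beta> = (sqrt (\<rho> \<beta>) * (x / D - z j) + e \<beta>) / S \<beta>" for j \<beta>
  let ?c = "sqrt (2 * \<gamma> / D)"
  have S1: "(S \<longlongrightarrow> 1) (at_right 0)"
  proof -
    have "((\<lambda>\<beta>. sqrt (1 - \<rho> \<beta>)) \<longlongrightarrow> sqrt (1 - 0)) (at_right 0)" by (intro tendsto_intros rho_tendsto)
    then show ?thesis by (simp add: S_def[abs_def])
  qed
  have Spos: "\<forall>\<^sub>F \<beta> in at_right 0. 0 < S \<beta> \<and> S \<beta> \<le> 1" using rho_bounds by eventually_elim (simp add: S_def)
  have eb: "\<forall>\<^sub>F \<beta> in at_right 0. 0 \<le> e \<beta> \<and> e \<beta> \<le> \<beta>"
    using beta_small
  proof eventually_elim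
    case (elim \<beta>)
    have "level x \<beta> / \<beta> \<le> i0 \<beta>" "i0 \<beta> \<le> level x \<beta> / \<beta> + 1" unfolding i0_def by linarith+
    then have "level x \<beta> \<le> \<beta> * real_of_int (i0 \<beta>)" "\<beta> * real_of_int (i0 \<beta>) \<le> level x \<beta> + \<beta>" using elim by (auto simp: field_simps)
    then show ?case by (simp add: e_def)
  qed
  have e0: "(e \<longlongrightarrow> 0) (at_right 0)"
    by (rule tendsto_sandwich[OF _ _ tendsto_const tendsto_ident_at]) (use eb in \<open>auto elim: eventually_mono\<close>)
  have ae0: "((\<lambda>\<beta>. a \<beta> * e \<beta>) \<longlongrightarrow> 0) (at_right 0)"
  proof (rule tendsto_sandwich[OF _ _ tendsto_const])
    show "((\<lambda>\<beta>. a \<beta> ^ 1 * \<beta>) \<longlongrightarrow> 0) (at_right 0)" by (rule a_power_beta)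
    show "\<forall>\<^sub>F \<beta> in at_right 0. 0 \<le> a \<beta> * e \<beta>" using eb a_pos by eventually_elim simp
    show "\<forall>\<^sub>F \<beta> in at_right 0. a \<beta> * e \<beta> \<le> a \<beta> ^ 1 * \<beta>" using eb a_pos by eventually_elim (simp add: mult_left_mono)
  qed
  have ad: "((\<lambda>\<beta>. a \<beta> * d j \<beta>) \<longlongrightarrow> ?c * (x / D - z j)) (at_right 0)" for j
  proof -
    have "((\<lambda>\<beta>. (sqrt (\<rho> \<beta>) * a \<beta> * (x / D - z j) + a \<beta> * e \<beta>) / S \<beta>) \<longlongrightarrow> (?c * (x / D - z j) + 0) / 1) (at_right 0)"
      by (intro tendsto_intros sqrt_rho_a ae0 S1) auto
    then show ?thesis by (simp add: d_def algebra_simps)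
  qed
  have d0: "(d j \<longlongrightarrow> 0) (at_right 0)" for j
  proof -
    have "((\<lambda>\<beta>. (sqrt (\<rho> \<beta>) * (x / D - z j) + e \<beta>) / S \<beta>) \<longlongrightarrow> (sqrt 0 * (x / D - z j) + 0) / 1) (at_right 0)"
      by (intro tendsto_intros rho_tendsto e0 S1) auto
    then show ?thesis by (simp add: d_def[abs_def])
  qed
  have td: "\<forall>\<^sub>F \<beta> in at_right 0. \<forall>j. t j \<beta> = a \<beta> + d j \<beta>"
    using Spos
  proof eventually_elim
    case (elim \<beta>)
    have "\<beta> * real_of_int (i0 \<beta>) = S \<beta> * a \<beta> + sqrt (\<rho> \<beta>) * (x / D) + e \<beta>" by (simp add: e_def level_def S_def)
    then show ?case using elim unfolding t_def d_def by (simp add: field_simps)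
  qed
  have tl: "((\<lambda>\<beta>. t j \<beta> / a \<beta>) \<longlongrightarrow> 1) (at_right 0)" for j
  proof -
    have "((\<lambda>\<beta>. 1 + d j \<beta> * inverse (a \<beta>)) \<longlongrightarrow> 1 + 0 * 0) (at_right 0)"
      by (intro tendsto_intros d0 tendsto_inverse_0_at_top a_at_top)
    moreover have "\<forall>\<^sub>F \<beta> in at_right 0. 1 + d j \<beta> * inverse (a \<beta>) = t j \<beta> / a \<beta>"
      using td a_pos by eventually_elim (simp add: field_simps)
    ultimately show ?thesis by (auto dest: Lim_transform_eventually)
  qed
  have hpos: "\<forall>\<^sub>F \<beta> in at_right 0. h \<beta> > 0" using Spos beta_small by eventually_elim (simp add: h_def)
  have ah: "((\<lambda>\<beta>. a \<beta> * h \<beta>) \<longlongrightarrow> 0) (at_right 0)"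
  proof -
    have "((\<lambda>\<beta>. (a \<beta> ^ 1 * \<beta>) / S \<beta>) \<longlongrightarrow> 0 / 1) (at_right 0)" by (intro tendsto_intros a_power_beta S1) auto
    then show ?thesis by (simp add: h_def)
  qed
  have dens: "((\<lambda>\<beta>. (\<Prod>j\<in>J. std_normal_density (t j \<beta>)) / (h \<beta> * a \<beta> ^ (card J + 1))) \<longlongrightarrow> (\<kappa> * exp (- ?c * (x - (\<Sum>j\<in>J. z j)))) * card J) (at_right 0)"
  proof -
    let ?G = "\<lambda>\<beta>. exp (- (real D * (a \<beta>)\<^sup>2) / 2) / (\<beta> * (a \<beta>) ^ (D + 1)) * S \<beta> * (1 / sqrt (2 * pi) ^ D) * (\<Prod>j\<in>J. exp (- (a \<beta> * d j \<beta>)) * exp (- (d j \<beta>)\<^sup>2 / 2))"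
    have g1: "(?G \<longlongrightarrow> \<kappa> * D * sqrt (2 * pi) ^ D * 1 * (1 / sqrt (2 * pi) ^ D) * (\<Prod>j\<in>J. exp (- (?c * (x / D - z j))) * exp (- 0\<^sup>2 / 2))) (at_right 0)"
      by (intro tendsto_intros a_dens S1 ad d0) auto
    have g2: "(\<Prod>j\<in>J. exp (- (?c * (x / D - z j))) * exp (- 0\<^sup>2 / 2)) = exp (- ?c * (x - (\<Sum>j\<in>J. z j)))"
    proof -
      have "(\<Sum>j\<in>J. - (?c * (x / D - z j))) = - ?c * (\<Sum>j\<in>J. x / D - z j)" by (simp add: sum_distrib_left sum_negf)
      also have "(\<Sum>j\<in>J. x / D - z j) = x - (\<Sum>j\<in>J. z j)" using D cJ by (simp add: sum_subtractf)
      finally show ?thesis using fin by (simp add: exp_sum[symmetric])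
    qed
    have g3: "\<forall>\<^sub>F \<beta> in at_right 0. ?G \<beta> = (\<Prod>j\<in>J. std_normal_density (t j \<beta>)) / (h \<beta> * a \<beta> ^ (card J + 1))"
      using td Spos
    proof eventually_elim
      case (elim \<beta>)
      have "(\<Prod>j\<in>J. std_normal_density (t j \<beta>)) = (\<Prod>j\<in>J. std_normal_density (a \<beta>) * (exp (- (a \<beta> * d j \<beta>)) * exp (- (d j \<beta>)\<^sup>2 / 2)))"
        using elim by (intro prod.cong refl) (simp add: std_normal_density_shift)
      also have "\<dots> = std_normal_density (a \<beta>) ^ D * (\<Prod>j\<in>J. exp (- (a \<beta> * d j \<beta>)) * exp (- (d j \<beta>)\<^sup>2 / 2))"
        unfolding prod.distrib[of "\<lambda>_. std_normal_density (a \<beta>)"] using cJ by simp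
      also have "std_normal_density (a \<beta>) ^ D = exp (- (real D * (a \<beta>)\<^sup>2) / 2) * (1 / sqrt (2 * pi) ^ D)"
        unfolding std_normal_density_def by (simp add: power_mult_distrib power_divide exp_of_nat_mult[symmetric])
      finally show ?case using elim by (simp add: h_def cJ mult_ac)
    qed
    from Lim_transform_eventually[OF g1 g3]
    have "((\<lambda>\<beta>. (\<Prod>j\<in>J. std_normal_density (t j \<beta>)) / (h \<beta> * a \<beta> ^ (card J + 1))) \<longlongrightarrow> \<kappa> * D * sqrt (2 * pi) ^ D * 1 * (1 / sqrt (2 * pi) ^ D) * exp (- ?c * (x - (\<Sum>j\<in>J. z j)))) (at_right 0)"
      unfolding g2 .
    then show ?thesis using cJ by (simp add: mult_ac)
  qed
  have nl: "filterlim (\<lambda>\<beta>. a \<beta> * (real (n \<beta>) * h \<beta>)) at_top (at_right 0)"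
  proof -
    have "filterlim (\<lambda>\<beta>. a \<beta> * (1 / 4)) at_top (at_right 0)"
      by (rule filterlim_at_top_mult_tendsto_pos[OF tendsto_const _ a_at_top]) simp
    moreover have "\<forall>\<^sub>F \<beta> in at_right 0. a \<beta> * (1 / 4) \<le> a \<beta> * (real (n \<beta>) * h \<beta>)"
      using level_bounds[of x] beta_small Spos a_ge[of 4]
    proof eventually_elim
      case (elim \<beta>)
      have "2 * a \<beta> / \<beta> - level x \<beta> / \<beta> - 1 \<le> real_of_int (i1 \<beta> - i0 \<beta> + 1)" unfolding i1_def i0_def by linarith
      also have "\<dots> \<le> real (n \<beta>)" unfolding n_def by simp
      finally have "2 * a \<beta> - level x \<beta> - \<beta> \<le> real (n \<beta>) * \<beta>" using elim by (simp add: field_simps)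
      then have "1 / 4 \<le> real (n \<beta>) * \<beta>" using elim by linarith
      also have "\<dots> \<le> real (n \<beta>) * h \<beta>" unfolding h_def using elim by (intro mult_left_mono) (auto simp: le_divide_eq mult_left_le)
      finally show ?case using elim by (intro mult_left_mono) auto
    qed
    ultimately show ?thesis by (rule filterlim_at_top_mono)
  qed
  have "((\<lambda>\<beta>. \<Sum>m<n \<beta>. \<Prod>j\<in>J. normal_tail (t j \<beta> + real m * h \<beta>)) \<longlongrightarrow> \<kappa> * exp (- ?c * (x - (\<Sum>j\<in>J. z j)))) (at_right 0)"
    by (rule normal_tail_sum_tendsto[OF fin ne a_at_top tl hpos ah dens nl])
  moreover have "\<forall>\<^sub>F \<beta> in at_right 0. (\<Sum>m<n \<beta>. \<Prod>j\<in>J. normal_tail (t j \<beta> + real m * h \<beta>))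
     = (\<Sum>i\<in>{i::int. level x \<beta> < \<beta> * real_of_int i \<and> \<beta> * real_of_int i \<le> 2 * a \<beta>}. \<Prod>j\<in>J. normal_tail ((\<beta> * real_of_int i - sqrt (\<rho> \<beta>) * z j) / sqrt (1 - \<rho> \<beta>)))"
    using beta_small Spos
  proof eventually_elim
    case (elim \<beta>)
    have set: "{i::int. level x \<beta> < \<beta> * real_of_int i \<and> \<beta> * real_of_int i \<le> 2 * a \<beta>} = {i0 \<beta>..i1 \<beta>}"
    proof -
      have "level x \<beta> < \<beta> * real_of_int i \<longleftrightarrow> i0 \<beta> \<le> i" for i :: int
      proof -
        have "level x \<beta> < \<beta> * real_of_int i \<longleftrightarrow> level x \<beta> / \<beta> < real_of_int i" using elim by (simp add: divide_less_eq mult.commute)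
        also have "\<dots> \<longleftrightarrow> i0 \<beta> \<le> i" unfolding i0_def by linarith
        finally show ?thesis .
      qed
      moreover have "\<beta> * real_of_int i \<le> 2 * a \<beta> \<longleftrightarrow> i \<le> i1 \<beta>" for i :: int
      proof -
        have "\<beta> * real_of_int i \<le> 2 * a \<beta> \<longleftrightarrow> real_of_int i \<le> 2 * a \<beta> / \<beta>" using elim by (simp add: le_divide_eq mult.commute)
        also have "\<dots> \<longleftrightarrow> i \<le> i1 \<beta>" unfolding i1_def by linarith
        finally show ?thesis .
      qed
      ultimately show ?thesis by auto
    qed
    have "bij_betw (\<lambda>m. i0 \<beta> + int m) {..<n \<beta>} {i0 \<beta>..i1 \<beta>}"
      by (rule bij_betw_byWitness[where f'="\<lambda>i. nat (i - i0 \<beta>)"]) (auto simp: n_def)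
    then have "(\<Sum>m<n \<beta>. (\<Prod>j\<in>J. normal_tail ((\<beta> * real_of_int (i0 \<beta> + int m) - sqrt (\<rho> \<beta>) * z j) / sqrt (1 - \<rho> \<beta>))))
       = (\<Sum>i\<in>{i0 \<beta>..i1 \<beta>}. \<Prod>j\<in>J. normal_tail ((\<beta> * real_of_int i - sqrt (\<rho> \<beta>) * z j) / sqrt (1 - \<rho> \<beta>)))"
      by (rule sum.reindex_bij_betw)
    moreover have "t j \<beta> + real m * h \<beta> = (\<beta> * real_of_int (i0 \<beta> + int m) - sqrt (\<rho> \<beta>) * z j) / sqrt (1 - \<rho> \<beta>)" for j m
      unfolding t_def h_def S_def[symmetric] by (simp add: algebra_simps add_divide_distrib diff_divide_distrib)
    ultimately show ?case unfolding set by simp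
  qed
  ultimately show ?thesis by (auto dest: Lim_transform_eventually)
qed

text \<open>The indices beyond the level on the right (if \<open>p\<close>) and on the left (if \<open>q\<close>). The cut at
  \<open>2 a / \<beta>\<close> makes the comparison of finite Gaussian vectors applicable; exceedances beyond it have
  vanishing probability.\<close>

definition window :: "bool \<Rightarrow> bool \<Rightarrow> real \<Rightarrow> real \<Rightarrow> real \<Rightarrow> int set" where
  "window p q y x \<beta> = {i. (p \<and> level y \<beta> < \<beta> * real_of_int i \<and> \<beta> * real_of_int i \<le> 2 * a \<beta>) \<or> (q \<and> level x \<beta> < \<beta> * (- real_of_int i) \<and> \<beta> * (- real_of_int i) \<le> 2 * a \<beta>)}"

text \<open>The limit of the expected number of joint exceedances in the window, given that the common
  components of the copies add up to \<open>s\<close>.\<close>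

definition intensity :: "bool \<Rightarrow> bool \<Rightarrow> real \<Rightarrow> real \<Rightarrow> real \<Rightarrow> real" where
  "intensity p q y x s = \<kappa> * ((if p then exp (- sqrt (2 * \<gamma> / D) * (y - s)) else 0) + (if q then exp (- sqrt (2 * \<gamma> / D) * (x - s)) else 0))"

lemma finite_side: "\<beta> > 0 \<Longrightarrow> finite {i::int. l < \<beta> * real_of_int i \<and> \<beta> * real_of_int i \<le> r}"
  by (rule finite_subset[of _ "{\<lfloor>l / \<beta>\<rfloor>..\<lfloor>r / \<beta>\<rfloor>}"])
     (auto simp: le_floor_iff floor_le_iff field_simps)

lemma finite_window: assumes "\<beta> > 0" shows "finite (window p q y x \<beta>)"
proof -
  have "window p q y x \<beta> \<subseteq> {i. level y \<beta> < \<beta> * real_of_int i \<and> \<beta> * real_of_int i \<le> 2 * a \<beta>} \<union> uminus ` {i::int. level x \<beta> < \<beta> * real_of_int i \<and> \<beta> * real_of_int i \<le> 2 * a \<beta>}"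
  proof
    fix i assume "i \<in> window p q y x \<beta>"
    then show "i \<in> {i. level y \<beta> < \<beta> * real_of_int i \<and> \<beta> * real_of_int i \<le> 2 * a \<beta>} \<union> uminus ` {i::int. level x \<beta> < \<beta> * real_of_int i \<and> \<beta> * real_of_int i \<le> 2 * a \<beta>}"
      by (auto simp: window_def intro!: image_eqI[of i uminus "- i"])
  qed
  then show ?thesis using finite_side[OF assms] by (meson finite_UnI finite_imageI finite_subset)
qed

lemma sum_window:
  assumes "\<beta> > 0" "level y \<beta> > 0" "level x \<beta> > 0"
  shows "(\<Sum>i\<in>window p q y x \<beta>. f (\<beta> * \<bar>real_of_int i\<bar>)) =
     (if p then \<Sum>i\<in>{i::int. level y \<beta> < \<beta> * real_of_int i \<and> \<beta> * real_of_int i \<le> 2 * a \<beta>}. f (\<beta> * real_of_int i) else 0) +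
     (if q then \<Sum>i\<in>{i::int. level x \<beta> < \<beta> * real_of_int i \<and> \<beta> * real_of_int i \<le> 2 * a \<beta>}. f (\<beta> * real_of_int i) else (0::real))"
proof -
  let ?A = "{i::int. level y \<beta> < \<beta> * real_of_int i \<and> \<beta> * real_of_int i \<le> 2 * a \<beta>}" and ?B = "{i::int. level x \<beta> < \<beta> * real_of_int i \<and> \<beta> * real_of_int i \<le> 2 * a \<beta>}"
  have pos: "i > 0" if "l < \<beta> * real_of_int i" "l > 0" for i l
    using that assms(1) by (smt (verit) mult_nonneg_nonpos of_int_le_0_iff zero_less_mult_pos of_int_0_less_iff)
  have w: "window p q y x \<beta> = (if p then ?A else {}) \<union> uminus ` (if q then ?B else {})"
    by (auto simp: window_def intro: image_eqI[of _ uminus "- _"])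
  have "(\<Sum>i\<in>window p q y x \<beta>. f (\<beta> * \<bar>real_of_int i\<bar>)) = (\<Sum>i\<in>(if p then ?A else {}). f (\<beta> * \<bar>real_of_int i\<bar>)) + (\<Sum>i\<in>uminus ` (if q then ?B else {}). f (\<beta> * \<bar>real_of_int i\<bar>))"
    unfolding w
  proof (rule sum.union_disjoint)
    show "(if p then ?A else {}) \<inter> uminus ` (if q then ?B else {}) = {}"
    proof -
      have "\<forall>i\<in>(if p then ?A else {}). i > 0" using pos[OF _ assms(2)] by auto
      moreover have "\<forall>i\<in>uminus ` (if q then ?B else {}). i < 0" using pos[OF _ assms(3)] by auto
      ultimately show ?thesis by force
    qed
  qed (use finite_side[OF assms(1)] in auto)
  also have "(\<Sum>i\<in>uminus ` (if q then ?B else {}). f (\<beta> * \<bar>real_of_int i\<bar>)) = (\<Sum>i\<in>(if q then ?B else {}). f (\<beta> * \<bar>real_of_int i\<bar>))"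
    by (subst sum.reindex) (auto simp: inj_on_def)
  also have "\<dots> = (if q then \<Sum>i\<in>?B. f (\<beta> * real_of_int i) else 0)"
    using pos[OF _ assms(3)] by (auto intro!: sum.cong arg_cong[where f=f] simp: abs_of_pos)
  also have "(\<Sum>i\<in>(if p then ?A else {}). f (\<beta> * \<bar>real_of_int i\<bar>)) = (if p then \<Sum>i\<in>?A. f (\<beta> * real_of_int i) else 0)"
    using pos[OF _ assms(2)] by (auto intro!: sum.cong arg_cong[where f=f] simp: abs_of_pos)
  finally show ?thesis .
qed

lemma level_pos: "\<forall>\<^sub>F \<beta> in at_right 0. level x \<beta> > 0"
  using level_bounds[of x] a_pos by eventually_elim auto

text \<open>Given the common components the exceedances at different indices are independent, so that the
  Poisson limit applies pointwise in \<open>z\<close>; dominated convergence passes to the integral.\<close>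

lemma reference_limit:
  assumes fin: "finite J" and cJ: "card J = D"
  shows "((\<lambda>\<beta>. \<integral>z. (\<Prod>i\<in>window p q y x \<beta>. 1 - (\<Prod>j\<in>J. normal_tail ((\<beta> * \<bar>real_of_int i\<bar> - sqrt (\<rho> \<beta>) * z j) / sqrt (1 - \<rho> \<beta>)))) \<partial>(\<Pi>\<^sub>M j\<in>J. \<Phi>))
    \<longlongrightarrow> (\<integral>z. exp (- intensity p q y x (\<Sum>j\<in>J. z j)) \<partial>(\<Pi>\<^sub>M j\<in>J. \<Phi>))) (at_right 0)"
proof -
  interpret PA: product_prob_space "\<lambda>_. \<Phi>" J by (rule product_prob_space_std_normal)
  interpret PJ: prob_space "\<Pi>\<^sub>M j\<in>J. \<Phi>" by (intro prob_space_PiM prob_space_std_normal)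
  obtain j0 where j0: "j0 \<in> J" using cJ D by (metis card.empty ex_in_conv not_one_le_zero)
  let ?q = "\<lambda>z \<beta> i. \<Prod>j\<in>J. normal_tail ((\<beta> * \<bar>real_of_int i\<bar> - sqrt (\<rho> \<beta>) * z j) / sqrt (1 - \<rho> \<beta>))"
  have q01: "0 \<le> ?q z \<beta> i" "?q z \<beta> i \<le> 1" for z \<beta> i
    by (auto intro!: prod_nonneg prod_le_1 simp: normal_tail_bounds01)
  have pt: "((\<lambda>\<beta>. \<Prod>i\<in>window p q y x \<beta> \<inter> {i. \<beta> > 0}. 1 - ?q z \<beta> i) \<longlongrightarrow> exp (- intensity p q y x (\<Sum>j\<in>J. z j))) (at_right 0)" for z
  proof (rule prod_one_minus_tendsto_exp)
    let ?\<epsilon> = "\<lambda>\<beta>. normal_tail ((level (min x y) \<beta> - sqrt (\<rho> \<beta>) * z j0) / sqrt (1 - \<rho> \<beta>))"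
    show "finite (window p q y x \<beta> \<inter> {i. \<beta> > 0})" for \<beta> using finite_window by (cases "\<beta> > 0") auto
    show "\<forall>\<^sub>F \<beta> in at_right 0. \<forall>i\<in>window p q y x \<beta> \<inter> {i. \<beta> > 0}. 0 \<le> ?q z \<beta> i \<and> ?q z \<beta> i \<le> ?\<epsilon> \<beta>"
      using level_mono rho_bounds
    proof eventually_elim
      case (elim \<beta>)
      show ?case
      proof (intro ballI conjI q01)
        fix i assume i: "i \<in> window p q y x \<beta> \<inter> {i. \<beta> > 0}"
        have "0 \<le> \<beta>" using i by (simp split: if_splits)
        then have "\<beta> * real_of_int i \<le> \<beta> * \<bar>real_of_int i\<bar>" "\<beta> * - real_of_int i \<le> \<beta> * \<bar>real_of_int i\<bar>"
          using mult_left_mono[of "real_of_int i" "\<bar>real_of_int i\<bar>" \<beta>] mult_left_mono[of "- real_of_int i" "\<bar>real_of_int i\<bar>" \<beta>] by auto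
        moreover have "level (min x y) \<beta> \<le> level x \<beta>" "level (min x y) \<beta> \<le> level y \<beta>" using elim by auto
        ultimately have l: "level (min x y) \<beta> \<le> \<beta> * \<bar>real_of_int i\<bar>" using i by (auto simp: window_def)
        have "?q z \<beta> i = normal_tail ((\<beta> * \<bar>real_of_int i\<bar> - sqrt (\<rho> \<beta>) * z j0) / sqrt (1 - \<rho> \<beta>)) * (\<Prod>j\<in>J - {j0}. normal_tail ((\<beta> * \<bar>real_of_int i\<bar> - sqrt (\<rho> \<beta>) * z j) / sqrt (1 - \<rho> \<beta>)))"
          by (rule prod.remove[OF fin j0])
        also have "\<dots> \<le> ?\<epsilon> \<beta> * 1"
          using l elim by (intro mult_mono normal_tail_antimono divide_right_mono prod_le_1 prod_nonneg) (auto simp: normal_tail_bounds01)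
        finally show "?q z \<beta> i \<le> ?\<epsilon> \<beta>" by simp
      qed
    qed
    have "filterlim (\<lambda>\<beta>. a \<beta> * ((level (min x y) \<beta> / a \<beta> - sqrt (\<rho> \<beta>) * z j0 * inverse (a \<beta>)) / sqrt (1 - \<rho> \<beta>))) at_top (at_right 0)"
    proof (rule filterlim_at_top_mult_tendsto_pos[OF _ _ a_at_top])
      show "((\<lambda>\<beta>. (level (min x y) \<beta> / a \<beta> - sqrt (\<rho> \<beta>) * z j0 * inverse (a \<beta>)) / sqrt (1 - \<rho> \<beta>)) \<longlongrightarrow> (1 - sqrt 0 * z j0 * 0) / sqrt (1 - 0)) (at_right 0)"
        by (intro tendsto_intros level_ratio rho_tendsto tendsto_inverse_0_at_top a_at_top) auto
    qed simp
    moreover have "\<forall>\<^sub>F \<beta> in at_right 0. a \<beta> * ((level (min x y) \<beta> / a \<beta> - sqrt (\<rho> \<beta>) * z j0 * inverse (a \<beta>)) / sqrt (1 - \<rho> \<beta>)) = (level (min x y) \<beta> - sqrt (\<rho> \<beta>) * z j0) / sqrt (1 - \<rho> \<beta>)"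
      using a_pos by eventually_elim (simp add: right_diff_distrib)
    ultimately have "filterlim (\<lambda>\<beta>. (level (min x y) \<beta> - sqrt (\<rho> \<beta>) * z j0) / sqrt (1 - \<rho> \<beta>)) at_top (at_right 0)"
      by (rule filterlim_cong[OF refl refl, THEN iffD1, rotated])
    then show "(?\<epsilon> \<longlongrightarrow> 0) (at_right 0)" by (rule filterlim_compose[OF normal_tail_tendsto_0])
    let ?s = "\<lambda>l \<beta>. \<Sum>i\<in>{i::int. level l \<beta> < \<beta> * real_of_int i \<and> \<beta> * real_of_int i \<le> 2 * a \<beta>}. \<Prod>j\<in>J. normal_tail ((\<beta> * real_of_int i - sqrt (\<rho> \<beta>) * z j) / sqrt (1 - \<rho> \<beta>))"
    have "((\<lambda>\<beta>. (if p then ?s y \<beta> else 0) + (if q then ?s x \<beta> else 0)) \<longlongrightarrow> intensity p q y x (\<Sum>j\<in>J. z j)) (at_right 0)"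
      using one_sided_intensity[OF fin cJ, where x=x and z=z] one_sided_intensity[OF fin cJ, where x=y and z=z]
      unfolding intensity_def by (cases p; cases q) (auto intro!: tendsto_add simp: distrib_left)
    moreover have "\<forall>\<^sub>F \<beta> in at_right 0. (if p then ?s y \<beta> else 0) + (if q then ?s x \<beta> else 0) = (\<Sum>i\<in>window p q y x \<beta> \<inter> {i. \<beta> > 0}. ?q z \<beta> i)"
      using beta_small level_pos[of x] level_pos[of y]
    proof eventually_elim
      case (elim \<beta>)
      then have "window p q y x \<beta> \<inter> {i. \<beta> > 0} = window p q y x \<beta>" by auto
      then show ?case
        using sum_window[where \<beta>=\<beta> and y=y and x=x and p=p and q=q and f="\<lambda>v. \<Prod>j\<in>J. normal_tail ((v - sqrt (\<rho> \<beta>) * z j) / sqrt (1 - \<rho> \<beta>))"] elim by simp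
    qed
    ultimately show "((\<lambda>\<beta>. \<Sum>i\<in>window p q y x \<beta> \<inter> {i. \<beta> > 0}. ?q z \<beta> i) \<longlongrightarrow> intensity p q y x (\<Sum>j\<in>J. z j)) (at_right 0)"
      by (auto dest: Lim_transform_eventually)
  qed
  have comp [measurable]: "(\<lambda>z. z j) \<in> borel_measurable (\<Pi>\<^sub>M j\<in>J. \<Phi>)" if "j \<in> J" for j
    using measurable_component_singleton[OF that, of "\<lambda>_. \<Phi>"] by simp
  show ?thesis
    unfolding tendsto_at_iff_sequentially comp_def
  proof (intro allI impI)
    fix B :: "nat \<Rightarrow> real" assume B: "\<forall>n. B n \<in> {0<..} - {0}" "B \<longlonglongrightarrow> 0"
    show "(\<lambda>n. \<integral>z. (\<Prod>i\<in>window p q y x (B n). 1 - ?q z (B n) i) \<partial>(\<Pi>\<^sub>M j\<in>J. \<Phi>)) \<longlonglongrightarrow> (\<integral>z. exp (- intensity p q y x (\<Sum>j\<in>J. z j)) \<partial>(\<Pi>\<^sub>M j\<in>J. \<Phi>))"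
    proof (rule integral_dominated_convergence[where w="\<lambda>_. 1"])
      show "(\<lambda>z. exp (- intensity p q y x (\<Sum>j\<in>J. z j))) \<in> borel_measurable (\<Pi>\<^sub>M j\<in>J. \<Phi>)"
        unfolding intensity_def by (cases p; cases q; simp only: if_True if_False; measurable)
      show "(\<lambda>z. \<Prod>i\<in>window p q y x (B n). 1 - ?q z (B n) i) \<in> borel_measurable (\<Pi>\<^sub>M j\<in>J. \<Phi>)" for n by measurable
      show "AE z in \<Pi>\<^sub>M j\<in>J. \<Phi>. (\<lambda>n. \<Prod>i\<in>window p q y x (B n). 1 - ?q z (B n) i) \<longlonglongrightarrow> exp (- intensity p q y x (\<Sum>j\<in>J. z j))"
      proof (intro AE_I2)
        fix z
        have "(\<lambda>n. \<Prod>i\<in>window p q y x (B n) \<inter> {i. B n > 0}. 1 - ?q z (B n) i) \<longlonglongrightarrow> exp (- intensity p q y x (\<Sum>j\<in>J. z j))"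
          using pt[of z] B unfolding tendsto_at_iff_sequentially comp_def by blast
        moreover have "window p q y x (B n) \<inter> {i. B n > 0} = window p q y x (B n)" for n using B by auto
        ultimately show "(\<lambda>n. \<Prod>i\<in>window p q y x (B n). 1 - ?q z (B n) i) \<longlonglongrightarrow> exp (- intensity p q y x (\<Sum>j\<in>J. z j))" by simp
      qed
      show "AE z in \<Pi>\<^sub>M j\<in>J. \<Phi>. norm (\<Prod>i\<in>window p q y x (B n). 1 - ?q z (B n) i) \<le> 1" for n
        using q01 by (intro AE_I2) (auto simp: abs_prod intro!: prod_le_1)
    qed simp
  qed
qed

end

section \<open>The comparison error for slowly decaying correlations\<close>

lemma abs_le_of_mem_closed_segment:
  fixes c :: real assumes "c \<in> closed_segment s t" "\<bar>s\<bar> \<le> e" "\<bar>t\<bar> \<le> e" shows "\<bar>c\<bar> \<le> e"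
  using assms by (auto simp: closed_segment_eq_real_ivl split: if_splits)

text \<open>Pairs of indices are separated into near ones (distance at most \<open>q\<close>), for which the
  correlation is only known to be bounded away from one, and far ones, for which the correlation times the
  square of the levels stays bounded.\<close>

lemma comparison_at_level:
  fixes I :: "int set" and J :: "'j set" and r :: "nat \<Rightarrow> real" and m \<beta> A \<delta> \<rho> q c0 K :: real
  assumes finI: "finite I" and finJ: "finite J" and J1: "card J \<ge> 1"
    and \<mu>: "prob_space \<mu>" "sets \<mu> = sets (\<Pi>\<^sub>M i\<in>I. borel)"
    and g: "gauss_family \<mu> I (\<lambda>i x. x i) (\<lambda>i k. r (nat \<bar>i - k\<bar>))" and r0: "r 0 = 1"
    and I: "\<And>i. i \<in> I \<Longrightarrow> m \<le> \<beta> * \<bar>real_of_int i\<bar>" "\<And>i. i \<in> I \<Longrightarrow> \<beta> * \<bar>real_of_int i\<bar> \<le> A" and m: "1 \<le> m"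
    and near: "\<And>n. n \<ge> 1 \<Longrightarrow> \<bar>r n\<bar> \<le> \<delta>" "\<rho> \<le> \<delta>" "\<delta> < 1" and \<rho>: "0 \<le> \<rho>" "\<rho> < 1"
    and far: "\<And>n. real n > q \<Longrightarrow> \<bar>r n\<bar> \<le> c0" "\<rho> \<le> c0" "c0 \<le> 1 / 2" "c0 * (A + 1)\<^sup>2 \<le> K" "c0 * A \<le> m / 2"
  shows "\<bar>(\<integral>x. (\<Prod>i\<in>I. 1 - (\<Prod>j\<in>J. indicator {\<beta> * \<bar>real_of_int i\<bar><..} (x j i))) \<partial>(\<Pi>\<^sub>M j\<in>J. \<mu>))
      - (\<integral>x. (\<Prod>i\<in>I. 1 - (\<Prod>j\<in>J. indicator {\<beta> * \<bar>real_of_int i\<bar><..} (x j i))) \<partial>(\<Pi>\<^sub>M j\<in>J. common_factor_law \<rho> I))\<bar>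
    \<le> card J * (\<Sum>i\<in>I. \<Sum>k\<in>I - {i}. \<bar>r (nat \<bar>i - k\<bar>) - \<rho>\<bar> *
        (if real (nat \<bar>i - k\<bar>) \<le> q then exp (- (card J * m\<^sup>2) / (1 + \<delta>)) / (2 * pi * sqrt (1 - \<delta>\<^sup>2))
         else exp (2 * K) * (4 * exp (2 * K)) ^ (card J - 1) *
           (exp (- (card J * (\<beta> * real_of_int i)\<^sup>2) / 2) * exp (- (card J * (\<beta> * real_of_int k)\<^sup>2) / 2)) / m ^ (2 * (card J - 1))))"
proof -
  let ?D = "card J"
  let ?u = "\<lambda>i. \<beta> * \<bar>real_of_int i\<bar>"
  let ?R = "\<lambda>i k. r (nat \<bar>i - k\<bar>)" and ?R' = "\<lambda>i k. if i = k then 1 else \<rho>"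
  let ?e = "\<lambda>i k. exp (- ((?u i)\<^sup>2 + (?u k)\<^sup>2) / 2)"
  let ?B = "\<lambda>i k::int. if real (nat \<bar>i - k\<bar>) \<le> q then exp (- m\<^sup>2 / (1 + \<delta>)) / (2 * pi * sqrt (1 - \<delta>\<^sup>2)) else exp (2 * K) * ?e i k"
  let ?p = "\<lambda>i k::int. if real (nat \<bar>i - k\<bar>) \<le> q then exp (- m\<^sup>2 / (1 + \<delta>)) else 4 * exp (2 * K) * ?e i k / m\<^sup>2"
  have sym: "?R i k = ?R k i" "?R' i k = ?R' k i" for i k by (auto simp: abs_minus_commute)
  have diag: "?R i i = 1" "?R' i i = 1" for i using r0 by auto
  have far_prod: "\<bar>c\<bar> * (v * w) \<le> K" if "\<bar>c\<bar> \<le> c0" "0 \<le> v" "0 \<le> w" "v \<le> A + 1" "w \<le> A + 1" for c v w :: real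
  proof -
    have "\<bar>c\<bar> * (v * w) \<le> c0 * ((A + 1) * (A + 1))"
      using that by (intro mult_mono) auto
    then show ?thesis using far(4) by (simp add: power2_eq_square)
  qed
  have far_half: "\<bar>c\<bar> * v \<le> w / 2" if "\<bar>c\<bar> \<le> c0" "0 \<le> v" "v \<le> A" "m \<le> w" for c v w
  proof -
    have "\<bar>c\<bar> * v \<le> c0 * A" using that by (intro mult_mono) auto
    then show ?thesis using far(5) that by linarith
  qed
  have corr_near: "\<bar>?R i k\<bar> \<le> \<delta>" "\<bar>?R' i k\<bar> \<le> \<delta>" if "i \<noteq> k" for i k :: int
    using near \<rho> that by auto
  have corr_far: "\<bar>?R i k\<bar> \<le> c0" "\<bar>?R' i k\<bar> \<le> c0" if "i \<noteq> k" "\<not> real (nat \<bar>i - k\<bar>) \<le> q" for i k :: int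
    using far \<rho> that by auto
  have dens: "\<bar>c\<bar> < 1 \<and> bvn c x y \<le> ?B i k"
    if "i \<in> I" "k \<in> I" "i \<noteq> k" "c \<in> closed_segment (?R i k) (?R' i k)" "?u i \<le> x" "x \<le> ?u i + 1" "?u k \<le> y" "y \<le> ?u k + 1" for i k c x y
  proof (cases "real (nat \<bar>i - k\<bar>) \<le> q")
    case True
    have c: "\<bar>c\<bar> \<le> \<delta>" by (rule abs_le_of_mem_closed_segment[OF that(4) corr_near[OF that(3)]])
    have "bvn c x y \<le> exp (- m\<^sup>2 / (1 + \<delta>)) / (2 * pi * sqrt (1 - \<delta>\<^sup>2))"
      using I(1)[OF that(1)] I(1)[OF that(2)] that m near(3) c by (intro bvn_le_near) auto
    then show ?thesis using True c near(3) by simp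
  next
    case False
    have c: "\<bar>c\<bar> \<le> c0" by (rule abs_le_of_mem_closed_segment[OF that(4) corr_far[OF that(3) False]])
    have pos: "0 \<le> ?u i" "0 \<le> ?u k" using I(1)[OF that(1)] I(1)[OF that(2)] m by auto
    have "bvn c x y \<le> exp (2 * K) * exp (- (x\<^sup>2 + y\<^sup>2) / 2)"
    proof (rule bvn_le_far)
      show "\<bar>c\<bar> * (x * y) \<le> K"
        using I(2)[OF that(1)] I(2)[OF that(2)] that pos by (intro far_prod[OF c]) auto
    qed (use c far(3) that pos in auto)
    also have "\<dots> \<le> exp (2 * K) * ?e i k"
    proof -
      have "(?u i)\<^sup>2 \<le> x\<^sup>2" "(?u k)\<^sup>2 \<le> y\<^sup>2" using that pos by (auto intro!: power_mono)
      then show ?thesis by (intro mult_left_mono) auto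
    qed
    finally show ?thesis using False c far(3) by simp
  qed
  have tail: "(\<integral>x. indicator {?u i<..} (x i) * indicator {?u k<..} (x k) \<partial>M) \<le> ?p i k"
    if ik: "i \<in> I" "k \<in> I" "i \<noteq> k" and M: "prob_space M" and gM: "gauss_family M I (\<lambda>i x. x i) Q"
      and symQ: "\<And>i k. Q i k = Q k i" and diagQ: "\<And>i. Q i i = 1"
      and Qn: "\<bar>Q i k\<bar> \<le> \<delta>" and Qf: "\<not> real (nat \<bar>i - k\<bar>) \<le> q \<Longrightarrow> \<bar>Q i k\<bar> \<le> c0"
    for i k Q and M :: "(int \<Rightarrow> real) measure"
  proof -
    have meas: "(\<lambda>x. x i) \<in> borel_measurable M" "(\<lambda>x. x k) \<in> borel_measurable M" using gM ik by (auto simp: gauss_family_def)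
    note char = gauss_family_pair_char[OF gM finI ik symQ diagQ]
    show ?thesis
    proof (cases "real (nat \<bar>i - k\<bar>) \<le> q")
      case True
      then show ?thesis using pair_tail_near[OF M meas char Qn near(3) m I(1)[OF ik(1)] I(1)[OF ik(2)]] by simp
    next
      case False
      note Qf = Qf[OF False]
      have pos: "0 < ?u i" "0 < ?u k" "0 \<le> ?u i" "0 \<le> ?u k" using I(1)[OF ik(1)] I(1)[OF ik(2)] m by auto
      have "(\<integral>x. indicator {?u i<..} (x i) * indicator {?u k<..} (x k) \<partial>M) \<le> 4 * exp (2 * K) * ?e i k / (?u i * ?u k)"
      proof (rule pair_tail_far[OF M meas char])
        show "\<bar>Q i k\<bar> * (?u i * ?u k) \<le> K"
          using I(2)[OF ik(1)] I(2)[OF ik(2)] pos by (intro far_prod[OF Qf]) auto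
        show "\<bar>Q i k\<bar> * ?u k \<le> ?u i / 2" "\<bar>Q i k\<bar> * ?u i \<le> ?u k / 2"
          by (rule far_half[OF Qf pos(4) I(2)[OF ik(2)] I(1)[OF ik(1)]], rule far_half[OF Qf pos(3) I(2)[OF ik(1)] I(1)[OF ik(2)]])
      qed (use Qf far(3) pos in auto)
      also have "\<dots> \<le> 4 * exp (2 * K) * ?e i k / (m * m)"
      proof (rule frac_le)
        show "m * m \<le> ?u i * ?u k" using I(1)[OF ik(1)] I(1)[OF ik(2)] m pos by (intro mult_mono) auto
      qed (use m in auto)
      finally show ?thesis using False by (simp add: power2_eq_square)
    qed
  qed
  have "\<bar>(\<integral>x. (\<Prod>i\<in>I. 1 - (\<Prod>j\<in>J. indicator {?u i<..} (x j i))) \<partial>(\<Pi>\<^sub>M j\<in>J. \<mu>))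
      - (\<integral>x. (\<Prod>i\<in>I. 1 - (\<Prod>j\<in>J. indicator {?u i<..} (x j i))) \<partial>(\<Pi>\<^sub>M j\<in>J. common_factor_law \<rho> I))\<bar>
    \<le> ?D * (\<Sum>i\<in>I. \<Sum>k\<in>I - {i}. \<bar>?R i k - ?R' i k\<bar> * ?B i k * ?p i k ^ (?D - 1))"
  proof (rule copies_comparison[where u="?u" and B="?B" and p="?p", OF finI finJ \<mu> prob_space_common_factor_law[OF finI \<rho>] sets_common_factor_law[OF finI \<rho>] g gauss_family_common_factor_law[OF finI \<rho>] sym diag dens])
    fix i k assume ik: "i \<in> I" "k \<in> I" "i \<noteq> k"
    show "(\<integral>x. indicator {?u i<..} (x i) * indicator {?u k<..} (x k) \<partial>\<mu>) \<le> ?p i k"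
      by (rule tail[OF ik \<mu>(1) g sym(1) diag(1) corr_near(1)[OF ik(3)] corr_far(1)[OF ik(3)]])
    show "(\<integral>x. indicator {?u i<..} (x i) * indicator {?u k<..} (x k) \<partial>common_factor_law \<rho> I) \<le> ?p i k"
      by (rule tail[OF ik prob_space_common_factor_law[OF finI \<rho>] gauss_family_common_factor_law[OF finI \<rho>] sym(2) diag(2) corr_near(2)[OF ik(3)] corr_far(2)[OF ik(3)]])
  qed
  also have "(\<Sum>i\<in>I. \<Sum>k\<in>I - {i}. \<bar>?R i k - ?R' i k\<bar> * ?B i k * ?p i k ^ (?D - 1)) = (\<Sum>i\<in>I. \<Sum>k\<in>I - {i}. \<bar>r (nat \<bar>i - k\<bar>) - \<rho>\<bar> *
        (if real (nat \<bar>i - k\<bar>) \<le> q then exp (- (?D * m\<^sup>2) / (1 + \<delta>)) / (2 * pi * sqrt (1 - \<delta>\<^sup>2))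
         else exp (2 * K) * (4 * exp (2 * K)) ^ (?D - 1) *
           (exp (- (?D * (\<beta> * real_of_int i)\<^sup>2) / 2) * exp (- (?D * (\<beta> * real_of_int k)\<^sup>2) / 2)) / m ^ (2 * (?D - 1))))"
  proof (intro sum.cong refl)
    fix i k assume ik: "i \<in> I" "k \<in> I - {i}"
    have pw: "v * v ^ (?D - 1) = v ^ ?D" for v :: real using J1 by (cases ?D) auto
    have e1: "exp v * exp v ^ (?D - 1) = exp (?D * v)" for v :: real unfolding pw by (simp add: exp_of_nat_mult)
    have e2: "?e i k * ?e i k ^ (?D - 1) = exp (- (?D * (\<beta> * real_of_int i)\<^sup>2) / 2) * exp (- (?D * (\<beta> * real_of_int k)\<^sup>2) / 2)"
    proof -
      have "?D * (- ((?u i)\<^sup>2 + (?u k)\<^sup>2) / 2) = - (?D * (\<beta> * real_of_int i)\<^sup>2) / 2 + - (?D * (\<beta> * real_of_int k)\<^sup>2) / 2"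
        by (simp add: power_mult_distrib field_simps)
      then show ?thesis unfolding e1 by (simp only: exp_add)
    qed
    show "\<bar>?R i k - ?R' i k\<bar> * ?B i k * ?p i k ^ (?D - 1) = \<bar>r (nat \<bar>i - k\<bar>) - \<rho>\<bar> *
        (if real (nat \<bar>i - k\<bar>) \<le> q then exp (- (?D * m\<^sup>2) / (1 + \<delta>)) / (2 * pi * sqrt (1 - \<delta>\<^sup>2))
         else exp (2 * K) * (4 * exp (2 * K)) ^ (?D - 1) *
           (exp (- (?D * (\<beta> * real_of_int i)\<^sup>2) / 2) * exp (- (?D * (\<beta> * real_of_int k)\<^sup>2) / 2)) / m ^ (2 * (?D - 1)))"
    proof (cases "real (nat \<bar>i - k\<bar>) \<le> q")
      case True
      then show ?thesis using ik e1[of "- m\<^sup>2 / (1 + \<delta>)"] by (simp add: mult_ac)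
    next
      case False
      have "exp (2 * K) * ?e i k * (4 * exp (2 * K) * ?e i k / m\<^sup>2) ^ (?D - 1)
         = exp (2 * K) * (4 * exp (2 * K)) ^ (?D - 1) * (?e i k * ?e i k ^ (?D - 1)) / m ^ (2 * (?D - 1))"
        by (simp add: power_mult_distrib power_divide power_mult)
      then have e3: "exp (2 * K) * ?e i k * (4 * exp (2 * K) * ?e i k / m\<^sup>2) ^ (?D - 1)
         = exp (2 * K) * (4 * exp (2 * K)) ^ (?D - 1) * (exp (- (?D * (\<beta> * real_of_int i)\<^sup>2) / 2) * exp (- (?D * (\<beta> * real_of_int k)\<^sup>2) / 2)) / m ^ (2 * (?D - 1))"
        unfolding e2 .
      have ne: "(i = k) = False" "(real (nat \<bar>i - k\<bar>) \<le> q) = False" using ik False by auto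
      show ?thesis unfolding ne if_False mult.assoc[of "\<bar>r (nat \<bar>i - k\<bar>) - \<rho>\<bar>"] e3 ..
    qed
  qed
  finally show ?thesis .
qed

lemma card_near_le:
  fixes i :: int assumes "0 \<le> q"
  shows "finite {k. real (nat \<bar>i - k\<bar>) \<le> q}" "real (card {k. real (nat \<bar>i - k\<bar>) \<le> q}) \<le> 2 * q + 1"
proof -
  have sub: "{k. real (nat \<bar>i - k\<bar>) \<le> q} \<subseteq> {i - \<lfloor>q\<rfloor>..i + \<lfloor>q\<rfloor>}"
  proof
    fix k assume "k \<in> {k. real (nat \<bar>i - k\<bar>) \<le> q}"
    then have "real_of_int \<bar>i - k\<bar> \<le> q" by simp
    then have "\<bar>i - k\<bar> \<le> \<lfloor>q\<rfloor>" by (simp only: le_floor_iff)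
    then show "k \<in> {i - \<lfloor>q\<rfloor>..i + \<lfloor>q\<rfloor>}" by auto
  qed
  then show "finite {k. real (nat \<bar>i - k\<bar>) \<le> q}" by (rule finite_subset) simp
  have "card {k. real (nat \<bar>i - k\<bar>) \<le> q} \<le> card {i - \<lfloor>q\<rfloor>..i + \<lfloor>q\<rfloor>}" by (rule card_mono[OF _ sub]) simp
  also have "\<dots> = nat (2 * \<lfloor>q\<rfloor> + 1)" by simp
  finally show "real (card {k. real (nat \<bar>i - k\<bar>) \<le> q}) \<le> 2 * q + 1" using assms by linarith
qed

text \<open>The double sum is split at the distances \<open>q\<close> and \<open>g\<close>: up to \<open>q\<close> only the number of pairs is
  small, between \<open>q\<close> and \<open>g\<close> the correlations are small as well, and beyond \<open>g\<close> they are close to \<open>\<rho>\<close>.\<close>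

lemma pair_sum_le:
  fixes I :: "int set" and r :: "nat \<Rightarrow> real" and E :: "int \<Rightarrow> real"
    and q g \<rho> c1 c2 d1 d2 d3 e0 :: real
  assumes fin: "finite I" and q: "0 \<le> q" and g: "0 \<le> g" and E: "\<And>i. i \<in> I \<Longrightarrow> 0 \<le> E i" "\<And>i. i \<in> I \<Longrightarrow> E i \<le> e0"
    and c: "0 \<le> c1" "0 \<le> c2"
    and r1: "\<And>n. n \<ge> 1 \<Longrightarrow> \<bar>r n - \<rho>\<bar> \<le> d1"
    and r2: "\<And>n. real n > q \<Longrightarrow> \<bar>r n - \<rho>\<bar> \<le> d2"
    and r3: "\<And>i k. i \<in> I \<Longrightarrow> k \<in> I \<Longrightarrow> real (nat \<bar>i - k\<bar>) > q \<Longrightarrow> real (nat \<bar>i - k\<bar>) > g \<Longrightarrow> \<bar>r (nat \<bar>i - k\<bar>) - \<rho>\<bar> \<le> d3"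
    and d: "0 \<le> d1" "0 \<le> d2" "0 \<le> d3"
  shows "(\<Sum>i\<in>I. \<Sum>k\<in>I - {i}. \<bar>r (nat \<bar>i - k\<bar>) - \<rho>\<bar> * (if real (nat \<bar>i - k\<bar>) \<le> q then c1 else c2 * (E i * E k)))
    \<le> d1 * c1 * (card I * (2 * q + 1)) + d2 * c2 * e0 * ((2 * g + 1) * (\<Sum>i\<in>I. E i)) + d3 * c2 * (\<Sum>i\<in>I. E i)\<^sup>2"
proof -
  have count: "(\<Sum>k\<in>I. if real (nat \<bar>i - k\<bar>) \<le> s then v else 0) \<le> (2 * s + 1) * v" if "0 \<le> s" "0 \<le> v" for i s and v :: real
  proof -
    have "(\<Sum>k\<in>I. if real (nat \<bar>i - k\<bar>) \<le> s then v else 0) = real (card {k\<in>I. real (nat \<bar>i - k\<bar>) \<le> s}) * v"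
      using fin by (simp add: sum.inter_filter[symmetric])
    also have "card {k\<in>I. real (nat \<bar>i - k\<bar>) \<le> s} \<le> card {k. real (nat \<bar>i - k\<bar>) \<le> s}"
      using card_near_le(1)[OF that(1)] by (intro card_mono) auto
    then have "real (card {k\<in>I. real (nat \<bar>i - k\<bar>) \<le> s}) * v \<le> (2 * s + 1) * v"
      using card_near_le(2)[OF that(1), of i] that by (intro mult_right_mono) linarith+
    finally show ?thesis .
  qed
  have "(\<Sum>i\<in>I. \<Sum>k\<in>I - {i}. \<bar>r (nat \<bar>i - k\<bar>) - \<rho>\<bar> * (if real (nat \<bar>i - k\<bar>) \<le> q then c1 else c2 * (E i * E k)))
     \<le> (\<Sum>i\<in>I. \<Sum>k\<in>I - {i}. (if real (nat \<bar>i - k\<bar>) \<le> q then d1 * c1 else 0) + (if real (nat \<bar>i - k\<bar>) \<le> g then d2 * c2 * e0 * E i else 0) + d3 * c2 * (E i * E k))"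
  proof (intro sum_mono)
    fix i k assume ik: "i \<in> I" "k \<in> I - {i}"
    let ?n = "nat \<bar>i - k\<bar>"
    have n1: "?n \<ge> 1" using ik by auto
    have Ei: "0 \<le> E i" "0 \<le> E k" "E k \<le> e0" using E ik by auto
    consider "real ?n \<le> q" | "real ?n > q" "real ?n \<le> g" | "real ?n > q" "real ?n > g" by linarith
    then show "\<bar>r ?n - \<rho>\<bar> * (if real ?n \<le> q then c1 else c2 * (E i * E k)) \<le> (if real ?n \<le> q then d1 * c1 else 0) + (if real ?n \<le> g then d2 * c2 * e0 * E i else 0) + d3 * c2 * (E i * E k)"
    proof cases
      case 1
      have "\<bar>r ?n - \<rho>\<bar> * c1 \<le> d1 * c1" using r1[OF n1] c by (intro mult_right_mono)
      moreover have "0 \<le> d3 * c2 * (E i * E k)" "0 \<le> d2 * c2 * e0 * E i" using d c Ei by auto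
      ultimately show ?thesis using 1 by simp
    next
      case 2
      have "\<bar>r ?n - \<rho>\<bar> * (c2 * (E i * E k)) \<le> d2 * (c2 * (E i * e0))"
        using r2[OF 2(1)] d c Ei by (intro mult_mono) auto
      moreover have "0 \<le> d3 * c2 * (E i * E k)" using d c Ei by auto
      ultimately show ?thesis using 2 by (simp add: mult_ac)
    next
      case 3
      have "\<bar>r ?n - \<rho>\<bar> * (c2 * (E i * E k)) \<le> d3 * (c2 * (E i * E k))"
        using r3[OF _ _ 3] ik d c Ei by (intro mult_mono) auto
      then show ?thesis using 3 by (simp add: mult_ac)
    qed
  qed
  also have "\<dots> \<le> (\<Sum>i\<in>I. \<Sum>k\<in>I. (if real (nat \<bar>i - k\<bar>) \<le> q then d1 * c1 else 0) + (if real (nat \<bar>i - k\<bar>) \<le> g then d2 * c2 * e0 * E i else 0) + d3 * c2 * (E i * E k))"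
  proof (intro sum_mono sum_mono2 fin)
    fix i k assume ik: "i \<in> I" "k \<in> I - (I - {i})"
    then have "0 \<le> E i" "0 \<le> E k" "0 \<le> e0" using E order_trans by blast+
    then show "0 \<le> (if real (nat \<bar>i - k\<bar>) \<le> q then d1 * c1 else 0) + (if real (nat \<bar>i - k\<bar>) \<le> g then d2 * c2 * e0 * E i else 0) + d3 * c2 * (E i * E k)"
      using c d by (auto intro!: add_nonneg_nonneg)
  qed auto
  also have "\<dots> \<le> (\<Sum>i\<in>I. (2 * q + 1) * (d1 * c1) + (2 * g + 1) * (d2 * c2 * e0 * E i) + d3 * c2 * (E i * (\<Sum>k\<in>I. E k)))"
  proof (intro sum_mono)
    fix i assume i: "i \<in> I"
    then have "0 \<le> E i" "0 \<le> e0" using E order_trans by blast+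
    then show "(\<Sum>k\<in>I. (if real (nat \<bar>i - k\<bar>) \<le> q then d1 * c1 else 0) + (if real (nat \<bar>i - k\<bar>) \<le> g then d2 * c2 * e0 * E i else 0) + d3 * c2 * (E i * E k)) \<le> (2 * q + 1) * (d1 * c1) + (2 * g + 1) * (d2 * c2 * e0 * E i) + d3 * c2 * (E i * (\<Sum>k\<in>I. E k))"
      unfolding sum.distrib sum_distrib_left[symmetric] using c d q g by (intro add_mono count order_refl) auto
  qed
  also have "\<dots> = d1 * c1 * (card I * (2 * q + 1)) + d2 * c2 * e0 * ((2 * g + 1) * (\<Sum>i\<in>I. E i)) + d3 * c2 * (\<Sum>i\<in>I. E i)\<^sup>2"
    by (simp add: sum.distrib sum_distrib_left[symmetric] sum_distrib_right[symmetric] power2_eq_square mult_ac)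
  finally show ?thesis .
qed

locale long_range_levels = crossing_levels +
  fixes r :: "nat \<Rightarrow> real" and \<delta> :: real
  assumes r0: "r 0 = 1" and r_le: "\<And>n. n \<ge> 1 \<Longrightarrow> \<bar>r n\<bar> \<le> \<delta>" and \<delta>: "1 / 2 \<le> \<delta>" "\<delta> < 1"
    and r_ln: "(\<lambda>n. r n * ln (real n)) \<longlonglongrightarrow> \<gamma>"
begin

text \<open>At distances beyond a fixed negative power of \<open>\<beta>\<close> the correlations are of the order
  \<open>1 / ln (1 / \<beta>)\<close>.\<close>

lemma correlation_far:
  assumes s: "0 < s"
  shows "\<forall>\<^sub>F \<beta> in at_right 0. \<forall>n. real n > \<beta> powr (- s) \<longrightarrow> \<bar>r n\<bar> \<le> (2 * \<gamma> / s) / ln (1 / \<beta>)"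
proof -
  have "\<forall>\<^sub>F n in sequentially. r n * ln (real n) < 2 * \<gamma>" using r_ln by (rule order_tendstoD) (use \<gamma> in simp)
  moreover have "\<forall>\<^sub>F n in sequentially. - 2 * \<gamma> < r n * ln (real n)" using r_ln by (rule order_tendstoD) (use \<gamma> in simp)
  ultimately have "\<forall>\<^sub>F n in sequentially. \<bar>r n * ln (real n)\<bar> \<le> 2 * \<gamma>" by eventually_elim auto
  then obtain N where N: "\<And>n. n \<ge> N \<Longrightarrow> \<bar>r n * ln (real n)\<bar> \<le> 2 * \<gamma>" by (auto simp: eventually_sequentially)
  have "filterlim (\<lambda>\<beta>. exp (s * ln (1 / \<beta>))) at_top (at_right 0)"
    by (rule filterlim_compose[OF exp_at_top filterlim_tendsto_pos_mult_at_top[OF tendsto_const s L_at_top]])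
  then have "\<forall>\<^sub>F \<beta> in at_right 0. real N \<le> exp (s * ln (1 / \<beta>))" by (auto simp: filterlim_at_top)
  then show ?thesis using beta_small L_pos
  proof eventually_elim
    case (elim \<beta>)
    have e: "exp (s * ln (1 / \<beta>)) = \<beta> powr (- s)" using elim by (simp add: powr_def ln_div)
    show ?case
    proof (intro allI impI)
      fix n assume n: "real n > \<beta> powr (- s)"
      then have nN: "N \<le> n" using elim e by simp
      have "s * ln (1 / \<beta>) = ln (\<beta> powr (- s))" using e by (metis ln_exp)
      also have "\<dots> \<le> ln (real n)"
      proof -
        have "0 < \<beta> powr (- s)" using elim by simp
        then have "0 < real n" using n by linarith
        then show ?thesis using n elim by (subst ln_le_cancel_iff) auto
      qed
      finally have ln: "s * ln (1 / \<beta>) \<le> ln (real n)" .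
      have pos: "0 < s * ln (1 / \<beta>)" using s elim by simp
      have "\<bar>r n\<bar> * (s * ln (1 / \<beta>)) \<le> \<bar>r n\<bar> * ln (real n)" using ln by (intro mult_left_mono) auto
      also have "\<dots> \<le> 2 * \<gamma>" using N[OF nN] ln pos by (simp add: abs_mult)
      finally have "\<bar>r n\<bar> \<le> 2 * \<gamma> / (s * ln (1 / \<beta>))" using pos by (simp add: pos_le_divide_eq)
      then show "\<bar>r n\<bar> \<le> (2 * \<gamma> / s) / ln (1 / \<beta>)" by simp
    qed
  qed
qed

text \<open>At the distances that carry almost all pairs the correlation is \<open>\<rho>\<close> up to
  \<open>o (1 / ln (1 / \<beta>))\<close>, because \<open>ln n\<close> is asymptotic to \<open>ln (1 / \<beta>)\<close> there.\<close>

lemma correlation_long: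
  assumes \<epsilon>: "0 < \<epsilon>"
  shows "\<forall>\<^sub>F \<beta> in at_right 0. \<forall>n. real n > 1 / (\<beta> * ln (1 / \<beta>)) \<longrightarrow> real n \<le> 4 * a \<beta> / \<beta> \<longrightarrow> \<bar>r n - \<rho> \<beta>\<bar> \<le> \<epsilon> / ln (1 / \<beta>)"
proof -
  define \<eta> where "\<eta> = \<epsilon> / 4"
  have \<eta>: "\<eta> > 0" using \<epsilon> by (simp add: \<eta>_def)
  have "\<forall>\<^sub>F n in sequentially. \<bar>r n * ln (real n) - \<gamma>\<bar> < \<eta>"
    using r_ln \<eta> by (auto simp: tendsto_iff dist_real_def)
  then obtain N where N: "\<And>n. n \<ge> N \<Longrightarrow> \<bar>r n * ln (real n) - \<gamma>\<bar> < \<eta>" by (auto simp: eventually_sequentially)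
  have f1: "filterlim (\<lambda>\<beta>::real. 1 / (\<beta> * ln (1 / \<beta>))) at_top (at_right 0)" by real_asymp
  have f2: "((\<lambda>\<beta>::real. ln (ln (1 / \<beta>)) / ln (1 / \<beta>)) \<longlongrightarrow> 0) (at_right 0)" by real_asymp
  have e1: "\<forall>\<^sub>F \<beta> in at_right 0. real N \<le> 1 / (\<beta> * ln (1 / \<beta>))" using f1 by (auto simp: filterlim_at_top)
  have e2: "\<forall>\<^sub>F \<beta>::real in at_right 0. ln (ln (1 / \<beta>)) / ln (1 / \<beta>) < 1 / 2" using f2 by (rule order_tendstoD) simp
  have e3: "\<forall>\<^sub>F \<beta>::real in at_right 0. ln (ln (1 / \<beta>)) / ln (1 / \<beta>) < \<epsilon> / (8 * \<gamma>)" using f2 by (rule order_tendstoD) (use \<epsilon> \<gamma> in simp)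
  have e4: "\<forall>\<^sub>F \<beta> in at_right 0. 4 * a \<beta> \<le> (ln (1 / \<beta>))\<^sup>2"
  proof -
    have "\<forall>\<^sub>F \<beta> in at_right 0. (a \<beta>)\<^sup>2 / ln (1 / \<beta>) < 3"
      using a_sq by (rule order_tendstoD) (use D in \<open>simp add: divide_less_eq\<close>)
    moreover have "\<forall>\<^sub>F \<beta>::real in at_right 0. 12 \<le> ln (1 / \<beta>)" using L_at_top by (auto simp: filterlim_at_top)
    ultimately show ?thesis using a_ge[of 1]
    proof eventually_elim
      case (elim \<beta>)
      have "4 * a \<beta> \<le> 4 * (a \<beta>)\<^sup>2" using elim(3) by (simp add: power2_eq_square)
      also have "\<dots> \<le> 12 * ln (1 / \<beta>)" using elim by (simp add: pos_divide_less_eq)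
      also have "\<dots> \<le> (ln (1 / \<beta>))\<^sup>2" using elim(2) by (simp add: power2_eq_square)
      finally show ?case .
    qed
  qed
  have e5: "\<forall>\<^sub>F \<beta>::real in at_right 0. 1 < ln (1 / \<beta>)" using L_at_top by (auto simp: filterlim_at_top_dense)
  show ?thesis
    using e1 e2 e3 e4 e5 beta_small rho_eq
  proof eventually_elim
    case (elim \<beta>)
    define L where "L = ln (1 / \<beta>)"
    have L: "1 < L" using elim by (simp add: L_def)
    have lnL: "0 < ln L" using L by simp
    have b: "0 < \<beta>" "\<beta> < 1" using elim by auto
    have lb: "ln (1 / (\<beta> * L)) = L - ln L"
    proof -
      have "1 / (\<beta> * L) = (1 / \<beta>) / L" by simp
      moreover have "ln ((1 / \<beta>) / L) = ln (1 / \<beta>) - ln L" using b L by (simp add: ln_div ln_mult)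
      ultimately show ?thesis by (simp only: L_def[symmetric])
    qed
    have lL: "ln L \<le> L / 2" "ln L \<le> \<epsilon> / (8 * \<gamma>) * L"
      using elim(2,3) L by (auto simp: L_def[symmetric] pos_divide_less_eq)
    show ?case unfolding L_def[symmetric]
    proof (intro allI impI)
      fix n assume n: "real n > 1 / (\<beta> * L)" "real n \<le> 4 * a \<beta> / \<beta>"
      have bL: "0 < \<beta> * L" using b L by simp
      have n0: "0 < real n" using n(1) bL by (meson less_trans zero_less_divide_1_iff)
      have "real N \<le> 1 / (\<beta> * L)" using elim(1) by (simp add: L_def)
      then have nN: "N \<le> n" using n by linarith
      have lo: "L - ln L \<le> ln (real n)"
        unfolding lb[symmetric] using n n0 bL by (subst ln_le_cancel_iff) auto
      have up: "ln (real n) \<le> L + 2 * ln L"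
      proof -
        have "real n \<le> L\<^sup>2 * (1 / \<beta>)" using n elim(4) b by (simp add: L_def[symmetric] order_trans[OF _ divide_right_mono])
        then have "ln (real n) \<le> ln (L\<^sup>2 * (1 / \<beta>))" using n0 b L by (subst ln_le_cancel_iff) auto
        also have "\<dots> = 2 * ln L + L"
        proof -
          have lnb: "ln \<beta> = - L" using b by (simp add: L_def ln_div)
          show ?thesis using b L by (simp add: ln_div ln_realpow lnb)
        qed
        finally show ?thesis by simp
      qed
      have half: "L / 2 \<le> ln (real n)" using lo lL by linarith
      have lnn: "0 < ln (real n)" using half L by linarith
      have d: "r n - \<rho> \<beta> = (r n * ln (real n) - \<gamma>) / ln (real n) + \<gamma> * (L - ln (real n)) / (L * ln (real n))"
      proof -
        have "\<rho> \<beta> = \<gamma> / L" using elim by (simp add: L_def)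
        then show ?thesis using lnn L by (simp add: field_simps)
      qed
      have t1: "\<bar>(r n * ln (real n) - \<gamma>) / ln (real n)\<bar> \<le> \<epsilon> / 2 / L"
      proof -
        have "\<bar>(r n * ln (real n) - \<gamma>) / ln (real n)\<bar> = \<bar>r n * ln (real n) - \<gamma>\<bar> / ln (real n)" using lnn by simp
        also have "\<dots> \<le> \<eta> / (L / 2)" using N[OF nN] half L \<eta> by (intro frac_le) auto
        finally show ?thesis by (simp add: \<eta>_def)
      qed
      have t2: "\<bar>\<gamma> * (L - ln (real n)) / (L * ln (real n))\<bar> \<le> \<epsilon> / 2 / L"
      proof -
        have "\<bar>L - ln (real n)\<bar> \<le> 2 * ln L" using lo up lnL by linarith
        then have "\<bar>L - ln (real n)\<bar> \<le> 2 * (\<epsilon> / (8 * \<gamma>) * L)" using lL(2) by linarith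
        then have "\<gamma> * \<bar>L - ln (real n)\<bar> \<le> \<gamma> * (2 * (\<epsilon> / (8 * \<gamma>) * L))" using \<gamma> by (intro mult_left_mono) auto
        also have "\<dots> = \<epsilon> / 4 * L" using \<gamma> by simp
        finally have x: "\<gamma> * \<bar>L - ln (real n)\<bar> \<le> \<epsilon> / 4 * L" .
        have "\<bar>\<gamma> * (L - ln (real n)) / (L * ln (real n))\<bar> = \<gamma> * \<bar>L - ln (real n)\<bar> / (L * ln (real n))"
          using lnn L \<gamma> by (simp add: abs_mult)
        also have "\<dots> \<le> (\<epsilon> / 4 * L) / (L * (L / 2))"
          using x half L \<gamma> \<epsilon> by (intro frac_le mult_left_mono mult_pos_pos) auto
        also have "\<dots> = \<epsilon> / 2 / L" using L by (simp add: field_simps)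
        finally show ?thesis .
      qed
      have "\<bar>r n - \<rho> \<beta>\<bar> \<le> \<bar>(r n * ln (real n) - \<gamma>) / ln (real n)\<bar> + \<bar>\<gamma> * (L - ln (real n)) / (L * ln (real n))\<bar>"
        unfolding d by (rule abs_triangle_ineq)
      also have "\<dots> \<le> \<epsilon> / L" using t1 t2 by (simp add: field_simps)
      finally show "\<bar>r n - \<rho> \<beta>\<bar> \<le> \<epsilon> / L" .
    qed
  qed
qed

text \<open>The total weight of the indices beyond a level.\<close>

lemma side_sum_le:
  fixes l R \<beta> :: real
  assumes "0 < \<beta>" "0 < l"
  shows "(\<Sum>i\<in>{i::int. l < \<beta> * real_of_int i \<and> \<beta> * real_of_int i \<le> R}. exp (- (real D * (\<beta> * real_of_int i)\<^sup>2) / 2))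
     \<le> exp (- (real D * l\<^sup>2) / 2) / (1 - exp (- (real D * l * \<beta>)))"
proof -
  define i0 where "i0 = \<lfloor>l / \<beta>\<rfloor> + 1"
  define S where "S = {i::int. l < \<beta> * real_of_int i \<and> \<beta> * real_of_int i \<le> R}"
  have finS: "finite S" unfolding S_def by (rule finite_side[OF assms(1)])
  have i0: "i0 \<le> i" if "i \<in> S" for i
  proof -
    have "l / \<beta> < real_of_int i" using that assms by (simp add: S_def divide_less_eq mult.commute)
    then show ?thesis unfolding i0_def by linarith
  qed
  have li0: "l \<le> \<beta> * real_of_int i0"
  proof -
    have "l / \<beta> \<le> real_of_int i0" unfolding i0_def by linarith
    then show ?thesis using assms by (simp add: pos_divide_le_eq mult.commute)
  qed
  let ?r = "exp (- (real D * l * \<beta>))"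
  have r: "0 \<le> ?r" "?r < 1" using assms D by auto
  have "(\<Sum>i\<in>S. exp (- (real D * (\<beta> * real_of_int i)\<^sup>2) / 2)) \<le> (\<Sum>i\<in>S. exp (- (real D * l\<^sup>2) / 2) * ?r ^ nat (i - i0))"
  proof (rule sum_mono)
    fix i assume i: "i \<in> S"
    define k where "k = real_of_int (i - i0)"
    have k: "0 \<le> k" "k = real (nat (i - i0))" using i0[OF i] by (auto simp: k_def)
    have "l + \<beta> * k \<le> \<beta> * real_of_int i" using li0 by (simp add: k_def algebra_simps)
    then have "(l + \<beta> * k)\<^sup>2 \<le> (\<beta> * real_of_int i)\<^sup>2" using assms k by (intro power_mono) auto
    moreover have "(l + \<beta> * k)\<^sup>2 = l\<^sup>2 + 2 * (l * \<beta> * k) + (\<beta> * k)\<^sup>2" by (simp add: power2_eq_square algebra_simps)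
    then have "l\<^sup>2 + 2 * (l * \<beta> * k) \<le> (l + \<beta> * k)\<^sup>2" using zero_le_power2[of "\<beta> * k"] by linarith
    ultimately have "l\<^sup>2 + 2 * (l * \<beta> * k) \<le> (\<beta> * real_of_int i)\<^sup>2" by linarith
    then have "real D * (l\<^sup>2 + 2 * (l * \<beta> * k)) \<le> real D * (\<beta> * real_of_int i)\<^sup>2" by (intro mult_left_mono) auto
    then have "- (real D * (\<beta> * real_of_int i)\<^sup>2) / 2 \<le> - (real D * l\<^sup>2) / 2 + k * - (real D * l * \<beta>)" by (simp add: algebra_simps)
    then have "exp (- (real D * (\<beta> * real_of_int i)\<^sup>2) / 2) \<le> exp (- (real D * l\<^sup>2) / 2) * exp (k * - (real D * l * \<beta>))"
      by (simp only: exp_add[symmetric] exp_le_cancel_iff)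
    also have "exp (k * - (real D * l * \<beta>)) = ?r ^ nat (i - i0)" unfolding k(2) by (rule exp_of_nat_mult)
    finally show "exp (- (real D * (\<beta> * real_of_int i)\<^sup>2) / 2) \<le> exp (- (real D * l\<^sup>2) / 2) * ?r ^ nat (i - i0)" .
  qed
  also have "\<dots> = exp (- (real D * l\<^sup>2) / 2) * (\<Sum>n\<in>(\<lambda>i. nat (i - i0)) ` S. ?r ^ n)"
  proof (subst sum.reindex)
    show "inj_on (\<lambda>i. nat (i - i0)) S"
    proof (rule inj_onI)
      fix x y assume "x \<in> S" "y \<in> S" "nat (x - i0) = nat (y - i0)"
      then show "x = y" using i0[of x] i0[of y] by (simp add: eq_nat_nat_iff)
    qed
  qed (simp add: sum_distrib_left)
  also have "\<dots> \<le> exp (- (real D * l\<^sup>2) / 2) * (1 / (1 - ?r))"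
  proof (intro mult_left_mono)
    have "(\<Sum>n\<in>(\<lambda>i. nat (i - i0)) ` S. ?r ^ n) \<le> (\<Sum>n. ?r ^ n)"
      using r finS by (intro sum_le_suminf summable_geometric) auto
    then show "(\<Sum>n\<in>(\<lambda>i. nat (i - i0)) ` S. ?r ^ n) \<le> 1 / (1 - ?r)" using suminf_geometric[of ?r] r by simp
  qed simp
  finally show ?thesis by (simp add: S_def)
qed

lemma geometric_factor: "((\<lambda>\<beta>. \<beta> * a \<beta> / (1 - exp (- (real D * level x \<beta> * \<beta>)))) \<longlongrightarrow> 1 / D) (at_right 0)"
proof -
  have l0: "((\<lambda>\<beta>. real D * (level x \<beta> / a \<beta>) * (a \<beta> ^ 1 * \<beta>)) \<longlongrightarrow> real D * 1 * 0) (at_right 0)"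
    by (intro tendsto_intros level_ratio a_power_beta)
  moreover have "\<forall>\<^sub>F \<beta> in at_right 0. real D * (level x \<beta> / a \<beta>) * (a \<beta> ^ 1 * \<beta>) = real D * level x \<beta> * \<beta>"
    using a_pos by eventually_elim simp
  ultimately have y0: "((\<lambda>\<beta>. real D * level x \<beta> * \<beta>) \<longlongrightarrow> 0) (at_right 0)" by (auto dest: Lim_transform_eventually)
  have yp: "\<forall>\<^sub>F \<beta> in at_right 0. real D * level x \<beta> * \<beta> > 0"
    using level_pos[of x] beta_small by eventually_elim (use D in simp)
  have "((\<lambda>\<beta>. real D * level x \<beta> * \<beta> / (1 - exp (- (real D * level x \<beta> * \<beta>))) / (real D * (level x \<beta> / a \<beta>))) \<longlongrightarrow> 1 / (real D * 1)) (at_right 0)"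
    by (intro tendsto_intros tendsto_one_minus_exp_ratio[OF y0 yp] level_ratio) (use D in auto)
  moreover have "\<forall>\<^sub>F \<beta> in at_right 0. real D * level x \<beta> * \<beta> / (1 - exp (- (real D * level x \<beta> * \<beta>))) / (real D * (level x \<beta> / a \<beta>)) = \<beta> * a \<beta> / (1 - exp (- (real D * level x \<beta> * \<beta>)))"
    using a_pos level_pos[of x] by eventually_elim (use D in simp)
  ultimately show ?thesis by (auto dest: Lim_transform_eventually)
qed

lemma window_weight:
  "\<exists>C>0. \<forall>\<^sub>F \<beta> in at_right 0. (\<Sum>i\<in>window p q y x \<beta>. exp (- (real D * (\<beta> * \<bar>real_of_int i\<bar>)\<^sup>2) / 2)) \<le> C * a \<beta> ^ D"
proof -
  let ?w = "\<lambda>l \<beta>. exp (- (real D * (level l \<beta>)\<^sup>2) / 2) / (1 - exp (- (real D * level l \<beta> * \<beta>)))"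
  have one: "\<exists>C>0. \<forall>\<^sub>F \<beta> in at_right 0. ?w l \<beta> \<le> C * a \<beta> ^ D" for l
  proof -
    let ?c = "\<kappa> * D * sqrt (2 * pi) ^ D * exp (\<gamma> - sqrt (2 * \<gamma> / D) * l) * (1 / D)"
    have "((\<lambda>\<beta>. exp (- (real D * (level l \<beta>)\<^sup>2) / 2) / (\<beta> * a \<beta> ^ (D + 1)) * (\<beta> * a \<beta> / (1 - exp (- (real D * level l \<beta> * \<beta>))))) \<longlongrightarrow> ?c) (at_right 0)"
      by (intro tendsto_mult level_density geometric_factor)
    then have "\<forall>\<^sub>F \<beta> in at_right 0. exp (- (real D * (level l \<beta>)\<^sup>2) / 2) / (\<beta> * a \<beta> ^ (D + 1)) * (\<beta> * a \<beta> / (1 - exp (- (real D * level l \<beta> * \<beta>)))) < \<bar>?c\<bar> + 1"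
      by (rule order_tendstoD) (rule order_le_less_trans[OF abs_ge_self], simp)
    then have "\<forall>\<^sub>F \<beta> in at_right 0. ?w l \<beta> \<le> (\<bar>?c\<bar> + 1) * a \<beta> ^ D"
      using a_pos beta_small
    proof eventually_elim
      case (elim \<beta>)
      have "exp (- (real D * (level l \<beta>)\<^sup>2) / 2) / (\<beta> * a \<beta> ^ (D + 1)) * (\<beta> * a \<beta> / (1 - exp (- (real D * level l \<beta> * \<beta>)))) = ?w l \<beta> / a \<beta> ^ D"
        using elim by simp
      then have "?w l \<beta> / a \<beta> ^ D < \<bar>?c\<bar> + 1" using elim(1) by (simp only:)
      then show ?case using elim by (simp only: pos_divide_less_eq zero_less_power)
    qed
    then show ?thesis by (intro exI[of _ "\<bar>?c\<bar> + 1"]) simp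
  qed
  obtain C1 C2 where C: "C1 > 0" "C2 > 0" "\<forall>\<^sub>F \<beta> in at_right 0. ?w y \<beta> \<le> C1 * a \<beta> ^ D" "\<forall>\<^sub>F \<beta> in at_right 0. ?w x \<beta> \<le> C2 * a \<beta> ^ D"
    using one[of y] one[of x] by auto
  have "\<forall>\<^sub>F \<beta> in at_right 0. (\<Sum>i\<in>window p q y x \<beta>. exp (- (real D * (\<beta> * \<bar>real_of_int i\<bar>)\<^sup>2) / 2)) \<le> (C1 + C2) * a \<beta> ^ D"
    using C(3,4) beta_small level_pos[of x] level_pos[of y] a_pos
  proof eventually_elim
    case (elim \<beta>)
    have b: "0 < \<beta>" using elim by simp
    have "(\<Sum>i\<in>window p q y x \<beta>. exp (- (real D * (\<beta> * \<bar>real_of_int i\<bar>)\<^sup>2) / 2)) = (if p then \<Sum>i\<in>{i::int. level y \<beta> < \<beta> * real_of_int i \<and> \<beta> * real_of_int i \<le> 2 * a \<beta>}. exp (- (real D * (\<beta> * real_of_int i)\<^sup>2) / 2) else 0) +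
     (if q then \<Sum>i\<in>{i::int. level x \<beta> < \<beta> * real_of_int i \<and> \<beta> * real_of_int i \<le> 2 * a \<beta>}. exp (- (real D * (\<beta> * real_of_int i)\<^sup>2) / 2) else 0)"
      using sum_window[where \<beta>=\<beta> and y=y and x=x and p=p and q=q and f="\<lambda>v. exp (- (real D * v\<^sup>2) / 2)"] elim by simp
    also have "\<dots> \<le> C1 * a \<beta> ^ D + C2 * a \<beta> ^ D"
    proof (rule add_mono)
      show "(if p then \<Sum>i\<in>{i::int. level y \<beta> < \<beta> * real_of_int i \<and> \<beta> * real_of_int i \<le> 2 * a \<beta>}. exp (- (real D * (\<beta> * real_of_int i)\<^sup>2) / 2) else 0) \<le> C1 * a \<beta> ^ D"
        using order_trans[OF side_sum_le[OF b elim(5)] elim(1)] C elim by simp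
      show "(if q then \<Sum>i\<in>{i::int. level x \<beta> < \<beta> * real_of_int i \<and> \<beta> * real_of_int i \<le> 2 * a \<beta>}. exp (- (real D * (\<beta> * real_of_int i)\<^sup>2) / 2) else 0) \<le> C2 * a \<beta> ^ D"
        using order_trans[OF side_sum_le[OF b elim(4)] elim(2)] C elim by simp
    qed
    finally show ?case by (simp add: algebra_simps)
  qed
  then show ?thesis using C by (intro exI[of _ "C1 + C2"]) simp
qed

lemma level_density_le: "\<exists>C>0. \<forall>\<^sub>F \<beta> in at_right 0. exp (- (real D * (level x \<beta>)\<^sup>2) / 2) \<le> C * (\<beta> * a \<beta> ^ (D + 1))"
proof -
  let ?c = "\<kappa> * D * sqrt (2 * pi) ^ D * exp (\<gamma> - sqrt (2 * \<gamma> / D) * x)"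
  have "\<forall>\<^sub>F \<beta> in at_right 0. exp (- (real D * (level x \<beta>)\<^sup>2) / 2) / (\<beta> * a \<beta> ^ (D + 1)) < \<bar>?c\<bar> + 1"
    using level_density by (rule order_tendstoD) (rule order_le_less_trans[OF abs_ge_self], simp)
  then have "\<forall>\<^sub>F \<beta> in at_right 0. exp (- (real D * (level x \<beta>)\<^sup>2) / 2) \<le> (\<bar>?c\<bar> + 1) * (\<beta> * a \<beta> ^ (D + 1))"
    using a_pos beta_small
  proof eventually_elim
    case (elim \<beta>)
    then have "0 < \<beta> * a \<beta> ^ (D + 1)" by simp
    then show ?case using elim(1) by (simp only: pos_divide_less_eq less_imp_le)
  qed
  then show ?thesis by (intro exI[of _ "\<bar>?c\<bar> + 1"]) simp
qed

lemma window_abs: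
  assumes "0 < \<beta>" "level y \<beta> > 0" "level x \<beta> > 0" and i: "i \<in> window p q y x \<beta>"
  shows "level y \<beta> < \<beta> * \<bar>real_of_int i\<bar> \<or> level x \<beta> < \<beta> * \<bar>real_of_int i\<bar>" "\<beta> * \<bar>real_of_int i\<bar> \<le> 2 * a \<beta>"
proof -
  have pos: "0 < v" if "l < \<beta> * v" "0 < l" for v l :: real
    using that assms(1) by (smt (verit) mult_nonneg_nonpos)
  have "(level y \<beta> < \<beta> * \<bar>real_of_int i\<bar> \<or> level x \<beta> < \<beta> * \<bar>real_of_int i\<bar>) \<and> \<beta> * \<bar>real_of_int i\<bar> \<le> 2 * a \<beta>"
    using i unfolding window_def
  proof (elim CollectE disjE conjE)
    assume l: "level y \<beta> < \<beta> * real_of_int i" "\<beta> * real_of_int i \<le> 2 * a \<beta>"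
    then have "\<bar>real_of_int i\<bar> = real_of_int i" using pos[OF l(1) assms(2)] by simp
    then show ?thesis using l by simp
  next
    assume l: "level x \<beta> < \<beta> * - real_of_int i" "\<beta> * - real_of_int i \<le> 2 * a \<beta>"
    then have "\<bar>real_of_int i\<bar> = - real_of_int i" using pos[OF l(1) assms(3)] by simp
    then show ?thesis using l by simp
  qed
  then show "level y \<beta> < \<beta> * \<bar>real_of_int i\<bar> \<or> level x \<beta> < \<beta> * \<bar>real_of_int i\<bar>" "\<beta> * \<bar>real_of_int i\<bar> \<le> 2 * a \<beta>" by auto
qed

lemma card_window_le: "\<forall>\<^sub>F \<beta> in at_right 0. real (card (window p q y x \<beta>)) \<le> 5 * a \<beta> / \<beta>"
  using beta_small a_ge[of 1] level_pos[of x] level_pos[of y]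
proof eventually_elim
  case (elim \<beta>)
  have b: "0 < \<beta>" using elim by simp
  have q0: "0 \<le> 2 * a \<beta> / \<beta>" using elim by simp
  have "window p q y x \<beta> \<subseteq> {k. real (nat \<bar>0 - k\<bar>) \<le> 2 * a \<beta> / \<beta>}"
    using window_abs(2)[OF b elim(4,3)] b by (auto simp: pos_le_divide_eq mult.commute)
  then have "card (window p q y x \<beta>) \<le> card {k. real (nat \<bar>0 - k\<bar>) \<le> 2 * a \<beta> / \<beta>}"
    by (rule card_mono[OF card_near_le(1)[OF q0]])
  also have "real (card {k. real (nat \<bar>0 - k\<bar>) \<le> 2 * a \<beta> / \<beta>}) \<le> 2 * (2 * a \<beta> / \<beta>) + 1" by (rule card_near_le(2)[OF q0])
  also have "1 \<le> a \<beta> / \<beta>" using elim by (simp add: le_divide_eq)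
  finally show ?case by simp
qed

text \<open>The whole comparison error tends to \<open>0\<close>. Near pairs are few, and their joint exceedance
  probability is a power of \<open>\<beta>\<close> smaller than the inverse of their number; for the other pairs the
  bound of order \<open>(\<Sum>\<^sub>i exp (- D u\<^sub>i\<^sup>2 / 2))\<^sup>2 = O (a\<^bsup>2 D\<^esup>)\<close> is compensated by the factor
  \<open>a\<^bsup>- 2 (D - 1)\<^esup>\<close> from the tails and by correlation differences of order \<open>o (a\<^bsup>- 2\<^esup>)\<close>.\<close>

lemma comparison_error:
  fixes J :: "'j set" and \<mu> :: "int set \<Rightarrow> (int \<Rightarrow> real) measure"
  assumes finJ: "finite J" and cJ: "card J = D"
    and \<mu>: "\<And>I. finite I \<Longrightarrow> prob_space (\<mu> I)" "\<And>I. finite I \<Longrightarrow> sets (\<mu> I) = sets (\<Pi>\<^sub>M i\<in>I. borel)"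
    and g: "\<And>I. finite I \<Longrightarrow> gauss_family (\<mu> I) I (\<lambda>i x. x i) (\<lambda>i k. r (nat \<bar>i - k\<bar>))"
  shows "((\<lambda>\<beta>. (\<integral>x. (\<Prod>i\<in>window p q y x' \<beta>. 1 - (\<Prod>j\<in>J. indicator {\<beta> * \<bar>real_of_int i\<bar><..} (x j i) :: real)) \<partial>(\<Pi>\<^sub>M j\<in>J. \<mu> (window p q y x' \<beta>)))
      - (\<integral>x. (\<Prod>i\<in>window p q y x' \<beta>. 1 - (\<Prod>j\<in>J. indicator {\<beta> * \<bar>real_of_int i\<bar><..} (x j i) :: real)) \<partial>(\<Pi>\<^sub>M j\<in>J. common_factor_law (\<rho> \<beta>) (window p q y x' \<beta>)))) \<longlongrightarrow> 0) (at_right 0)"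
    (is "(?d \<longlongrightarrow> 0) _")
proof -
  define x0 where "x0 = min y x'"
  \<comment> \<open>Near pairs contribute \<open>(\<beta> a\<^bsup>D + 1\<^esup>)\<^bsup>\<theta>\<^esup>\<close> each. Up to powers of \<open>a\<close> their number is \<open>\<beta>\<^bsup>- 1 - s\<^esup>\<close>, and
    \<open>\<theta> = 1 + 2 s\<close> leaves a factor \<open>\<beta>\<^bsup>s\<^esup>\<close>, against which powers of \<open>a\<close> do not count.\<close>
  define \<theta> where "\<theta> = 2 / (1 + \<delta>)"
  define s where "s = (\<theta> - 1) / 2"
  have \<theta>: "1 < \<theta>" "\<theta> \<le> 2" using \<delta> by (auto simp: \<theta>_def field_simps)
  have s: "0 < s" "s < 1" using \<theta> by (auto simp: s_def)
  define C1 where "C1 = 2 * \<gamma> / s"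
  have C1: "0 < C1" "\<gamma> \<le> C1" using \<gamma> s by (auto simp: C1_def field_simps)
  define K where "K = C1 * (9 * (2 / D + 1))"
  define c\<delta> where "c\<delta> = 1 / (2 * pi * sqrt (1 - \<delta>\<^sup>2))"
  have c\<delta>: "0 \<le> c\<delta>" using \<delta> by (auto simp: c\<delta>_def abs_square_le_1 intro!: divide_nonneg_nonneg)
  define cK where "cK = exp (2 * K) * (4 * exp (2 * K)) ^ (D - 1)"
  have cK: "0 \<le> cK" by (simp add: cK_def)
  let ?E = "\<lambda>\<beta> i. exp (- (real D * (\<beta> * real_of_int i)\<^sup>2) / 2)"
  obtain C3 where C3: "0 < C3" "\<forall>\<^sub>F \<beta> in at_right 0. (\<Sum>i\<in>window p q y x' \<beta>. ?E \<beta> i) \<le> C3 * a \<beta> ^ D"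
    using window_weight[of p q y x'] by (auto simp: power_mult_distrib)
  obtain C4 where C4: "0 < C4" "\<forall>\<^sub>F \<beta> in at_right 0. exp (- (real D * (level x0 \<beta>)\<^sup>2) / 2) \<le> C4 * (\<beta> * a \<beta> ^ (D + 1))"
    using level_density_le[of x0] by auto
  define T1 where "T1 \<beta> = 2 * (c\<delta> * C4 powr \<theta>) * 5 * 3 * (a \<beta> ^ (2 * (D + 1) + 1) * \<beta> powr s)" for \<beta>
  define T2 where "T2 \<beta> = 2 * C1 * cK * 4 ^ (D - 1) * C4 * C3 * (2 * ((a \<beta>)\<^sup>2 / ln (1 / \<beta>) * (a \<beta> / ln (1 / \<beta>))) + (a \<beta>)\<^sup>2 / ln (1 / \<beta>) * (a \<beta> ^ 1 * \<beta>))" for \<beta>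
  have bound: "\<forall>\<^sub>F \<beta> in at_right 0. \<bar>?d \<beta>\<bar> \<le> real D * (T1 \<beta> + T2 \<beta> + \<epsilon> * (cK * 4 ^ (D - 1) * C3\<^sup>2) * ((a \<beta>)\<^sup>2 / ln (1 / \<beta>)))" if \<epsilon>: "0 < \<epsilon>" for \<epsilon>
  proof -
    have K9: "\<forall>\<^sub>F \<beta> in at_right 0. (a \<beta>)\<^sup>2 / ln (1 / \<beta>) < 2 / D + 1"
      using a_sq by (rule order_tendstoD) simp
    have CL: "\<forall>\<^sub>F \<beta>::real in at_right 0. 8 * C1 \<le> ln (1 / \<beta>)" using L_at_top by (auto simp: filterlim_at_top)
    have L1: "\<forall>\<^sub>F \<beta>::real in at_right 0. 1 < ln (1 / \<beta>)" using L_at_top by (auto simp: filterlim_at_top_dense)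
    show ?thesis
      using C3(2) C4(2) beta_small rho_eq rho_bounds a_ge[of 2] level_bounds[of x0] level_pos[of y] level_pos[of x'] level_mono
        correlation_far[OF s(1)] correlation_long[OF \<epsilon>] card_window_le[of p q y x'] K9 CL L1
    proof eventually_elim
      case (elim \<beta>)
      define L where "L = ln (1 / \<beta>)"
      define A where "A = a \<beta>"
      define m where "m = level x0 \<beta>"
      define I where "I = window p q y x' \<beta>"
      define SE where "SE = (\<Sum>i\<in>I. ?E \<beta> i)"
      have b: "0 < \<beta>" "\<beta> < 1" using elim(3) by auto
      have L: "1 < L" "8 * C1 \<le> L" using elim(15,16) by (auto simp: L_def)
      have A: "2 \<le> A" using elim(6) by (simp add: A_def)
      have m: "A / 2 \<le> m" "m \<le> 3 / 2 * A" "1 \<le> m" using elim(7) A by (auto simp: A_def m_def)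
      have \<rho>: "\<rho> \<beta> = \<gamma> / L" "0 < \<rho> \<beta>" "\<rho> \<beta> < 1 / 2" using elim(4,5) by (auto simp: L_def)
      have finI: "finite I" unfolding I_def by (rule finite_window[OF b(1)])
      have mlev: "m \<le> level y \<beta>" "m \<le> level x' \<beta>" using elim(10) by (auto simp: m_def x0_def)
      have Iu: "\<beta> * \<bar>real_of_int i\<bar> \<le> 2 * A" if "i \<in> I" for i
        using window_abs(2)[OF b(1) elim(8,9)] that by (simp add: I_def A_def)
      have Il: "m \<le> \<beta> * \<bar>real_of_int i\<bar>" if "i \<in> I" for i
        using window_abs(1)[OF b(1) elim(8,9)] that mlev by (fastforce simp: I_def)
      let ?q = "\<beta> powr (- s)" and ?g = "1 / (\<beta> * L)"
      have c0: "C1 / L \<le> 1 / 8" using L by (simp add: divide_le_eq)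
      have A2: "A\<^sup>2 / L < 2 / D + 1" using elim(14) by (simp add: A_def L_def)
      have far: "\<bar>r n\<bar> \<le> C1 / L" if "real n > ?q" for n
        using elim(11) that by (simp add: C1_def L_def)
      have rho_c: "\<rho> \<beta> \<le> C1 / L" using \<rho>(1) C1 L by (simp add: divide_right_mono)
      have far4: "C1 / L * (2 * A + 1)\<^sup>2 \<le> K"
      proof -
        have "(2 * A + 1)\<^sup>2 \<le> (3 * A)\<^sup>2" using A by (intro power_mono) auto
        then have "C1 / L * (2 * A + 1)\<^sup>2 \<le> C1 / L * (9 * A\<^sup>2)" using C1 L by (intro mult_left_mono) (auto simp: power_mult_distrib)
        also have "\<dots> = C1 * (9 * (A\<^sup>2 / L))" by simp
        also have "\<dots> \<le> K" unfolding K_def using A2 C1 by (intro mult_left_mono) auto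
        finally show ?thesis .
      qed
      have far5: "C1 / L * (2 * A) \<le> m / 2"
        using mult_right_mono[OF c0, of "2 * A"] A m by linarith
      have \<rho>1: "0 \<le> \<rho> \<beta>" "\<rho> \<beta> < 1" "\<rho> \<beta> \<le> \<delta>" using \<rho>(2,3) \<delta> by linarith+
      have c0': "C1 / L \<le> 1 / 2" using c0 by linarith
      have "\<bar>?d \<beta>\<bar> \<le> card J * (\<Sum>i\<in>I. \<Sum>k\<in>I - {i}. \<bar>r (nat \<bar>i - k\<bar>) - \<rho> \<beta>\<bar> *
        (if real (nat \<bar>i - k\<bar>) \<le> ?q then exp (- (card J * m\<^sup>2) / (1 + \<delta>)) / (2 * pi * sqrt (1 - \<delta>\<^sup>2))
         else exp (2 * K) * (4 * exp (2 * K)) ^ (card J - 1) *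
           (exp (- (card J * (\<beta> * real_of_int i)\<^sup>2) / 2) * exp (- (card J * (\<beta> * real_of_int k)\<^sup>2) / 2)) / m ^ (2 * (card J - 1))))"
        unfolding I_def[symmetric]
        by (rule comparison_at_level[OF finI finJ _ \<mu>(1)[OF finI] \<mu>(2)[OF finI] g[OF finI] r0 Il Iu m(3) r_le \<rho>1(3) \<delta>(2) \<rho>1(1,2) far rho_c c0' far4 far5]) (use cJ D in simp)
      also have "\<dots> = D * (\<Sum>i\<in>I. \<Sum>k\<in>I - {i}. \<bar>r (nat \<bar>i - k\<bar>) - \<rho> \<beta>\<bar> *
        (if real (nat \<bar>i - k\<bar>) \<le> ?q then c\<delta> * exp (- (D * m\<^sup>2) / (1 + \<delta>)) else cK / m ^ (2 * (D - 1)) * (?E \<beta> i * ?E \<beta> k)))"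
        unfolding cJ c\<delta>_def cK_def by (simp only: mult_1_left times_divide_eq_left times_divide_eq_right)
      also have "\<dots> \<le> D * (2 * (c\<delta> * exp (- (D * m\<^sup>2) / (1 + \<delta>))) * (card I * (2 * ?q + 1))
          + (2 * C1 / L) * (cK / m ^ (2 * (D - 1))) * exp (- (D * m\<^sup>2) / 2) * ((2 * ?g + 1) * SE)
          + (\<epsilon> / L) * (cK / m ^ (2 * (D - 1))) * SE\<^sup>2)"
        unfolding SE_def
      proof (intro mult_left_mono pair_sum_le finI)
        fix i assume i: "i \<in> I"
        have "m\<^sup>2 \<le> (\<beta> * \<bar>real_of_int i\<bar>)\<^sup>2" using Il[OF i] m by (intro power_mono) auto
        then have "real D * m\<^sup>2 \<le> real D * (\<beta> * real_of_int i)\<^sup>2" by (intro mult_left_mono) (auto simp: power_mult_distrib)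
        then show "?E \<beta> i \<le> exp (- (D * m\<^sup>2) / 2)" by simp
      next
        fix n :: nat assume "n \<ge> 1"
        from r_le[OF this] show "\<bar>r n - \<rho> \<beta>\<bar> \<le> 2" using \<rho> \<delta> by linarith
      next
        fix n :: nat assume "real n > ?q"
        from far[OF this] show "\<bar>r n - \<rho> \<beta>\<bar> \<le> 2 * C1 / L" using rho_c \<rho> by simp
      next
        fix i k assume ik: "i \<in> I" "k \<in> I" "real (nat \<bar>i - k\<bar>) > ?g"
        have "\<beta> * \<bar>real_of_int (i - k)\<bar> \<le> \<beta> * (\<bar>real_of_int i\<bar> + \<bar>real_of_int k\<bar>)" using b by (intro mult_left_mono) auto
        also have "\<dots> \<le> 4 * A" using Iu[OF ik(1)] Iu[OF ik(2)] by (simp add: distrib_left)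
        finally have "real (nat \<bar>i - k\<bar>) \<le> 4 * A / \<beta>" using b by (simp add: pos_le_divide_eq mult.commute)
        then show "\<bar>r (nat \<bar>i - k\<bar>) - \<rho> \<beta>\<bar> \<le> \<epsilon> / L" using elim(12) ik(3) by (simp add: L_def A_def)
      qed (use b L C1 \<epsilon> c\<delta> cK m in auto)
      also have "\<dots> \<le> D * (T1 \<beta> + T2 \<beta> + \<epsilon> * (cK * 4 ^ (D - 1) * C3\<^sup>2) * (A\<^sup>2 / L))"
      proof (intro mult_left_mono add_mono)
        have SE: "0 \<le> SE" "SE \<le> C3 * A ^ D" using elim(1) by (auto simp: SE_def I_def A_def intro!: sum_nonneg)
        have dm: "exp (- (D * m\<^sup>2) / 2) \<le> C4 * (\<beta> * A ^ (D + 1))" using elim(2) by (simp add: m_def A_def)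
        have q1: "1 \<le> ?q" using b s by (simp add: ge_one_powr_ge_zero powr_minus one_le_inverse powr_le1)
        have mm: "1 / m ^ (2 * (D - 1)) \<le> 4 ^ (D - 1) / A ^ (2 * (D - 1))"
        proof -
          have "(A / 2) ^ (2 * (D - 1)) \<le> m ^ (2 * (D - 1))" using m A by (intro power_mono) auto
          then have "1 / m ^ (2 * (D - 1)) \<le> 1 / (A / 2) ^ (2 * (D - 1))" using A by (intro divide_left_mono) (use m in auto)
          also have "\<dots> = 4 ^ (D - 1) / A ^ (2 * (D - 1))" by (simp add: power_divide power_mult)
          finally show ?thesis .
        qed
        have Apow: "A ^ (2 * (D - 1)) * A\<^sup>2 = A ^ (2 * D)"
          unfolding power_add[symmetric] using D by (intro arg_cong[where f="(^) A"]) simp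
        show "2 * (c\<delta> * exp (- (D * m\<^sup>2) / (1 + \<delta>))) * (card I * (2 * ?q + 1)) \<le> T1 \<beta>"
        proof -
          have "exp (- (D * m\<^sup>2) / (1 + \<delta>)) = exp (- (D * m\<^sup>2) / 2) powr \<theta>"
            using \<delta> by (simp add: powr_def \<theta>_def field_simps)
          also have "\<dots> \<le> (C4 * (\<beta> * A ^ (D + 1))) powr \<theta>" using dm \<theta> by (intro powr_mono2) auto
          also have "\<dots> = C4 powr \<theta> * (\<beta> powr \<theta> * (A ^ (D + 1)) powr \<theta>)" using C4 b A by (simp add: powr_mult)
          also have "\<dots> \<le> C4 powr \<theta> * (\<beta> powr \<theta> * A ^ (2 * (D + 1)))"
          proof (intro mult_left_mono)
            have "1 \<le> A ^ (D + 1)" using A by (intro one_le_power) simp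
            then have "(A ^ (D + 1)) powr \<theta> \<le> (A ^ (D + 1)) powr 2" using \<theta> by (intro powr_mono)
            also have "\<dots> = A ^ (2 * (D + 1))" using A by (simp add: powr_realpow[symmetric] powr_powr power_mult[symmetric] mult.commute del: power_Suc)
            finally show "(A ^ (D + 1)) powr \<theta> \<le> A ^ (2 * (D + 1))" .
          qed auto
          finally have e: "exp (- (D * m\<^sup>2) / (1 + \<delta>)) \<le> C4 powr \<theta> * (\<beta> powr \<theta> * A ^ (2 * (D + 1)))" .
          have "real (card I) * (2 * ?q + 1) \<le> (5 * A / \<beta>) * (3 * ?q)"
            using elim(13) q1 b A by (intro mult_mono) (auto simp: I_def A_def)
          then have "2 * (c\<delta> * exp (- (D * m\<^sup>2) / (1 + \<delta>))) * (card I * (2 * ?q + 1)) \<le> 2 * (c\<delta> * (C4 powr \<theta> * (\<beta> powr \<theta> * A ^ (2 * (D + 1))))) * ((5 * A / \<beta>) * (3 * ?q))"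
          proof (rule mult_mono[rotated])
            show "2 * (c\<delta> * exp (- (D * m\<^sup>2) / (1 + \<delta>))) \<le> 2 * (c\<delta> * (C4 powr \<theta> * (\<beta> powr \<theta> * A ^ (2 * (D + 1)))))"
              by (intro mult_left_mono e c\<delta>) simp
          qed (use c\<delta> A q1 in \<open>auto intro!: mult_nonneg_nonneg add_nonneg_nonneg\<close>)
          also have "\<dots> = 2 * (c\<delta> * C4 powr \<theta>) * 5 * 3 * (A ^ (2 * (D + 1) + 1) * (\<beta> powr \<theta> / \<beta> * ?q))"
            by simp
          also have "\<beta> powr \<theta> / \<beta> * ?q = \<beta> powr s"
          proof -
            have "\<beta> powr \<theta> / \<beta> * ?q = \<beta> powr (\<theta> - 1 + - s)" using b by (simp only: powr_add powr_diff powr_one)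
            also have "\<theta> - 1 + - s = s" by (simp add: s_def field_simps)
            finally show ?thesis .
          qed
          finally show ?thesis by (simp add: T1_def A_def)
        qed
        show "(2 * C1 / L) * (cK / m ^ (2 * (D - 1))) * exp (- (D * m\<^sup>2) / 2) * ((2 * ?g + 1) * SE) \<le> T2 \<beta>"
        proof -
          have "(2 * C1 / L) * (cK / m ^ (2 * (D - 1))) * exp (- (D * m\<^sup>2) / 2) * ((2 * ?g + 1) * SE)
             = (2 * C1 / L) * (cK * (1 / m ^ (2 * (D - 1)))) * exp (- (D * m\<^sup>2) / 2) * ((2 * ?g + 1) * SE)" by simp
          also have "\<dots> \<le> (2 * C1 / L) * (cK * (4 ^ (D - 1) / A ^ (2 * (D - 1)))) * (C4 * (\<beta> * A ^ (D + 1))) * ((2 * ?g + 1) * (C3 * A ^ D))"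
            using mm dm SE C1 L cK C4 b A m by (intro mult_mono mult_left_mono) auto
          also have "\<dots> = 2 * C1 * cK * 4 ^ (D - 1) * C4 * C3 * ((A ^ (D + 1) * A ^ D / A ^ (2 * (D - 1))) * (\<beta> * (2 * ?g + 1)) / L)" by (simp add: mult_ac)
          also have "A ^ (D + 1) * A ^ D / A ^ (2 * (D - 1)) = A ^ 3"
          proof -
            have "A ^ (D + 1) * A ^ D = A ^ 3 * A ^ (2 * (D - 1))"
              unfolding power_add[symmetric] using D by (intro arg_cong[where f="(^) A"]) simp
            then show ?thesis using A by simp
          qed
          also have "A ^ 3 * (\<beta> * (2 * ?g + 1)) / L = 2 * (A\<^sup>2 / L * (A / L)) + A\<^sup>2 / L * (A ^ 1 * \<beta>)"
            using b L by (simp add: field_simps power2_eq_square power3_eq_cube)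
          finally show ?thesis by (simp add: T2_def A_def L_def)
        qed
        show "(\<epsilon> / L) * (cK / m ^ (2 * (D - 1))) * SE\<^sup>2 \<le> \<epsilon> * (cK * 4 ^ (D - 1) * C3\<^sup>2) * (A\<^sup>2 / L)"
        proof -
          have S2: "SE\<^sup>2 \<le> (C3 * A ^ D)\<^sup>2" using SE by (intro power_mono) auto
          have "(\<epsilon> / L) * (cK / m ^ (2 * (D - 1))) * SE\<^sup>2 = (\<epsilon> / L) * (cK * (1 / m ^ (2 * (D - 1)))) * SE\<^sup>2" by simp
          also have "\<dots> \<le> (\<epsilon> / L) * (cK * (4 ^ (D - 1) / A ^ (2 * (D - 1)))) * (C3 * A ^ D)\<^sup>2"
            using mm S2 \<epsilon> L cK m A by (intro mult_mono mult_left_mono) auto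
          also have "\<dots> = \<epsilon> * (cK * 4 ^ (D - 1) * C3\<^sup>2) * (A ^ (2 * D) / A ^ (2 * (D - 1)) / L)"
            by (simp add: power_mult_distrib power_mult[symmetric] mult_ac)
          also have "A ^ (2 * D) / A ^ (2 * (D - 1)) = A\<^sup>2" using Apow A by (simp add: field_simps)
          finally show ?thesis .
        qed
      qed simp
      finally show ?case by (simp add: A_def L_def)
    qed
  qed
  have T1: "(T1 \<longlongrightarrow> 0) (at_right 0)"
  proof -
    have "((\<lambda>\<beta>. 2 * (c\<delta> * C4 powr \<theta>) * 5 * 3 * (a \<beta> ^ (2 * (D + 1) + 1) * \<beta> powr s)) \<longlongrightarrow> 2 * (c\<delta> * C4 powr \<theta>) * 5 * 3 * 0) (at_right 0)"
      by (intro tendsto_mult tendsto_const a_power_powr s)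
    then show ?thesis by (simp add: T1_def[abs_def])
  qed
  have aL: "((\<lambda>\<beta>. a \<beta> / ln (1 / \<beta>)) \<longlongrightarrow> 0) (at_right 0)"
  proof -
    have "((\<lambda>\<beta>. (a \<beta>)\<^sup>2 / ln (1 / \<beta>) * inverse (a \<beta>)) \<longlongrightarrow> 2 / D * 0) (at_right 0)"
      by (intro tendsto_mult a_sq tendsto_inverse_0_at_top a_at_top)
    moreover have "\<forall>\<^sub>F \<beta> in at_right 0. (a \<beta>)\<^sup>2 / ln (1 / \<beta>) * inverse (a \<beta>) = a \<beta> / ln (1 / \<beta>)"
      using a_pos by eventually_elim (simp add: power2_eq_square)
    ultimately have "((\<lambda>\<beta>. a \<beta> / ln (1 / \<beta>)) \<longlongrightarrow> 2 / D * 0) (at_right 0)" by (rule Lim_transform_eventually)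
    then show ?thesis by simp
  qed
  have T2: "(T2 \<longlongrightarrow> 0) (at_right 0)"
  proof -
    have "((\<lambda>\<beta>. 2 * C1 * cK * 4 ^ (D - 1) * C4 * C3 * (2 * ((a \<beta>)\<^sup>2 / ln (1 / \<beta>) * (a \<beta> / ln (1 / \<beta>))) + (a \<beta>)\<^sup>2 / ln (1 / \<beta>) * (a \<beta> ^ 1 * \<beta>)))
       \<longlongrightarrow> 2 * C1 * cK * 4 ^ (D - 1) * C4 * C3 * (2 * (2 / D * 0) + 2 / D * 0)) (at_right 0)"
      by (intro tendsto_mult tendsto_add tendsto_const aL a_sq a_power_beta)
    then show ?thesis by (simp add: T2_def[abs_def])
  qed
  show ?thesis
  proof (rule tendstoI)
    fix e :: real assume e: "0 < e"
    define G where "G = cK * 4 ^ (D - 1) * C3\<^sup>2"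
    have G: "0 \<le> G" using cK by (simp add: G_def)
    define \<epsilon> where "\<epsilon> = e / (2 * (G * 2 + 1))"
    have \<epsilon>: "0 < \<epsilon>" using e G by (simp add: \<epsilon>_def add_nonneg_pos)
    have "((\<lambda>\<beta>. real D * (T1 \<beta> + T2 \<beta> + \<epsilon> * G * ((a \<beta>)\<^sup>2 / ln (1 / \<beta>)))) \<longlongrightarrow> real D * (0 + 0 + \<epsilon> * G * (2 / D))) (at_right 0)"
      by (intro tendsto_intros T1 T2 a_sq)
    moreover have "real D * (0 + 0 + \<epsilon> * G * (2 / D)) < e"
    proof -
      have "real D * (0 + 0 + \<epsilon> * G * (2 / D)) = \<epsilon> * (G * 2)" using D by simp
      also have "\<dots> \<le> \<epsilon> * (G * 2 + 1)" using \<epsilon> by simp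
      also have "\<dots> = e / 2" using G by (simp add: \<epsilon>_def field_simps add_nonneg_pos)
      finally show ?thesis using e by simp
    qed
    ultimately have "\<forall>\<^sub>F \<beta> in at_right 0. real D * (T1 \<beta> + T2 \<beta> + \<epsilon> * G * ((a \<beta>)\<^sup>2 / ln (1 / \<beta>))) < e"
      by (rule order_tendstoD)
    then show "\<forall>\<^sub>F \<beta> in at_right 0. dist (?d \<beta>) 0 < e"
      using bound[OF \<epsilon>] by eventually_elim (simp add: dist_real_def G_def)
  qed
qed

end

section \<open>Crossings of independent Gaussian sequences\<close>

lemma measure_gauss_gt:
  assumes M: "prob_space M" and g: "gauss_family M {i} X R" and R: "R i i = 1"
  shows "measure M {\<omega>\<in>space M. t < X i \<omega>} = normal_tail t"
proof -
  have m [measurable]: "X i \<in> borel_measurable M" using g by (auto simp: gauss_family_def)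
  have "measure (distr M borel (X i)) {t<..} = measure M (X i -` {t<..} \<inter> space M)" by (rule measure_distr) auto
  also have "X i -` {t<..} \<inter> space M = {\<omega>\<in>space M. t < X i \<omega>}" by auto
  finally show ?thesis unfolding normal_tail_def using gauss_family_marginal[OF M g _ _ R] by simp
qed

lemma gauss_family_uminus:
  assumes "gauss_family M I X R" shows "gauss_family M I (\<lambda>i \<omega>. - X i \<omega>) R"
  unfolding gauss_family_def
proof (intro conjI ballI allI)
  fix i assume "i \<in> I"
  then have "X i \<in> borel_measurable M" using assms by (auto simp: gauss_family_def)
  then show "(\<lambda>\<omega>. - X i \<omega>) \<in> borel_measurable M" by measurable
next
  fix t :: "'b \<Rightarrow> real"
  have "(CLINT \<omega>|M. iexp (\<Sum>i\<in>I. t i * - X i \<omega>)) = (CLINT \<omega>|M. iexp (\<Sum>i\<in>I. (- t i) * X i \<omega>))" by simp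
  also have "\<dots> = complex_of_real (exp (- (\<Sum>i\<in>I. \<Sum>k\<in>I. (- t i) * (- t k) * R i k) / 2))"
    by (rule assms[unfolded gauss_family_def, THEN conjunct2, rule_format])
  finally show "(CLINT \<omega>|M. iexp (\<Sum>i\<in>I. t i * - X i \<omega>)) = complex_of_real (exp (- (\<Sum>i\<in>I. \<Sum>k\<in>I. t i * t k * R i k) / 2))" by simp
qed

text \<open>By the Borel--Cantelli lemma a sequence of standard normal variables stays below every line of
  positive slope from some index on.\<close>

lemma AE_eventually_below_line:
  fixes X :: "int \<Rightarrow> 'a \<Rightarrow> real" and f :: "nat \<Rightarrow> int"
  assumes M: "prob_space M" and g: "\<And>i. gauss_family M {i} X R" and R: "\<And>i. R i i = 1" and c: "c > 0"
  shows "AE \<omega> in M. \<forall>\<^sub>F n in sequentially. X (f n) \<omega> \<le> c * real n"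
proof -
  interpret prob_space M by fact
  have m [measurable]: "X i \<in> borel_measurable M" for i using g[of i] by (auto simp: gauss_family_def)
  define A where "A n = {\<omega>\<in>space M. c * real n < X (f n) \<omega>}" for n
  have "summable (\<lambda>n. measure M (A n))"
  proof (rule summable_comparison_test_ev)
    obtain N :: nat where N: "1 / c + 2 / c\<^sup>2 \<le> real N" using real_arch_simple by blast
    have "norm (measure M (A n)) \<le> exp (- 1) ^ n" if "n \<ge> N" for n
    proof -
      have "1 / c \<le> real n" "2 / c\<^sup>2 \<le> real n" using N that c by (smt (verit) divide_nonneg_pos of_nat_mono zero_less_power)+
      then have n: "1 \<le> c * real n" "2 \<le> c\<^sup>2 * real n" using c by (auto simp: pos_divide_le_eq mult.commute)
      have "measure M (A n) = normal_tail (c * real n)"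
        unfolding A_def by (rule measure_gauss_gt[OF M g R])
      also have "\<dots> \<le> exp (- (c * real n)\<^sup>2 / 2)" by (rule normal_tail_le_exp[OF n(1)])
      also have "\<dots> \<le> exp (real n * - 1)"
        using mult_right_mono[OF n(2), of "real n"] by (simp add: power_mult_distrib power2_eq_square algebra_simps)
      also have "\<dots> = exp (- 1) ^ n" by (rule exp_of_nat_mult)
      finally show ?thesis by simp
    qed
    then show "\<forall>\<^sub>F n in sequentially. norm (measure M (A n)) \<le> exp (- 1) ^ n"
      by (auto simp: eventually_sequentially)
    show "summable (\<lambda>n. exp (- 1 :: real) ^ n)" by (rule summable_geometric) simp
  qed
  then have "AE \<omega> in M. \<forall>\<^sub>F n in sequentially. \<omega> \<in> space M - A n"
    by (intro borel_cantelli_AE1) (auto simp: A_def emeasure_eq_measure)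
  then show ?thesis
  proof (rule AE_mp, intro AE_I2 impI)
    fix \<omega> assume "\<forall>\<^sub>F n in sequentially. \<omega> \<in> space M - A n"
    then show "\<forall>\<^sub>F n in sequentially. X (f n) \<omega> \<le> c * real n"
      by eventually_elim (auto simp: A_def)
  qed
qed

context long_range_levels
begin

text \<open>The limit theorem for the event that the copies with index in \<open>J\<close> never exceed the two-sided
  line \<open>\<beta> \<bar>i\<bar>\<close> simultaneously beyond the levels.\<close>

lemma crossing_limit:
  fixes Xs :: "'j \<Rightarrow> int \<Rightarrow> 'a \<Rightarrow> real"
  assumes M: "prob_space M" and finJ: "finite J" and cJ: "card J = D"
    and indep: "prob_space.indep_vars M (\<lambda>_. \<Pi>\<^sub>M i\<in>(UNIV::int set). borel) (\<lambda>j \<omega> i. Xs j i \<omega>) J"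
    and g: "\<And>j I. j \<in> J \<Longrightarrow> finite I \<Longrightarrow> gauss_family M I (Xs j) (\<lambda>i k. r (nat \<bar>i - k\<bar>))"
  shows "((\<lambda>\<beta>. measure M {\<omega>\<in>space M. \<forall>i. (p \<and> level y \<beta> < \<beta> * real_of_int i) \<or> (q \<and> level x \<beta> < \<beta> * (- real_of_int i)) \<longrightarrow>
       \<not> (\<forall>j\<in>J. \<beta> * \<bar>real_of_int i\<bar> < Xs j i \<omega>)})
     \<longlongrightarrow> (\<integral>z. exp (- intensity p q y x (\<Sum>j\<in>J. z j)) \<partial>(\<Pi>\<^sub>M j\<in>J. \<Phi>))) (at_right 0)"
    (is "((\<lambda>\<beta>. measure M (?E \<beta>)) \<longlongrightarrow> ?L) _")
proof -
  interpret prob_space M by fact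
  obtain j0 where j0: "j0 \<in> J" using cJ D by (metis card.empty ex_in_conv not_one_le_zero)
  have J0: "J \<noteq> {}" using j0 by auto
  have m [measurable]: "Xs j i \<in> borel_measurable M" if "j \<in> J" for j i
    using g[OF that, of "{i}"] by (auto simp: gauss_family_def)
  define V where "V I j \<omega> = (\<lambda>i\<in>I. Xs j i \<omega>)" for I j \<omega>
  have mV: "V I j \<in> measurable M (\<Pi>\<^sub>M i\<in>I. borel)" if "j \<in> J" for I j
    unfolding V_def using that by measurable
  define \<mu> where "\<mu> I = distr M (\<Pi>\<^sub>M i\<in>I. borel) (V I j0)" for I
  have \<mu>p: "prob_space (\<mu> I)" for I unfolding \<mu>_def by (rule prob_space_distr[OF mV[OF j0]])
  have \<mu>s: "sets (\<mu> I) = sets (\<Pi>\<^sub>M i\<in>I. borel)" for I by (simp add: \<mu>_def)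
  have \<mu>g: "gauss_family (\<mu> I) I (\<lambda>i x. x i) (\<lambda>i k. r (nat \<bar>i - k\<bar>))" if "finite I" for I
    unfolding gauss_family_def
  proof (intro conjI ballI allI)
    fix i assume "i \<in> I"
    then show "(\<lambda>x. x i) \<in> borel_measurable (\<mu> I)" by (simp add: \<mu>_def)
  next
    fix t :: "int \<Rightarrow> real"
    have "(CLINT x|\<mu> I. iexp (\<Sum>i\<in>I. t i * x i)) = (CLINT \<omega>|M. iexp (\<Sum>i\<in>I. t i * V I j0 \<omega> i))"
      unfolding \<mu>_def by (rule integral_distr[OF mV[OF j0]]) measurable
    also have "\<dots> = (CLINT \<omega>|M. iexp (\<Sum>i\<in>I. t i * Xs j0 i \<omega>))" by (simp add: V_def)
    finally show "(CLINT x|\<mu> I. iexp (\<Sum>i\<in>I. t i * x i)) = complex_of_real (exp (- (\<Sum>i\<in>I. \<Sum>k\<in>I. t i * t k * r (nat \<bar>i - k\<bar>)) / 2))"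
      using g[OF j0 that] unfolding gauss_family_def by simp
  qed
  have law: "distr M (\<Pi>\<^sub>M j\<in>J. \<Pi>\<^sub>M i\<in>I. borel) (\<lambda>\<omega>. \<lambda>j\<in>J. V I j \<omega>) = (\<Pi>\<^sub>M j\<in>J. \<mu> I)" if I: "finite I" for I
  proof -
    have rm: "(\<lambda>x. restrict x I) \<in> measurable (\<Pi>\<^sub>M i\<in>UNIV. borel) (\<Pi>\<^sub>M i\<in>I. borel :: real measure)" by (rule measurable_restrict_subset) simp
    have iv: "indep_vars (\<lambda>_. \<Pi>\<^sub>M i\<in>I. borel) (V I) J"
      using indep_vars_compose2[OF indep rm] by (simp add: V_def[abs_def] restrict_def)
    have "distr M (\<Pi>\<^sub>M j\<in>J. \<Pi>\<^sub>M i\<in>I. borel) (\<lambda>\<omega>. \<lambda>j\<in>J. V I j \<omega>) = (\<Pi>\<^sub>M j\<in>J. distr M (\<Pi>\<^sub>M i\<in>I. borel) (V I j))"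
      using indep_vars_iff_distr_eq_PiM'[OF J0, of "V I" "\<lambda>_. \<Pi>\<^sub>M i\<in>I. borel"] mV iv by blast
    also have "\<dots> = (\<Pi>\<^sub>M j\<in>J. \<mu> I)"
    proof (rule PiM_cong[OF refl])
      fix j assume j: "j \<in> J"
      show "distr M (\<Pi>\<^sub>M i\<in>I. borel) (V I j) = \<mu> I"
        unfolding \<mu>_def V_def[abs_def]
        by (rule char_vector_unique[OF I M M]) (use g[OF j I] g[OF j0 I] in \<open>auto simp: gauss_family_def\<close>)
    qed
    finally show ?thesis .
  qed
  define Ev where "Ev i \<beta> = {\<omega>\<in>space M. \<forall>j\<in>J. \<beta> * \<bar>real_of_int i\<bar> < Xs j i \<omega>}" for i \<beta>
  have Ev_meas [measurable]: "Ev i \<beta> \<in> sets M" for i \<beta>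
    unfolding Ev_def using finJ m by measurable
  define W where "W \<beta> = window p q y x \<beta>" for \<beta>
  define A where "A \<beta> = space M - (\<Union>i\<in>W \<beta>. Ev i \<beta>)" for \<beta>
  have ProbEv: "measure M (Ev i \<beta>) = normal_tail (\<beta> * \<bar>real_of_int i\<bar>) ^ D" for i \<beta>
  proof -
    have "measure M (\<Inter>j\<in>J. (\<lambda>\<omega> i. Xs j i \<omega>) -` {x. \<beta> * \<bar>real_of_int i\<bar> < x i} \<inter> space M) = (\<Prod>j\<in>J. measure M ((\<lambda>\<omega> i. Xs j i \<omega>) -` {x. \<beta> * \<bar>real_of_int i\<bar> < x i} \<inter> space M))"
    proof (rule indep_varsD[OF indep J0 finJ subset_refl])
      fix j
      have "{x \<in> space (\<Pi>\<^sub>M i\<in>(UNIV::int set). borel :: real measure). \<beta> * \<bar>real_of_int i\<bar> < x i} \<in> sets (\<Pi>\<^sub>M i\<in>(UNIV::int set). borel :: real measure)" by measurable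
      then show "{x. \<beta> * \<bar>real_of_int i\<bar> < x i} \<in> sets (\<Pi>\<^sub>M i\<in>(UNIV::int set). borel :: real measure)" by (simp add: space_PiM)
    qed
    moreover have "(\<Inter>j\<in>J. (\<lambda>\<omega> i. Xs j i \<omega>) -` {x. \<beta> * \<bar>real_of_int i\<bar> < x i} \<inter> space M) = Ev i \<beta>"
      using J0 by (auto simp: Ev_def)
    moreover have "measure M ((\<lambda>\<omega> i. Xs j i \<omega>) -` {x. \<beta> * \<bar>real_of_int i\<bar> < x i} \<inter> space M) = normal_tail (\<beta> * \<bar>real_of_int i\<bar>)" if "j \<in> J" for j
    proof -
      have "(\<lambda>\<omega> i. Xs j i \<omega>) -` {x. \<beta> * \<bar>real_of_int i\<bar> < x i} \<inter> space M = {\<omega>\<in>space M. \<beta> * \<bar>real_of_int i\<bar> < Xs j i \<omega>}" by auto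
      then show ?thesis using measure_gauss_gt[OF M g[OF that, of "{i}"]] r0 by simp
    qed
    ultimately show ?thesis using cJ by simp
  qed
  have probA: "\<forall>\<^sub>F \<beta> in at_right 0. measure M (A \<beta>) = (\<integral>x. (\<Prod>i\<in>W \<beta>. 1 - (\<Prod>j\<in>J. indicator {\<beta> * \<bar>real_of_int i\<bar><..} (x j i) :: real)) \<partial>(\<Pi>\<^sub>M j\<in>J. \<mu> (W \<beta>)))"
    using beta_small
  proof eventually_elim
    case (elim \<beta>)
    have finW: "finite (W \<beta>)" unfolding W_def using elim by (intro finite_window) simp
    let ?F = "\<lambda>x. \<Prod>i\<in>W \<beta>. 1 - (\<Prod>j\<in>J. indicator {\<beta> * \<bar>real_of_int i\<bar><..} (x j i) :: real)"
    have mVV: "(\<lambda>\<omega>. \<lambda>j\<in>J. V (W \<beta>) j \<omega>) \<in> measurable M (\<Pi>\<^sub>M j\<in>J. \<Pi>\<^sub>M i\<in>W \<beta>. borel)"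
      by (rule measurable_restrict) (rule mV)
    have comp: "(\<lambda>x. x j i) \<in> borel_measurable (\<Pi>\<^sub>M j\<in>J. \<Pi>\<^sub>M i\<in>W \<beta>. borel :: real measure)" if "j \<in> J" "i \<in> W \<beta>" for j i
      using measurable_comp[OF measurable_component_singleton[OF that(1)] measurable_component_singleton[OF that(2)]] by (simp add: comp_def)
    have mF: "?F \<in> borel_measurable (\<Pi>\<^sub>M j\<in>J. \<Pi>\<^sub>M i\<in>W \<beta>. borel :: real measure)"
    proof (intro borel_measurable_prod borel_measurable_diff borel_measurable_const)
      fix i j assume "i \<in> W \<beta>" "j \<in> J"
      then show "(\<lambda>x. indicator {\<beta> * \<bar>real_of_int i\<bar><..} (x j i) :: real) \<in> borel_measurable (\<Pi>\<^sub>M j\<in>J. \<Pi>\<^sub>M i\<in>W \<beta>. borel :: real measure)"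
        using measurable_compose[OF comp, of j i "indicator {\<beta> * \<bar>real_of_int i\<bar><..} :: real \<Rightarrow> real" borel] by simp
    qed
    have "(\<integral>x. ?F x \<partial>(\<Pi>\<^sub>M j\<in>J. \<mu> (W \<beta>))) = (\<integral>\<omega>. ?F (\<lambda>j\<in>J. V (W \<beta>) j \<omega>) \<partial>M)"
      unfolding law[OF finW, symmetric] by (rule integral_distr[OF mVV mF])
    also have "\<dots> = (\<integral>\<omega>. indicator (A \<beta>) \<omega> \<partial>M)"
    proof (intro Bochner_Integration.integral_cong refl)
      fix \<omega> assume \<omega>: "\<omega> \<in> space M"
      have "(\<Prod>j\<in>J. indicator {\<beta> * \<bar>real_of_int i\<bar><..} ((\<lambda>j\<in>J. V (W \<beta>) j \<omega>) j i) :: real) = indicator (Ev i \<beta>) \<omega>" if "i \<in> W \<beta>" for i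
        using that finJ \<omega> by (auto simp: V_def Ev_def indicator_def prod_zero_iff)
      then have "?F (\<lambda>j\<in>J. V (W \<beta>) j \<omega>) = (\<Prod>i\<in>W \<beta>. 1 - indicator (Ev i \<beta>) \<omega>)" by (intro prod.cong) auto
      also have "\<dots> = indicator (A \<beta>) \<omega>" using finW \<omega> by (auto simp: A_def indicator_def prod_zero_iff)
      finally show "?F (\<lambda>j\<in>J. V (W \<beta>) j \<omega>) = indicator (A \<beta>) \<omega>" .
    qed
    also have "\<dots> = measure M (A \<beta>)"
    proof -
      have "A \<beta> \<in> sets M" unfolding A_def using finW by (intro sets.Diff sets.top sets.finite_UN) auto
      then show ?thesis by simp
    qed
    finally show ?case by simp
  qed
  have ref: "\<forall>\<^sub>F \<beta> in at_right 0. (\<integral>x. (\<Prod>i\<in>W \<beta>. 1 - (\<Prod>j\<in>J. indicator {\<beta> * \<bar>real_of_int i\<bar><..} (x j i) :: real)) \<partial>(\<Pi>\<^sub>M j\<in>J. common_factor_law (\<rho> \<beta>) (W \<beta>)))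
      = (\<integral>z. (\<Prod>i\<in>W \<beta>. 1 - (\<Prod>j\<in>J. normal_tail ((\<beta> * \<bar>real_of_int i\<bar> - sqrt (\<rho> \<beta>) * z j) / sqrt (1 - \<rho> \<beta>)))) \<partial>(\<Pi>\<^sub>M j\<in>J. \<Phi>))"
    using beta_small rho_bounds
  proof eventually_elim
    case (elim \<beta>)
    show ?case
      by (rule expectation_common_factor_copies) (use elim finite_window finJ in \<open>auto simp: W_def\<close>)
  qed
  have limA: "((\<lambda>\<beta>. measure M (A \<beta>)) \<longlongrightarrow> ?L) (at_right 0)"
  proof -
    from tendsto_add[OF comparison_error[OF finJ cJ \<mu>p \<mu>s \<mu>g, of p q y x] reference_limit[OF finJ cJ, of p q y x]]
    have "((\<lambda>\<beta>. ((\<integral>x. (\<Prod>i\<in>W \<beta>. 1 - (\<Prod>j\<in>J. indicator {\<beta> * \<bar>real_of_int i\<bar><..} (x j i) :: real)) \<partial>(\<Pi>\<^sub>M j\<in>J. \<mu> (W \<beta>)))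
      - (\<integral>x. (\<Prod>i\<in>W \<beta>. 1 - (\<Prod>j\<in>J. indicator {\<beta> * \<bar>real_of_int i\<bar><..} (x j i) :: real)) \<partial>(\<Pi>\<^sub>M j\<in>J. common_factor_law (\<rho> \<beta>) (W \<beta>))))
      + (\<integral>z. (\<Prod>i\<in>W \<beta>. 1 - (\<Prod>j\<in>J. normal_tail ((\<beta> * \<bar>real_of_int i\<bar> - sqrt (\<rho> \<beta>) * z j) / sqrt (1 - \<rho> \<beta>)))) \<partial>(\<Pi>\<^sub>M j\<in>J. \<Phi>))) \<longlongrightarrow> 0 + ?L) (at_right 0)"
      unfolding W_def .
    moreover have "\<forall>\<^sub>F \<beta> in at_right 0. ((\<integral>x. (\<Prod>i\<in>W \<beta>. 1 - (\<Prod>j\<in>J. indicator {\<beta> * \<bar>real_of_int i\<bar><..} (x j i) :: real)) \<partial>(\<Pi>\<^sub>M j\<in>J. \<mu> (W \<beta>)))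
      - (\<integral>x. (\<Prod>i\<in>W \<beta>. 1 - (\<Prod>j\<in>J. indicator {\<beta> * \<bar>real_of_int i\<bar><..} (x j i) :: real)) \<partial>(\<Pi>\<^sub>M j\<in>J. common_factor_law (\<rho> \<beta>) (W \<beta>))))
      + (\<integral>z. (\<Prod>i\<in>W \<beta>. 1 - (\<Prod>j\<in>J. normal_tail ((\<beta> * \<bar>real_of_int i\<bar> - sqrt (\<rho> \<beta>) * z j) / sqrt (1 - \<rho> \<beta>)))) \<partial>(\<Pi>\<^sub>M j\<in>J. \<Phi>)) = measure M (A \<beta>)"
      using probA ref by eventually_elim simp
    ultimately have "((\<lambda>\<beta>. measure M (A \<beta>)) \<longlongrightarrow> 0 + ?L) (at_right 0)" by (rule Lim_transform_eventually)
    then show ?thesis by simp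
  qed
  \<comment> \<open>A bound for the probability of a joint exceedance beyond the window. The exponent at \<open>2 a\<close> is four
    times the one at \<open>a\<close>, which gives a fourth power of a quantity of order \<open>\<beta> a\<^bsup>D + 1\<^esup>\<close>.\<close>
  let ?t = "\<lambda>\<beta>. 2 * (exp (- (real D * (2 * a \<beta>)\<^sup>2) / 2) / (1 - exp (- (real D * (2 * a \<beta>) * \<beta>))))"
  have tail0: "(?t \<longlongrightarrow> 0) (at_right 0)"
  proof -
    let ?Q = "\<lambda>\<beta>. exp (- (real D * (a \<beta>)\<^sup>2) / 2) / (\<beta> * (a \<beta>) ^ (D + 1))"
    let ?y = "\<lambda>\<beta>. 2 * real D * (a \<beta> ^ 1 * \<beta>)"
    have y0: "(?y \<longlongrightarrow> 0) (at_right 0)" using tendsto_mult[OF tendsto_const[of "2 * real D"] a_power_beta[of 1]] by (simp only: mult_zero_right)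
    have yp: "\<forall>\<^sub>F \<beta> in at_right 0. ?y \<beta> > 0" using a_pos beta_small by eventually_elim (use D in simp)
    have "((\<lambda>\<beta>. 2 * (?Q \<beta> ^ 4 * (?y \<beta> / (1 - exp (- ?y \<beta>))) / (2 * real D) * (a \<beta> ^ (4 * D + 3) * \<beta>) * (\<beta> * \<beta>))) \<longlongrightarrow> 2 * ((\<kappa> * D * sqrt (2 * pi) ^ D) ^ 4 * 1 / (2 * real D) * 0 * (0 * 0))) (at_right 0)"
      by (intro tendsto_intros a_dens tendsto_one_minus_exp_ratio[OF y0 yp] a_power_beta) (use D in auto)
    then have "((\<lambda>\<beta>. 2 * (?Q \<beta> ^ 4 * (?y \<beta> / (1 - exp (- ?y \<beta>))) / (2 * real D) * (a \<beta> ^ (4 * D + 3) * \<beta>) * (\<beta> * \<beta>))) \<longlongrightarrow> 0) (at_right 0)" by simp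
    moreover have "\<forall>\<^sub>F \<beta> in at_right 0. 2 * (?Q \<beta> ^ 4 * (?y \<beta> / (1 - exp (- ?y \<beta>))) / (2 * real D) * (a \<beta> ^ (4 * D + 3) * \<beta>) * (\<beta> * \<beta>)) = ?t \<beta>"
      using a_pos beta_small
    proof eventually_elim
      case (elim \<beta>)
      have e4: "exp (- (real D * (2 * a \<beta>)\<^sup>2) / 2) = exp (- (real D * (a \<beta>)\<^sup>2) / 2) ^ 4"
        by (simp add: exp_of_nat_mult[symmetric] power_mult_distrib)
      have ey: "real D * (2 * a \<beta>) * \<beta> = ?y \<beta>" by simp
      have h1: "?Q \<beta> ^ 4 * (\<beta> ^ 4 * a \<beta> ^ (4 * D + 4)) = exp (- (real D * (a \<beta>)\<^sup>2) / 2) ^ 4"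
      proof -
        have "a \<beta> ^ (4 * D + 4) = (a \<beta> ^ (D + 1)) ^ 4" by (simp add: power_mult[symmetric] algebra_simps del: power_Suc)
        then show ?thesis using elim by (simp add: power_divide power_mult_distrib del: power_Suc)
      qed
      have h2: "?y \<beta> / (2 * real D) * (a \<beta> ^ (4 * D + 3) * \<beta>) * (\<beta> * \<beta>) = \<beta> ^ 4 * a \<beta> ^ (4 * D + 4)"
        using D by (simp add: power_add numeral_eq_Suc)
      have "2 * (?Q \<beta> ^ 4 * (?y \<beta> / (1 - exp (- ?y \<beta>))) / (2 * real D) * (a \<beta> ^ (4 * D + 3) * \<beta>) * (\<beta> * \<beta>))
         = 2 * (?Q \<beta> ^ 4 * (?y \<beta> / (2 * real D) * (a \<beta> ^ (4 * D + 3) * \<beta>) * (\<beta> * \<beta>)) / (1 - exp (- ?y \<beta>)))"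
      proof -
        have "2 * (Q * (Y / Z) / dd * u * v) = 2 * (Q * (Y / dd * u * v) / Z)" for Q Y Z dd u v :: real by (simp add: mult_ac)
        then show ?thesis .
      qed
      also have "\<dots> = ?t \<beta>" unfolding h2 h1 e4 ey ..
      finally show ?case .
    qed
    ultimately show ?thesis by (rule Lim_transform_eventually)
  qed
  have E_meas: "?E \<beta> \<in> sets M" for \<beta>
  proof -
    have "?E \<beta> = space M - (\<Union>i\<in>{i. (p \<and> level y \<beta> < \<beta> * real_of_int i) \<or> (q \<and> level x \<beta> < \<beta> * (- real_of_int i))}. Ev i \<beta>)"
      by (auto simp: Ev_def)
    then show ?thesis using Ev_meas by (simp add: sets.countable_UN'')
  qed
  have diff: "\<forall>\<^sub>F \<beta> in at_right 0. measure M (A \<beta>) - ?t \<beta> \<le> measure M (?E \<beta>) \<and> measure M (?E \<beta>) \<le> measure M (A \<beta>)"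
    using beta_small a_ge[of 1]
  proof eventually_elim
    case (elim \<beta>)
    have b: "0 < \<beta>" using elim by simp
    have finW: "finite (W \<beta>)" unfolding W_def by (rule finite_window[OF b])
    have A_meas: "A \<beta> \<in> sets M" unfolding A_def using finW by (intro sets.Diff sets.top sets.finite_UN) auto
    define S where "S n = {i::int. 2 * a \<beta> < \<beta> * real_of_int i \<and> \<beta> * real_of_int i \<le> real n}" for n :: nat
    have finS: "finite (S n)" for n unfolding S_def by (rule finite_side[OF b])
    define U where "U n = (\<Union>i\<in>S n. Ev i \<beta> \<union> Ev (- i) \<beta>)" for n
    have U_meas: "U n \<in> sets M" for n unfolding U_def using finS by (intro sets.finite_UN sets.Un) auto
    have Ub: "measure M (U n) \<le> ?t \<beta>" for n
    proof -
      have "measure M (U n) \<le> (\<Sum>i\<in>S n. measure M (Ev i \<beta> \<union> Ev (- i) \<beta>))"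
        unfolding U_def by (rule finite_measure_subadditive_finite[OF finS]) auto
      also have "\<dots> \<le> (\<Sum>i\<in>S n. 2 * exp (- (real D * (\<beta> * real_of_int i)\<^sup>2) / 2))"
      proof (rule sum_mono)
        fix i assume i: "i \<in> S n"
        have bi: "1 \<le> \<beta> * real_of_int i" using i elim by (simp add: S_def)
        then have "0 < real_of_int i" using b by (smt (verit) mult_nonneg_nonpos)
        then have ai: "\<bar>real_of_int i\<bar> = real_of_int i" by simp
        have "measure M (Ev i \<beta> \<union> Ev (- i) \<beta>) \<le> measure M (Ev i \<beta>) + measure M (Ev (- i) \<beta>)"
          by (rule measure_Un_le) auto
        also have "\<dots> = 2 * normal_tail (\<beta> * real_of_int i) ^ D" unfolding ProbEv using ai by simp
        also have "\<dots> \<le> 2 * exp (- (\<beta> * real_of_int i)\<^sup>2 / 2) ^ D"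
          using normal_tail_le_exp[OF bi] normal_tail_bounds01 by (intro mult_left_mono power_mono) auto
        also have "exp (- (\<beta> * real_of_int i)\<^sup>2 / 2) ^ D = exp (- (real D * (\<beta> * real_of_int i)\<^sup>2) / 2)"
          by (simp add: exp_of_nat_mult[symmetric])
        finally show "measure M (Ev i \<beta> \<union> Ev (- i) \<beta>) \<le> 2 * exp (- (real D * (\<beta> * real_of_int i)\<^sup>2) / 2)" .
      qed
      also have "\<dots> = 2 * (\<Sum>i\<in>S n. exp (- (real D * (\<beta> * real_of_int i)\<^sup>2) / 2))" by (simp add: sum_distrib_left)
      also have "\<dots> \<le> ?t \<beta>"
        unfolding S_def using elim by (intro mult_left_mono side_sum_le b) auto
      finally show ?thesis .
    qed
    have UUm: "(\<Union>n. U n) \<in> sets M" using U_meas by (intro sets.countable_UN) auto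
    have incU: "incseq U"
    proof (rule incseq_SucI)
      fix n show "U n \<le> U (Suc n)" unfolding U_def S_def by (intro UN_mono) auto
    qed
    have "(\<lambda>n. measure M (U n)) \<longlonglongrightarrow> measure M (\<Union>n. U n)"
      using U_meas incU by (intro finite_Lim_measure_incseq) auto
    then have UU: "measure M (\<Union>n. U n) \<le> ?t \<beta>"
      by (rule LIMSEQ_le_const2) (use Ub in auto)
    have EA: "?E \<beta> \<subseteq> A \<beta>"
      by (auto simp: A_def W_def window_def Ev_def)
    have AE: "A \<beta> \<subseteq> ?E \<beta> \<union> (\<Union>n. U n)"
    proof
      fix \<omega> assume \<omega>: "\<omega> \<in> A \<beta>"
      show "\<omega> \<in> ?E \<beta> \<union> (\<Union>n. U n)"
      proof (cases "\<omega> \<in> ?E \<beta>")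
        case False
        have sp: "\<omega> \<in> space M" using \<omega> by (simp add: A_def)
        obtain i where i: "(p \<and> level y \<beta> < \<beta> * real_of_int i) \<or> (q \<and> level x \<beta> < \<beta> * (- real_of_int i))" and Ei: "\<omega> \<in> Ev i \<beta>"
          using False sp unfolding Ev_def by blast
        have "i \<notin> W \<beta>" using \<omega> Ei by (auto simp: A_def)
        then have "2 * a \<beta> < \<beta> * real_of_int i \<or> 2 * a \<beta> < \<beta> * (- real_of_int i)"
          using i unfolding W_def window_def by fastforce
        then obtain k where k: "2 * a \<beta> < \<beta> * real_of_int k" "\<omega> \<in> Ev k \<beta> \<union> Ev (- k) \<beta>"
          using Ei by (auto intro: that[of i] that[of "- i"])
        obtain n where "\<beta> * real_of_int k \<le> real n" using real_arch_simple by blast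
        then have "\<omega> \<in> U n" using k by (auto simp: U_def S_def)
        then show ?thesis by blast
      qed simp
    qed
    have "measure M (A \<beta>) \<le> measure M (?E \<beta> \<union> (\<Union>n. U n))"
      by (rule finite_measure_mono[OF AE sets.Un[OF E_meas UUm]])
    also have "\<dots> \<le> measure M (?E \<beta>) + measure M (\<Union>n. U n)"
      by (rule measure_Un_le[OF E_meas UUm])
    finally have "measure M (A \<beta>) - ?t \<beta> \<le> measure M (?E \<beta>)" using UU by linarith
    moreover have "measure M (?E \<beta>) \<le> measure M (A \<beta>)" by (rule finite_measure_mono[OF EA A_meas])
    ultimately show ?case by blast
  qed
  show ?thesis
  proof (rule tendsto_sandwich[where f="\<lambda>\<beta>. measure M (A \<beta>) - ?t \<beta>" and h="\<lambda>\<beta>. measure M (A \<beta>)"])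
    show "((\<lambda>\<beta>. measure M (A \<beta>) - ?t \<beta>) \<longlongrightarrow> ?L) (at_right 0)" using tendsto_diff[OF limA tail0] by simp
    show "\<forall>\<^sub>F \<beta> in at_right 0. measure M (A \<beta>) - ?t \<beta> \<le> measure M (?E \<beta>)" using diff by eventually_elim simp
    show "\<forall>\<^sub>F \<beta> in at_right 0. measure M (?E \<beta>) \<le> measure M (A \<beta>)" using diff by eventually_elim simp
  qed (rule limA)
qed

end

section \<open>Stationary Gaussian sequences\<close>

text \<open>The degenerate normal laws of variance \<open>0\<close> obey the same formula.\<close>

lemma normal_rv_char:
  assumes M: "prob_space M" and Y: "normal_rv M Y" and m0: "prob_space.expectation M Y = 0"
  shows "integrable M (\<lambda>\<omega>. (Y \<omega>)\<^sup>2)"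
    and "(CLINT \<omega>|M. iexp (s * Y \<omega>)) = exp (- (s\<^sup>2 * (\<integral>\<omega>. (Y \<omega>)\<^sup>2 \<partial>M)) / 2)"
proof -
  interpret prob_space M by fact
  have m [measurable]: "Y \<in> borel_measurable M" using Y by (simp add: normal_rv_def)
  obtain \<mu> \<sigma> where \<sigma>: "\<sigma> \<ge> 0" and law: "distr M borel Y = (if \<sigma> = 0 then return borel \<mu> else density lborel (\<lambda>x. ennreal (normal_density \<mu> \<sigma> x)))"
    using Y unfolding normal_rv_def by blast
  have E: "(\<integral>\<omega>. f (Y \<omega>) \<partial>M) = (\<integral>x. f x \<partial>distr M borel Y)" if "f \<in> borel_measurable borel" for f :: "real \<Rightarrow> 'c::{banach, second_countable_topology}"
    using that by (subst integral_distr) auto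
  have I: "integrable M (\<lambda>\<omega>. f (Y \<omega>)) \<longleftrightarrow> integrable (distr M borel Y) f" if "f \<in> borel_measurable borel" for f :: "real \<Rightarrow> real"
    using that by (subst integrable_distr_eq) auto
  have "integrable M (\<lambda>\<omega>. (Y \<omega>)\<^sup>2) \<and> (CLINT \<omega>|M. iexp (s * Y \<omega>)) = exp (- (s\<^sup>2 * (\<integral>\<omega>. (Y \<omega>)\<^sup>2 \<partial>M)) / 2)"
  proof (cases "\<sigma> = 0")
    case True
    have "\<mu> = 0" using m0 E[of "\<lambda>x. x"] law True by (simp add: integral_return)
    have ir: "integrable (return borel (0::real)) (\<lambda>x. x\<^sup>2 :: real)"
      by (rule finite_measure.integrable_const_bound[OF prob_space.axioms(1)[OF prob_space_return], where B=0]) (auto simp: AE_return)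
    then show ?thesis
      using \<open>\<mu> = 0\<close> I[of "\<lambda>x. x\<^sup>2"] E[of "\<lambda>x. x\<^sup>2"] E[of "\<lambda>x. iexp (s * x)"] law True
      by (simp add: integral_return)
  next
    case False
    then have \<sigma>p: "\<sigma> > 0" using \<sigma> by simp
    have dist: "distributed M lborel Y (normal_density \<mu> \<sigma>)"
      using law False unfolding distributed_def by (auto simp: distr_cong[OF refl sets_lborel] cong: distr_cong)
    have "\<mu> = 0" using normal_distributed_expectation[OF \<sigma>p dist] m0 by simp
    then have std: "distributed M lborel (\<lambda>\<omega>. Y \<omega> / \<sigma>) std_normal_density"
      using normal_standard_normal_convert[OF \<sigma>p, of Y \<mu>] dist by simp
    have "distr M borel (\<lambda>\<omega>. Y \<omega> / \<sigma>) = distr M lborel (\<lambda>\<omega>. Y \<omega> / \<sigma>)" by (intro distr_cong) auto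
    also have "\<dots> = \<Phi>" using std by (simp add: distributed_def)
    finally have law': "distr M borel (\<lambda>\<omega>. Y \<omega> / \<sigma>) = \<Phi>" .
    have "integrable (distr M borel (\<lambda>\<omega>. Y \<omega> / \<sigma>)) (\<lambda>x. x\<^sup>2)" unfolding law' by (rule integrable_std_normal_distribution_moment)
    then have i: "integrable M (\<lambda>\<omega>. (Y \<omega> / \<sigma>)\<^sup>2)" by (subst (asm) integrable_distr_eq) auto
    then have "integrable M (\<lambda>\<omega>. \<sigma>\<^sup>2 * (Y \<omega> / \<sigma>)\<^sup>2)" by (rule integrable_mult_right)
    then have i2: "integrable M (\<lambda>\<omega>. (Y \<omega>)\<^sup>2)" using \<sigma>p by (simp add: power_divide)
    have "(\<integral>\<omega>. (Y \<omega> / \<sigma>)\<^sup>2 \<partial>M) = (\<integral>x. x\<^sup>2 \<partial>distr M borel (\<lambda>\<omega>. Y \<omega> / \<sigma>))" by (subst integral_distr) auto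
    also have "\<dots> = 1" unfolding law' using std_normal_distribution_even_moments(1)[of 1] by simp
    finally have v: "(\<integral>\<omega>. (Y \<omega>)\<^sup>2 \<partial>M) = \<sigma>\<^sup>2" using \<sigma>p by (simp add: power_divide)
    have "(CLINT \<omega>|M. iexp (s * Y \<omega>)) = (CLINT \<omega>|M. iexp (s * \<sigma> * (Y \<omega> / \<sigma>)))" using \<sigma>p by simp
    also have "\<dots> = (CLINT x|distr M borel (\<lambda>\<omega>. Y \<omega> / \<sigma>). iexp (s * \<sigma> * x))" by (subst integral_distr) auto
    also have "\<dots> = exp (- ((s * \<sigma>)\<^sup>2) / 2)" unfolding law' by (rule expectation_iexp_std_normal)
    finally show ?thesis using i2 v by (simp add: power_mult_distrib)
  qed
  then show "integrable M (\<lambda>\<omega>. (Y \<omega>)\<^sup>2)" "(CLINT \<omega>|M. iexp (s * Y \<omega>)) = exp (- (s\<^sup>2 * (\<integral>\<omega>. (Y \<omega>)\<^sup>2 \<partial>M)) / 2)" by auto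
qed

lemma sequence_law_integral:
  fixes f :: "(int \<Rightarrow> real) \<Rightarrow> 'c::{banach, second_countable_topology}"
  assumes "\<And>i. X i \<in> borel_measurable M" and f: "f \<in> borel_measurable (\<Pi>\<^sub>M i\<in>UNIV. borel)"
  shows "(\<integral>x. f x \<partial>sequence_law M X) = (\<integral>\<omega>. f (\<lambda>i. X i \<omega>) \<partial>M)"
  unfolding sequence_law_def
proof (rule integral_distr[OF _ f])
  show "(\<lambda>\<omega> i. X i \<omega>) \<in> measurable M (\<Pi>\<^sub>M i\<in>UNIV. borel)"
    by (rule measurable_PiM_single') (use assms in auto)
qed

context
  fixes N :: "'b measure" and X :: "int \<Rightarrow> 'b \<Rightarrow> real"
  assumes N: "prob_space N" and X: "standard_stationary_gaussian N X"
begin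

interpretation prob_space N by (rule N)

lemma stationary_linear_combination: "finite I \<Longrightarrow> normal_rv N (\<lambda>\<omega>. \<Sum>i\<in>I. t i * X i \<omega>)"
  using X unfolding standard_stationary_gaussian_def gaussian_sequence_def by simp

lemma stationary_measurable [measurable]: "X i \<in> borel_measurable N"
proof -
  have "normal_rv N (\<lambda>\<omega>. \<Sum>k\<in>{i}. 1 * X k \<omega>)" by (rule stationary_linear_combination) simp
  then show ?thesis by (simp add: normal_rv_def)
qed

lemma stationary_moments:
  shows "integrable N (\<lambda>\<omega>. (X i \<omega>)\<^sup>2)" "integrable N (X i)" "expectation (X i) = 0" "expectation (\<lambda>\<omega>. (X i \<omega>)\<^sup>2) = 1"
    "integrable N (\<lambda>\<omega>. X i \<omega> * X k \<omega>)"
proof -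
  have mv: "\<forall>i. expectation (X i) = 0 \<and> variance (X i) = 1"
    using X unfolding standard_stationary_gaussian_def by (elim conjE)
  have e0: "expectation (X i) = 0" for i by (rule mv[rule_format, THEN conjunct1])
  have v1: "variance (X i) = 1" for i by (rule mv[rule_format, THEN conjunct2])
  have nr: "normal_rv N (X i)" for i
  proof -
    have "normal_rv N (\<lambda>\<omega>. \<Sum>k\<in>{i}. 1 * X k \<omega>)" by (rule stationary_linear_combination) simp
    then show ?thesis by simp
  qed
  have sq: "integrable N (\<lambda>\<omega>. (X i \<omega>)\<^sup>2)" for i by (rule normal_rv_char(1)[OF N nr e0])
  show "integrable N (\<lambda>\<omega>. (X i \<omega>)\<^sup>2)" by (rule sq)
  show "integrable N (X i)" by (rule square_integrable_imp_integrable[OF _ sq]) simp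
  show "expectation (X i) = 0" by (rule e0)
  show "expectation (\<lambda>\<omega>. (X i \<omega>)\<^sup>2) = 1" using v1[of i] unfolding e0 by simp
  show "integrable N (\<lambda>\<omega>. X i \<omega> * X k \<omega>)"
  proof (rule Bochner_Integration.integrable_bound[of _ "\<lambda>\<omega>. (X i \<omega>)\<^sup>2 + (X k \<omega>)\<^sup>2"])
    have "\<bar>x * y\<bar> \<le> x\<^sup>2 + y\<^sup>2" for x y :: real
    proof -
      have "0 \<le> (\<bar>x\<bar> - \<bar>y\<bar>)\<^sup>2" by simp
      then have "2 * \<bar>x * y\<bar> \<le> x\<^sup>2 + y\<^sup>2" by (simp add: power2_diff abs_mult)
      then show ?thesis using abs_ge_zero[of "x * y"] by linarith
    qed
    then show "AE \<omega> in N. norm (X i \<omega> * X k \<omega>) \<le> norm ((X i \<omega>)\<^sup>2 + (X k \<omega>)\<^sup>2)" by (intro AE_I2) simp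
  qed (use sq in auto)
qed

lemma stationary_covariance: "expectation (\<lambda>\<omega>. X i \<omega> * X k \<omega>) = covariance_fun N X (nat \<bar>i - k\<bar>)"
proof -
  have shift: "expectation (\<lambda>\<omega>. X i \<omega> * X (i + int n) \<omega>) = covariance_fun N X n" for i n
  proof -
    let ?f = "\<lambda>x::int \<Rightarrow> real. x 1 * x (int n + 1)"
    have f: "?f \<in> borel_measurable (\<Pi>\<^sub>M i\<in>UNIV. borel)" by measurable
    have "(\<integral>x. ?f x \<partial>sequence_law N (\<lambda>l. X (l + (i - 1)))) = (\<integral>x. ?f x \<partial>sequence_law N X)"
      using X unfolding standard_stationary_gaussian_def stationary_sequence_def by simp
    then show ?thesis
      by (subst (asm) (1 2) sequence_law_integral[OF _ f]) (auto simp: covariance_fun_def algebra_simps)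
  qed
  show ?thesis
  proof (cases "i \<le> k")
    case True
    then show ?thesis using shift[of i "nat (k - i)"] by (simp add: abs_minus_commute)
  next
    case False
    then show ?thesis using shift[of k "nat (i - k)"] by (simp add: mult.commute)
  qed
qed

lemma covariance_0: "covariance_fun N X 0 = 1"
  using stationary_covariance[of 1 1] stationary_moments(4)[of 1] by (simp add: power2_eq_square)

lemma stationary_gauss_family:
  assumes fin: "finite I"
  shows "gauss_family N I X (\<lambda>i k. covariance_fun N X (nat \<bar>i - k\<bar>))"
  unfolding gauss_family_def
proof (intro conjI ballI allI)
  fix t :: "int \<Rightarrow> real"
  let ?Y = "\<lambda>\<omega>. \<Sum>i\<in>I. t i * X i \<omega>"
  have nr: "normal_rv N ?Y" by (rule stationary_linear_combination[OF fin])
  have e: "expectation ?Y = 0" using stationary_moments by (simp add: Bochner_Integration.integral_sum)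
  have "expectation (\<lambda>\<omega>. (?Y \<omega>)\<^sup>2) = expectation (\<lambda>\<omega>. \<Sum>i\<in>I. \<Sum>k\<in>I. t i * t k * (X i \<omega> * X k \<omega>))"
    by (intro Bochner_Integration.integral_cong) (auto simp: power2_eq_square sum_product mult_ac intro!: sum.cong)
  also have "\<dots> = (\<Sum>i\<in>I. \<Sum>k\<in>I. t i * t k * covariance_fun N X (nat \<bar>i - k\<bar>))"
    using stationary_moments by (simp add: Bochner_Integration.integral_sum stationary_covariance)
  finally have v: "expectation (\<lambda>\<omega>. (?Y \<omega>)\<^sup>2) = (\<Sum>i\<in>I. \<Sum>k\<in>I. t i * t k * covariance_fun N X (nat \<bar>i - k\<bar>))" .
  have "(CLINT \<omega>|N. iexp (1 * ?Y \<omega>)) = exp (- (1\<^sup>2 * expectation (\<lambda>\<omega>. (?Y \<omega>)\<^sup>2)) / 2)"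
    by (rule normal_rv_char(2)[OF N nr e])
  then show "(CLINT \<omega>|N. iexp (?Y \<omega>)) = complex_of_real (exp (- (\<Sum>i\<in>I. \<Sum>k\<in>I. t i * t k * covariance_fun N X (nat \<bar>i - k\<bar>)) / 2))"
    unfolding v by (simp del: of_real_sum)
qed simp

lemma copy_gauss_family:
  fixes Y :: "int \<Rightarrow> 'a \<Rightarrow> real"
  assumes fin: "finite I" and Y: "\<And>i. Y i \<in> borel_measurable M" and law: "sequence_law M Y = sequence_law N X"
  shows "gauss_family M I Y (\<lambda>i k. covariance_fun N X (nat \<bar>i - k\<bar>))"
  unfolding gauss_family_def
proof (intro conjI ballI allI Y)
  fix t :: "int \<Rightarrow> real"
  have f: "(\<lambda>x. iexp (\<Sum>i\<in>I. t i * x i)) \<in> borel_measurable (\<Pi>\<^sub>M i\<in>UNIV. borel :: real measure)" by measurable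
  have "(CLINT \<omega>|M. iexp (\<Sum>i\<in>I. t i * Y i \<omega>)) = (CLINT x|sequence_law M Y. iexp (\<Sum>i\<in>I. t i * x i))"
    by (rule sequence_law_integral[OF Y f, symmetric])
  also have "\<dots> = (CLINT \<omega>|N. iexp (\<Sum>i\<in>I. t i * X i \<omega>))"
    unfolding law by (rule sequence_law_integral[OF stationary_measurable f])
  also have "\<dots> = complex_of_real (exp (- (\<Sum>i\<in>I. \<Sum>k\<in>I. t i * t k * covariance_fun N X (nat \<bar>i - k\<bar>)) / 2))"
    by (rule stationary_gauss_family[OF fin, unfolded gauss_family_def, THEN conjunct2, rule_format])
  finally show "(CLINT \<omega>|M. iexp (\<Sum>i\<in>I. t i * Y i \<omega>)) = complex_of_real (exp (- (\<Sum>i\<in>I. \<Sum>k\<in>I. t i * t k * covariance_fun N X (nat \<bar>i - k\<bar>)) / 2))" .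
qed

text \<open>If the correlation at some distance \<open>n\<close> were \<open>\<plusminus>1\<close>, then \<open>X\<^bsub>i+n\<^esub> = \<plusminus> X\<^sub>i\<close> almost surely,
  and the correlation would have modulus one at every multiple of \<open>n\<close>. A covariance that tends to
  zero is therefore bounded away from one.\<close>

lemma covariance_bounded_away:
  assumes lim: "covariance_fun N X \<longlonglongrightarrow> 0"
  shows "\<exists>\<delta>. 1 / 2 \<le> \<delta> \<and> \<delta> < 1 \<and> (\<forall>n\<ge>1. \<bar>covariance_fun N X n\<bar> \<le> \<delta>)"
proof -
  let ?r = "covariance_fun N X"
  have dev: "expectation (\<lambda>\<omega>. (X (i + int n) \<omega> - s * X i \<omega>)\<^sup>2) = 1 + s\<^sup>2 - 2 * s * ?r n" for i n s
  proof -
    have "expectation (\<lambda>\<omega>. (X (i + int n) \<omega> - s * X i \<omega>)\<^sup>2) = expectation (\<lambda>\<omega>. (X (i + int n) \<omega>)\<^sup>2 + s\<^sup>2 * (X i \<omega>)\<^sup>2 - 2 * s * (X (i + int n) \<omega> * X i \<omega>))"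
      by (intro Bochner_Integration.integral_cong) (auto simp: power2_eq_square algebra_simps)
    also have "\<dots> = 1 + s\<^sup>2 - 2 * s * ?r n"
      using stationary_moments by (simp add: stationary_covariance)
    finally show ?thesis .
  qed
  have le1: "\<bar>?r n\<bar> \<le> 1" for n
  proof -
    have "0 \<le> expectation (\<lambda>\<omega>. (X (0 + int n) \<omega> - s * X 0 \<omega>)\<^sup>2)" for s by (rule integral_nonneg_AE) simp
    then have "0 \<le> 1 + s\<^sup>2 - 2 * s * ?r n" for s unfolding dev .
    from this[of 1] this[of "-1"] show ?thesis by simp
  qed
  have lt1: "\<bar>?r n\<bar> < 1" if n: "n \<ge> 1" for n
  proof (rule ccontr)
    assume "\<not> \<bar>?r n\<bar> < 1"
    then have r1: "\<bar>?r n\<bar> = 1" using le1[of n] by simp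
    define s where "s = ?r n"
    have s: "\<bar>s\<bar> = 1" "s\<^sup>2 = 1" "s * s = 1" using r1 by (auto simp: s_def power2_eq_square abs_if split: if_splits)
    have ae: "AE \<omega> in N. X (i + int n) \<omega> = s * X i \<omega>" for i
    proof -
      have e0: "expectation (\<lambda>\<omega>. (X (i + int n) \<omega> - s * X i \<omega>)\<^sup>2) = 0" unfolding dev using s by (simp add: s_def[symmetric])
      have "(\<lambda>\<omega>. (X (i + int n) \<omega> - s * X i \<omega>)\<^sup>2) = (\<lambda>\<omega>. (X (i + int n) \<omega>)\<^sup>2 + s\<^sup>2 * (X i \<omega>)\<^sup>2 - 2 * s * (X (i + int n) \<omega> * X i \<omega>))"
        by (simp add: fun_eq_iff power2_eq_square algebra_simps)
      moreover have "integrable N \<dots>"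
        by (intro Bochner_Integration.integrable_add Bochner_Integration.integrable_diff integrable_mult_right stationary_moments)
      ultimately have "integrable N (\<lambda>\<omega>. (X (i + int n) \<omega> - s * X i \<omega>)\<^sup>2)" by (simp only:)
      from integral_nonneg_eq_0_iff_AE[OF this] e0
      have "AE \<omega> in N. (X (i + int n) \<omega> - s * X i \<omega>)\<^sup>2 = 0" by simp
      then show ?thesis by (rule eventually_mono) simp
    qed
    have mult: "\<bar>?r (m * n)\<bar> = 1" for m
    proof (induction m)
      case 0
      then show ?case using covariance_0 by simp
    next
      case (Suc m)
      have ix: "nat \<bar>0 - (int a + int b)\<bar> = a + b" "nat \<bar>0 - int a\<bar> = a" for a b by simp_all
      have "?r (Suc m * n) = ?r (m * n + n)" by (simp add: add.commute)
      also have "\<dots> = expectation (\<lambda>\<omega>. X 0 \<omega> * X (int (m * n) + int n) \<omega>)"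
        unfolding stationary_covariance ix ..
      also have "\<dots> = expectation (\<lambda>\<omega>. s * (X 0 \<omega> * X (int (m * n)) \<omega>))"
      proof (rule integral_cong_AE)
        show "AE \<omega> in N. X 0 \<omega> * X (int (m * n) + int n) \<omega> = s * (X 0 \<omega> * X (int (m * n)) \<omega>)"
          using ae[of "int (m * n)"] by (rule eventually_mono) simp
      qed measurable
      also have "\<dots> = s * ?r (m * n)" by (simp only: integral_mult_right_zero stationary_covariance ix)
      finally show ?case using Suc s by (simp add: abs_mult)
    qed
    have "\<forall>\<^sub>F k in sequentially. \<bar>?r k\<bar> < 1 / 2"
      using lim by (auto simp: tendsto_iff dist_real_def elim!: allE[of _ "1 / 2"])
    then obtain K where K: "\<And>k. k \<ge> K \<Longrightarrow> \<bar>?r k\<bar> < 1 / 2" by (auto simp: eventually_sequentially)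
    have "K \<le> K * n" using n by simp
    from K[OF this] mult[of K] show False by simp
  qed
  have "\<forall>\<^sub>F k in sequentially. \<bar>?r k\<bar> < 1 / 2"
    using lim by (auto simp: tendsto_iff dist_real_def elim!: allE[of _ "1 / 2"])
  then obtain K where K: "\<And>k. k \<ge> K \<Longrightarrow> \<bar>?r k\<bar> < 1 / 2" by (auto simp: eventually_sequentially)
  define S where "S = insert (1 / 2) ((\<lambda>n. \<bar>?r n\<bar>) ` {1..K})"
  have S: "finite S" "S \<noteq> {}" by (auto simp: S_def)
  show ?thesis
  proof (intro exI conjI allI impI)
    show "1 / 2 \<le> Max S" using S by (intro Max_ge) (auto simp: S_def)
    show "Max S < 1" using S lt1 by (subst Max_less_iff) (auto simp: S_def)
    fix n :: nat assume n: "n \<ge> 1"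
    show "\<bar>?r n\<bar> \<le> Max S"
    proof (cases "n \<le> K")
      case True
      then show ?thesis using S n by (intro Max_ge) (auto simp: S_def)
    next
      case False
      then have "\<bar>?r n\<bar> \<le> 1 / 2" using K[of n] by simp
      also have "1 / 2 \<le> Max S" using S by (intro Max_ge) (auto simp: S_def)
      finally show ?thesis .
    qed
  qed
qed

end

section \<open>Asymptotics of the norming constants\<close>

text \<open>With \<open>L = ln (\<surd>(1 - \<rho>) / \<beta>)\<close> the norming constant \<open>A\<close> satisfies \<open>k A\<^sup>2 / 2 = G\<close> for
  \<open>G = L - (k + 1) / 2 * ln (2 L / k) + c\<close>. Hence \<open>exp (- G)\<close> is \<open>\<beta>\<close> times the \<open>(k + 1)\<close>-st power of
  \<open>\<surd>(2 L / k)\<close>, up to a convergent factor, and \<open>\<surd>(2 L / k)\<close> is asymptotic to \<open>A\<close> itself.\<close>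

lemma crossing_levels_a_level:
  assumes k: "1 \<le> k" "k \<le> d" and \<gamma>: "\<gamma> > 0"
  shows "crossing_levels (\<lambda>\<beta>. a_level d (\<beta> / sqrt (1 - rho \<gamma> \<beta>)) k) \<gamma> (1 / real (d choose k)) k"
proof -
  define c where "c = ln (real (d choose k) * (1 / real k) * (2 * pi) powr (- real k / 2))"
  define s where "s \<beta> = sqrt (1 - rho \<gamma> \<beta>)" for \<beta>
  define L where "L \<beta> = ln (1 / (\<beta> / s \<beta>))" for \<beta>
  define G where "G x = x - (real k + 1) / 2 * ln (2 / real k * x) + c" for x
  define A where "A \<beta> = a_level d (\<beta> / s \<beta>) k" for \<beta>
  have kp: "real k > 0" "real (d choose k) > 0" using k by auto
  have rho0: "(rho \<gamma> \<longlongrightarrow> 0) (at_right 0)"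
  proof -
    have "((\<lambda>\<beta>. \<gamma> * (1 / \<bar>ln \<beta>\<bar>)) \<longlongrightarrow> \<gamma> * 0) (at_right 0)" by (intro tendsto_mult tendsto_const) real_asymp
    then show ?thesis by (simp add: rho_def[abs_def])
  qed
  have s1: "(s \<longlongrightarrow> 1) (at_right 0)"
  proof -
    have "((\<lambda>\<beta>. sqrt (1 - rho \<gamma> \<beta>)) \<longlongrightarrow> sqrt (1 - 0)) (at_right 0)" by (intro tendsto_intros rho0)
    then show ?thesis by (simp add: s_def[abs_def])
  qed
  have sp: "\<forall>\<^sub>F \<beta> in at_right 0. 0 < s \<beta>" using s1 by (rule order_tendstoD) simp
  have bs: "\<forall>\<^sub>F \<beta>::real in at_right 0. 0 < \<beta> \<and> \<beta> < 1"
    using eventually_at_right_real[of 0 "1::real"] by (auto elim: eventually_mono)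
  have L0: "filterlim (\<lambda>\<beta>::real. ln (1 / \<beta>)) at_top (at_right 0)" by real_asymp
  have Leq: "\<forall>\<^sub>F \<beta> in at_right 0. L \<beta> = ln (s \<beta>) + ln (1 / \<beta>)"
    using sp bs by eventually_elim (simp add: L_def ln_div)
  have Lratio: "((\<lambda>\<beta>. L \<beta> / ln (1 / \<beta>)) \<longlongrightarrow> 1) (at_right 0)"
  proof -
    have "((\<lambda>\<beta>. ln (s \<beta>) * inverse (ln (1 / \<beta>)) + 1) \<longlongrightarrow> ln 1 * 0 + 1) (at_right 0)"
      by (intro tendsto_intros s1 tendsto_inverse_0_at_top L0) auto
    moreover have "\<forall>\<^sub>F \<beta>::real in at_right 0. ln (1 / \<beta>) > 0" using L0 by (auto simp: filterlim_at_top_dense)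
    then have "\<forall>\<^sub>F \<beta> in at_right 0. ln (s \<beta>) * inverse (ln (1 / \<beta>)) + 1 = L \<beta> / ln (1 / \<beta>)"
      using Leq by eventually_elim (simp add: field_simps)
    ultimately have "((\<lambda>\<beta>. L \<beta> / ln (1 / \<beta>)) \<longlongrightarrow> ln 1 * 0 + 1) (at_right 0)" by (rule Lim_transform_eventually)
    then show ?thesis by simp
  qed
  have Ltop: "filterlim L at_top (at_right 0)"
  proof -
    have "filterlim (\<lambda>\<beta>. L \<beta> / ln (1 / \<beta>) * ln (1 / \<beta>)) at_top (at_right 0)"
      by (rule filterlim_tendsto_pos_mult_at_top[OF Lratio _ L0]) simp
    moreover have "\<forall>\<^sub>F \<beta>::real in at_right 0. ln (1 / \<beta>) > 0" using L0 by (auto simp: filterlim_at_top_dense)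
    then have "\<forall>\<^sub>F \<beta> in at_right 0. L \<beta> / ln (1 / \<beta>) * ln (1 / \<beta>) = L \<beta>" by eventually_elim simp
    ultimately show ?thesis by (rule filterlim_cong[OF refl refl, THEN iffD1, rotated])
  qed
  have Gr: "((\<lambda>x. G x / x) \<longlongrightarrow> 1) at_top" unfolding G_def using kp(1) by real_asymp
  have GL: "((\<lambda>\<beta>. G (L \<beta>) / L \<beta>) \<longlongrightarrow> 1) (at_right 0)" by (rule filterlim_compose[OF Gr Ltop])
  have Lpos: "\<forall>\<^sub>F \<beta> in at_right 0. L \<beta> > 0" using Ltop by (auto simp: filterlim_at_top_dense)
  have Gpos: "\<forall>\<^sub>F \<beta> in at_right 0. G (L \<beta>) > 0"
  proof -
    have "\<forall>\<^sub>F \<beta> in at_right 0. 0 < G (L \<beta>) / L \<beta>" using GL by (rule order_tendstoD) simp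
    then show ?thesis using Lpos by eventually_elim (simp add: zero_less_divide_iff)
  qed
  have Aeq: "A \<beta> = sqrt (2 / real k * G (L \<beta>))" for \<beta>
    unfolding A_def a_level_def G_def L_def c_def by simp
  have Asq: "\<forall>\<^sub>F \<beta> in at_right 0. (A \<beta>)\<^sup>2 = 2 / real k * G (L \<beta>)"
    using Gpos by eventually_elim (use kp in \<open>simp add: Aeq\<close>)
  have Apos: "\<forall>\<^sub>F \<beta> in at_right 0. A \<beta> > 0"
    using Gpos by eventually_elim (use kp in \<open>simp add: Aeq\<close>)
  have lim_sq: "((\<lambda>\<beta>. (A \<beta>)\<^sup>2 / ln (1 / \<beta>)) \<longlongrightarrow> 2 / real k) (at_right 0)"
  proof -
    have "((\<lambda>\<beta>. 2 / real k * (G (L \<beta>) / L \<beta>) * (L \<beta> / ln (1 / \<beta>))) \<longlongrightarrow> 2 / real k * 1 * 1) (at_right 0)"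
      by (intro tendsto_mult tendsto_const GL Lratio)
    moreover have "\<forall>\<^sub>F \<beta> in at_right 0. 2 / real k * (G (L \<beta>) / L \<beta>) * (L \<beta> / ln (1 / \<beta>)) = (A \<beta>)\<^sup>2 / ln (1 / \<beta>)"
      using Asq Lpos by eventually_elim simp
    ultimately have "((\<lambda>\<beta>. (A \<beta>)\<^sup>2 / ln (1 / \<beta>)) \<longlongrightarrow> 2 / real k * 1 * 1) (at_right 0)" by (rule Lim_transform_eventually)
    then show ?thesis by simp
  qed
  have ec: "exp (- c) = 1 / real (d choose k) * real k * sqrt (2 * pi) ^ k"
  proof -
    have "exp c = real (d choose k) * (1 / real k) * (2 * pi) powr (- real k / 2)"
      unfolding c_def using kp by (intro exp_ln mult_pos_pos) auto
    moreover have "(2 * pi) powr (- real k / 2) = 1 / sqrt (2 * pi) ^ k"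
    proof -
      have "sqrt (2 * pi) ^ k = ((2 * pi) powr (1 / 2)) powr real k"
        by (simp add: powr_half_sqrt powr_realpow)
      also have "\<dots> = (2 * pi) powr (real k / 2)" by (simp add: powr_powr)
      finally show ?thesis by (simp add: powr_minus_divide)
    qed
    ultimately have "exp c = real (d choose k) / (real k * sqrt (2 * pi) ^ k)" by simp
    then show ?thesis using kp by (simp add: exp_minus)
  qed
  have lim_dens: "((\<lambda>\<beta>. exp (- (real k * (A \<beta>)\<^sup>2) / 2) / (\<beta> * A \<beta> ^ (k + 1))) \<longlongrightarrow> 1 / real (d choose k) * real k * sqrt (2 * pi) ^ k) (at_right 0)"
  proof -
    have "((\<lambda>\<beta>. 1 / s \<beta> * inverse (G (L \<beta>) / L \<beta>) powr ((real k + 1) / 2) * exp (- c)) \<longlongrightarrow> 1 / 1 * inverse 1 powr ((real k + 1) / 2) * exp (- c)) (at_right 0)"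
      by (intro tendsto_intros s1 GL) auto
    moreover have "\<forall>\<^sub>F \<beta> in at_right 0. 1 / s \<beta> * inverse (G (L \<beta>) / L \<beta>) powr ((real k + 1) / 2) * exp (- c) = exp (- (real k * (A \<beta>)\<^sup>2) / 2) / (\<beta> * A \<beta> ^ (k + 1))"
      using Asq Apos Lpos Gpos sp bs
    proof eventually_elim
      case (elim \<beta>)
      let ?h = "(real k + 1) / 2"
      have b: "0 < \<beta>" using elim by simp
      have "exp (- (real k * (A \<beta>)\<^sup>2) / 2) = exp (- G (L \<beta>))" using elim(1) kp by simp
      also have "\<dots> = exp (- L \<beta>) * exp (?h * ln (2 / real k * L \<beta>)) * exp (- c)"
        unfolding exp_add[symmetric] G_def by (simp add: algebra_simps)
      also have "exp (- L \<beta>) = \<beta> / s \<beta>" using elim b by (simp add: L_def exp_minus)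
      also have "exp (?h * ln (2 / real k * L \<beta>)) = (2 / real k * L \<beta>) powr ?h" using elim kp by (simp add: powr_def)
      finally have e: "exp (- (real k * (A \<beta>)\<^sup>2) / 2) = \<beta> / s \<beta> * (2 / real k * L \<beta>) powr ?h * exp (- c)" .
      have "A \<beta> ^ (k + 1) = ((A \<beta>)\<^sup>2) powr ?h"
      proof -
        have "((A \<beta>)\<^sup>2) powr ?h = (A \<beta> powr 2) powr ?h" using elim by simp
        also have "\<dots> = A \<beta> powr real (k + 1)" unfolding powr_powr by (rule arg_cong[where f="\<lambda>t. A \<beta> powr t"]) simp
        also have "\<dots> = A \<beta> ^ (k + 1)" using elim by (intro powr_realpow) simp
        finally show ?thesis ..
      qed
      also have "\<dots> = (2 / real k * G (L \<beta>)) powr ?h" using elim by simp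
      finally have a: "A \<beta> ^ (k + 1) = (2 / real k * G (L \<beta>)) powr ?h" .
      have "inverse (G (L \<beta>) / L \<beta>) = (2 / real k * L \<beta>) / (2 / real k * G (L \<beta>))" using kp by simp
      then have "inverse (G (L \<beta>) / L \<beta>) powr ?h = (2 / real k * L \<beta>) powr ?h / (2 / real k * G (L \<beta>)) powr ?h"
        using kp elim by (simp only: powr_divide)
      then show ?case unfolding e a using b by simp
    qed
    ultimately have "((\<lambda>\<beta>. exp (- (real k * (A \<beta>)\<^sup>2) / 2) / (\<beta> * A \<beta> ^ (k + 1))) \<longlongrightarrow> 1 / 1 * inverse 1 powr ((real k + 1) / 2) * exp (- c)) (at_right 0)"
      by (rule Lim_transform_eventually)
    then show ?thesis by (simp add: ec)
  qed
  show ?thesis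
    unfolding crossing_levels_def A_def[unfolded s_def, symmetric]
    using \<gamma> k Apos lim_sq lim_dens by simp
qed

section \<open>Order statistics, first crossings and last exits\<close>

lemma order_stat_max_gt:
  assumes "1 \<le> d" shows "t < order_stat d 1 x \<longleftrightarrow> (\<exists>j\<in>{1..d}. t < x j)"
proof -
  let ?s = "sort (map x [1..<Suc d])"
  have len: "length ?s = d" by simp
  have st: "set ?s = x ` {1..d}" by (auto simp: atLeastLessThanSuc_atLeastAtMost)
  have o: "order_stat d 1 x = ?s ! (d - 1)" using assms len by (simp add: order_stat_def rev_nth)
  show ?thesis
  proof
    assume "t < order_stat d 1 x"
    moreover have "?s ! (d - 1) \<in> set ?s" using assms len by (intro nth_mem) linarith
    ultimately show "\<exists>j\<in>{1..d}. t < x j" unfolding o st by auto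
  next
    assume "\<exists>j\<in>{1..d}. t < x j"
    then obtain v where "v \<in> set ?s" "t < v" unfolding st by auto
    then obtain n where n: "n < d" "?s ! n = v" using len by (metis in_set_conv_nth)
    have "?s ! n \<le> ?s ! (d - 1)" using n len by (intro sorted_nth_mono) auto
    then show "t < order_stat d 1 x" unfolding o using n \<open>t < v\<close> by simp
  qed
qed

lemma order_stat_min_gt:
  assumes "1 \<le> d" shows "t < order_stat d d x \<longleftrightarrow> (\<forall>j\<in>{1..d}. t < x j)"
proof -
  let ?s = "sort (map x [1..<Suc d])"
  have len: "length ?s = d" by simp
  have st: "set ?s = x ` {1..d}" by (auto simp: atLeastLessThanSuc_atLeastAtMost)
  have o: "order_stat d d x = ?s ! 0" using assms len by (simp add: order_stat_def rev_nth)
  show ?thesis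
  proof
    assume t: "t < order_stat d d x"
    show "\<forall>j\<in>{1..d}. t < x j"
    proof
      fix j assume "j \<in> {1..d}"
      then have "x j \<in> set ?s" unfolding st by auto
      then obtain n where n: "n < d" "?s ! n = x j" using len by (metis in_set_conv_nth)
      have "?s ! 0 \<le> ?s ! n" using n len by (intro sorted_nth_mono) auto
      then show "t < x j" using less_le_trans[OF t[unfolded o]] unfolding n(2) by blast
    qed
  next
    assume a: "\<forall>j\<in>{1..d}. t < x j"
    have "?s ! 0 \<in> set ?s" using assms len by (intro nth_mem) linarith
    then show "t < order_stat d d x" unfolding o st using a by auto
  qed
qed

lemma int_bounded_below_least:
  fixes P :: "int \<Rightarrow> bool"
  assumes "P i" "\<And>i. P i \<Longrightarrow> b \<le> i"
  shows "\<exists>i. P i \<and> (\<forall>k. P k \<longrightarrow> i \<le> k)"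
proof -
  have ex: "P (b + int (nat (i - b)))" using assms by simp
  define n where "n = (LEAST n::nat. P (b + int n))"
  have P: "P (b + int n)" unfolding n_def by (rule LeastI[of "\<lambda>n. P (b + int n)"]) (rule ex)
  have "b + int n \<le> k" if "P k" for k
  proof -
    have "P (b + int (nat (k - b)))" using assms(2)[OF that] that by simp
    then have "n \<le> nat (k - b)" unfolding n_def by (rule Least_le)
    then show ?thesis using assms(2)[OF that] by linarith
  qed
  then show ?thesis using P by blast
qed

text \<open>Both functionals written with quantifiers over the integers only. This shows measurability
  also on the paths without a minimum or maximum, where the value is a fixed integer.\<close>

lemma first_crossing_ge_iff:
  "c \<le> real_of_int (first_crossing \<beta> y) \<longleftrightarrow>
    (if \<exists>i. - \<beta> * real_of_int i < y i \<and> (\<forall>k. - \<beta> * real_of_int k < y k \<longrightarrow> i \<le> k)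
     then \<forall>i. - \<beta> * real_of_int i < y i \<longrightarrow> c \<le> real_of_int i
     else c \<le> real_of_int (THE i. False))"
proof (cases "\<exists>i. - \<beta> * real_of_int i < y i \<and> (\<forall>k. - \<beta> * real_of_int k < y k \<longrightarrow> i \<le> k)")
  case True
  then obtain i where i: "- \<beta> * real_of_int i < y i" "\<And>k. - \<beta> * real_of_int k < y k \<Longrightarrow> i \<le> k" by blast
  have fe: "first_crossing \<beta> y = i" unfolding first_crossing_def by (rule Least_equality) (fact i)+
  have ce: "c \<le> real_of_int i \<longleftrightarrow> (\<forall>k. - \<beta> * real_of_int k < y k \<longrightarrow> c \<le> real_of_int k)"
  proof
    assume c: "c \<le> real_of_int i"
    show "\<forall>k. - \<beta> * real_of_int k < y k \<longrightarrow> c \<le> real_of_int k"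
    proof (intro allI impI)
      fix k assume "- \<beta> * real_of_int k < y k"
      then have "i \<le> k" by (rule i(2))
      then show "c \<le> real_of_int k" using c by linarith
    qed
  next
    assume "\<forall>k. - \<beta> * real_of_int k < y k \<longrightarrow> c \<le> real_of_int k"
    then show "c \<le> real_of_int i" using i(1) by blast
  qed
  show ?thesis unfolding if_P[OF True] fe by (rule ce)
next
  case False
  have none: "P = (\<lambda>_. False)" if "\<not> (\<exists>i. P i)" for P :: "int \<Rightarrow> bool" using that by auto
  have ff: "(\<lambda>i. - \<beta> * real_of_int i < y i \<and> (\<forall>k. - \<beta> * real_of_int k < y k \<longrightarrow> i \<le> k)) = (\<lambda>i. False)" by (rule none[OF False])
  have "first_crossing \<beta> y = (THE i. False)" unfolding first_crossing_def Least_def by (rule arg_cong[OF ff])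
  then show ?thesis unfolding if_not_P[OF False] by (rule arg_cong)
qed

lemma last_exit_le_iff:
  "real_of_int (last_exit \<beta> y) \<le> c \<longleftrightarrow>
    (if \<exists>i\<ge>0. \<beta> * real_of_int i < y i then
      (if \<exists>i. (0 \<le> i \<and> \<beta> * real_of_int i < y i) \<and> (\<forall>k. 0 \<le> k \<and> \<beta> * real_of_int k < y k \<longrightarrow> k \<le> i)
       then \<forall>i. 0 \<le> i \<and> \<beta> * real_of_int i < y i \<longrightarrow> real_of_int i \<le> c
       else real_of_int (THE i. False) \<le> c)
     else 0 \<le> c)"
proof (cases "\<exists>i\<ge>0. \<beta> * real_of_int i < y i")
  case ne: True
  show ?thesis
  proof (cases "\<exists>i. (0 \<le> i \<and> \<beta> * real_of_int i < y i) \<and> (\<forall>k. 0 \<le> k \<and> \<beta> * real_of_int k < y k \<longrightarrow> k \<le> i)")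
    case True
    then obtain i where i: "0 \<le> i \<and> \<beta> * real_of_int i < y i" "\<And>k. 0 \<le> k \<and> \<beta> * real_of_int k < y k \<Longrightarrow> k \<le> i" by blast
    have "(GREATEST i. 0 \<le> i \<and> \<beta> * real_of_int i < y i) = i" by (rule Greatest_equality) (fact i)+
    then have le: "last_exit \<beta> y = i" unfolding last_exit_def if_P[OF ne] .
    have ce: "real_of_int i \<le> c \<longleftrightarrow> (\<forall>k. 0 \<le> k \<and> \<beta> * real_of_int k < y k \<longrightarrow> real_of_int k \<le> c)"
    proof
      assume c: "real_of_int i \<le> c"
      show "\<forall>k. 0 \<le> k \<and> \<beta> * real_of_int k < y k \<longrightarrow> real_of_int k \<le> c"
      proof (intro allI impI)
        fix k assume "0 \<le> k \<and> \<beta> * real_of_int k < y k"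
        then have "k \<le> i" by (rule i(2))
        then show "real_of_int k \<le> c" using c by linarith
      qed
    next
      assume "\<forall>k. 0 \<le> k \<and> \<beta> * real_of_int k < y k \<longrightarrow> real_of_int k \<le> c"
      then show "real_of_int i \<le> c" using i(1) by blast
    qed
    show ?thesis unfolding if_P[OF ne] if_P[OF True] le by (rule ce)
  next
    case False
    have none: "P = (\<lambda>_. False)" if "\<not> (\<exists>i. P i)" for P :: "int \<Rightarrow> bool" using that by auto
    have ff: "(\<lambda>i. (0 \<le> i \<and> \<beta> * real_of_int i < y i) \<and> (\<forall>k. 0 \<le> k \<and> \<beta> * real_of_int k < y k \<longrightarrow> k \<le> i)) = (\<lambda>i. False)" by (rule none[OF False])
    have "last_exit \<beta> y = (THE i. False)" unfolding last_exit_def if_P[OF ne] Greatest_def by (rule arg_cong[OF ff])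
    then show ?thesis unfolding if_P[OF ne] if_not_P[OF False] by (rule arg_cong)
  qed
next
  case False
  then have "last_exit \<beta> y = 0" unfolding last_exit_def by (rule if_not_P)
  then show ?thesis unfolding if_not_P[OF False] by simp
qed

text \<open>On a path that stays below the two lines far out and above \<open>- \<beta> i\<close> somewhere, the two
  functionals are determined by the absence of exceedances.\<close>

lemma exit_events_iff:
  assumes b: "\<beta> > 0" and N: "\<And>n::nat. n \<ge> N \<Longrightarrow> y (int n) \<le> \<beta> * real n \<and> y (- int n) \<le> \<beta> * real n"
    and ne: "- \<beta> * real_of_int i0 < y i0" and u: "0 \<le> u" and v: "0 \<le> v"
  shows "(q \<longrightarrow> - u \<le> real_of_int (first_crossing \<beta> y)) \<and> (p \<longrightarrow> real_of_int (last_exit \<beta> y) \<le> v) \<longleftrightarrow>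
     (\<forall>i. (p \<and> v < real_of_int i) \<or> (q \<and> u < - real_of_int i) \<longrightarrow> \<not> \<beta> * \<bar>real_of_int i\<bar> < y i)"
proof -
  have "\<exists>i. - \<beta> * real_of_int i < y i \<and> (\<forall>k. - \<beta> * real_of_int k < y k \<longrightarrow> i \<le> k)"
  proof (rule int_bounded_below_least[where b="- int N" and i=i0])
    show "- \<beta> * real_of_int i0 < y i0" by (rule ne)
    fix i :: int assume i: "- \<beta> * real_of_int i < y i"
    show "- int N \<le> i"
    proof (rule ccontr)
      assume "\<not> - int N \<le> i"
      then have "N \<le> nat (- i)" "int (nat (- i)) = - i" by auto
      with N[of "nat (- i)"] i show False by (simp add: of_nat_nat)
    qed
  qed
  then have fc: "- u \<le> real_of_int (first_crossing \<beta> y) \<longleftrightarrow> (\<forall>i. - \<beta> * real_of_int i < y i \<longrightarrow> - u \<le> real_of_int i)"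
    unfolding first_crossing_ge_iff by (rule if_P)
  have le: "real_of_int (last_exit \<beta> y) \<le> v \<longleftrightarrow> (\<forall>i. 0 \<le> i \<and> \<beta> * real_of_int i < y i \<longrightarrow> real_of_int i \<le> v)"
  proof (cases "\<exists>i\<ge>0. \<beta> * real_of_int i < y i")
    case True
    then obtain i1 where i1: "0 \<le> i1" "\<beta> * real_of_int i1 < y i1" by blast
    have "\<exists>i. (0 \<le> - i \<and> \<beta> * real_of_int (- i) < y (- i)) \<and> (\<forall>k. 0 \<le> - k \<and> \<beta> * real_of_int (- k) < y (- k) \<longrightarrow> i \<le> k)"
    proof (rule int_bounded_below_least[where b="- int N" and i="- i1"])
      show "0 \<le> - (- i1) \<and> \<beta> * real_of_int (- (- i1)) < y (- (- i1))" using i1 by simp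
      fix i :: int assume i: "0 \<le> - i \<and> \<beta> * real_of_int (- i) < y (- i)"
      show "- int N \<le> i"
      proof (rule ccontr)
        assume "\<not> - int N \<le> i"
        then have "N \<le> nat (- i)" "int (nat (- i)) = - i" by auto
        with N[of "nat (- i)"] i show False by (simp add: of_nat_nat)
      qed
    qed
    then obtain i where i: "0 \<le> - i \<and> \<beta> * real_of_int (- i) < y (- i)" "\<forall>k. 0 \<le> - k \<and> \<beta> * real_of_int (- k) < y (- k) \<longrightarrow> i \<le> k" by blast
    have "\<exists>i. (0 \<le> i \<and> \<beta> * real_of_int i < y i) \<and> (\<forall>k. 0 \<le> k \<and> \<beta> * real_of_int k < y k \<longrightarrow> k \<le> i)"
    proof (intro exI[of _ "- i"] conjI allI impI)
      fix k assume "0 \<le> k \<and> \<beta> * real_of_int k < y k"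
      then have "i \<le> - k" using i(2)[rule_format, of "- k"] by simp
      then show "k \<le> - i" by simp
    qed (use i in auto)
    then show ?thesis unfolding last_exit_le_iff if_P[OF True] by (rule if_P)
  next
    case False
    then have "\<forall>i. 0 \<le> i \<and> \<beta> * real_of_int i < y i \<longrightarrow> real_of_int i \<le> v" by blast
    then show ?thesis unfolding last_exit_le_iff if_not_P[OF False] using v by blast
  qed
  have 1: "(\<forall>i. - \<beta> * real_of_int i < y i \<longrightarrow> - u \<le> real_of_int i) \<longleftrightarrow> (\<forall>i. u < - real_of_int i \<longrightarrow> \<not> \<beta> * \<bar>real_of_int i\<bar> < y i)"
  proof -
    have "- \<beta> * real_of_int i = \<beta> * \<bar>real_of_int i\<bar>" if "u < - real_of_int i" for i :: int using that u by simp
    then show ?thesis by (metis linorder_not_less minus_less_iff neg_less_iff_less)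
  qed
  have 2: "(\<forall>i. 0 \<le> i \<and> \<beta> * real_of_int i < y i \<longrightarrow> real_of_int i \<le> v) \<longleftrightarrow> (\<forall>i. v < real_of_int i \<longrightarrow> \<not> \<beta> * \<bar>real_of_int i\<bar> < y i)"
  proof -
    have "\<beta> * real_of_int i = \<beta> * \<bar>real_of_int i\<bar>" "0 \<le> i" if "v < real_of_int i" for i :: int using that v by auto
    moreover have "\<beta> * real_of_int i = \<beta> * \<bar>real_of_int i\<bar>" if "0 \<le> i" for i :: int using that by simp
    ultimately show ?thesis by (metis linorder_not_less)
  qed
  show ?thesis unfolding fc le 1 2 by blast
qed

section \<open>The limit laws\<close>

context
  fixes M :: "'a measure" and Xs :: "nat \<Rightarrow> int \<Rightarrow> 'a \<Rightarrow> real" and d :: nat and r :: "nat \<Rightarrow> real"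
  assumes M: "prob_space M" and d: "1 \<le> d" and r0: "r 0 = 1"
    and g: "\<And>j I. j \<in> {1..d} \<Longrightarrow> finite I \<Longrightarrow> gauss_family M I (Xs j) (\<lambda>i k. r (nat \<bar>i - k\<bar>))"
begin

interpretation prob_space M by (rule M)

lemma copy_measurable: "j \<in> {1..d} \<Longrightarrow> Xs j i \<in> borel_measurable M"
  using g[of j "{i}"] by (auto simp: gauss_family_def)

lemma order_stat_gt_all:
  assumes "k = 1 \<or> k = d" and "\<And>j. j \<in> {1..d} \<Longrightarrow> t < Xs j i \<omega>"
  shows "t < order_stat_seq d k Xs \<omega> i"
  using assms(1)
proof
  assume k: "k = 1"
  have "\<exists>j\<in>{1..d}. t < Xs j i \<omega>" using assms(2)[of 1] d by (intro bexI[of _ 1]) auto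
  then show ?thesis unfolding order_stat_seq_def k order_stat_max_gt[OF d] .
next
  assume k: "k = d"
  show ?thesis unfolding order_stat_seq_def k order_stat_min_gt[OF d] using assms(2) by blast
qed

lemma order_stat_le_all:
  assumes "k = 1 \<or> k = d" and "\<And>j. j \<in> {1..d} \<Longrightarrow> Xs j i \<omega> \<le> t"
  shows "order_stat_seq d k Xs \<omega> i \<le> t"
  using assms(1)
proof
  assume k: "k = 1"
  have "\<not> (\<exists>j\<in>{1..d}. t < Xs j i \<omega>)" using assms(2) by (auto simp: not_less)
  then show ?thesis unfolding order_stat_seq_def k order_stat_max_gt[OF d, symmetric] by simp
next
  assume k: "k = d"
  have "\<not> (\<forall>j\<in>{1..d}. t < Xs j i \<omega>)" using assms(2)[of 1] d by (auto simp: not_less intro!: bexI[of _ 1])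
  then show ?thesis unfolding order_stat_seq_def k order_stat_min_gt[OF d, symmetric] by simp
qed

lemma order_stat_measurable:
  assumes "k = 1 \<or> k = d" shows "(\<lambda>\<omega>. order_stat_seq d k Xs \<omega> i) \<in> borel_measurable M"
  unfolding borel_measurable_iff_greater
proof
  fix t
  have s: "{\<omega>\<in>space M. t < Xs j i \<omega>} \<in> sets M" if "j \<in> {1..d}" for j
    using copy_measurable[OF that, of i] unfolding borel_measurable_iff_greater by blast
  show "{\<omega>\<in>space M. t < order_stat_seq d k Xs \<omega> i} \<in> sets M"
    using assms
  proof
    assume k: "k = 1"
    show ?thesis unfolding order_stat_seq_def k order_stat_max_gt[OF d]
      by (rule sets.sets_Collect_finite_Ex) (use s in auto)
  next
    assume k: "k = d"
    show ?thesis unfolding order_stat_seq_def k order_stat_min_gt[OF d]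
      by (rule sets.sets_Collect_finite_All) (use s d in auto)
  qed
qed

lemma AE_copies_below_line:
  fixes f :: "nat \<Rightarrow> int"
  assumes c: "c > 0" and s: "s = 1 \<or> s = -1"
  shows "AE \<omega> in M. \<forall>\<^sub>F n in sequentially. \<forall>j\<in>{1..d}. s * Xs j (f n) \<omega> \<le> c * real n"
proof -
  have "AE \<omega> in M. \<forall>j\<in>{1..d}. \<forall>\<^sub>F n in sequentially. s * Xs j (f n) \<omega> \<le> c * real n"
  proof (rule AE_finite_allI)
    fix j assume j: "j \<in> {1..d}"
    have G: "gauss_family M {i} (\<lambda>i \<omega>. s * Xs j i \<omega>) (\<lambda>i k. r (nat \<bar>i - k\<bar>))" for i
      using s
    proof
      assume "s = 1" then show ?thesis using g[OF j, of "{i}"] by simp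
    next
      assume "s = -1" then show ?thesis using gauss_family_uminus[OF g[OF j, of "{i}"]] by simp
    qed
    show "AE \<omega> in M. \<forall>\<^sub>F n in sequentially. s * Xs j (f n) \<omega> \<le> c * real n"
      by (rule AE_eventually_below_line[OF M G _ c]) (simp add: r0)
  qed simp
  then show ?thesis
    by (rule eventually_mono) (rule eventually_ball_finite, auto)
qed

text \<open>The order statistics inherit the sublinear growth of the copies, so that almost every path
  meets the conditions under which the first crossing and the last exit are read off from the
  absence of exceedances.\<close>

lemma measure_exit_events:
  assumes k: "k = 1 \<or> k = d" and b: "\<beta> > 0" and u: "0 \<le> u" and v: "0 \<le> v"
  shows "measure M {\<omega>\<in>space M. (q \<longrightarrow> - u \<le> real_of_int (first_crossing \<beta> (order_stat_seq d k Xs \<omega>))) \<and>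
        (p \<longrightarrow> real_of_int (last_exit \<beta> (order_stat_seq d k Xs \<omega>)) \<le> v)}
    = measure M {\<omega>\<in>space M. \<forall>i. (p \<and> v < real_of_int i) \<or> (q \<and> u < - real_of_int i) \<longrightarrow>
        \<not> \<beta> * \<bar>real_of_int i\<bar> < order_stat_seq d k Xs \<omega> i}" (is "measure M ?A = measure M ?B")
proof (rule measure_eq_AE)
  have m [measurable]: "(\<lambda>\<omega>. order_stat_seq d k Xs \<omega> i) \<in> borel_measurable M" for i by (rule order_stat_measurable[OF k])
  show "?A \<in> sets M"
    unfolding first_crossing_ge_iff last_exit_le_iff if_bool_eq_disj by measurable
  show "?B \<in> sets M" by measurable
  have "AE \<omega> in M. (\<omega> \<in> ?A \<longleftrightarrow> \<omega> \<in> ?B) \<or> \<omega> \<notin> space M"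
    using AE_copies_below_line[OF b disjI1[OF refl], of int] AE_copies_below_line[OF b disjI1[OF refl], of "\<lambda>n. - int n"]
      AE_copies_below_line[OF half_gt_zero[OF b] disjI2[OF refl], of int]
  proof eventually_elim
    case (elim \<omega>)
    let ?y = "order_stat_seq d k Xs \<omega>"
    have "\<forall>\<^sub>F n in sequentially. ?y (int n) \<le> \<beta> * real n \<and> ?y (- int n) \<le> \<beta> * real n"
      using elim(1,2) by eventually_elim (intro conjI order_stat_le_all[OF k], auto)
    then obtain N where N: "\<And>n. n \<ge> N \<Longrightarrow> ?y (int n) \<le> \<beta> * real n \<and> ?y (- int n) \<le> \<beta> * real n"
      unfolding eventually_sequentially by blast
    \<comment> \<open>Slope \<open>\<beta> / 2\<close> rather than \<open>\<beta>\<close>, because the crossing has to be strict.\<close>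
    obtain n where n: "n \<ge> 1" "\<And>j. j \<in> {1..d} \<Longrightarrow> - 1 * Xs j (int n) \<omega> \<le> \<beta> / 2 * real n"
      using elim(3) unfolding eventually_sequentially by (metis nle_le)
    have "- \<beta> * real_of_int (int n) < ?y (int n)"
    proof (rule order_stat_gt_all[OF k])
      fix j assume "j \<in> {1..d}"
      from n(2)[OF this] have "- (\<beta> / 2 * real n) \<le> Xs j (int n) \<omega>" by simp
      moreover have "\<beta> / 2 * real n < \<beta> * real n" using b n by simp
      ultimately show "- \<beta> * real_of_int (int n) < Xs j (int n) \<omega>" by simp
    qed
    from exit_events_iff[OF b N this u v, where q=q and p=p] show ?case by auto
  qed
  then show "AE \<omega> in M. \<omega> \<in> ?A \<longleftrightarrow> \<omega> \<in> ?B" by (rule AE_mp) (intro AE_I2, blast)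
qed

context
  fixes \<gamma> \<delta> :: real
  assumes \<gamma>: "\<gamma> > 0" and \<delta>: "1 / 2 \<le> \<delta>" "\<delta> < 1" and r_le: "\<And>n. n \<ge> 1 \<Longrightarrow> \<bar>r n\<bar> \<le> \<delta>"
    and r_ln: "(\<lambda>n. r n * ln (real n)) \<longlonglongrightarrow> \<gamma>"
    and indep: "indep_vars (\<lambda>_. \<Pi>\<^sub>M i\<in>(UNIV::int set). borel) (\<lambda>j \<omega> i. Xs j i \<omega>) {1..d}"
begin

lemma long_range_levels_a_level:
  assumes "1 \<le> k" "k \<le> d"
  shows "long_range_levels (\<lambda>\<beta>. a_level d (\<beta> / sqrt (1 - rho \<gamma> \<beta>)) k) \<gamma> (1 / real (d choose k)) k r \<delta>"
  by (intro long_range_levels.intro crossing_levels_a_level long_range_levels_axioms.intro assms \<gamma> r0 r_le \<delta> r_ln)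

text \<open>The minimum exceeds a level when all copies do, so one application of the limit for joint
  exceedances of \<open>d\<close> copies suffices.\<close>

lemma min_limit:
  "((\<lambda>\<beta>. measure M {\<omega>\<in>space M. (q \<longrightarrow> - u_min d \<gamma> \<beta> x \<le> real_of_int (first_crossing \<beta> (order_stat_seq d d Xs \<omega>))) \<and>
        (p \<longrightarrow> real_of_int (last_exit \<beta> (order_stat_seq d d Xs \<omega>)) \<le> u_min d \<gamma> \<beta> y)})
    \<longlongrightarrow> (\<integral>z. exp (- ((if q then exp (- sqrt (2 * (1 / real d) * \<gamma>) * (x - (\<Sum>j=1..d. z j))) else 0)
          + (if p then exp (- sqrt (2 * (1 / real d) * \<gamma>) * (y - (\<Sum>j=1..d. z j))) else 0))) \<partial>Phi_prod d)) (at_right 0)"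
proof -
  interpret L: long_range_levels "\<lambda>\<beta>. a_level d (\<beta> / sqrt (1 - rho \<gamma> \<beta>)) d" \<gamma> "1 / real (d choose d)" d r \<delta>
    by (rule long_range_levels_a_level[OF d order_refl])
  have "((\<lambda>\<beta>. measure M {\<omega>\<in>space M. \<forall>i. (p \<and> L.level y \<beta> < \<beta> * real_of_int i) \<or> (q \<and> L.level x \<beta> < \<beta> * (- real_of_int i)) \<longrightarrow>
       \<not> (\<forall>j\<in>{1..d}. \<beta> * \<bar>real_of_int i\<bar> < Xs j i \<omega>)})
     \<longlongrightarrow> (\<integral>z. exp (- L.intensity p q y x (\<Sum>j\<in>{1..d}. z j)) \<partial>(\<Pi>\<^sub>M j\<in>{1..d}. \<Phi>))) (at_right 0)"
    by (rule L.crossing_limit[OF M _ _ indep g]) auto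
  moreover have "\<forall>\<^sub>F \<beta> in at_right 0. measure M {\<omega>\<in>space M. \<forall>i. (p \<and> L.level y \<beta> < \<beta> * real_of_int i) \<or> (q \<and> L.level x \<beta> < \<beta> * (- real_of_int i)) \<longrightarrow>
       \<not> (\<forall>j\<in>{1..d}. \<beta> * \<bar>real_of_int i\<bar> < Xs j i \<omega>)}
     = measure M {\<omega>\<in>space M. (q \<longrightarrow> - u_min d \<gamma> \<beta> x \<le> real_of_int (first_crossing \<beta> (order_stat_seq d d Xs \<omega>))) \<and>
        (p \<longrightarrow> real_of_int (last_exit \<beta> (order_stat_seq d d Xs \<omega>)) \<le> u_min d \<gamma> \<beta> y)}"
    using L.beta_small L.level_pos[of x] L.level_pos[of y]
  proof eventually_elim
    case (elim \<beta>)
    then have b: "\<beta> > 0" by simp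
    have u: "u_min d \<gamma> \<beta> t = L.level t \<beta> / \<beta>" for t
      unfolding u_min_def b_level_def L.level_def by simp
    have c: "L.level t \<beta> / \<beta> < s \<longleftrightarrow> L.level t \<beta> < \<beta> * s" for t s
      using b by (simp add: pos_divide_less_eq mult.commute)
    have "0 \<le> u_min d \<gamma> \<beta> x" "0 \<le> u_min d \<gamma> \<beta> y" unfolding u using elim by simp_all
    from measure_exit_events[OF _ b this, of d q p] show ?case
      unfolding u c order_stat_seq_def order_stat_min_gt[OF d] by simp
  qed
  ultimately have "((\<lambda>\<beta>. measure M {\<omega>\<in>space M. (q \<longrightarrow> - u_min d \<gamma> \<beta> x \<le> real_of_int (first_crossing \<beta> (order_stat_seq d d Xs \<omega>))) \<and>
        (p \<longrightarrow> real_of_int (last_exit \<beta> (order_stat_seq d d Xs \<omega>)) \<le> u_min d \<gamma> \<beta> y)})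
     \<longlongrightarrow> (\<integral>z. exp (- L.intensity p q y x (\<Sum>j\<in>{1..d}. z j)) \<partial>(\<Pi>\<^sub>M j\<in>{1..d}. \<Phi>))) (at_right 0)"
    by (rule Lim_transform_eventually)
  moreover have "L.intensity p q y x s = (if q then exp (- sqrt (2 * (1 / real d) * \<gamma>) * (x - s)) else 0)
      + (if p then exp (- sqrt (2 * (1 / real d) * \<gamma>) * (y - s)) else 0)" for s
    unfolding L.intensity_def by simp
  ultimately show ?thesis unfolding Phi_prod_def by (simp only:)
qed

text \<open>The maximum stays below a level when all copies do. Hence the probability is the \<open>d\<close>-th power
  of the one for a single copy, and so is the limit. The constant \<open>1 / d\<close> in the intensity comes
  from the binomial coefficient in \<^term>\<open>a_level\<close>, which raises the level by as much as the maximum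
  of \<open>d\<close> copies requires.\<close>

lemma max_limit:
  "((\<lambda>\<beta>. measure M {\<omega>\<in>space M. (q \<longrightarrow> - u_max d \<gamma> \<beta> x \<le> real_of_int (first_crossing \<beta> (order_stat_seq d 1 Xs \<omega>))) \<and>
        (p \<longrightarrow> real_of_int (last_exit \<beta> (order_stat_seq d 1 Xs \<omega>)) \<le> u_max d \<gamma> \<beta> y)})
    \<longlongrightarrow> (\<integral>z. exp (- (1 / real d) * (\<Sum>j=1..d. (if q then exp (- sqrt (2 * \<gamma>) * (x - z j)) else 0)
          + (if p then exp (- sqrt (2 * \<gamma>) * (y - z j)) else 0))) \<partial>Phi_prod d)) (at_right 0)"
proof -
  interpret L: long_range_levels "\<lambda>\<beta>. a_level d (\<beta> / sqrt (1 - rho \<gamma> \<beta>)) 1" \<gamma> "1 / real (d choose 1)" 1 r \<delta>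
    by (rule long_range_levels_a_level[OF order_refl d])
  interpret \<Phi>: product_prob_space "\<lambda>_::nat. \<Phi>" by (rule product_prob_space_std_normal)
  define E where "E j \<beta> = {\<omega>\<in>space M. \<forall>i. (p \<and> L.level y \<beta> < \<beta> * real_of_int i) \<or> (q \<and> L.level x \<beta> < \<beta> * (- real_of_int i)) \<longrightarrow>
       \<not> \<beta> * \<bar>real_of_int i\<bar> < Xs j i \<omega>}" for j \<beta>
  define h where "h z = exp (- L.intensity p q y x z)" for z
  have hm [measurable]: "h \<in> borel_measurable borel" unfolding h_def L.intensity_def by measurable
  have lim1: "((\<lambda>\<beta>. measure M (E j \<beta>)) \<longlongrightarrow> (\<integral>z. h z \<partial>\<Phi>)) (at_right 0)" if j: "j \<in> {1..d}" for j
  proof -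
    have "((\<lambda>\<beta>. measure M {\<omega>\<in>space M. \<forall>i. (p \<and> L.level y \<beta> < \<beta> * real_of_int i) \<or> (q \<and> L.level x \<beta> < \<beta> * (- real_of_int i)) \<longrightarrow>
       \<not> (\<forall>j\<in>{j}. \<beta> * \<bar>real_of_int i\<bar> < Xs j i \<omega>)})
     \<longlongrightarrow> (\<integral>z. exp (- L.intensity p q y x (\<Sum>j\<in>{j}. z j)) \<partial>(\<Pi>\<^sub>M j\<in>{j}. \<Phi>))) (at_right 0)"
      by (rule L.crossing_limit[OF M _ _ indep_vars_subset[OF indep] g]) (use j in auto)
    moreover have "(\<integral>z. h (z j) \<partial>(\<Pi>\<^sub>M j\<in>{j}. \<Phi>)) = (\<integral>z. h z \<partial>\<Phi>)"
      by (rule \<Phi>.product_integral_singleton) simp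
    ultimately show ?thesis unfolding E_def h_def by simp
  qed
  have "((\<lambda>\<beta>. \<Prod>j\<in>{1..d}. measure M (E j \<beta>)) \<longlongrightarrow> (\<Prod>j\<in>{1..d}. \<integral>z. h z \<partial>\<Phi>)) (at_right 0)"
    by (intro tendsto_prod lim1)
  moreover have "\<forall>\<^sub>F \<beta> in at_right 0. (\<Prod>j\<in>{1..d}. measure M (E j \<beta>))
     = measure M {\<omega>\<in>space M. (q \<longrightarrow> - u_max d \<gamma> \<beta> x \<le> real_of_int (first_crossing \<beta> (order_stat_seq d 1 Xs \<omega>))) \<and>
        (p \<longrightarrow> real_of_int (last_exit \<beta> (order_stat_seq d 1 Xs \<omega>)) \<le> u_max d \<gamma> \<beta> y)}"
    using L.beta_small L.level_pos[of x] L.level_pos[of y]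
  proof eventually_elim
    case (elim \<beta>)
    then have b: "\<beta> > 0" by simp
    have u: "u_max d \<gamma> \<beta> t = L.level t \<beta> / \<beta>" for t
      unfolding u_max_def b_level_def L.level_def by simp
    have c: "L.level t \<beta> / \<beta> < s \<longleftrightarrow> L.level t \<beta> < \<beta> * s" for t s
      using b by (simp add: pos_divide_less_eq mult.commute)
    have "0 \<le> u_max d \<gamma> \<beta> x" "0 \<le> u_max d \<gamma> \<beta> y" unfolding u using elim by simp_all
    note ev = measure_exit_events[OF _ b this, of 1 q p]
    define A where "A = {w\<in>space (\<Pi>\<^sub>M i\<in>(UNIV::int set). borel :: real measure). \<forall>i. (p \<and> L.level y \<beta> < \<beta> * real_of_int i) \<or> (q \<and> L.level x \<beta> < \<beta> * (- real_of_int i)) \<longrightarrow>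
       \<not> \<beta> * \<bar>real_of_int i\<bar> < w i}"
    have A: "A \<in> sets (\<Pi>\<^sub>M i\<in>(UNIV::int set). borel)" unfolding A_def by measurable
    have EA: "E j \<beta> = (\<lambda>\<omega> i. Xs j i \<omega>) -` A \<inter> space M" for j
      by (auto simp: E_def A_def space_PiM)
    have "(\<Prod>j\<in>{1..d}. measure M (E j \<beta>)) = measure M (\<Inter>j\<in>{1..d}. E j \<beta>)"
      unfolding EA by (rule indep_varsD[OF indep, symmetric]) (use d A in auto)
    also have "(\<Inter>j\<in>{1..d}. E j \<beta>) = {\<omega>\<in>space M. \<forall>i. (p \<and> L.level y \<beta> < \<beta> * real_of_int i) \<or> (q \<and> L.level x \<beta> < \<beta> * (- real_of_int i)) \<longrightarrow>
       \<not> (\<exists>j\<in>{1..d}. \<beta> * \<bar>real_of_int i\<bar> < Xs j i \<omega>)}"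
    proof -
      have "1 \<in> {1..d}" using d by simp
      then show ?thesis unfolding E_def by blast
    qed
    also have "measure M \<dots> = measure M {\<omega>\<in>space M. (q \<longrightarrow> - u_max d \<gamma> \<beta> x \<le> real_of_int (first_crossing \<beta> (order_stat_seq d 1 Xs \<omega>))) \<and>
        (p \<longrightarrow> real_of_int (last_exit \<beta> (order_stat_seq d 1 Xs \<omega>)) \<le> u_max d \<gamma> \<beta> y)}"
      using ev unfolding u c order_stat_seq_def order_stat_max_gt[OF d] by simp
    finally show ?case .
  qed
  ultimately have "((\<lambda>\<beta>. measure M {\<omega>\<in>space M. (q \<longrightarrow> - u_max d \<gamma> \<beta> x \<le> real_of_int (first_crossing \<beta> (order_stat_seq d 1 Xs \<omega>))) \<and>
        (p \<longrightarrow> real_of_int (last_exit \<beta> (order_stat_seq d 1 Xs \<omega>)) \<le> u_max d \<gamma> \<beta> y)})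
     \<longlongrightarrow> (\<Prod>j\<in>{1..d}. \<integral>z. h z \<partial>\<Phi>)) (at_right 0)"
    by (rule Lim_transform_eventually)
  also have "(\<Prod>j\<in>{1..d}. \<integral>z. h z \<partial>\<Phi>) = (\<integral>z. (\<Prod>j\<in>{1..d}. h (z j)) \<partial>(\<Pi>\<^sub>M j\<in>{1..d}. \<Phi>))"
  proof (rule \<Phi>.product_integral_prod[symmetric])
    have "\<bar>h z\<bar> \<le> 1" for z unfolding h_def L.intensity_def by simp
    then show "integrable \<Phi> h"
      by (intro finite_measure.integrable_const_bound[OF prob_space.axioms(1)[OF prob_space_std_normal], where B=1]) auto
  qed simp
  also have "(\<lambda>z. \<Prod>j\<in>{1..d}. h (z j)) = (\<lambda>z. exp (- (1 / real d) * (\<Sum>j=1..d. (if q then exp (- sqrt (2 * \<gamma>) * (x - z j)) else 0)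
          + (if p then exp (- sqrt (2 * \<gamma>) * (y - z j)) else 0))))"
    unfolding h_def L.intensity_def of_nat_1 div_by_1 by (simp add: exp_sum[symmetric] sum_distrib_left sum_negf[symmetric] add.commute)
  finally show ?thesis unfolding Phi_prod_def .
qed

end

end

theorem theorem2p2:
  fixes N :: "'b measure" and X :: "int \<Rightarrow> 'b \<Rightarrow> real"
    and M :: "'a measure" and Xs :: "nat \<Rightarrow> int \<Rightarrow> 'a \<Rightarrow> real"
    and d :: nat and \<gamma> :: real
  assumes "d \<ge> 1"
    and "prob_space N" and "standard_stationary_gaussian N X"
    and "prob_space M" and "independent_copies M d Xs N X"
    and "\<gamma> > 0"
    and "(\<lambda>n. covariance_fun N X n * ln (real n)) \<longlonglongrightarrow> \<gamma>"
  shows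
   "((\<forall>x y.
       ((\<lambda>\<beta>. measure M {\<omega> \<in> space M.
            real_of_int (first_crossing \<beta> (order_stat_seq d 1 Xs \<omega>)) \<ge> - u_max d \<gamma> \<beta> x \<and>
            real_of_int (last_exit \<beta> (order_stat_seq d 1 Xs \<omega>)) \<le> u_max d \<gamma> \<beta> y})
         \<longlongrightarrow> (\<integral>z. exp (- (1 / real d) *
            (\<Sum>j=1..d. exp (- sqrt (2 * \<gamma>) * (x - z j)) + exp (- sqrt (2 * \<gamma>) * (y - z j)))) \<partial>Phi_prod d))
         (at_right 0)) \<and>
    (\<forall>x.
       ((\<lambda>\<beta>. measure M {\<omega> \<in> space M.
            real_of_int (first_crossing \<beta> (order_stat_seq d 1 Xs \<omega>)) \<ge> - u_max d \<gamma> \<beta> x})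
         \<longlongrightarrow> (\<integral>z. exp (- (1 / real d) * (\<Sum>j=1..d. exp (- sqrt (2 * \<gamma>) * (x - z j)))) \<partial>Phi_prod d))
         (at_right 0) \<and>
       ((\<lambda>\<beta>. measure M {\<omega> \<in> space M.
            real_of_int (last_exit \<beta> (order_stat_seq d 1 Xs \<omega>)) \<le> u_max d \<gamma> \<beta> x})
         \<longlongrightarrow> (\<integral>z. exp (- (1 / real d) * (\<Sum>j=1..d. exp (- sqrt (2 * \<gamma>) * (x - z j)))) \<partial>Phi_prod d))
         (at_right 0))) \<and>
    ((\<forall>x y.
       ((\<lambda>\<beta>. measure M {\<omega> \<in> space M.
            real_of_int (first_crossing \<beta> (order_stat_seq d d Xs \<omega>)) \<ge> - u_min d \<gamma> \<beta> x \<and>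
            real_of_int (last_exit \<beta> (order_stat_seq d d Xs \<omega>)) \<le> u_min d \<gamma> \<beta> y})
         \<longlongrightarrow> (\<integral>z. exp (- (exp (- sqrt (2 * (1 / real d) * \<gamma>) * (x - (\<Sum>j=1..d. z j)))
            + exp (- sqrt (2 * (1 / real d) * \<gamma>) * (y - (\<Sum>j=1..d. z j))))) \<partial>Phi_prod d))
         (at_right 0)) \<and>
    (\<forall>x.
       ((\<lambda>\<beta>. measure M {\<omega> \<in> space M.
            real_of_int (first_crossing \<beta> (order_stat_seq d d Xs \<omega>)) \<ge> - u_min d \<gamma> \<beta> x})
         \<longlongrightarrow> (\<integral>z. exp (- exp (- sqrt (2 * (1 / real d) * \<gamma>) * (x - (\<Sum>j=1..d. z j)))) \<partial>Phi_prod d))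
         (at_right 0) \<and>
       ((\<lambda>\<beta>. measure M {\<omega> \<in> space M.
            real_of_int (last_exit \<beta> (order_stat_seq d d Xs \<omega>)) \<le> u_min d \<gamma> \<beta> x})
         \<longlongrightarrow> (\<integral>z. exp (- exp (- sqrt (2 * (1 / real d) * \<gamma>) * (x - (\<Sum>j=1..d. z j)))) \<partial>Phi_prod d))
         (at_right 0)))"
proof -
  let ?r = "covariance_fun N X"
  note X = \<open>prob_space N\<close> \<open>standard_stationary_gaussian N X\<close>
  note r_ln = \<open>(\<lambda>n. ?r n * ln (real n)) \<longlonglongrightarrow> \<gamma>\<close>
  have "filterlim (\<lambda>n. ln (real n)) at_top sequentially" by real_asymp
  then have "(\<lambda>n. ?r n * ln (real n) * inverse (ln (real n))) \<longlonglongrightarrow> \<gamma> * 0"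
    by (intro tendsto_mult r_ln tendsto_inverse_0_at_top)
  moreover have "\<forall>\<^sub>F n in sequentially. ?r n * ln (real n) * inverse (ln (real n)) = ?r n"
    using eventually_gt_at_top[of 1] by eventually_elim simp
  ultimately have "?r \<longlonglongrightarrow> \<gamma> * 0" by (rule Lim_transform_eventually)
  then have "?r \<longlonglongrightarrow> 0" by simp
  from covariance_bounded_away[OF X this] obtain \<delta> where \<delta>: "1 / 2 \<le> \<delta>" "\<delta> < 1"
    and r_le: "\<And>n. n \<ge> 1 \<Longrightarrow> \<bar>?r n\<bar> \<le> \<delta>" by blast
  interpret prob_space M by fact
  have indep: "indep_vars (\<lambda>_. \<Pi>\<^sub>M i\<in>(UNIV::int set). borel) (\<lambda>j \<omega> i. Xs j i \<omega>) {1..d}"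
    and law: "\<And>j. j \<in> {1..d} \<Longrightarrow> sequence_law M (Xs j) = sequence_law N X"
    using \<open>independent_copies M d Xs N X\<close> unfolding independent_copies_def by blast+
  have m: "Xs j i \<in> borel_measurable M" if "j \<in> {1..d}" for j i
  proof -
    have "(\<lambda>\<omega> i. Xs j i \<omega>) \<in> measurable M (\<Pi>\<^sub>M i\<in>UNIV. borel)"
      using indep that unfolding indep_vars_def by blast
    from measurable_compose[OF this measurable_component_singleton[of i]] show ?thesis by simp
  qed
  have g: "gauss_family M I (Xs j) (\<lambda>i k. ?r (nat \<bar>i - k\<bar>))" if "j \<in> {1..d}" "finite I" for j I
    by (rule copy_gauss_family[OF X that(2) m[OF that(1)] law[OF that(1)]])
  note hyps = \<open>prob_space M\<close> \<open>d \<ge> 1\<close> covariance_0[OF X] g \<open>\<gamma> > 0\<close> \<delta> r_le r_ln indep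
  note max = max_limit[OF hyps] and min = min_limit[OF hyps]
  note flags = if_True if_False simp_thms add_0_left add_0_right
  show ?thesis
    by (intro conjI allI
      max[where p=True and q=True, unfolded flags] max[where p=False and q=True, unfolded flags] max[where p=True and q=False, unfolded flags]
      min[where p=True and q=True, unfolded flags] min[where p=False and q=True, unfolded flags] min[where p=True and q=False, unfolded flags])
qed

end
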